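(* If the driver $f$ satisfies (f1)--(f5) and is increasing in $y$, then for every bounded lower semicontinuous function $\varphi:C^d[0,T]\to\mathbb R$, the BSDE with driver $f$ and terminal condition $\xi=\varphi(W)$ has a minimal bounded supersolution $(Y,Z,A)$. It satisfies bounded comparison from above and $Z$ is a BMO process.
   Context: Setting. $T\in(0,\infty)$; $W$ is a $d$-dimensional Brownian motion on $(\Omega,\mathcal F,\mathbb P)$, $(\mathcal F_t)_{t\in[0,T]}$ its augmented filtration; (in)equalities between random variables hold a.s. $|\cdot|$ is the Euclidean norm, $C^d[0,T]$ the space of continuous $w:[0,T]\to\mathbb R^d$ with the supremum norm; lower semicontinuity is with respect to this norm. $\mathcal P$ is the predictable $\sigma$-algebra on $[0,T]\times C^d[0,T]$ for the filtration generated by the coordinate process. A driver is a $\mathcal P\otimes\mathcal B(\mathbb R)\otimes\mathcal B(\mathbb R^d)$-measurable function $f:[0,T]\times C^d[0,T]\times\mathbb R\times\mathbb R^d\to\mathbb R$. The BSDE with driver $f$ and ($\mathcal F_T$-measurable) terminal condition $\xi$ is $$Y_t=\xi+\int_t^Tf(s,W,Y_s,Z_s)ds-\int_t^TZ_s\,dW_s,\quad0\le t\le T,$$ where $Z_s\,dW_s=\sum_kZ^k_s\,dW^k_s$. A supersolution is a triple of predictable processes $(Y,Z,A)$ with values in $\mathbb R\times\mathbb R^d\times\mathbb R$ such that $Y$ is RCLL (right-continuous with left limits), $A$ is increasing, RCLL and starts at $0$, $\int_0^T|f(s,W,Y_s,Z_s)|ds<\infty$, $\int_0^T|Z_s|^2ds<\infty$,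 and $Y_t=\xi+\int_t^Tf(s,W,Y_s,Z_s)ds-\int_t^TZ_s\,dW_s+A_T-A_t$ for all $t\in[0,T]$. "Increasing" is in the weak sense. A supersolution $(Y,Z,A)$ of the BSDE with $(f,\xi)$ satisfies bounded comparison from above if for every supersolution $(Y',Z',A')$ of the BSDE with a driver $f'\ge f$ and terminal condition $\xi'\ge\xi$ such that $Y'$ is bounded, one has $Y'_t\ge Y_t$ for all $t$. A minimal bounded supersolution is a supersolution $(Y,Z,A)$ with $Y$ bounded such that $Y'_t\ge Y_t$ for all $t$ for every supersolution $(Y',Z',A')$ of the same BSDE with $Y'$ bounded. A $d$-dimensional predictable process $\mu$ is BMO if there is $C\in\mathbb R_+$ with $\mathbb E[\int_\tau^T|\mu_s|^2ds\mid\mathcal F_\tau]\le C$ for all $[0,T]$-valued stopping times $\tau$. Conditions on $f$: (f1) $f(t,w,y,z)$ is convex in $z$. (f2) $\sup_{t,w}|f(t,w,0,0)|<\infty$. (f3) There is $K\in\mathbb R_+$ with $|f(t,w_1,y_1,z)-f(t,w_2,y_2,z)|\le K(\sup_{0\le s\le t}|w_1(s)-w_2(s)|+|y_1-y_2|)$ for all $t,w_1,w_2,y_1,y_2,z$. (f4) For every $a\in\mathbb R_+$ there is $b\in\mathbb R_+$ with $|f(t,w,y,z_1)-f(t,w,y,z_2)|\le b|z_1-z_2|$ for all $t,w,y$ and all $|z_1|\vee|z_2|\le a$. (f5) $\inf_{w\in C^d[0,T],\,y\in[-c,c],\,z\in\mathbb R^d,\,t\in[0,T]}f(t,w,y,z)>-\infty$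 for all $c\in\mathbb R_+$. *)

theory Defs
  imports "HOL-Probability.Probability"
begin

section \<open>Path space\<close>

text \<open>
  $\mathbb R^d$ is \<open>real ^ 'n\<close>. An element of $C^d[0,T]$ is represented by a function on \<open>real\<close>
  that is continuous on $[0,T]$ and extensional, i.e. \<^const>\<open>undefined\<close> outside $[0,T]$, so that
  distinct representatives are distinct paths.
\<close>

definition C_paths :: "real \<Rightarrow> (real \<Rightarrow> real ^ 'n) set" where
  "C_paths T = {w \<in> extensional {0..T}. continuous_on {0..T} w}"

definition sup_dist :: "real \<Rightarrow> (real \<Rightarrow> real ^ 'n) \<Rightarrow> (real \<Rightarrow> real ^ 'n) \<Rightarrow> real" where
  "sup_dist t w v = (SUP s\<in>{0..t}. norm (w s - v s))"

definition lower_semicontinuous :: "real \<Rightarrow> ((real \<Rightarrow> real ^ 'n) \<Rightarrow> real) \<Rightarrow> bool" where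
  "lower_semicontinuous T \<phi> \<longleftrightarrow>
     (\<forall>w\<in>C_paths T. \<forall>a<\<phi> w. \<exists>\<delta>>0. \<forall>v\<in>C_paths T. sup_dist T w v < \<delta> \<longrightarrow> a < \<phi> v)"


section \<open>Filtrations and predictable processes\<close>

text \<open>
  Filtrations are indexed by all reals; they are trivial before time $0$ and constant
  after time $T$, so that the library notions \<^const>\<open>stopping_time\<close> and
  \<^const>\<open>filtration.pre_sigma\<close> apply to $[0,T]$-valued times.
\<close>

definition generated_filtration ::
    "real \<Rightarrow> 'a set \<Rightarrow> (real \<Rightarrow> 'a \<Rightarrow> 'b::topological_space) \<Rightarrow> real \<Rightarrow> 'a measure" where
  "generated_filtration T \<Omega> X t =
     sigma \<Omega> {X s -` B \<inter> \<Omega> | s B. s \<in> {0..T} \<and> s \<le> t \<and> B \<in> sets borel}"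

text \<open>
  The augmentation adds all subsets of null sets. These need not be events of \<open>M\<close>, so the
  augmented $\sigma$-algebras are sub-$\sigma$-algebras of \<open>completion M\<close>.
\<close>

definition augmented_filtration ::
    "'a measure \<Rightarrow> real \<Rightarrow> (real \<Rightarrow> 'a \<Rightarrow> 'b::topological_space) \<Rightarrow> real \<Rightarrow> 'a measure" where
  "augmented_filtration M T X t =
     sigma (space M) (sets (generated_filtration T (space M) X t) \<union> null_sets (completion M))"

definition predictable_algebra ::
    "real \<Rightarrow> 'a set \<Rightarrow> (real \<Rightarrow> 'a measure) \<Rightarrow> (real \<times> 'a) measure" where
  "predictable_algebra T \<Omega> F = sigma ({0..T} \<times> \<Omega>)
     ({{0} \<times> A | A. A \<in> sets (F 0)} \<union>
      {{s<..t} \<times> A | s t A. 0 \<le> s \<and> s \<le> t \<and> t \<le> T \<and> A \<in> sets (F s)})"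

definition path_predictable_algebra :: "real \<Rightarrow> (real \<times> (real \<Rightarrow> real ^ 'n)) measure" where
  "path_predictable_algebra T =
     predictable_algebra T (C_paths T) (generated_filtration T (C_paths T) (\<lambda>s w. w s))"

definition predictable_process ::
    "'a measure \<Rightarrow> real \<Rightarrow> (real \<Rightarrow> 'a \<Rightarrow> real ^ 'n) \<Rightarrow>
     (real \<Rightarrow> 'a \<Rightarrow> 'b::topological_space) \<Rightarrow> bool" where
  "predictable_process M T W X \<longleftrightarrow>
     (\<lambda>(t, \<omega>). X t \<omega>) \<in>
       borel_measurable (predictable_algebra T (space M) (augmented_filtration M T W))"

definition rcll :: "real \<Rightarrow> (real \<Rightarrow> real) \<Rightarrow> bool" where
  "rcll T x \<longleftrightarrow> (\<forall>t\<in>{0..<T}. (x \<longlongrightarrow> x t) (at_right t)) \<and>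
                (\<forall>t\<in>{0<..T}. \<exists>l. (x \<longlongrightarrow> l) (at_left t))"

definition bounded_process :: "'a measure \<Rightarrow> real \<Rightarrow> (real \<Rightarrow> 'a \<Rightarrow> real) \<Rightarrow> bool" where
  "bounded_process M T Y \<longleftrightarrow> (\<exists>c. AE \<omega> in M. \<forall>t\<in>{0..T}. \<bar>Y t \<omega>\<bar> \<le> c)"


section \<open>Brownian motion and the stochastic integral\<close>

definition brownian_motion :: "'a measure \<Rightarrow> real \<Rightarrow> (real \<Rightarrow> 'a \<Rightarrow> real ^ 'n) \<Rightarrow> bool" where
  "brownian_motion M T W \<longleftrightarrow>
     prob_space M \<and>
     (\<forall>t\<in>{0..T}. W t \<in> borel_measurable M) \<and>
     (AE \<omega> in M. W 0 \<omega> = 0 \<and> continuous_on {0..T} (\<lambda>t. W t \<omega>)) \<and>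
     (\<forall>s t. 0 \<le> s \<and> s < t \<and> t \<le> T \<longrightarrow>
        prob_space.indep_set M
          (sets (generated_filtration T (space M) W s))
          (sets (vimage_algebra (space M) (\<lambda>\<omega>. W t \<omega> - W s \<omega>) borel)) \<and>
        distributed M lborel (\<lambda>\<omega>. W t \<omega> - W s \<omega>)
          (\<lambda>x. ennreal (\<Prod>i\<in>UNIV. normal_density 0 (sqrt (t - s)) (x $ i))))"

definition brownian_path :: "real \<Rightarrow> (real \<Rightarrow> 'a \<Rightarrow> real ^ 'n) \<Rightarrow> 'a \<Rightarrow> real \<Rightarrow> real ^ 'n" where
  "brownian_path T W \<omega> = (\<lambda>t\<in>{0..T}. W t \<omega>)"

text \<open>
  \<open>(m, t, \<xi>)\<close> encodes the simple integrand
  $H = \sum_{i<m} \xi_i 1_{(t_i, t_{i+1}]}$.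
\<close>

type_synonym ('a, 'n) simple_integrand = "nat \<times> (nat \<Rightarrow> real) \<times> (nat \<Rightarrow> 'a \<Rightarrow> real ^ 'n)"

definition simple_integrand ::
    "'a measure \<Rightarrow> real \<Rightarrow> (real \<Rightarrow> 'a \<Rightarrow> real ^ 'n) \<Rightarrow> ('a, 'n) simple_integrand \<Rightarrow> bool" where
  "simple_integrand M T W H = (case H of (m, t, \<xi>) \<Rightarrow>
     0 \<le> t 0 \<and> t m \<le> T \<and>
     (\<forall>i<m. t i \<le> t (Suc i) \<and>
            \<xi> i \<in> borel_measurable (augmented_filtration M T W (t i)) \<and>
            bounded (\<xi> i ` space M)))"

definition simple_value :: "('a, 'n) simple_integrand \<Rightarrow> real \<Rightarrow> 'a \<Rightarrow> real ^ 'n" where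
  "simple_value H s \<omega> = (case H of (m, t, \<xi>) \<Rightarrow>
     \<Sum>i<m. indicator {t i<..t (Suc i)} s *\<^sub>R \<xi> i \<omega>)"

definition simple_integral ::
    "(real \<Rightarrow> 'a \<Rightarrow> real ^ 'n) \<Rightarrow> ('a, 'n) simple_integrand \<Rightarrow> real \<Rightarrow> 'a \<Rightarrow> real" where
  "simple_integral W H s \<omega> = (case H of (m, t, \<xi>) \<Rightarrow>
     \<Sum>i<m. \<xi> i \<omega> \<bullet> (W (min s (t (Suc i))) \<omega> - W (min s (t i)) \<omega>))"

definition tends_to_0_in_probability :: "'a measure \<Rightarrow> (nat \<Rightarrow> 'a \<Rightarrow> ennreal) \<Rightarrow> bool" where
  "tends_to_0_in_probability N X \<longleftrightarrow>
     (\<forall>\<epsilon>>0. (\<lambda>k. measure N {\<omega> \<in> space N. ennreal \<epsilon> < X k \<omega>}) \<longlonglongrightarrow> 0)"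

text \<open>
  \<open>I\<close> is (a version of) the process $\int_0^t Z_s\,dW_s$, for predictable \<open>Z\<close> with
  $\int_0^T |Z_s|^2\,ds < \infty$ a.s.: the adapted continuous process whose values are the limits
  in probability of the integrals of simple integrands approximating \<open>Z\<close>. It is determined up to
  indistinguishability. Adaptedness of \<open>I\<close> and predictability of \<open>Z\<close> ensure that the events in
  \<^const>\<open>tends_to_0_in_probability\<close> are measurable with respect to the completion.
\<close>

definition is_stochastic_integral ::
    "'a measure \<Rightarrow> real \<Rightarrow> (real \<Rightarrow> 'a \<Rightarrow> real ^ 'n) \<Rightarrow>
     (real \<Rightarrow> 'a \<Rightarrow> real ^ 'n) \<Rightarrow> (real \<Rightarrow> 'a \<Rightarrow> real) \<Rightarrow> bool" where
  "is_stochastic_integral M T W Z I \<longleftrightarrow>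
     predictable_process M T W Z \<and>
     (AE \<omega> in M. set_integrable lborel {0..T} (\<lambda>s. (norm (Z s \<omega>))\<^sup>2)) \<and>
     (\<forall>t\<in>{0..T}. I t \<in> borel_measurable (augmented_filtration M T W t)) \<and>
     (AE \<omega> in M. continuous_on {0..T} (\<lambda>t. I t \<omega>)) \<and>
     (\<exists>H. (\<forall>k. simple_integrand M T W (H k)) \<and>
          tends_to_0_in_probability (completion M)
            (\<lambda>k \<omega>. \<integral>\<^sup>+s\<in>{0..T}. ennreal ((norm (Z s \<omega> - simple_value (H k) s \<omega>))\<^sup>2) \<partial>lborel) \<and>
          (\<forall>t\<in>{0..T}. tends_to_0_in_probability (completion M)
            (\<lambda>k \<omega>. ennreal \<bar>simple_integral W (H k) t \<omega> - I t \<omega>\<bar>)))"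

definition BMO ::
    "'a measure \<Rightarrow> real \<Rightarrow> (real \<Rightarrow> 'a \<Rightarrow> real ^ 'n) \<Rightarrow> (real \<Rightarrow> 'a \<Rightarrow> real ^ 'n) \<Rightarrow> bool" where
  "BMO M T W \<mu> \<longleftrightarrow>
     predictable_process M T W \<mu> \<and>
     (\<exists>C\<ge>0. \<forall>\<tau>. stopping_time (augmented_filtration M T W) \<tau> \<and> \<tau> \<in> space M \<rightarrow> {0..T} \<longrightarrow>
        (AE \<omega> in M.
           nn_cond_exp (completion M)
             (filtration.pre_sigma (space M) (augmented_filtration M T W) \<tau>)
             (\<lambda>\<omega>. \<integral>\<^sup>+s\<in>{\<tau> \<omega>..T}. ennreal ((norm (\<mu> s \<omega>))\<^sup>2) \<partial>lborel) \<omega>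
           \<le> ennreal C))"


section \<open>BSDEs\<close>

type_synonym 'n driver = "real \<Rightarrow> (real \<Rightarrow> real ^ 'n) \<Rightarrow> real \<Rightarrow> real ^ 'n \<Rightarrow> real"

definition driver :: "real \<Rightarrow> 'n::finite driver \<Rightarrow> bool" where
  "driver T f \<longleftrightarrow>
     (\<lambda>((t, w), y, z). f t w y z) \<in>
       borel_measurable (path_predictable_algebra T \<Otimes>\<^sub>M (borel \<Otimes>\<^sub>M borel))"

definition terminal_condition ::
    "'a measure \<Rightarrow> real \<Rightarrow> (real \<Rightarrow> 'a \<Rightarrow> real ^ 'n) \<Rightarrow> ('a \<Rightarrow> real) \<Rightarrow> bool" where
  "terminal_condition M T W \<xi> \<longleftrightarrow> \<xi> \<in> borel_measurable (augmented_filtration M T W T)"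

definition supersolution ::
    "'a measure \<Rightarrow> real \<Rightarrow> (real \<Rightarrow> 'a \<Rightarrow> real ^ 'n) \<Rightarrow> 'n::finite driver \<Rightarrow> ('a \<Rightarrow> real) \<Rightarrow>
     (real \<Rightarrow> 'a \<Rightarrow> real) \<Rightarrow> (real \<Rightarrow> 'a \<Rightarrow> real ^ 'n) \<Rightarrow> (real \<Rightarrow> 'a \<Rightarrow> real) \<Rightarrow> bool" where
  "supersolution M T W f \<xi> Y Z A \<longleftrightarrow>
     driver T f \<and> terminal_condition M T W \<xi> \<and>
     predictable_process M T W Y \<and> predictable_process M T W Z \<and> predictable_process M T W A \<and>
     (AE \<omega> in M. rcll T (\<lambda>t. Y t \<omega>)) \<and>
     (AE \<omega> in M. rcll T (\<lambda>t. A t \<omega>) \<and> mono_on {0..T} (\<lambda>t. A t \<omega>) \<and> A 0 \<omega> = 0) \<and>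
     (AE \<omega> in M. set_integrable lborel {0..T} (\<lambda>s. f s (brownian_path T W \<omega>) (Y s \<omega>) (Z s \<omega>))) \<and>
     (AE \<omega> in M. set_integrable lborel {0..T} (\<lambda>s. (norm (Z s \<omega>))\<^sup>2)) \<and>
     (\<exists>I. is_stochastic_integral M T W Z I \<and>
        (AE \<omega> in M. \<forall>t\<in>{0..T}.
           Y t \<omega> = \<xi> \<omega> + (LINT s:{t..T}|lborel. f s (brownian_path T W \<omega>) (Y s \<omega>) (Z s \<omega>))
                    - (I T \<omega> - I t \<omega>) + A T \<omega> - A t \<omega>))"

definition bounded_comparison_from_above ::
    "'a measure \<Rightarrow> real \<Rightarrow> (real \<Rightarrow> 'a \<Rightarrow> real ^ 'n) \<Rightarrow> 'n::finite driver \<Rightarrow> ('a \<Rightarrow> real) \<Rightarrow>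
     (real \<Rightarrow> 'a \<Rightarrow> real) \<Rightarrow> (real \<Rightarrow> 'a \<Rightarrow> real ^ 'n) \<Rightarrow> (real \<Rightarrow> 'a \<Rightarrow> real) \<Rightarrow> bool" where
  "bounded_comparison_from_above M T W f \<xi> Y Z A \<longleftrightarrow>
     supersolution M T W f \<xi> Y Z A \<and>
     (\<forall>f' \<xi>' Y' Z' A'.
        (\<forall>t\<in>{0..T}. \<forall>w\<in>C_paths T. \<forall>y z. f t w y z \<le> f' t w y z) \<and>
        (AE \<omega> in M. \<xi> \<omega> \<le> \<xi>' \<omega>) \<and>
        supersolution M T W f' \<xi>' Y' Z' A' \<and> bounded_process M T Y' \<longrightarrow>
        (AE \<omega> in M. \<forall>t\<in>{0..T}. Y t \<omega> \<le> Y' t \<omega>))"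

definition minimal_bounded_supersolution ::
    "'a measure \<Rightarrow> real \<Rightarrow> (real \<Rightarrow> 'a \<Rightarrow> real ^ 'n) \<Rightarrow> 'n::finite driver \<Rightarrow> ('a \<Rightarrow> real) \<Rightarrow>
     (real \<Rightarrow> 'a \<Rightarrow> real) \<Rightarrow> (real \<Rightarrow> 'a \<Rightarrow> real ^ 'n) \<Rightarrow> (real \<Rightarrow> 'a \<Rightarrow> real) \<Rightarrow> bool" where
  "minimal_bounded_supersolution M T W f \<xi> Y Z A \<longleftrightarrow>
     supersolution M T W f \<xi> Y Z A \<and> bounded_process M T Y \<and>
     (\<forall>Y' Z' A'. supersolution M T W f \<xi> Y' Z' A' \<and> bounded_process M T Y' \<longrightarrow>
        (AE \<omega> in M. \<forall>t\<in>{0..T}. Y t \<omega> \<le> Y' t \<omega>))"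


section \<open>Conditions on the driver\<close>

definition cond_f1 :: "real \<Rightarrow> 'n::finite driver \<Rightarrow> bool" where
  "cond_f1 T f \<longleftrightarrow> (\<forall>t\<in>{0..T}. \<forall>w\<in>C_paths T. \<forall>y. convex_on UNIV (\<lambda>z. f t w y z))"

definition cond_f2 :: "real \<Rightarrow> 'n::finite driver \<Rightarrow> bool" where
  "cond_f2 T f \<longleftrightarrow> (\<exists>C. \<forall>t\<in>{0..T}. \<forall>w\<in>C_paths T. \<bar>f t w 0 0\<bar> \<le> C)"

definition cond_f3 :: "real \<Rightarrow> 'n::finite driver \<Rightarrow> bool" where
  "cond_f3 T f \<longleftrightarrow> (\<exists>K\<ge>0. \<forall>t\<in>{0..T}. \<forall>w1\<in>C_paths T. \<forall>w2\<in>C_paths T. \<forall>y1 y2 z.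
     \<bar>f t w1 y1 z - f t w2 y2 z\<bar> \<le> K * (sup_dist t w1 w2 + \<bar>y1 - y2\<bar>))"

definition cond_f4 :: "real \<Rightarrow> 'n::finite driver \<Rightarrow> bool" where
  "cond_f4 T f \<longleftrightarrow> (\<forall>a\<ge>0. \<exists>b\<ge>0. \<forall>t\<in>{0..T}. \<forall>w\<in>C_paths T. \<forall>y z1 z2.
     max (norm z1) (norm z2) \<le> a \<longrightarrow> \<bar>f t w y z1 - f t w y z2\<bar> \<le> b * norm (z1 - z2))"

definition cond_f5 :: "real \<Rightarrow> 'n::finite driver \<Rightarrow> bool" where
  "cond_f5 T f \<longleftrightarrow> (\<forall>c\<ge>0. \<exists>m. \<forall>t\<in>{0..T}. \<forall>w\<in>C_paths T. \<forall>y\<in>{-c..c}. \<forall>z. m \<le> f t w y z)"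

definition increasing_in_y :: "real \<Rightarrow> 'n::finite driver \<Rightarrow> bool" where
  "increasing_in_y T f \<longleftrightarrow> (\<forall>t\<in>{0..T}. \<forall>w\<in>C_paths T. \<forall>z. mono (\<lambda>y. f t w y z))"

end

theory Submission imports Defs
begin

text \<open>
The solution is the essential infimum of all bounded supersolutions. On bounded \<open>y\<close> the driver is bounded below by some
\<open>m\<close>, so a bounded supersolution satisfies \<open>Y\<^sub>s - Y\<^sub>t + \<integral>\<^sub>s\<^sup>t Z dW \<ge> m (t - s)\<close>. This alone bounds the conditional
expectation of \<open>\<integral>\<^sub>s\<^sup>T |Z|\<^sup>2\<close> given \<open>F\<^sub>s\<close> in terms of the bound of \<open>Y\<close>. An explicit exponential barrier is a bounded
supersolution, and bounded supersolutions are uniformly bounded below and can be pasted along events. Hence some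
sequence of them approaches the infimum at all times of a countable dense set. By the energy bound convex combinations
of the \<open>Z\<close> converge in \<open>L\<^sup>2\<close>, and Fatou's lemma, with convexity in \<open>z\<close> and monotonicity in \<open>y\<close>, passes the inequality
to the limit, whose right-continuous regularization is the solution. Its increasing part is predictable because
bounded Brownian functionals are closed by continuous martingales. Comparison holds since a supersolution for
\<open>f' \<ge> f\<close> and \<open>\<xi>' \<ge> \<xi>\<close> becomes one for \<open>f\<close> and \<open>\<xi>\<close> when the excess is moved into \<open>A\<close>.
\<close>

text \<open>The class of competitors carries two constants: a bound \<open>C\<close> of
  \<open>Y\<close>, and a lower bound \<open>m\<close> of the driver for \<open>|y| <= C\<close>
  that makes the integrand nonnegative before its integrability is known. Minimality is thus first
  obtained only among processes with the same bound, while comparison must reach every bounded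
  supersolution. The way out is that the minimal element of a larger class lies between
  \<open>- bar K\<close> and \<open>bar K\<close>, curves that depend only on the growth of the
  driver and the bound of the terminal value, and so falls back into the class of bound
  \<open>bar K 0\<close>. The increasing part is dropped because nothing controls it along a
  minimizing sequence; it returns at the end as the deficit in the inequality. The regularized
  infimum at \<open>t\<close> is a limit of variables known only after \<open>t\<close>, so its
  adaptedness requires a right-continuous filtration. The energy bound rests on a sign:
  \<open>X = Y + m t - c\<close> is nonpositive, so the drift enters the formula for
  \<open>X^2\<close> favourably. Martingales are handled by orthogonality, second moments and dyadic
  times, and integrals are stopped by means of events.\<close>

abbreviation iffa (infixr "<->" 25) where "A <-> B == (A = (B :: bool))"
abbreviation ind :: "'a set => 'a => 'b::zero_neq_one" where "ind == indicator"
abbreviation diff :: "(real => 'a => 'b::minus) => (real => 'a => 'b) => real => 'a => 'b" (infixl "~-" 65) where "Z ~- Z' == %u w. Z u w - Z' u w"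
abbreviation lims :: "(nat => 'a::topological_space) => 'a => bool" (infix "~>" 60) where "X ~> l == X \<longlonglongrightarrow> l"
abbreviation EV :: "(nat => bool) => bool" (binder "EV " 10) where "EV n. p n == eventually p sequentially"
abbreviation bm :: "'a measure => ('a => 'b::topological_space) set" where "bm == borel_measurable"

section \<open>The completed probability space and the augmented filtration\<close>

locale wiener =
 fixes M :: "'a measure" and T :: real and W :: "real => 'a => real ^ 'n::finite"
 assumes T_pos: "0 < T" and bm: "brownian_motion M T W"
begin

abbreviation P :: "'a measure" where "P == completion M"
abbreviation TI where "TI == {0..T}"
abbreviation F :: "real => 'a measure" where "F == augmented_filtration M T W"

abbreviation sint where "sint == is_stochastic_integral M T W"
abbreviation pred :: "(real => 'a => 'b::topological_space) => bool" where "pred == predictable_process M T W"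
abbreviation PA :: "(real \<times> 'a) measure" where "PA == predictable_algebra T (space M) F"
abbreviation simple where "simple == simple_integrand M T W"
abbreviation si where "si == Defs.simple_integral W"
abbreviation sv where "sv == simple_value"
abbreviation tip where "tip == tends_to_0_in_probability P"
abbreviation NN :: "('a => ennreal) => ennreal" (binder "NN " 10) where "NN w. X w == nn_integral P X"
abbreviation EE :: "('a => real) => real" (binder "EE " 10) where "EE w. X w == lebesgue_integral P X"

lemma prob_space_M: "prob_space M"
 using bm unfolding brownian_motion_def by auto

sublocale prob_space P
proof
 interpret M: prob_space M by (rule prob_space_M)
 show "emeasure P (space P) = 1" by (simp add: M.emeasure_space_1)
qed

lemma W_measurable_M: "t : TI ==> W t : bm M"
 using bm unfolding brownian_motion_def by auto

lemma sets_gen_le: "sets (generated_filtration T (space M) W t) \<subseteq> sets M"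
 unfolding generated_filtration_def
 by (subst sets_measure_of) (auto intro!: sets.sigma_sets_subset measurable_sets[OF W_measurable_M])

lemma space_gen [simp]: "space (generated_filtration T (space M) W t) = space M"
 unfolding generated_filtration_def by (subst space_measure_of) auto

lemma space_F [simp]: "space (F t) = space M"
 unfolding augmented_filtration_def
 by (subst space_measure_of)
 (use sets.sets_into_space sets.sets_into_space[of _ P] sets_gen_le in "fastforce+")

lemma sets_F: "sets (F t) = sigma_sets (space M)
 (sets (generated_filtration T (space M) W t) Un null_sets P)"
 unfolding augmented_filtration_def
 by (subst sets_measure_of)
 (use sets.sets_into_space sets.sets_into_space[of _ P] sets_gen_le in "fastforce+")

lemma null_F: "N : null_sets P ==> N : sets (F t)"
 unfolding sets_F by auto

lemma gen_F: "A : sets (generated_filtration T (space M) W t) ==> A : sets (F t)"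
 unfolding sets_F by auto

lemma sets_F_le: "sets (F t) \<subseteq> sets P"
proof -
 have "sets (generated_filtration T (space M) W t) Un null_sets P \<subseteq> sets P"
 using sets_gen_le by auto
 then show ?thesis unfolding sets_F
 using sets.sigma_sets_subset[of _ P] by simp
qed

lemma gen_mono: "s <= t ==>
 sets (generated_filtration T (space M) W s) \<subseteq> sets (generated_filtration T (space M) W t)"
 unfolding generated_filtration_def
 by (subst (1 2) sets_measure_of) (auto intro!: sigma_sets_mono, force)

lemma F_mono: "s <= t ==> sets (F s) \<subseteq> sets (F t)"
 unfolding sets_F using gen_mono by (intro sigma_sets_mono') auto

lemma subalgebra_F: "subalgebra P (F t)"
 using sets_F_le unfolding subalgebra_def by auto

lemma mFP: "f : F t \<rightarrow>\<^sub>M N ==> f : P \<rightarrow>\<^sub>M N"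
 using measurable_from_subalg[OF subalgebra_F] .

lemma mF_mono: "s <= t ==> f : F s \<rightarrow>\<^sub>M N ==> f : F t \<rightarrow>\<^sub>M N"
 using F_mono by (intro measurable_from_subalg[of "F t" "F s"]) (auto simp: subalgebra_def)

lemma W_F: assumes "s : TI" "s <= t" shows "W s : bm (F t)"
proof (rule measurableI)
 fix B :: "(real ^ 'n) set" assume "B : sets borel"
 then have "W s -` B Int space M : sets (generated_filtration T (space M) W t)"
 unfolding generated_filtration_def using assms by (subst sets_measure_of) auto
 then show "W s -` B Int space (F t) : sets (F t)" by (simp add: gen_F)
qed simp

lemma null_subset: "A \<subseteq> N ==> N : null_sets P ==> A : null_sets P"
 by (rule null_sets_completion_subset)

lemma AE_null: "(AE w in P. Q w) <-> {w : space M. \<not> Q w} : null_sets P"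
proof
 assume "AE w in P. Q w"
 then obtain N where "{w : space P. \<not> Q w} \<subseteq> N" "N : null_sets P"
 unfolding eventually_ae_filter by auto
 then show "{w : space M. \<not> Q w} : null_sets P" using null_subset by auto
next
 assume "{w : space M. \<not> Q w} : null_sets P"
 then show "AE w in P. Q w" by (intro AE_I'[of "{w : space M. \<not> Q w}"]) auto
qed

text \<open>Every subset of a null set belongs to \<open>F t\<close>, so an exceptional set can be
  cut out and another one put back. Adaptedness may therefore be checked almost surely, which is
  what admits limits that exist only almost everywhere.\<close>

lemma sets_F_AE:
 assumes A: "A : sets (F t)" and B: "B \<subseteq> space M" and eq: "AE w in P. w : A <-> w : B"
 shows "B : sets (F t)"
proof -
 define N where "N = {w : space M. \<not> (w : A <-> w : B)}"
 have N: "N : null_sets P" using eq unfolding AE_null N_def .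
 have "B Int N : null_sets P" using null_subset[OF _ N] by auto
 moreover have "B = (A - N) Un (B Int N)" 
 using B sets.sets_into_space[OF A] unfolding N_def by auto
 ultimately show ?thesis using A null_F[OF N, of t] null_F[of "B Int N" t] 
 by (metis sets.Diff sets.Un)
qed

lemma measurable_F_AE:
 assumes f: "f : F t \<rightarrow>\<^sub>M N" and g: "!!w. w : space M ==> g w : space N" and eq: "AE w in P. f w = g w"
 shows "g : F t \<rightarrow>\<^sub>M N"
proof (rule measurableI)
 fix B assume B: "B : sets N"
 show "g -` B Int space (F t) : sets (F t)"
 proof (rule sets_F_AE[OF measurable_sets[OF f B]])
 show "AE w in P. (w : f -` B Int space (F t)) = (w : g -` B Int space (F t))"
 using eq by eventually_elim auto
 qed auto
qed (use g in auto)

lemma borel_F_AE: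
 "f : bm (F t) ==> AE w in P. f w = g w ==> g : bm (F t)"
 by (rule measurable_F_AE) auto

lemma borel_F_AE_lim:
 fixes f :: "nat => 'a => 'b::{banach, second_countable_topology}"
 assumes "!!i. f i : bm (F t)" "AE w in P. (%i. f i w) ~> g w"
 shows "g : bm (F t)"
proof (rule borel_F_AE[of "%w. lim (%i. f i w)"])
 show "(%w. lim (%i. f i w)) : bm (F t)"
 by (rule borel_measurable_lim_metric) (rule assms(1))
 show "AE w in P. lim (%i. f i w) = g w"
 using assms(2) by eventually_elim (rule limI)
qed

text \<open>Independence of increments is given for the raw filtration; this carries it over to the
  augmented one, since an event and its representative have the same probability. The events with a
  representative are closed under the sigma-algebra operations.\<close>

lemma F_rep:
 assumes "A : sets (F t)"
 shows "EX B:sets (generated_filtration T (space M) W t). AE w in P. w : A <-> w : B"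
 using assms unfolding sets_F
proof (induction rule: sigma_sets.induct)
 case (Basic a)
 then show ?case
 proof
 assume "a : null_sets P"
 then show ?thesis by (intro bexI[of _ "{}"]) (auto dest: AE_not_in)
 qed auto
next
 case Empty
 then show ?case by (auto intro!: bexI[of _ "{}"])
next
 case (Compl a)
 then obtain B where B: "B:sets (generated_filtration T (space M) W t)" 
 "AE w in P. w : a <-> w : B" by auto
 then show ?case
 using sets.compl_sets[OF B(1)] by (intro bexI[of _ "space M - B"]) auto
next
 case (Union a)
 then obtain B where B: "!!i::nat. B i:sets (generated_filtration T (space M) W t)" 
 "!!i. AE w in P. w : a i <-> w : B i" by metis
 then have "AE w in P. ALL i. w : a i <-> w : B i" by (simp add: AE_all_countable)
 then show ?case using B(1) by (intro bexI[of _ "\<Union>i. B i"]) auto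
qed

lemma W_0: "AE w in P. W 0 w = 0"
 using bm unfolding brownian_motion_def by (auto simp: AE_completion_iff)

lemma W_cont: "AE w in P. continuous_on TI (%t. W t w)"
 using bm unfolding brownian_motion_def by (auto simp: AE_completion_iff)

end

section \<open>Gaussian laws and the independence of increments\<close>

definition gauss :: "real => (real ^ 'n::finite) measure" where
 "gauss r = (if r = 0 then return borel 0 else
 density lborel (%x. ennreal (\<Prod>i\<in>UNIV. normal_density 0 (sqrt r) (x $ i))))"

lemma sets_gauss [simp, measurable_cong]: "sets (gauss r) = sets borel"
 unfolding gauss_def by auto

lemma space_gauss [simp]: "space (gauss r) = UNIV"
 unfolding gauss_def by auto

lemma nn_integral_vec_prod:
 fixes g :: "'n::finite => real => ennreal"
 assumes [measurable]: "!!i. g i : borel_measurable borel"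
 shows "(\<integral>\<^sup>+x. (\<Prod>i\<in>UNIV. g i (x $ i)) \<partial>(lborel :: (real^'n) measure)) = (\<Prod>i\<in>UNIV. (\<integral>\<^sup>+x. g i x \<partial>lborel))"
proof -
 have B: "(Basis :: (real^'n) set) = range (%i. axis i 1)"
 by (auto simp: Basis_vec_def)
 have inj: "inj (%i. axis i (1::real) :: real^'n)"
 by (auto simp: inj_def axis_eq_axis)
 define h where "h b = g (inv (%i. axis i (1::real) :: real^'n) b)" for b
 have h: "h (axis i 1) = g i" for i
 unfolding h_def by (simp add: inv_f_f[OF inj])
 have "(\<integral>\<^sup>+x. (\<Prod>b\<in>Basis. h b (x \<bullet> b)) \<partial>(lborel :: (real^'n) measure)) = (\<Prod>b\<in>Basis. (\<integral>\<^sup>+x. h b x \<partial>lborel))"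
 by (rule nn_integral_lborel_prod) (auto simp: h_def)
 then show ?thesis unfolding B
 by (simp add: prod.reindex[OF inj] h inner_axis)
qed

text \<open>Completing the square turns the integrand into a constant times the normal density with
  mean \<open>a * \<sigma>^2\<close>.\<close>

lemma nn_integral_normal_exp:
 assumes "0 < \<sigma>"
 shows "(\<integral>\<^sup>+x. ennreal (normal_density 0 \<sigma> x * exp (a * x)) \<partial>lborel) = ennreal (exp (a^2 * \<sigma>^2 / 2))"
proof -
 have "normal_density 0 \<sigma> x * exp (a * x) = exp (a^2 * \<sigma>^2 / 2) * normal_density (a * \<sigma>^2) \<sigma> x" for x
 proof -
 have "- x\<^sup>2 / (2 * \<sigma>^2) + a * x = a^2 * \<sigma>^2 / 2 + - (x - a * \<sigma>^2)\<^sup>2 / (2 * \<sigma>^2)"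
 using assms by (simp add: field_simps power2_eq_square)
 then show ?thesis
 unfolding normal_density_def by (simp add: exp_add[symmetric] mult.left_commute)
 qed
 then have "(\<integral>\<^sup>+x. ennreal (normal_density 0 \<sigma> x * exp (a * x)) \<partial>lborel)
 = (\<integral>\<^sup>+x. ennreal (exp (a^2 * \<sigma>^2 / 2)) * ennreal (normal_density (a * \<sigma>^2) \<sigma> x) \<partial>lborel)"
 by (simp add: ennreal_mult')
 also have "... = ennreal (exp (a^2 * \<sigma>^2 / 2)) * (\<integral>\<^sup>+x. ennreal (normal_density (a * \<sigma>^2) \<sigma> x) \<partial>lborel)"
 by (rule nn_integral_cmult) simp
 also have "(\<integral>\<^sup>+x. ennreal (normal_density (a * \<sigma>^2) \<sigma> x) \<partial>lborel) = 1"
 using prob_space.emeasure_space_1[OF prob_space_normal_density[OF assms, of "a * \<sigma>^2"]]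
 by (simp add: emeasure_density)
 finally show ?thesis by simp
qed

text \<open>The one explicit Gaussian computation: at \<open>x = 0\<close> it yields the total mass,
  and its difference quotients later yield mean and variance.\<close>

lemma gauss_mgf:
 assumes "0 <= r"
 shows "(\<integral>\<^sup>+y. ennreal (exp (x \<bullet> y)) \<partial>(gauss r :: (real^'n::finite) measure)) = ennreal (exp ((norm x)^2 * r / 2))"
proof (cases "r = 0")
 case True
 then show ?thesis by (simp add: gauss_def nn_integral_return)
next
 case False
 then have r: "0 < sqrt r" "0 < r" using assms by auto
 have eq: "(\<Prod>i\<in>UNIV. normal_density 0 (sqrt r) (y $ i)) * exp (x \<bullet> y) =
 (\<Prod>i\<in>UNIV. (normal_density 0 (sqrt r) (y $ i) * exp (x $ i * y $ i)))" for y
 by (simp add: inner_vec_def exp_sum prod.distrib)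
 have "(\<integral>\<^sup>+y. ennreal (exp (x \<bullet> y)) \<partial>(gauss r)) =
 (\<integral>\<^sup>+y. ennreal (\<Prod>i\<in>UNIV. normal_density 0 (sqrt r) (y $ i)) * ennreal (exp (x \<bullet> y)) \<partial>lborel)"
 using False unfolding gauss_def by (simp add: nn_integral_density)
 also have "... = (\<integral>\<^sup>+y. (\<Prod>i\<in>UNIV. ennreal (normal_density 0 (sqrt r) (y $ i) * exp (x $ i * y $ i))) \<partial>lborel)"
 by (intro nn_integral_cong)
 (simp add: ennreal_mult[symmetric] prod_nonneg eq prod_ennreal)
 also have "... = (\<Prod>i\<in>UNIV. (\<integral>\<^sup>+y. ennreal (normal_density 0 (sqrt r) y * exp (x $ i * y)) \<partial>lborel))"
 by (rule nn_integral_vec_prod) simp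
 also have "... = ennreal (\<Prod>i\<in>UNIV. exp ((x $ i)^2 * r / 2))"
 using nn_integral_normal_exp[OF r(1)] r(2) by (simp add: prod_ennreal)
 also have "(\<Prod>i\<in>UNIV. exp ((x $ i)^2 * r / 2)) = exp ((norm x)^2 * r / 2)"
 by (simp add: exp_sum[symmetric] power2_norm_eq_inner inner_vec_def power2_eq_square[of "_ $ _"] sum_distrib_right sum_divide_distrib)
 finally show ?thesis .
qed

lemma prob_space_gauss: "0 <= r ==> prob_space (gauss r :: (real^'n::finite) measure)"
 using gauss_mgf[of r "0 :: real^'n"] by (intro prob_spaceI) (simp add: nn_integral_const)

context wiener begin

lemma distr_increment:
 assumes "0 <= s" "s <= t" "t <= T"
 shows "distr P borel (%w. W t w - W s w) = gauss (t - s)"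
proof (cases "s = t")
 \<comment> \<open>The increment vanishes, and its law is the point mass that \<open>gauss\<close>
   assigns to variance 0. Degenerate intervals are thus covered by all later formulas.\<close>
 case True
 then show ?thesis
 using prob_space_axioms by (simp add: gauss_def)
next
 case False
 have [measurable]: "W s : bm M" "W t : bm M"
 using W_measurable_M assms by auto
 have "distributed M lborel (%w. W t w - W s w)
 (%x. ennreal (\<Prod>i\<in>UNIV. normal_density 0 (sqrt (t - s)) (x $ i)))"
 using bm assms False unfolding brownian_motion_def by (auto simp: order_less_le)
 then have "distr M borel (%w. W t w - W s w) = gauss (t - s)"
 unfolding distributed_def gauss_def using False
 by (simp, metis (no_types, lifting) distr_cong sets_lborel)
 then show ?thesis by (simp add: distr_completion)
qed

lemma indep_increment:
 assumes st: "0 <= s" "s <= t" "t <= T" and A: "A : sets (F s)" and B: "B : sets borel"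
 shows "emeasure P (A Int {w:space M. W t w - W s w : B}) = emeasure P A * emeasure (gauss (t - s)) B"
proof -
 have [measurable]: "W s : bm P" "W t : bm P" "A : sets P"
 using W_measurable_M st A sets_F_le by (auto intro: measurable_completion)
 note B[measurable]
 have g: "emeasure (gauss (t - s)) B = emeasure P {w:space M. W t w - W s w : B}"
 using B by (subst distr_increment[OF st, symmetric], subst emeasure_distr)
 (auto intro!: arg_cong2[where f=emeasure])
 show ?thesis
 proof (cases "s = t")
 case True
 then show ?thesis using g sets.sets_into_space[of A P]
 by (cases "0 : B") (auto simp: emeasure_space_1[simplified] Int_absorb2)
 next
 case False
 interpret M: prob_space M by (rule prob_space_M)
 obtain A' where A': "A' : sets (generated_filtration T (space M) W s)" 
 and eq: "AE w in P. w : A <-> w : A'"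
 using F_rep[OF A] by auto
 define D where "D = {w:space M. W t w - W s w : B}"
 have [measurable]: "A' : sets M" using A' sets_gen_le by auto
 have [measurable]: "W s : bm M" "W t : bm M"
 using W_measurable_M st by auto
 have [measurable]: "D : sets M" unfolding D_def by measurable
 have "M.indep_set
 (sets (generated_filtration T (space M) W s))
 (sets (vimage_algebra (space M) (%w. W t w - W s w) borel))"
 using bm st False unfolding brownian_motion_def by (auto simp: order_less_le)
 moreover have "D : sets (vimage_algebra (space M) (%w. W t w - W s w) borel)"
 unfolding D_def
 using B by (subst sets_vimage_algebra2) (auto intro!: exI[of _ B])
 ultimately have "measure M (A' Int D) = measure M A' * measure M D"
 using A' M.indep_setD by blast
 then have "emeasure P (A' Int D) = emeasure P A' * emeasure P D"
 by (simp add: M.emeasure_eq_measure ennreal_mult)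
 moreover have "emeasure P (A' Int D) = emeasure P (A Int D)" "emeasure P A' = emeasure P A"
 proof -
 show "emeasure P (A' Int D) = emeasure P (A Int D)"
 by (rule emeasure_eq_AE) (use eq in "auto")
 show "emeasure P A' = emeasure P A"
 by (rule emeasure_eq_AE) (use eq in "auto")
 qed
 ultimately show ?thesis unfolding g D_def by metis
 qed
qed

abbreviation FP :: "real => 'a measure" where "FP s == restr_to_subalg P (F s)"

lemma sets_FP [simp, measurable_cong]: "sets (FP s) = sets (F s)"
 by (rule sets_restr_to_subalg[OF subalgebra_F])

lemma space_FP [simp]: "space (FP s) = space M"
 by (simp add: space_restr_to_subalg)

lemma prob_space_FP: "prob_space (FP s)"
 by (rule prob_spaceI)
 (use emeasure_restr_to_subalg[OF subalgebra_F, of "space M" s] in \<open>simp add: sets.top[of "F s", simplified] emeasure_space_1[simplified]\<close>)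

text \<open>With the identity as first component, measured by \<open>F s\<close> only, one product
  formula expresses independence from the whole of \<open>F s\<close>. On rectangles it is
  \<open>indep_increment\<close>, and rectangles determine the product measure.\<close>

lemma core_distr:
 assumes st: "0 <= s" "s <= t" "t <= T"
 shows core_measurable: "(%w. (w, W t w - W s w)) : P \<rightarrow>\<^sub>M (FP s \<Otimes>\<^sub>M gauss (t - s))" (is "?X : _")
 and "FP s \<Otimes>\<^sub>M gauss (t - s) = distr P (FP s \<Otimes>\<^sub>M gauss (t - s)) (%w. (w, W t w - W s w))"
proof -
 define Q where "Q = FP s"
 have sQ [measurable_cong]: "sets Q = sets (F s)" and spQ: "space Q = space M"
 unfolding Q_def by auto
 have eQ: "emeasure Q A = emeasure P A" if "A : sets (F s)" for A
 unfolding Q_def by (rule emeasure_restr_to_subalg[OF subalgebra_F that])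
 interpret Q: prob_space Q unfolding Q_def by (rule prob_space_FP)
 interpret g: prob_space "gauss (t - s) :: (real^'n) measure" using st by (intro prob_space_gauss) auto
 have [measurable]: "W s : bm P" "W t : bm P"
 using W_measurable_M st by (auto intro: measurable_completion)
 have id [measurable]: "(%w. w) : P \<rightarrow>\<^sub>M Q" 
 proof (rule measurableI)
 fix A assume "A : sets Q"
 then have "A : sets P" using sets_F_le sQ by auto
 then show "(%w. w) -` A Int space P : sets P" by (metis sets.Int_space_eq2 vimage_ident)
 qed (auto simp: spQ)
 have X: "(%w. (w, W t w - W s w)) : P \<rightarrow>\<^sub>M (Q \<Otimes>\<^sub>M gauss (t - s))"
 by measurable
 have "Q \<Otimes>\<^sub>M gauss (t - s) = distr P (Q \<Otimes>\<^sub>M gauss (t - s)) (%w. (w, W t w - W s w))"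
 proof (rule pair_measure_eqI)
 fix A B assume A: "A : sets Q" and B: "B : sets (gauss (t - s) :: (real^'n) measure)"
 have "(%w. (w, W t w - W s w)) -` (A \<times> B) Int space P = A Int {w:space M. W t w - W s w : B}"
 by auto
 then show "emeasure Q A * emeasure (gauss (t - s)) B =
 emeasure (distr P (Q \<Otimes>\<^sub>M gauss (t - s)) (%w. (w, W t w - W s w))) (A \<times> B)"
 using A B indep_increment[OF st, of A B] eQ[of A] X
 by (subst emeasure_distr) (auto simp: sQ)
 qed (auto intro: Q.sigma_finite_measure g.sigma_finite_measure)
 with X show "?X : P \<rightarrow>\<^sub>M (FP s \<Otimes>\<^sub>M gauss (t - s))"
 "FP s \<Otimes>\<^sub>M gauss (t - s) = distr P (FP s \<Otimes>\<^sub>M gauss (t - s)) (%w. (w, W t w - W s w))"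
 unfolding Q_def by auto
qed

text \<open>Freezing: whatever is known at time \<open>s\<close> is held fixed while the increment
  is integrated out against its Gaussian law. All moment and Markov computations below are
  instances.\<close>

lemma core:
 assumes st: "0 <= s" "s <= t" "t <= T" and Phi: "\<Phi> : bm (F s \<Otimes>\<^sub>M borel)"
 shows "(NN w. \<Phi> (w, W t w - W s w)) = (NN w. (\<integral>\<^sup>+y. \<Phi> (w, y) \<partial>gauss (t - s)))"
proof -
 interpret g: prob_space "gauss (t - s) :: (real^'n) measure" using st by (intro prob_space_gauss) auto
 have Phi': "\<Phi> : bm (FP s \<Otimes>\<^sub>M gauss (t - s))"
 using Phi by (simp add: measurable_cong_sets[OF sets_pair_measure_cong[OF sets_FP sets_gauss] refl])
 have "(NN w. \<Phi> (w, W t w - W s w)) = (\<integral>\<^sup>+z. \<Phi> z \<partial>(distr P (FP s \<Otimes>\<^sub>M gauss (t - s)) (%w. (w, W t w - W s w))))"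
 using Phi' by (subst nn_integral_distr[OF core_measurable[OF st]]) auto
 also have "... = (\<integral>\<^sup>+z. \<Phi> z \<partial>(FP s \<Otimes>\<^sub>M gauss (t - s)))"
 using core_distr(2)[OF st] by simp
 also have "... = (\<integral>\<^sup>+w. (\<integral>\<^sup>+y. \<Phi> (w, y) \<partial>gauss (t - s)) \<partial>FP s)"
 using Phi' by (subst g.nn_integral_fst) auto
 also have "... = (NN w. (\<integral>\<^sup>+y. \<Phi> (w, y) \<partial>gauss (t - s)))"
 proof (rule nn_integral_subalgebra2[OF subalgebra_F])
 have "\<Phi> : bm (F s \<Otimes>\<^sub>M gauss (t - s))" using Phi by (simp cong: measurable_cong_sets)
 then show "(%w. \<integral>\<^sup>+ y. \<Phi> (w, y) \<partial>gauss (t - s)) : bm (F s)"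
 by measurable
 qed
 finally show ?thesis .
qed

lemma core_lebesgue:
 fixes \<Phi> :: "'a \<times> (real ^ 'n) => real"
 assumes st: "0 <= s" "s <= t" "t <= T" and Phi: "\<Phi> : bm (F s \<Otimes>\<^sub>M borel)"
 and int: "integrable P (%w. \<Phi> (w, W t w - W s w))"
 shows "(EE w. \<Phi> (w, W t w - W s w)) = (EE w. (\<integral>y. \<Phi> (w, y) \<partial>gauss (t - s)))"
proof -
 interpret g: prob_space "gauss (t - s) :: (real^'n) measure" using st by (intro prob_space_gauss) auto
 interpret Q: prob_space "FP s" by (rule prob_space_FP)
 interpret pair_sigma_finite "FP s" "gauss (t - s) :: (real^'n) measure" ..
 have Phi': "\<Phi> : bm (FP s \<Otimes>\<^sub>M gauss (t - s))"
 using Phi by (simp add: measurable_cong_sets[OF sets_pair_measure_cong[OF sets_FP sets_gauss] refl])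
 have "integrable (distr P (FP s \<Otimes>\<^sub>M gauss (t - s)) (%w. (w, W t w - W s w))) \<Phi>"
 using int by (subst integrable_distr_eq[OF core_measurable[OF st] Phi'])
 then have i: "integrable (FP s \<Otimes>\<^sub>M gauss (t - s)) \<Phi>" using core_distr(2)[OF st] by simp
 have "(EE w. \<Phi> (w, W t w - W s w)) = (\<integral>z. \<Phi> z \<partial>(distr P (FP s \<Otimes>\<^sub>M gauss (t - s)) (%w. (w, W t w - W s w))))"
 by (subst integral_distr[OF core_measurable[OF st] Phi']) auto
 also have "... = (\<integral>z. \<Phi> z \<partial>(FP s \<Otimes>\<^sub>M gauss (t - s)))"
 using core_distr(2)[OF st] by simp
 also have "... = (\<integral>w. (\<integral>y. \<Phi> (w, y) \<partial>gauss (t - s)) \<partial>FP s)"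
 using integral_fst'[OF i] by simp
 also have "... = (EE w. (\<integral>y. \<Phi> (w, y) \<partial>gauss (t - s)))"
 proof (rule integral_subalgebra2[OF subalgebra_F])
 have "\<Phi> : bm (F s \<Otimes>\<^sub>M gauss (t - s))" using Phi by (simp cong: measurable_cong_sets)
 then show "(%w. \<integral>y. \<Phi> (w, y) \<partial>gauss (t - s)) : bm (F s)"
 by measurable
 qed
 finally show ?thesis .
qed

end

section \<open>Moments of Gaussian vectors\<close>

lemma exp_slope:
 fixes z :: real
 assumes "h ~> 0" "!!n::nat. h n ~= 0"
 shows "(%n. (exp (h n * z) - 1) / h n) ~> z"
proof -
 have "((%t. exp (t * z)) has_real_derivative z) (at 0)" by (auto intro!: derivative_eq_intros)
 then have "(%t. (exp (t * z) - 1) / t) \<midarrow>0\<rightarrow> z" by (simp add: DERIV_def)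
 moreover have "filterlim h (at 0) sequentially" using assms by (simp add: filterlim_at)
 ultimately show ?thesis by (rule filterlim_compose)
qed

text \<open>This dominates the symmetric difference quotients of the exponential by exponentials,
  uniformly in the step, so that dominated convergence applies under a Gaussian law.\<close>

lemma sinh_bound: "abs (exp z - exp (- z)) <= 2 * abs z * exp (abs z)" for z :: real
proof -
 have "exp a - exp (- a) <= 2 * a * exp a" for a :: real
 proof -
 have "exp a * (1 - exp (- (2 * a))) <= exp a * (2 * a)" using exp_ge_add_one_self[of "- (2 * a)"] by (intro mult_left_mono) auto
 then show ?thesis by (simp add: right_diff_distrib exp_add[symmetric] mult_ac)
 qed
 from this[of "abs z"] show ?thesis by (cases "0 <= z") (auto simp: abs_if)
qed

context
 fixes r :: real and x :: "real^'n::finite"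
 assumes r: "0 <= r"
begin

lemma gauss_exp:
 shows "integrable (gauss r) (%y. exp (c * (x \<bullet> y)))"
 and "(\<integral>y. exp (c * (x \<bullet> y)) \<partial>gauss r) = exp (c^2 * ((norm x)^2 * r) / 2)"
proof -
 have e: "(\<integral>\<^sup>+y. ennreal (exp (c * (x \<bullet> y))) \<partial>gauss r) = ennreal (exp (c^2 * ((norm x)^2 * r) / 2))"
 using gauss_mgf[OF r, of "c *\<^sub>R x"] by (simp add: power_mult_distrib mult.assoc)
 show i: "integrable (gauss r) (%y. exp (c * (x \<bullet> y)))"
 using e by (intro integrableI_nonneg) auto
 show "(\<integral>y. exp (c * (x \<bullet> y)) \<partial>gauss r) = exp (c^2 * ((norm x)^2 * r) / 2)"
 using e i by (subst (asm) nn_integral_eq_integral) auto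
qed

text \<open>The moments are limits of those of the symmetric difference quotients of \<open>%t. exp (t * (x \<bullet> y))\<close> at \<open>0\<close>.\<close>
lemma gauss_moments:
 shows gauss_mean: "(\<integral>y. (x \<bullet> y) \<partial>gauss r) = 0"
 and gauss_square: "integrable (gauss r) (%y. (x \<bullet> y)^2)"
 and gauss_variance: "(\<integral>y. (x \<bullet> y)^2 \<partial>gauss r) = (norm x)^2 * r"
proof -
 define h where "h n = 1 / real (Suc n)" for n
 have h: "h ~> 0" "h n ~= 0" "0 < h n" "h n <= 1" for n using LIMSEQ_Suc[OF lim_1_over_n] unfolding h_def by auto
 \<comment> \<open>The symmetric quotient is chosen because its square is again a combination of
   exponentials; the first and the second moment then both come from
   \<open>gauss_exp\<close>.\<close>
 define s where "s n z = (exp (h n * (z / 2)) - exp (- (h n * (z / 2)))) / h n" for n z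
 have sl: "(%n. s n z) ~> z" for z
 using tendsto_diff[OF exp_slope[OF h(1,2), of "z / 2"] exp_slope[OF h(1,2), of "- (z / 2)"]] unfolding s_def by (simp add: diff_divide_distrib)
 have sb: "abs (s n z) <= 2 * exp (abs z)" and sq: "(s n z)^2 = (exp (h n * z) + exp (- h n * z) - 2) / (h n)\<^sup>2" for n z
 proof -
 have "abs (s n z) = abs (exp (h n * (z / 2)) - exp (- (h n * (z / 2)))) / h n" using h(3)[of n] unfolding s_def by simp
 also have "... <= (2 * abs (h n * (z / 2)) * exp (abs (h n * (z / 2)))) / h n" using h(3)[of n] by (intro divide_right_mono sinh_bound) simp
 also have "... = abs z * exp (h n * (abs z / 2))" using h(3)[of n] by (simp add: abs_mult)
 also have "... <= (2 * exp (abs z / 2)) * exp (1 * (abs z / 2))"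
 proof (intro mult_mono)
 show "abs z <= 2 * exp (abs z / 2)" using exp_ge_add_one_self[of "abs z / 2"] by linarith
 have "h n * (abs z / 2) <= 1 * (abs z / 2)" using h(4)[of n] by (intro mult_right_mono) auto
 then show "exp (h n * (abs z / 2)) <= exp (1 * (abs z / 2))" by simp
 qed auto
 also have "... = 2 * exp (abs z)" by (simp add: exp_add[symmetric])
 finally show "abs (s n z) <= 2 * exp (abs z)" .
 have "(exp (h n * (z / 2)) - exp (- (h n * (z / 2))))^2 = exp (h n * z) + exp (- h n * z) - 2"
 by (simp add: power2_eq_square algebra_simps exp_add[symmetric])
 then show "(s n z)^2 = (exp (h n * z) + exp (- h n * z) - 2) / (h n)\<^sup>2" unfolding s_def by (simp add: power_divide)
 qed
 have e: "exp (c * abs z) <= exp (c * z) + exp (- c * z)" for c z :: real by (auto simp: abs_if)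
 have w: "integrable (gauss r) (%y. C * (exp (c * (x \<bullet> y)) + exp (- c * (x \<bullet> y))))" for C c
 by (intro integrable_mult_right Bochner_Integration.integrable_add gauss_exp)
 have lim1: "(%n. \<integral>y. s n (x \<bullet> y) \<partial>gauss r) ~> (\<integral>y. (x \<bullet> y) \<partial>gauss r)"
 proof (rule integral_dominated_convergence[OF _ _ w[of 2 1]])
 show "AE y in gauss r. norm (s n (x \<bullet> y)) <= 2 * (exp (1 * (x \<bullet> y)) + exp (- 1 * (x \<bullet> y)))" for n
 using sb e[of 1] by (intro AE_I2) (smt (verit) real_norm_def)
 show "AE y in gauss r. (%n. s n (x \<bullet> y)) ~> x \<bullet> y" by (intro AE_I2 sl)
 show "(%y. s n (x \<bullet> y)) : bm (gauss r)" for n unfolding s_def by measurable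
 qed simp
 have "(\<integral>y. s n (x \<bullet> y) \<partial>gauss r) = 0" for n
 using gauss_exp(1)[of "h n / 2"] gauss_exp(1)[of "- h n / 2"] gauss_exp(2)[of "h n / 2"] gauss_exp(2)[of "- h n / 2"] unfolding s_def by simp
 then show "(\<integral>y. (x \<bullet> y) \<partial>gauss r) = 0" using lim1 LIMSEQ_unique[OF _ tendsto_const] by fastforce
 have dom: "(s n z)^2 <= 4 * (exp (2 * z) + exp (- 2 * z))" for n z
 proof -
 have "(s n z)^2 <= (2 * exp (abs z))^2" using power_mono[OF sb abs_ge_zero, of n z 2] by simp
 also have "... = 4 * exp (2 * abs z)" by (simp add: power_mult_distrib exp_double)
 finally show ?thesis using e[of 2 z] by simp
 qed
 have l2: "AE y in gauss r. (%n. (s n (x \<bullet> y))^2) ~> (x \<bullet> y)^2" by (intro AE_I2 tendsto_power sl)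
 have d2: "AE y in gauss r. norm ((s n (x \<bullet> y))^2) <= 4 * (exp (2 * (x \<bullet> y)) + exp (- 2 * (x \<bullet> y)))" for n using dom by simp
 have m: "(%y. (x \<bullet> y)^2) : bm (gauss r)" "(%y. (s n (x \<bullet> y))^2) : bm (gauss r)" for n unfolding s_def by measurable
 show "integrable (gauss r) (%y. (x \<bullet> y)^2)" by (rule integrable_dominated_convergence[OF m w l2 d2])
 have "(%n. 2 * ((exp ((h n)^2 * ((norm x)^2 * r / 2)) - 1) / (h n)\<^sup>2)) ~> 2 * ((norm x)^2 * r / 2)"
 using tendsto_power[OF h(1), of 2] h(2) by (intro tendsto_mult tendsto_const exp_slope) auto
 moreover have "(\<integral>y. (s n (x \<bullet> y))^2 \<partial>gauss r) = 2 * ((exp ((h n)^2 * ((norm x)^2 * r / 2)) - 1) / (h n)\<^sup>2)" for n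
 proof -
 interpret prob_space "gauss r :: (real^'n) measure" by (rule prob_space_gauss[OF r])
 show ?thesis unfolding sq using gauss_exp[of "h n"] gauss_exp[of "- h n"]
 by (simp add: Bochner_Integration.integral_diff prob_space[simplified] field_simps)
 qed
 ultimately show "(\<integral>y. (x \<bullet> y)^2 \<partial>gauss r) = (norm x)^2 * r"
 using LIMSEQ_unique[OF integral_dominated_convergence[OF m w l2 d2]] by simp
qed

end

section \<open>Square-integrable adapted variables\<close>

context wiener begin

definition L2F :: "real => ('a => real) => bool" where
 "L2F s X <-> X : bm (F s) & integrable P (%w. (X w)^2)"

lemma L2F_m: "L2F s X ==> X : bm (F s)"
 and L2F_mP: "L2F s X ==> X : bm P"
 and L2F_square: "L2F s X ==> integrable P (%w. (X w)^2)"
 unfolding L2F_def by (auto intro: mFP)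

lemma L2F_mono: "L2F s X ==> s <= t ==> L2F t X"
 unfolding L2F_def by (auto intro: mF_mono)

lemma L2_mult:
 fixes X Y :: "'a => real"
 assumes [measurable]: "X : bm P" "Y : bm P"
 and "integrable P (%w. (X w)^2)" "integrable P (%w. (Y w)^2)"
 shows "integrable P (%w. X w * Y w)"
proof (rule Bochner_Integration.integrable_bound[OF Bochner_Integration.integrable_add[OF assms(3,4)]])
 have "abs (x * y) <= x^2 + y^2" for x y :: real
 proof -
 have "0 <= abs x * abs y" "2 * (abs x * abs y) <= x^2 + y^2"
 using sum_squares_bound[of "abs x" "abs y"] by (simp_all add: mult.assoc)
 then show ?thesis unfolding abs_mult by linarith
 qed
 then show "AE w in P. norm (X w * Y w) <= norm ((X w)^2 + (Y w)^2)" by (intro AE_I2) auto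
qed measurable

lemma L2F_mult: "L2F s X ==> L2F t Y ==> integrable P (%w. X w * Y w)"
 unfolding L2F_def by (intro L2_mult) (auto intro: mFP)

lemma L2F_const [simp]: "L2F s (%_. c)"
 unfolding L2F_def by auto

lemma L2F_integrable: "L2F s X ==> integrable P X"
 using L2F_mult[of s X s "%_. 1"] by simp

lemma L2F_add: assumes "L2F s X" "L2F s Y" shows "L2F s (%w. X w + Y w)"
proof -
 have "integrable P (%w. (X w)^2 + 2 * (X w * Y w) + (Y w)^2)"
 using assms L2F_mult[OF assms] unfolding L2F_def by auto
 then show ?thesis using assms unfolding L2F_def by (auto simp: power2_sum algebra_simps)
qed

lemma L2F_cmult: "L2F s X ==> L2F s (%w. c * X w)"
 unfolding L2F_def by (auto simp: power_mult_distrib)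

lemma L2F_diff: "L2F s X ==> L2F s Y ==> L2F s (%w. X w - Y w)"
 using L2F_add[of s X "%w. - 1 * Y w"] L2F_cmult[of s Y "-1"] by simp

lemma L2F_sum: "finite I ==> (!!i. i : I ==> L2F s (X i)) ==> L2F s (%w. SUM i:I. X i w)"
 by (induction I rule: finite_induct) (auto intro: L2F_add)

lemma L2F_bounded:
 assumes "X : bm (F s)" "AE w in P. abs (X w) <= C" shows "L2F s X"
proof -
 have "integrable P (%w. (X w)^2)"
 proof (rule integrable_const_bound)
 show "AE w in P. norm ((X w)^2) <= C^2"
 using assms(2) by eventually_elim (simp add: abs_le_square_iff[symmetric] power2_le_iff_abs_le)
 qed (use assms(1) in "auto intro: mFP borel_measurable_power")
 then show ?thesis using assms unfolding L2F_def by auto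
qed

lemma L2F_bounded_mult:
 assumes "L2F s X" "c : bm (F s)" "AE w in P. abs (c w) <= C"
 shows "L2F s (%w. c w * X w)"
proof -
 have [measurable]: "c : bm P" "X : bm P"
 using assms by (auto intro: mFP L2F_m)
 have "integrable P (%w. (c w * X w)^2)"
 proof (rule Bochner_Integration.integrable_bound)
 show "integrable P (%w. C^2 * (X w)^2)" using L2F_square[OF assms(1)] by simp
 show "AE w in P. norm ((c w * X w)^2) <= norm (C^2 * (X w)^2)"
 using assms(3) by eventually_elim (auto simp: power_mult_distrib abs_le_square_iff[symmetric] intro!: mult_right_mono)
 qed measurable
 then show ?thesis using assms unfolding L2F_def by auto
qed

lemma L2F_indicator:
 assumes "A : sets (F s)" shows "L2F s (ind A)"
 by (rule L2F_bounded[where C=1]) (use assms in "auto split: split_indicator")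

lemma L2F_indicator_mult:
 assumes "L2F s X" "A : sets (F s)" shows "L2F s (%w. ind A w * X w)"
 by (rule L2F_bounded_mult[where C=1]) (use assms in "auto split: split_indicator")

lemma L2F_AE: "L2F s X ==> AE w in P. X w = Y w ==> L2F s Y"
proof -
 assume X: "L2F s X" and eq: "AE w in P. X w = Y w"
 have Y: "Y : bm (F s)" using borel_F_AE[OF L2F_m[OF X] eq] .
 have [measurable]: "Y : bm P" "X : bm P"
 using Y X by (auto intro: mFP L2F_m)
 have "integrable P (%w. (Y w)^2)"
 using L2F_square[OF X] by (rule integrable_cong_AE_imp) (use eq in auto)
 then show "L2F s Y" using Y unfolding L2F_def by auto
qed

context
 fixes Xi :: "'a => real ^ 'n" and s t K :: real
 assumes st: "0 <= s" "s <= t" "t <= T"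
 and xi: "Xi : bm (F s)" and K: "!!w. w : space M ==> norm (Xi w) <= K"
begin

lemma W_measurables: "W s : bm P" "W t : bm P" "Xi : bm P"
 "W s : bm (F s)" "W t : bm (F t)" "W s : bm (F t)" "Xi : bm (F t)"
 using st xi W_F[of s s] W_F[of t t] W_F[of s t]
 by (auto intro: mFP mF_mono[OF st(2)])

text \<open>With \<open>Xi\<close> frozen, the inner product is a centred Gaussian variable of
  variance \<open>(norm (Xi w))^2 * (t - s)\<close>: the isometry for a single cell.\<close>

lemma increment_L2:
 shows "L2F t (%w. Xi w \<bullet> (W t w - W s w))"
 and "integrable P (%w. (norm (Xi w))^2 * (t - s))"
 and "(EE w. (Xi w \<bullet> (W t w - W s w))^2) = (EE w. (norm (Xi w))^2 * (t - s))"
proof -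
 note W_measurables[measurable] xi[measurable]
 show b: "integrable P (%w. (norm (Xi w))^2 * (t - s))"
 by (rule integrable_const_bound[where B = "K^2 * (t - s)"]) (use K st in "auto intro!: AE_I2 mult_right_mono power_mono simp: abs_mult")
 have "(NN w. ennreal ((Xi w \<bullet> (W t w - W s w))^2)) = (NN w. (\<integral>\<^sup>+y. ennreal ((Xi w \<bullet> y)^2) \<partial>gauss (t - s)))"
 using core[OF st, of "%(w, y). ennreal ((Xi w \<bullet> y)^2)"] by simp
 also have "... = (NN w. ennreal ((norm (Xi w))^2 * (t - s)))"
 using st by (simp add: nn_integral_eq_integral gauss_square gauss_variance)
 also have "... = ennreal (EE w. (norm (Xi w))^2 * (t - s))" by (rule nn_integral_eq_integral[OF b]) (use st in auto)
 finally have e: "(NN w. ennreal ((Xi w \<bullet> (W t w - W s w))^2)) = ennreal (EE w. (norm (Xi w))^2 * (t - s))" .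
 then have i: "integrable P (%w. (Xi w \<bullet> (W t w - W s w))^2)" by (intro integrableI_nonneg) auto
 then show "L2F t (%w. Xi w \<bullet> (W t w - W s w))" unfolding L2F_def by simp
 show "(EE w. (Xi w \<bullet> (W t w - W s w))^2) = (EE w. (norm (Xi w))^2 * (t - s))"
 using e st by (subst (asm) nn_integral_eq_integral[OF i]) auto
qed

text \<open>Both \<open>X\<close> and \<open>Xi\<close> are known at \<open>s\<close>; once they are
  frozen, the integrand is linear in a centred Gaussian vector.\<close>

lemma increment_mean:
 assumes X: "L2F s X"
 shows "(EE w. X w * (Xi w \<bullet> (W t w - W s w))) = 0"
proof -
 have [measurable]: "X : bm (F s)" "Xi : bm (F s)" using X xi by (auto simp: L2F_def)
 have "(EE w. X w * (Xi w \<bullet> (W t w - W s w))) = (EE w. (\<integral>y. X w * (Xi w \<bullet> y) \<partial>gauss (t - s)))"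
 using core_lebesgue[OF st, of "%(w, y). X w * (Xi w \<bullet> y)"]
 L2F_mult[OF X increment_L2(1)] by simp
 also have "... = 0"
 proof -
 have z: "(\<integral>y. X w * (Xi w \<bullet> y) \<partial>gauss (t - s)) = 0" for w
 using gauss_mean[of "t - s" "Xi w"] st by simp
 show ?thesis unfolding z by simp
 qed
 finally show ?thesis .
qed

end

end

section \<open>Martingale differences and the maximal inequality\<close>

context wiener begin

lemma grid_mono:
 fixes t :: "nat => real"
 assumes "!!i. i < m ==> t i <= t (Suc i)" "i <= j" "j <= m" shows "t i <= t j"
 using assms(2,3)
proof (induction j rule: dec_induct)
 case (step k)
 then show ?case using assms(1)[of k] by auto
qed simp

lemma fatou_square:
 fixes f :: "nat => 'a => real"
 assumes [measurable]: "!!n. f n : bm P" "g : bm P"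
 and conv: "AE w in P. (%n. f n w) ~> g w"
 and f: "!!n. integrable P (%w. (f n w)^2)" "!!n. (EE w. (f n w)^2) <= c"
 shows "integrable P (%w. (g w)^2)" "(EE w. (g w)^2) <= c"
proof -
 have c: "0 <= c" using order_trans[OF Bochner_Integration.integral_nonneg f(2)[of 0]] by simp
 have "(NN w. ennreal ((g w)^2)) = (NN w. liminf (%n. ennreal ((f n w)^2)))"
 proof (rule nn_integral_cong_AE)
 show "AE w in P. ennreal ((g w)^2) = liminf (%n. ennreal ((f n w)^2))"
 using conv
 proof eventually_elim
 case (elim w)
 then have "(%n. ennreal ((f n w)^2)) ~> ennreal ((g w)^2)"
 by (intro tendsto_ennrealI tendsto_power)
 then have "liminf (%n. ennreal ((f n w)^2)) = ennreal ((g w)^2)" by (intro lim_imp_Liminf) auto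
 then show ?case by simp
 qed
 qed
 also have "... <= liminf (%n. (NN w. ennreal ((f n w)^2)))"
 by (rule nn_integral_liminf) auto
 also have "... <= ennreal c"
 proof (rule Liminf_le)
 show "EV n. (NN w. ennreal ((f n w)^2)) <= ennreal c"
 using f by (intro always_eventually allI, subst nn_integral_eq_integral) (auto intro!: ennreal_leI)
 qed simp
 finally have le: "(NN w. ennreal ((g w)^2)) <= ennreal c" .
 then show i: "integrable P (%w. (g w)^2)"
 by (intro integrableI_nonneg) (auto intro: le_less_trans)
 show "(EE w. (g w)^2) <= c"
 using le c by (subst (asm) nn_integral_eq_integral[OF i]) auto
qed

lemma square_add_le:
 fixes X Y :: "'a => real"
 assumes [measurable]: "X : bm P" "Y : bm P"
 and "integrable P (%w. (X w)^2)" "integrable P (%w. (Y w)^2)"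
 shows "integrable P (%w. (X w + Y w)^2)"
 and "(EE w. (X w + Y w)^2) <= 2 * (EE w. (X w)^2) + 2 * (EE w. (Y w)^2)"
proof -
 have b: "(x + y)^2 <= 2 * x^2 + 2 * y^2" for x y :: real
 using zero_le_power2[of "x - y"] by (simp add: power2_sum power2_diff)
 show i: "integrable P (%w. (X w + Y w)^2)"
 by (rule Bochner_Integration.integrable_bound[of _ "%w. 2 * (X w)^2 + 2 * (Y w)^2"])
 (use assms b in auto)
 have "(EE w. (X w + Y w)^2) <= (EE w. 2 * (X w)^2 + 2 * (Y w)^2)"
 using assms i b by (intro integral_mono) auto
 then show "(EE w. (X w + Y w)^2) <= 2 * (EE w. (X w)^2) + 2 * (EE w. (Y w)^2)"
 using assms by simp
qed

lemma L2_tendsto_mult: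
 fixes X :: "'a => real" and Y :: "nat => 'a => real"
 assumes [measurable]: "X : bm P" "!!n. Y n : bm P"
 and X: "integrable P (%w. (X w)^2)" and Y: "!!n. integrable P (%w. (Y n w)^2)"
 and lim: "(%n. (EE w. (Y n w)^2)) ~> 0"
 shows "(%n. (EE w. X w * Y n w)) ~> 0"
proof (rule LIMSEQ_I)
 fix e :: real assume e: "0 < e"
 define C where "C = (EE w. (X w)^2)"
 have C: "0 <= C" unfolding C_def by simp
 \<comment> \<open>The weight in \<open>2 |x y| <= d x^2 + y^2 / d\<close>. It makes
   \<open>d * C <= e\<close>, and the other term is below \<open>e\<close> once the second moment of
   \<open>Y n\<close> is below \<open>e * d\<close>.\<close>
 define d where "d = e / (1 + C)"
 have d: "0 < d" using e C unfolding d_def by (intro divide_pos_pos) auto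
 have "EV n. (EE w. (Y n w)^2) < e * d"
 using lim e d by (intro order_tendstoD(2)) auto
 then obtain n0 where n0: "!!n. n >= n0 ==> (EE w. (Y n w)^2) < e * d"
 unfolding eventually_sequentially by auto
 have "norm ((EE w. X w * Y n w) - 0) < e" if "n >= n0" for n
 proof -
 have b: "abs (x * y) <= (d * x^2 + y^2 / d) / 2" for x y :: real
 proof -
 have "0 <= (d * abs x - abs y)^2 / d" using d by simp
 also have "... = d * x^2 + y^2 / d - 2 * abs (x * y)"
 using d by (simp add: power2_diff abs_mult field_simps power2_eq_square)
 finally show ?thesis by (simp add: field_simps)
 qed
 have "abs ((EE w. X w * Y n w)) <= (EE w. abs (X w * Y n w))" by (rule integral_abs_bound)
 also have "... <= (EE w. (d * (X w)^2 + (Y n w)^2 / d) / 2)"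
 by (rule integral_mono) (use X Y L2_mult[OF assms(1,2) X Y] b in auto)
 also have "... = (d * C + (EE w. (Y n w)^2) / d) / 2" unfolding C_def using X Y by simp
 also have "... < (e + e) / 2"
 proof (intro divide_strict_right_mono add_le_less_mono)
 show "d * C <= e" unfolding d_def using C e by (simp add: field_simps)
 show "(EE w. (Y n w)^2) / d < e" using n0[OF that] d by (simp add: field_simps)
 qed simp
 finally show ?thesis by simp
 qed
 then show "EX n0. ALL n>=n0. norm ((EE w. X w * Y n w) - 0) < e" by blast
qed

context
 fixes t :: "nat => real" and m :: nat and d :: "nat => 'a => real"
 assumes t_mono: "!!i. i < m ==> t i <= t (Suc i)"
 and d_L2: "!!i. i < m ==> L2F (t (Suc i)) (d i)"
 and d_zero: "!!i X. i < m ==> L2F (t i) X ==> (EE w. X w * d i w) = 0"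
begin

lemma mdiff_sum_L2F: "j <= m ==> L2F (t j) (%w. \<Sum>i<j. d i w)"
 by (intro L2F_sum) (auto intro!: L2F_mono[OF d_L2] grid_mono[of m t] t_mono)

text \<open>Each difference has mean zero against everything square-integrable that is known before
  it, so all differences from index \<open>j\<close> on drop out of a mean taken against a variable
  known at \<open>t j\<close>.\<close>

lemma mdiff_orth:
 assumes "j <= k" "k <= m" "L2F (t j) X"
 shows "(EE w. X w * (\<Sum>i<k. d i w)) = (EE w. X w * (\<Sum>i<j. d i w))"
 using assms(1,2)
proof (induction k rule: dec_induct)
 case (step k)
 then have k: "k < m" by simp
 have X: "L2F (t k) X"
 by (rule L2F_mono[OF assms(3) grid_mono[of m t]]) (use step(1) k t_mono in auto)
 have "(EE w. X w * (\<Sum>i<Suc k. d i w)) = (EE w. X w * (\<Sum>i<k. d i w) + X w * d k w)"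
 by (simp add: algebra_simps)
 also have "... = (EE w. X w * (\<Sum>i<k. d i w)) + (EE w. X w * d k w)"
 by (rule Bochner_Integration.integral_add)
 (use k in "auto intro!: L2F_mult[OF X mdiff_sum_L2F] L2F_mult[OF X d_L2]")
 finally show ?case using step k d_zero[OF k X] by simp
qed simp

lemma mdiff_isometry:
 "j <= m ==> (EE w. (\<Sum>i<j. d i w)^2) = (\<Sum>i<j. (EE w. (d i w)^2))"
proof (induction j)
 case (Suc j)
 then have j: "j < m" by simp
 have S: "L2F (t j) (%w. \<Sum>i<j. d i w)" by (rule mdiff_sum_L2F) (use j in simp)
 have "(EE w. (\<Sum>i<Suc j. d i w)^2) =
 (EE w. (\<Sum>i<j. d i w)^2 + 2 * ((\<Sum>i<j. d i w) * d j w) + (d j w)^2)"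
 by (simp add: power2_sum algebra_simps)
 also have "... = (EE w. (\<Sum>i<j. d i w)^2) + 2 * (EE w. (\<Sum>i<j. d i w) * d j w) + (EE w. (d j w)^2)"
 using L2F_square[OF S] L2F_square[OF d_L2[OF j]] L2F_mult[OF S d_L2[OF j]] by simp
 finally show ?case using d_zero[OF j S] Suc by simp
qed simp

end

text \<open>The event splits according to the first index \<open>j\<close> at which the level is
  reached. The part \<open>A j\<close> is known at \<open>t j\<close>, so \<open>S j\<close> and
  \<open>S m\<close> have the same mean against \<open>X = ind (A j) * S j\<close>, and
  \<open>2 * S j * S m - (S j)^2 <= (S m)^2\<close> bounds the part by the second moment of
  \<open>S m\<close> on \<open>A j\<close>.\<close>

lemma kolmogorov:
 fixes S :: "nat => 'a => real" and t :: "nat => real"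
 assumes S: "!!j. j <= m ==> L2F (t j) (S j)"
 and t_mono: "!!i. i < m ==> t i <= t (Suc i)"
 and mart: "!!j X. j <= m ==> L2F (t j) X ==> (EE w. X w * S m w) = (EE w. X w * S j w)"
 and a: "0 < a"
 shows "prob {w:space M. EX j<=m. a <= abs (S j w)} <= (EE w. (S m w)^2) / a^2"
proof -
 define A where "A j = {w:space M. a <= abs (S j w) & (ALL k<j. abs (S k w) < a)}" for j
 have Sm: "S k : bm (F (t j))" if "k <= j" "j <= m" for j k
 using S[of k] that by (auto intro: L2F_m mF_mono[OF grid_mono[of m t]] t_mono)
 have A: "A j : sets (F (t j))" if "j <= m" for j
 proof -
 have "A j = {w:space (F (t j)). a <= abs (S j w)} - (\<Union>k\<in>{..<j}. {w:space (F (t j)). a <= abs (S k w)})"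
 unfolding A_def by auto
 also have "... : sets (F (t j))" using Sm that
 by (intro sets.Diff sets.finite_UN borel_measurable_le borel_measurable_abs measurable_const) auto
 finally show ?thesis .
 qed
 have AP: "A j : sets P" if "j <= m" for j using A[OF that] sets_F_le by auto
 have dis: "disjoint_family_on A {..m}"
 unfolding disjoint_family_on_def A_def by (auto simp: not_less[symmetric] elim: linorder_cases) (metis not_less nat_neq_iff)
 have un: "{w:space M. EX j<=m. a <= abs (S j w)} = (\<Union>j\<in>{..m}. A j)" (is "?L = ?R")
 proof
 show "?L \<subseteq> ?R"
 proof
 fix w assume w: "w : ?L"
 define j where "j = (LEAST j. j <= m & a <= abs (S j w))"
 have "j <= m & a <= abs (S j w)" unfolding j_def by (rule LeastI_ex) (use w in auto)
 moreover have "abs (S k w) < a" if "k < j" for k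
 using not_less_Least[of k "%j. j <= m & a <= abs (S j w)"] that calculation unfolding j_def by auto
 ultimately show "w : ?R" using w unfolding A_def by auto
 qed
 qed (auto simp: A_def)
 have Sq: "integrable P (%w. (S m w)^2)" using S[of m] by (auto intro: L2F_square)
 have key: "a^2 * prob (A j) <= (EE w. ind (A j) w * (S m w)^2)" if j: "j <= m" for j
 proof -
 define X where "X = (%w. ind (A j) w * S j w)"
 have X: "L2F (t j) X" unfolding X_def by (rule L2F_indicator_mult[OF S A]) (use j in auto)
 have mX: "(EE w. X w * S m w) = (EE w. X w * S j w)" by (rule mart[OF j X])
 have iX: "integrable P (%w. X w * S m w)" "integrable P (%w. X w * S j w)"
 using S j by (auto intro: L2F_mult[OF X])
 have iS: "integrable P (%w. ind (A j) w * (S m w)^2)"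
 using integrable_mult_indicator[OF AP[OF j] Sq] by simp
 have "a^2 * prob (A j) = (EE w. a^2 * ind (A j) w)" using AP[OF j] sets.sets_into_space[OF AP[OF j]] by (simp add: Int_absorb2)
 also have "... <= (EE w. X w * S j w)"
 proof (rule integral_mono)
 show "integrable P (%w. a^2 * ind (A j) w :: real)" using AP[OF j] by (intro integrable_mult_right integrable_real_indicator) (auto simp: emeasure_eq_measure)
 fix w
 show "a^2 * ind (A j) w <= X w * S j w"
 unfolding X_def A_def using a power_mono[of a "abs (S j w)" 2]
 by (auto simp: power2_eq_square split: split_indicator)
 qed (rule iX)
 also have "... = (EE w. 2 * (X w * S m w) - X w * S j w)"
 using iX mX by simp
 also have "... <= (EE w. ind (A j) w * (S m w)^2)"
 proof (rule integral_mono)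
 fix w
 show "2 * (X w * S m w) - X w * S j w <= ind (A j) w * (S m w)^2"
 using zero_le_power2[of "S m w - S j w"] unfolding X_def
 by (auto simp: power2_diff power2_eq_square algebra_simps split: split_indicator)
 qed (use iX iS in auto)
 finally show ?thesis .
 qed
 have "a^2 * prob (\<Union>j\<in>{..m}. A j) = (SUM j<=m. a^2 * prob (A j))"
 using dis AP by (subst finite_measure_finite_Union) (auto simp: sum_distrib_left)
 also have "... <= (SUM j<=m. (EE w. ind (A j) w * (S m w)^2))"
 by (intro sum_mono key) auto
 also have "... = (EE w. (SUM j<=m. ind (A j) w * (S m w)^2))"
 by (rule Bochner_Integration.integral_sum[symmetric])
 (use integrable_mult_indicator[OF AP Sq] in auto)
 also have "... <= (EE w. (S m w)^2)"
 proof (rule integral_mono)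
 show "integrable P (%w. SUM j<=m. ind (A j) w * (S m w)^2)"
 by (rule Bochner_Integration.integrable_sum) (use integrable_mult_indicator[OF AP Sq] in auto)
 fix w
 have "(SUM j<=m. ind (A j) w * (S m w)^2) = ind (\<Union>j\<in>{..m}. A j) w * (S m w)^2"
 by (simp add: sum_distrib_right[symmetric] indicator_UN_disjoint[OF _ dis])
 also have "... <= (S m w)^2" by (auto split: split_indicator)
 finally show "(SUM j<=m. ind (A j) w * (S m w)^2) <= (S m w)^2" .
 qed (rule Sq)
 finally show ?thesis unfolding un using a by (simp add: field_simps)
qed

end

section \<open>Continuous square-integrable martingales\<close>

lemma dyadic_dense:
 fixes T :: real
 assumes T: "0 < T" and t: "t : {0..T}"
 shows "EX j. (ALL n. j n <= (2::nat) ^ n & T * real (j n) / 2 ^ n <= t) & (%n. T * real (j n) / 2 ^ n) ~> t"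
proof -
 define j where "j n = nat \<lfloor>t * 2 ^ n / T\<rfloor>" for n
 have nn: "0 <= t * 2 ^ n / T" for n using T t by auto
 have lo: "real (j n) <= t * 2 ^ n / T" and up: "t * 2 ^ n / T <= real (j n) + 1" for n
 unfolding j_def using nn[of n] by (auto simp: of_nat_nat)
 have a: "T * real (j n) / 2 ^ n <= t" for n
 using lo[of n] T by (simp add: field_simps)
 have b: "t - T / 2 ^ n <= T * real (j n) / 2 ^ n" for n
 proof -
 have "T * (t * 2 ^ n / T) / 2 ^ n <= T * (real (j n) + 1) / 2 ^ n"
 using up[of n] T by (intro divide_right_mono mult_left_mono) auto
 moreover have "T * (t * 2 ^ n / T) / 2 ^ n = t" using T by simp
 moreover have "T * (real (j n) + 1) / 2 ^ n = T * real (j n) / 2 ^ n + T / 2 ^ n"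
 by (simp add: distrib_left add_divide_distrib)
 ultimately show ?thesis by linarith
 qed
 have "j n <= 2 ^ n" for n
 proof -
 have "t * 2 ^ n / T <= 2 ^ n" using t T by (simp add: field_simps)
 then have "real (j n) <= real (2 ^ n)" using lo[of n] unfolding of_nat_power of_nat_numeral by linarith
 then show ?thesis unfolding of_nat_le_iff .
 qed
 moreover have "(%n. T * real (j n) / 2 ^ n) ~> t"
 proof (rule tendsto_sandwich[of "%n. t - T / 2 ^ n" _ _ "%_. t"])
 show "(%n. t - T / 2 ^ n) ~> t"
 using tendsto_diff[OF tendsto_const[of t] tendsto_mult[OF tendsto_const[of T] LIMSEQ_inverse_realpow_zero[of 2]]]
 by (simp add: divide_inverse)
 qed (use a b in "auto intro!: always_eventually")
 ultimately show ?thesis using a by blast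
qed

lemma continuous_le_dyadic:
 fixes g :: "real => real"
 assumes T: "0 < T" and c: "continuous_on {0..T} g"
 and le: "!!n j. j <= 2 ^ n ==> g (T * real j / 2 ^ n) <= a" and t: "t : {0..T}"
 shows "g t <= a"
proof -
 obtain j where j: "!!n. j n <= 2 ^ n" "(%n. T * real (j n) / 2 ^ n) ~> t" "!!n. T * real (j n) / 2 ^ n <= t"
 using dyadic_dense[OF T t] by blast
 have m: "T * real (j n) / 2 ^ n : {0..T}" for n
 using j(3)[of n] t T by auto
 have "(%n. g (T * real (j n) / 2 ^ n)) ~> g t"
 by (rule continuous_on_tendsto_compose[OF c j(2) t]) (use m in auto)
 then show ?thesis by (rule LIMSEQ_le_const2) (use le j(1) in auto)
qed

context wiener begin

text \<open>The martingale property is stated by testing against square-integrable variables known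
  at the earlier time, which takes the place of a conditional expectation.\<close>

definition L2mart :: "(real => 'a => real) => bool" where
 "L2mart N <-> (ALL t:TI. L2F t (N t)) &
 (ALL s t X. 0 <= s & s <= t & t <= T & L2F s X --> (EE w. X w * N t w) = (EE w. X w * N s w)) &
 (AE w in P. continuous_on TI (%t. N t w))"

lemma L2mart_L2F: "L2mart N ==> t : TI ==> L2F t (N t)"
 and L2mart_orth: "L2mart N ==> 0 <= s ==> s <= t ==> t <= T ==> L2F s X ==> (EE w. X w * N t w) = (EE w. X w * N s w)"
 and L2mart_cont: "L2mart N ==> AE w in P. continuous_on TI (%t. N t w)"
 unfolding L2mart_def by auto

lemma L2mart_m: "L2mart N ==> t : TI ==> N t : bm P"
 using L2mart_L2F L2F_mP by blast

lemma L2mart_add: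
 assumes N: "L2mart N" and N': "L2mart N'"
 shows "L2mart (%t w. N t w + N' t w)"
 unfolding L2mart_def
proof (intro conjI ballI allI impI)
 fix t assume "t : TI"
 then show "L2F t (%w. N t w + N' t w)" by (intro L2F_add L2mart_L2F assms)
next
 fix s t X assume a: "0 <= s & s <= t & t <= T & L2F s X"
 then have "(EE w. X w * (N r w + N' r w)) = (EE w. X w * N r w) + (EE w. X w * N' r w)" if "r : TI" for r
 using L2F_mult[OF _ L2mart_L2F[OF N that], of s X] L2F_mult[OF _ L2mart_L2F[OF N' that], of s X] a
 by (simp add: distrib_left)
 then show "(EE w. X w * (N t w + N' t w)) = (EE w. X w * (N s w + N' s w))"
 using L2mart_orth[OF N, of s t X] L2mart_orth[OF N', of s t X] a by auto
next
 show "AE w in P. continuous_on TI (%t. N t w + N' t w)"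
 using L2mart_cont[OF N] L2mart_cont[OF N'] by eventually_elim (rule continuous_on_add)
qed

lemma L2mart_cmult: assumes N: "L2mart N" shows "L2mart (%t w. c * N t w)"
 unfolding L2mart_def
proof (intro conjI ballI allI impI)
 fix s t X assume a: "0 <= s & s <= t & t <= T & L2F s X"
 have "(EE w. X w * (c * N r w)) = c * (EE w. X w * N r w)" for r
 by (simp add: mult.left_commute)
 then show "(EE w. X w * (c * N t w)) = (EE w. X w * (c * N s w))"
 using L2mart_orth[OF N, of s t X] a by auto
next
 show "AE w in P. continuous_on TI (%t. c * N t w)"
 using L2mart_cont[OF N] by eventually_elim (intro continuous_intros)
qed (use L2mart_L2F[OF N] in "auto intro: L2F_cmult")

lemma L2mart_diff: "L2mart N ==> L2mart N' ==> L2mart (%t w. N t w - N' t w)"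
 using L2mart_add[of N "%t w. -1 * N' t w"] L2mart_cmult[of N' "-1"] by simp

lemma L2mart_square_le:
 assumes N: "L2mart N" and t: "t : TI"
 shows "(EE w. (N t w)^2) <= (EE w. (N T w)^2)"
proof -
 note Nt = L2mart_L2F[OF N t]
 have NT: "L2F T (N T)" using L2mart_L2F[OF N] T_pos by auto
 have "(EE w. N t w * N T w) = (EE w. (N t w)^2)"
 using L2mart_orth[OF N, of t T "N t"] Nt t by (auto simp: power2_eq_square)
 moreover have "0 <= (EE w. (N T w - N t w)^2)" by simp
 moreover have "(EE w. (N T w - N t w)^2) = (EE w. (N T w)^2 + (N t w)^2 - 2 * (N t w * N T w))"
 by (simp add: power2_diff mult_ac)
 moreover have "... = (EE w. (N T w)^2) + (EE w. (N t w)^2) - 2 * (EE w. N t w * N T w)"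
 using L2F_square[OF Nt] L2F_square[OF NT] L2F_mult[OF Nt NT] by simp
 ultimately show ?thesis by linarith
qed

text \<open>Dyadic grids are nested, so the events increase with \<open>n\<close>, and the bound,
  the same for every grid, passes to the union. Dyadic times keep the event measurable; path
  continuity supplies the other times later.\<close>

lemma doob_dyadic:
 assumes N: "L2mart N" and a: "0 < a"
 shows "{w:space M. EX n. EX j<=2^n. a < abs (N (T * real j / 2 ^ n) w)} : sets P"
 and "prob {w:space M. EX n. EX j<=2^n. a < abs (N (T * real j / 2 ^ n) w)} <= (EE w. (N T w)^2) / a^2"
proof -
 define A where "A n = {w:space M. EX j<=2^n. a < abs (N (T * real j / 2 ^ n) w)}" for n :: nat
 have dy: "T * real j / 2 ^ n : TI" if "j <= 2 ^ n" for j n :: nat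
 proof -
 have "real j <= 2 ^ n" using that by (metis of_nat_le_iff of_nat_numeral of_nat_power)
 then show ?thesis using T_pos by (simp add: field_simps)
 qed
 have Am: "A n : sets P" for n
 proof -
 have "A n = (\<Union>j\<in>{..2^n}. {w:space P. a < abs (N (T * real j / 2 ^ n) w)})" unfolding A_def by auto
 also have "... : sets P" using L2mart_m[OF N dy]
 by (intro sets.finite_UN borel_measurable_less borel_measurable_abs measurable_const) auto
 finally show ?thesis .
 qed
 have un: "{w:space M. EX n. EX j<=2^n. a < abs (N (T * real j / 2 ^ n) w)} = (\<Union>n. A n)"
 unfolding A_def by auto
 show "{w:space M. EX n. EX j<=2^n. a < abs (N (T * real j / 2 ^ n) w)} : sets P"
 unfolding un using Am by auto
 have inc: "incseq A"
 proof (rule incseq_SucI)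
 fix n show "A n \<subseteq> A (Suc n)"
 proof
 fix w assume "w : A n"
 then obtain j where j: "j <= 2 ^ n" "a < abs (N (T * real j / 2 ^ n) w)" "w : space M" unfolding A_def by auto
 have "T * real (2 * j) / 2 ^ Suc n = T * real j / 2 ^ n" by simp
 then show "w : A (Suc n)" unfolding A_def using j by (auto intro!: exI[of _ "2 * j"])
 qed
 qed
 have le: "prob (A n) <= (EE w. (N T w)^2) / a^2" for n
 proof -
 have "prob {w:space M. EX j<=2^n. a <= abs (N (T * real j / 2 ^ n) w)} <= (EE w. (N (T * real (2^n) / 2 ^ n) w)^2) / a^2"
 proof (rule kolmogorov[where t = "%j. T * real j / 2 ^ n" and S = "%j. N (T * real j / 2 ^ n)" and m = "2^n"])
 fix j X assume j: "j <= 2 ^ n" "L2F (T * real j / 2 ^ n) X"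
 have *: "T * real j / 2 ^ n <= T * real (2 ^ n) / 2 ^ n"
 using dy[OF j(1)] by simp
 show "expectation (%w. X w * N (T * real (2 ^ n) / 2 ^ n) w) = expectation (%w. X w * N (T * real j / 2 ^ n) w)"
 by (rule L2mart_orth[OF N _ *]) (use dy[OF j(1)] j T_pos in auto)
 qed (use dy L2mart_L2F[OF N] a T_pos in "auto simp: field_simps")
 moreover have "T * real (2 ^ n) / 2 ^ n = T" by simp
 ultimately have "prob {w:space M. EX j<=2^n. a <= abs (N (T * real j / 2 ^ n) w)} <= (EE w. (N T w)^2) / a^2"
 by (simp only:)
 moreover have "prob (A n) <= prob {w:space M. EX j<=2^n. a <= abs (N (T * real j / 2 ^ n) w)}"
 proof (rule finite_measure_mono)
 have "{w:space M. EX j<=2^n. a <= abs (N (T * real j / 2 ^ n) w)} = (\<Union>j\<in>{..2^n}. {w:space P. a <= abs (N (T * real j / 2 ^ n) w)})" by auto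
 also have "... : sets P" using L2mart_m[OF N dy]
 by (intro sets.finite_UN borel_measurable_le borel_measurable_abs measurable_const) auto
 finally show "{w:space M. EX j<=2^n. a <= abs (N (T * real j / 2 ^ n) w)} : sets P" .
 qed (auto simp: A_def intro: less_imp_le)
 ultimately show ?thesis by (rule order_trans[rotated])
 qed
 have "(%n. prob (A n)) ~> prob (\<Union>n. A n)"
 using finite_Lim_measure_incseq[OF _ inc] Am by blast
 then show "prob {w:space M. EX n. EX j<=2^n. a < abs (N (T * real j / 2 ^ n) w)} <= (EE w. (N T w)^2) / a^2"
 unfolding un by (rule LIMSEQ_le_const2) (use le in auto)
qed

text \<open>The rate is made for the Borel-Cantelli lemma: at level \<open>(1/2)^n\<close> the
  maximal inequality costs \<open>(1/16)^n / (1/4)^n = (1/4)^n\<close>, which is summable.\<close>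

lemma L2mart_fast_small:
 assumes D: "!!n. L2mart (D n)" and fast: "!!n. (EE w. (D n T w)^2) <= (1 / 16) ^ n"
 shows "AE w in P. EV n. ALL t:TI. abs (D n t w) <= (1 / 2) ^ n"
proof -
 define A where "A n = {w:space M. EX k. EX j<=2^k. (1 / 2) ^ n < abs (D n (T * real j / 2 ^ k) w)}" for n
 have A: "A n : sets P" for n unfolding A_def by (rule doob_dyadic(1)[OF D]) simp
 have le: "prob (A n) <= (1 / 4) ^ n" for n
 proof -
 have "prob (A n) <= (EE w. (D n T w)^2) / ((1 / 2) ^ n)\<^sup>2"
 unfolding A_def by (rule doob_dyadic(2)[OF D]) simp
 also have "... <= (1 / 16) ^ n / ((1 / 2) ^ n)\<^sup>2" using fast by (intro divide_right_mono) auto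
 also have "... = (1 / 4) ^ n" by (simp add: power_divide power2_eq_square power_mult_distrib[symmetric] field_simps)
 finally show ?thesis .
 qed
 have "AE w in P. EV n. w : space P - A n"
 proof (rule borel_cantelli_AE1)
 show "summable (%n. prob (A n))"
 by (rule summable_comparison_test[OF _ summable_geometric[of "1/4 :: real"]]) (use le in auto)
 qed (use A in "auto simp: emeasure_eq_measure less_top[symmetric]")
 moreover have "AE w in P. ALL n. continuous_on TI (%t. D n t w)"
 using L2mart_cont[OF D] by (simp add: AE_all_countable)
 ultimately show ?thesis
 proof eventually_elim
 case (elim w)
 show ?case
 using elim(1)
 proof eventually_elim
 fix n assume w: "w : space P - A n"
 have le: "abs (D n (T * real j / 2 ^ k) w) <= (1 / 2) ^ n" if "j <= 2 ^ k" for j k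
 by (rule leI) (use w that in "auto simp: A_def")
 have c: "continuous_on TI (%t. abs (D n t w))"
 using elim(2) by (intro continuous_on_rabs) blast
 show "ALL t:TI. abs (D n t w) <= (1 / 2) ^ n"
 using continuous_le_dyadic[OF T_pos c le] by blast
 qed
 qed
qed

lemma L2mart_fast_limit:
 assumes N: "!!n. L2mart (N n)"
 and fast: "!!n. (EE w. (N (Suc n) T w - N n T w)^2) <= (1 / 16) ^ n"
 shows "EX N'. L2mart N' & (AE w in P. uniform_limit TI (%n t. N n t w) (%t. N' t w) sequentially) &
 (ALL n. (EE w. (N n T w - N' T w)^2) <= 4 * (1 / 16) ^ n)"
proof -
 define N' where "N' t w = lim (%n. N n t w)" for t w
 note Nm[measurable] = L2mart_m[OF N]
 have small: "AE w in P. EV n. ALL t:TI. abs (N (Suc n) t w - N n t w) <= (1 / 2) ^ n"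
 by (rule L2mart_fast_small[of "%n t w. N (Suc n) t w - N n t w"]) (use N fast in "auto intro: L2mart_diff")
 have unif: "AE w in P. uniform_limit TI (%n t. N n t w) (%t. N' t w) sequentially"
 using small
 proof eventually_elim
 case (elim w)
 then obtain n0 where n0: "!!n t. n >= n0 ==> t : TI ==> abs (N (Suc n) t w - N n t w) <= (1 / 2) ^ n"
 unfolding eventually_sequentially by blast
 have step: "abs (N m t w - N n t w) <= 2 * (1 / 2) ^ n - 2 * (1 / 2) ^ m" if "n >= n0" "n <= m" "t : TI" for n m t
 using that(2)
 proof (induction m rule: dec_induct)
 case (step m)
 have "abs (N (Suc m) t w - N n t w) <= abs (N (Suc m) t w - N m t w) + abs (N m t w - N n t w)" by simp
 also have "... <= (1 / 2) ^ m + (2 * (1 / 2) ^ n - 2 * (1 / 2) ^ m)"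
 using n0[of m t] step that by (intro add_mono) auto
 also have "... = 2 * (1 / 2) ^ n - 2 * (1 / 2) ^ Suc m" by simp
 finally show ?case .
 qed simp
 have "uniformly_Cauchy_on TI (%n t. N n t w)"
 proof (rule uniformly_Cauchy_onI)
 fix e :: real assume e: "0 < e"
 obtain k where k: "(1 / 2 :: real) ^ k < e / 4" using real_arch_pow_inv[of "e / 4" "1 / 2"] e by auto
 have "dist (N m t w) (N n t w) < e" if "t : TI" "m >= max n0 k" "n >= max n0 k" for m n t
 proof -
 have "dist (N m t w) (N (max n0 k) t w) <= 2 * (1/2) ^ max n0 k" "dist (N n t w) (N (max n0 k) t w) <= 2 * (1/2) ^ max n0 k"
 using step[of "max n0 k" m t] step[of "max n0 k" n t] that by (auto simp: dist_real_def intro: order_trans)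
 moreover have "(1/2 :: real) ^ max n0 k <= (1/2) ^ k" by (intro power_decreasing) auto
 moreover have "dist (N m t w) (N n t w) <= dist (N m t w) (N (max n0 k) t w) + dist (N n t w) (N (max n0 k) t w)"
 by (metis dist_triangle dist_commute)
 ultimately show ?thesis using k by linarith
 qed
 then show "EX K. ALL t:TI. ALL m>=K. ALL n>=K. dist (N m t w) (N n t w) < e" by blast
 qed
 then have "uniformly_convergent_on TI (%n t. N n t w)" by (rule Cauchy_uniformly_convergent)
 then show ?case unfolding N'_def by (simp add: uniformly_convergent_uniform_limit_iff)
 qed
 have lim: "AE w in P. (%n. N n t w) ~> N' t w" if "t : TI" for t
 using unif by eventually_elim (rule tendsto_uniform_limitI[OF _ that])
 have N'F: "N' t : bm (F t)" if "t : TI" for t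
 unfolding N'_def using L2mart_L2F[OF N that] by (intro borel_measurable_lim_metric) (auto intro: L2F_m)
 have d2: "integrable P (%w. (N n t w - N m t w)^2)" if "t : TI" for n m t
 by (rule L2F_square[OF L2mart_L2F[OF L2mart_diff[OF N N] that]])
 \<comment> \<open>The constant 4 survives the factor 2 lost in each use of
   \<open>square_add_le\<close>, because \<open>2 + 2 * 4 / 16 <= 4\<close>.\<close>
 have bT: "(EE w. (N n T w - N (n + k) T w)^2) <= 4 * (1 / 16) ^ n" for n k
 proof (induction k arbitrary: n)
 case (Suc k)
 have T: "T : TI" using T_pos by auto
 have "(EE w. (N n T w - N (n + Suc k) T w)^2) = (EE w. ((N n T w - N (Suc n) T w) + (N (Suc n) T w - N (Suc n + k) T w))^2)"
 by simp
 also have "... <= 2 * (EE w. (N n T w - N (Suc n) T w)^2) + 2 * (EE w. (N (Suc n) T w - N (Suc n + k) T w)^2)"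
 using T by (intro square_add_le d2) auto
 also have "... <= 2 * (1 / 16) ^ n + 2 * (4 * (1 / 16) ^ Suc n)"
 using Suc[of "Suc n"] fast[of n] by (intro add_mono mult_left_mono) (auto simp: power2_commute)
 also have "... <= 4 * (1 / 16) ^ n" by simp
 finally show ?case .
 qed simp
 have bt: "(EE w. (N n t w - N (n + k) t w)^2) <= 4 * (1 / 16) ^ n" if "t : TI" for n k t
 using L2mart_square_le[OF L2mart_diff[OF N N] that, of n "n + k"] bT[of n k] by linarith
 have lim2: "AE w in P. (%k. N n t w - N (n + k) t w) ~> N n t w - N' t w" if "t : TI" for n t
 using lim[OF that]
 by eventually_elim (intro tendsto_intros, subst add.commute, rule LIMSEQ_ignore_initial_segment)
 have fat: "integrable P (%w. (N n t w - N' t w)^2)" "(EE w. (N n t w - N' t w)^2) <= 4 * (1 / 16) ^ n"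
 if t: "t : TI" for n t
 proof -
 have [measurable]: "N' t : bm P" using N'F[OF t] by (rule mFP)
 show "integrable P (%w. (N n t w - N' t w)^2)" "(EE w. (N n t w - N' t w)^2) <= 4 * (1 / 16) ^ n"
 using t by (auto intro!: fatou_square[OF _ _ lim2[OF t, of n] d2 bt])
 qed
 have N'L: "L2F t (N' t)" if "t : TI" for t
 proof -
 have "L2F t (%w. N 0 t w - N' t w)"
 unfolding L2F_def using N'F[OF that] fat(1)[OF that] L2mart_L2F[OF N that, of 0]
 by (auto intro!: borel_measurable_diff intro: L2F_m)
 from L2F_diff[OF L2mart_L2F[OF N that, of 0] this] show ?thesis by simp
 qed
 have "L2mart N'" unfolding L2mart_def
 proof (intro conjI ballI allI impI)
 fix s t X assume a: "0 <= s & s <= t & t <= T & L2F s X"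
 have conv: "(%n. (EE w. X w * N n r w)) ~> (EE w. X w * N' r w)" if r: "r : TI" for r
 proof -
 have "(%n. (EE w. X w * (N n r w - N' r w))) ~> 0"
 proof (rule L2_tendsto_mult)
 show "(%n. (EE w. (N n r w - N' r w)^2)) ~> 0"
 proof (rule tendsto_sandwich[OF _ _ tendsto_const])
 show "(%n. 4 * (1 / 16 :: real) ^ n) ~> 0"
 using tendsto_mult[OF tendsto_const[of 4] LIMSEQ_realpow_zero[of "1/16"]] by simp
 qed (use fat[OF r] in auto)
 qed (use a r fat[OF r] N'L[OF r] L2mart_L2F[OF N r] in "auto intro!: borel_measurable_diff intro: L2F_mP L2F_square")
 moreover have "(EE w. X w * (N n r w - N' r w)) = (EE w. X w * N n r w) - (EE w. X w * N' r w)" for n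
 using L2F_mult[OF _ L2mart_L2F[OF N r, of n], of s X] L2F_mult[OF _ N'L[OF r], of s X] a
 by (simp add: right_diff_distrib)
 ultimately show ?thesis by (simp add: LIM_zero_iff)
 qed
 have "(%n. (EE w. X w * N n t w)) = (%n. (EE w. X w * N n s w))"
 by (rule ext, rule L2mart_orth[OF N]) (use a in blast)+
 moreover have "t : TI" "s : TI" using a by auto
 ultimately show "(EE w. X w * N' t w) = (EE w. X w * N' s w)"
 using LIMSEQ_unique[OF conv[of t]] conv[of s] by simp
 next
 have "AE w in P. ALL n. continuous_on TI (%t. N n t w)"
 using L2mart_cont[OF N] by (simp add: AE_all_countable)
 then show "AE w in P. continuous_on TI (%t. N' t w)"
 using unif by eventually_elim (auto intro: uniform_limit_theorem[rotated])
 qed (rule N'L)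
 then show ?thesis using unif fat(2)[of T] T_pos by auto
qed

lemma ex_fast_subseq:
 fixes a c :: "nat => real"
 assumes "a ~> 0" "!!n. 0 < c n"
 shows "EX r. strict_mono r & (ALL n. a (r n) <= c n)"
proof -
 have "EX k>m. a k <= c n" for m n
 proof -
 have "EV k. a k < c n" using assms by (intro order_tendstoD(2)) auto
 then obtain k0 where "!!k. k >= k0 ==> a k < c n" unfolding eventually_sequentially by auto
 then show ?thesis by (intro exI[of _ "max k0 (Suc m)"]) (auto intro: less_imp_le)
 qed
 then obtain g where g: "!!m n. g m n > m" "!!m n. a (g m n) <= c n" by metis
 define r where "r = rec_nat (g 0 0) (%n x. g x (Suc n))"
 have "r (Suc n) > r n" "a (r n) <= c n" for n
 unfolding r_def using g by (auto) (cases n; auto simp: g)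
 then show ?thesis by (auto intro!: exI[of _ r] simp: strict_mono_Suc_iff)
qed

text \<open>Convergence of the terminal values suffices: a fast subsequence converges uniformly in
  time, and its limit has terminal value \<open>X\<close>. The factor 1/4 in the choice of
  \<open>r\<close> pays for the detour through \<open>X\<close> between consecutive terms.\<close>

lemma L2mart_limit:
 assumes N: "!!n. L2mart (N n)" and X[measurable]: "X : bm P"
 and i: "!!n. integrable P (%w. (N n T w - X w)^2)"
 and lim: "(%n. (EE w. (N n T w - X w)^2)) ~> 0"
 shows "EX N' r. strict_mono r & L2mart N' & (AE w in P. N' T w = X w) &
 (AE w in P. uniform_limit TI (%n t. N (r n) t w) (%t. N' t w) sequentially)"
proof -
 have T: "T : TI" using T_pos by auto
 note [measurable] = L2mart_m[OF N T]
 obtain r where r: "strict_mono r" "!!n. (EE w. (N (r n) T w - X w)^2) <= (1 / 16) ^ n / 4"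
 using ex_fast_subseq[OF lim, of "%n. (1 / 16) ^ n / 4"] by auto
 have "(EE w. (N (r (Suc n)) T w - N (r n) T w)^2) <= (1 / 16) ^ n" for n
 proof -
 have "(EE w. (N (r (Suc n)) T w - N (r n) T w)^2) = (EE w. ((N (r (Suc n)) T w - X w) + (X w - N (r n) T w))^2)" by simp
 also have "... <= 2 * (EE w. (N (r (Suc n)) T w - X w)^2) + 2 * (EE w. (X w - N (r n) T w)^2)"
 using i by (intro square_add_le) (auto simp: power2_commute)
 also have "... <= 2 * ((1 / 16) ^ Suc n / 4) + 2 * ((1 / 16) ^ n / 4)"
 using r(2)[of n] r(2)[of "Suc n"] by (intro add_mono mult_left_mono) (auto simp: power2_commute)
 also have "... <= (1 / 16) ^ n" by simp
 finally show ?thesis .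
 qed
 from L2mart_fast_limit[of "%n. N (r n)", OF N this] obtain N' where N': "L2mart N'" 
 "AE w in P. uniform_limit TI (%n t. N (r n) t w) (%t. N' t w) sequentially"
 "!!n. (EE w. (N (r n) T w - N' T w)^2) <= 4 * (1 / 16) ^ n"
 by (elim exE conjE) blast
 note [measurable] = L2mart_m[OF N'(1) T]
 have iN: "integrable P (%w. (N n T w - N' T w)^2)" for n
 by (rule L2F_square[OF L2mart_L2F[OF L2mart_diff[OF N N'(1)] T]])
 have eq: "(%w. (N' T w - X w)^2) = (%w. ((N' T w - N (r n) T w) + (N (r n) T w - X w))^2)" for n by simp
 have iX: "integrable P (%w. (N' T w - X w)^2)"
 unfolding eq[of 0] using i[of "r 0"] iN[of "r 0"] by (intro square_add_le) (auto simp: power2_commute)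
 have "(EE w. (N' T w - X w)^2) <= 10 * (1 / 16) ^ n" for n
 proof -
 have "(EE w. (N' T w - X w)^2) <= 2 * (EE w. (N' T w - N (r n) T w)^2) + 2 * (EE w. (N (r n) T w - X w)^2)"
 unfolding eq[of n] using i[of "r n"] iN[of "r n"] by (intro square_add_le) (auto simp: power2_commute)
 also have "... <= 2 * (4 * (1 / 16) ^ n) + 2 * ((1 / 16) ^ n / 4)"
 using r(2)[of n] N'(3)[of n] by (intro add_mono mult_left_mono) (auto simp: power2_commute)
 also have "... <= 10 * (1 / 16) ^ n" by simp
 finally show ?thesis .
 qed
 moreover have "(%n. 10 * (1 / 16 :: real) ^ n) ~> 0"
 using tendsto_mult[OF tendsto_const[of 10] LIMSEQ_realpow_zero[of "1/16"]] by simp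
 ultimately have "(EE w. (N' T w - X w)^2) <= 0"
 using LIMSEQ_le_const by blast
 then have "(EE w. (N' T w - X w)^2) = 0" by (intro antisym) auto
 then have "AE w in P. (N' T w - X w)^2 = 0"
 using integral_nonneg_eq_0_iff_AE[OF iX] by auto
 then have eq: "AE w in P. N' T w = X w" by eventually_elim simp
 show ?thesis
 by (rule exI[of _ N'], rule exI[of _ r], rule conjI[OF r(1) conjI[OF N'(1) conjI[OF eq N'(2)]]])
qed

end

section \<open>Partitions and simple integrands\<close>

definition grid :: "real => real => nat => (nat => real) => bool" where
 "grid a b m t <-> (ALL i<m. t i < t (Suc i)) & t 0 = a & t m = b"

lemma grid_less:
 assumes g: "grid a b m t" and "i < j" "j <= m" shows "t i < t j"
 using assms(2,3)
proof (induction j rule: less_induct)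
 case (less j)
 then obtain k where k: "j = Suc k" by (cases j) auto
 have "t k < t j" using g less(3) k unfolding grid_def by auto
 moreover have "t i <= t k" using less k by (cases "i = k") (auto intro: less_imp_le)
 ultimately show ?case by simp
qed

lemma grid_le: "grid a b m t ==> i <= j ==> j <= m ==> t i <= t j"
 using grid_less[of a b m t i j] by (cases "i = j") auto

lemma grid_le_iff: "grid a b m t ==> i <= m ==> j <= m ==> t i <= t j <-> i <= j"
 using grid_le[of a b m t i j] grid_less[of a b m t j i] by (cases "i <= j") auto

lemma grid_bounds: "grid a b m t ==> i <= m ==> a <= t i & t i <= b"
 using grid_le[of a b m t 0 i] grid_le[of a b m t i m] unfolding grid_def by auto

lemma grid_exists:
 fixes a b :: real
 assumes S: "finite S" "S \<subseteq> {a..b}" and ab: "a <= b"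
 shows "EX m t. grid a b m t & S \<subseteq> t ` {..m}"
proof -
 define xs where "xs = sorted_list_of_set (insert a (insert b S))"
 have set: "set xs = insert a (insert b S)" and sorted: "sorted xs" and dist: "distinct xs"
 unfolding xs_def using S by (auto simp del: sorted_list_of_set_insert_remove)
 have ne: "xs ~= []" using set by (metis empty_iff empty_set insertI1)
 define m where "m = length xs - 1"
 have len: "length xs = Suc m" using ne unfolding m_def by (cases xs) auto
 have inc: "xs ! i < xs ! Suc i" if "i < m" for i
 using sorted_nth_mono[OF sorted, of i "Suc i"] nth_eq_iff_index_eq[OF dist, of i "Suc i"] that len
 by (auto simp: order_less_le)
 have mono: "xs ! i <= xs ! j" if "i <= j" "j <= m" for i j
 using sorted_nth_mono[OF sorted, of i j] that len by auto
 have range: "x : {a..b}" if "x : set xs" for x using that set S ab by auto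
 obtain i where i: "i <= m" "xs ! i = a" using set len by (metis in_set_conv_nth insertI1 less_Suc_eq_le)
 obtain j where j: "j <= m" "xs ! j = b" using set len by (metis in_set_conv_nth insertI1 insertI2 less_Suc_eq_le)
 have "xs ! 0 = a" using mono[of 0 i] i range[of "xs ! 0"] len by force
 moreover have "xs ! m = b" using mono[of j m] j range[of "xs ! m"] len by force
 moreover have "S \<subseteq> (!) xs ` {..m}"
 proof
 fix x assume "x : S"
 then have "x : set xs" using set by auto
 then show "x : (!) xs ` {..m}" using len by (auto simp: in_set_conv_nth less_Suc_eq_le)
 qed
 ultimately show ?thesis using inc unfolding grid_def by blast
qed

text \<open>The sum runs over all cells and a condition selects those inside the interval. In this
  form the sums over coarse intervals and over fine cells can be interchanged, as
  \<open>regrid\<close> requires.\<close>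

lemma grid_telescope:
 fixes V :: "real => 'b::ab_group_add"
 assumes g: "grid a b m t" and p: "p <= q" "q <= m"
 shows "V (t q) - V (t p) = (\<Sum>i<m. if t p <= t i & t (Suc i) <= t q then V (t (Suc i)) - V (t i) else 0)"
proof -
 have "V (t q) - V (t p) = (SUM i:{p..<q}. V (t (Suc i)) - V (t i))"
 using sum_Suc_diff'[of p q "%i. V (t i)"] p by simp
 also have "... = (\<Sum>i<m. if t p <= t i & t (Suc i) <= t q then V (t (Suc i)) - V (t i) else 0)"
 using p by (intro sum.mono_neutral_cong_left) (auto simp: grid_le_iff[OF g])
 finally show ?thesis .
qed

lemma grid_telescope':
 fixes V :: "real => 'b::ab_group_add"
 assumes g: "grid a b m t" and xy: "x : t ` {..m}" "y : t ` {..m}" "x <= y"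
 shows "V y - V x = (\<Sum>i<m. if x <= t i & t (Suc i) <= y then V (t (Suc i)) - V (t i) else 0)"
proof -
 obtain p q where "p <= m" "q <= m" "x = t p" "y = t q" using xy by auto
 then show ?thesis using grid_telescope[OF g, of p q V] xy(3) grid_le_iff[OF g, of p q] by auto
qed

context wiener begin

definition endpoints :: "('a, 'n) simple_integrand => real set" where
 "endpoints H = (case H of (m, t, Xi) => t ` {..m})"

lemma finite_endpoints: "finite (endpoints H)"
 unfolding endpoints_def by (cases H) auto

lemma endpoints_range:
 assumes "simple H" shows "endpoints H \<subseteq> TI"
proof -
 obtain m t Xi where H: "H = (m, t, Xi)" by (cases H)
 have t: "0 <= t 0" "t m <= T" "!!i. i < m ==> t i <= t (Suc i)"
 using assms unfolding H simple_integrand_def by auto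
 have "0 <= t i & t i <= T" if "i <= m" for i
 using grid_mono[of m t 0 i, OF t(3)] grid_mono[of m t i m, OF t(3)] t(1,2) that by auto
 then show ?thesis unfolding H endpoints_def by auto
qed

lemma simpleD:
 assumes "simple (m, t, Xi)" "i < m"
 shows "Xi i : bm (F (t i))" "t i <= t (Suc i)" "bounded (Xi i ` space M)"
 using assms unfolding simple_integrand_def by auto

text \<open>Two simple integrands can be combined only on a common grid. The coefficient on a fine
  cell is the sum of all old coefficients whose interval contains it. Both the value and the
  integral are built from increments of some function along the grid, so the same telescoping
  argument serves for both.\<close>

lemma regrid:
 assumes H: "simple H" and g: "grid 0 T m t" and sub: "endpoints H \<subseteq> t ` {..m}"
 shows "EX Xi. simple (m, t, Xi) &
 (ALL s w. sv (m, t, Xi) s w = sv H s w) &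
 (ALL s w. si (m, t, Xi) s w = si H s w)"
proof -
 obtain m' t' Xi' where Heq: "H = (m', t', Xi')" by (cases H)
 have mem: "t' j : t ` {..m}" if "j <= m'" for j using sub that unfolding Heq endpoints_def by auto
 have mono: "t' j <= t' (Suc j)" if "j < m'" for j using H that unfolding Heq simple_integrand_def by auto
 define c where "c j i <-> t' j <= t i & t (Suc i) <= t' (Suc j)" for i j
 define Xi where "Xi i w = (\<Sum>j<m'. if c j i then Xi' j w else 0)" for i w
 have tele: "V (t' (Suc j)) - V (t' j) = (\<Sum>i<m. if c j i then V (t (Suc i)) - V (t i) else 0)"
 if "j < m'" for j and V :: "real => real"
 using grid_telescope'[OF g mem[of j] mem[of "Suc j"] mono, of V] that unfolding c_def by auto
 have tele': "V (t' (Suc j)) - V (t' j) = (\<Sum>i<m. if c j i then V (t (Suc i)) - V (t i) else 0)"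
 if "j < m'" for j and V :: "real => real ^ 'n"
 using grid_telescope'[OF g mem[of j] mem[of "Suc j"] mono, of V] that unfolding c_def by auto
 have "simple (m, t, Xi)"
 unfolding simple_integrand_def prod.case
 proof (intro conjI allI impI)
 show "0 <= t 0" "t m <= T" using g unfolding grid_def by auto
 fix i assume i: "i < m"
 show "t i <= t (Suc i)" using g i unfolding grid_def by (auto intro: less_imp_le)
 show "Xi i : bm (F (t i))"
 unfolding Xi_def
 proof (rule borel_measurable_sum)
 fix j assume "j : {..<m'}"
 then have "Xi' j : bm (F (t' j))" using H unfolding Heq by (auto dest: simpleD)
 then show "(%w. if c j i then Xi' j w else 0) : bm (F (t i))"
 by (cases "c j i") (auto simp: c_def intro: mF_mono)
 qed
 have "EX B. ALL w:space M. norm (Xi' j w) <= B" if "j < m'" for j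
 using H that unfolding Heq by (auto dest!: simpleD(3) simp: bounded_iff)
 then obtain B where B: "!!j w. j < m' ==> w : space M ==> norm (Xi' j w) <= B j" by metis
 have "norm (Xi i w) <= (\<Sum>j<m'. abs (B j))" if "w : space M" for w
 unfolding Xi_def using B that by (intro order_trans[OF norm_sum] sum_mono) (auto intro: order_trans[OF _ abs_ge_self])
 then show "bounded (Xi i ` space M)" by (auto simp: bounded_iff)
 qed
 moreover have "sv (m, t, Xi) s w = sv H s w" for s w
 proof -
 \<comment> \<open>The indicator of \<open>{x<..y}\<close> at \<open>s\<close> is an increment of
   this step function, which makes the value telescope in the same way as the integral.\<close>
 define V where "V x = (if s <= x then 1 else 0 :: real)" for x
 have V: "ind {x<..y} s = V y - V x" if "x <= y" for x y
 unfolding V_def using that by (auto split: split_indicator)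
 have "sv H s w = (\<Sum>j<m'. (V (t' (Suc j)) - V (t' j)) *\<^sub>R Xi' j w)"
 unfolding Heq simple_value_def prod.case by (intro sum.cong refl, subst V) (use mono in auto)
 also have "... = (\<Sum>j<m'. \<Sum>i<m. (if c j i then (V (t (Suc i)) - V (t i)) *\<^sub>R Xi' j w else 0))"
 by (intro sum.cong refl, subst tele)
 (auto simp: scaleR_sum_left if_distrib[of "%x. x *\<^sub>R _"] cong: if_cong)
 also have "... = (\<Sum>i<m. \<Sum>j<m'. (if c j i then (V (t (Suc i)) - V (t i)) *\<^sub>R Xi' j w else 0))"
 by (rule sum.swap)
 also have "... = (\<Sum>i<m. (V (t (Suc i)) - V (t i)) *\<^sub>R Xi i w)"
 unfolding Xi_def by (auto intro!: sum.cong simp: scaleR_sum_right)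
 also have "... = sv (m, t, Xi) s w"
 unfolding simple_value_def prod.case
 by (intro sum.cong refl, subst V) (use g in "auto simp: grid_def less_imp_le")
 finally show ?thesis by simp
 qed
 moreover have "si (m, t, Xi) s w = si H s w" for s w
 proof -
 define V where "V x = W (min s x) w" for x
 have "si H s w = (\<Sum>j<m'. Xi' j w \<bullet> (V (t' (Suc j)) - V (t' j)))"
 unfolding Heq simple_integral_def V_def by simp
 also have "... = (\<Sum>j<m'. \<Sum>i<m. (if c j i then Xi' j w \<bullet> (V (t (Suc i)) - V (t i)) else 0))"
 by (intro sum.cong refl, subst tele')
 (auto simp: inner_sum_right if_distrib[of "%x. _ \<bullet> x"] cong: if_cong)
 also have "... = (\<Sum>i<m. \<Sum>j<m'. (if c j i then Xi' j w \<bullet> (V (t (Suc i)) - V (t i)) else 0))"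
 by (rule sum.swap)
 also have "... = (\<Sum>i<m. Xi i w \<bullet> (V (t (Suc i)) - V (t i)))"
 unfolding Xi_def by (auto intro!: sum.cong simp: inner_sum_left)
 also have "... = si (m, t, Xi) s w"
 unfolding simple_integral_def V_def by simp
 finally show ?thesis by simp
 qed
 ultimately show ?thesis by blast
qed

lemma simple_bound:
 assumes "simple (m, t, Xi)"
 shows "EX K>=0. ALL i<m. ALL w:space M. norm (Xi i w) <= K"
proof -
 have "EX B. ALL w:space M. norm (Xi j w) <= B" if "j < m" for j
 using assms that by (auto dest!: simpleD(3) simp: bounded_iff)
 then obtain B where B: "!!j w. j < m ==> w : space M ==> norm (Xi j w) <= B j" by metis
 have "norm (Xi j w) <= (\<Sum>j<m. abs (B j))" if "w : space M" "j < m" for j w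
 using B[OF that(2,1)] member_le_sum[of j "{..<m}" "%j. abs (B j)"] that by auto
 then show ?thesis by (intro exI[of _ "\<Sum>j<m. abs (B j)"]) (auto intro!: sum_nonneg)
qed

lemma simple_integrand_gridI:
 assumes g: "grid 0 T m t" and "!!i. i < m ==> Xi i : bm (F (t i))"
 and "!!i w. i < m ==> w : space M ==> norm (Xi i w) <= K"
 shows "simple (m, t, Xi)"
 unfolding simple_integrand_def prod.case
 using assms by (auto simp: grid_def bounded_iff less_imp_le)

lemma simple_lincomb:
 assumes H: "simple H" and H': "simple H'"
 shows "EX H''. simple H'' &
 (ALL s w. sv H'' s w = a *\<^sub>R sv H s w + b *\<^sub>R sv H' s w) &
 (ALL s w. si H'' s w = a * si H s w + b * si H' s w)"
proof -
 obtain m t where g: "grid 0 T m t" and sub: "endpoints H Un endpoints H' \<subseteq> t ` {..m}"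
 using grid_exists[of "endpoints H Un endpoints H'" 0 T] finite_endpoints endpoints_range[OF H] endpoints_range[OF H'] T_pos
 by auto
 obtain Xi where x: "simple (m, t, Xi)" "ALL s w. sv (m, t, Xi) s w = sv H s w"
 "ALL s w. si (m, t, Xi) s w = si H s w" using regrid[OF H g] sub by auto
 obtain Xi' where x': "simple (m, t, Xi')" "ALL s w. sv (m, t, Xi') s w = sv H' s w"
 "ALL s w. si (m, t, Xi') s w = si H' s w" using regrid[OF H' g] sub by auto
 obtain K where K: "ALL i<m. ALL w:space M. norm (Xi i w) <= K" using simple_bound[OF x(1)] by blast
 obtain K' where K': "ALL i<m. ALL w:space M. norm (Xi' i w) <= K'" using simple_bound[OF x'(1)] by blast
 have "simple (m, t, %i w. a *\<^sub>R Xi i w + b *\<^sub>R Xi' i w)"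
 proof (rule simple_integrand_gridI[OF g, where K = "abs a * K + abs b * K'"])
 fix i assume i: "i < m"
 show "(%w. a *\<^sub>R Xi i w + b *\<^sub>R Xi' i w) : bm (F (t i))"
 using simpleD(1)[OF x(1) i] simpleD(1)[OF x'(1) i] by measurable
 fix w assume w: "w : space M"
 have "norm (a *\<^sub>R Xi i w + b *\<^sub>R Xi' i w) <= abs a * norm (Xi i w) + abs b * norm (Xi' i w)"
 by (rule order_trans[OF norm_triangle_ineq]) simp
 also have "... <= abs a * K + abs b * K'" using K K' i w by (intro add_mono mult_left_mono) auto
 finally show "norm (a *\<^sub>R Xi i w + b *\<^sub>R Xi' i w) <= abs a * K + abs b * K'" .
 qed
 moreover have "sv (m, t, %i w. a *\<^sub>R Xi i w + b *\<^sub>R Xi' i w) s w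
 = a *\<^sub>R sv (m, t, Xi) s w + b *\<^sub>R sv (m, t, Xi') s w" for s w
 unfolding simple_value_def by (simp add: scaleR_add_right sum.distrib scaleR_sum_right mult.commute)
 moreover have "si (m, t, %i w. a *\<^sub>R Xi i w + b *\<^sub>R Xi' i w) s w
 = a * si (m, t, Xi) s w + b * si (m, t, Xi') s w" for s w
 unfolding simple_integral_def by (simp add: inner_add_left sum.distrib sum_distrib_left)
 ultimately show ?thesis unfolding x(2)[rule_format] x(3)[rule_format] x'(2)[rule_format] x'(3)[rule_format]
 by (intro exI[of _ "(m, t, %i w. a *\<^sub>R Xi i w + b *\<^sub>R Xi' i w)"] conjI allI)
qed

text \<open>With \<open>s\<close> among the grid points, the event \<open>A\<close> is known at the
  left end of every cell that starts at \<open>s\<close> or later, so multiplying those coefficients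
  by its indicator and dropping the others leaves an adapted integrand.\<close>

lemma simple_restrict:
 assumes H: "simple H" and s: "s : TI" and A: "A : sets (F s)"
 shows "EX H''. simple H'' &
 (ALL u<=T. ALL w. sv H'' u w = (ind A w * ind {s<..T} u) *\<^sub>R sv H u w) &
 (ALL u w. si H'' u w = ind A w * (si H (max s u) w - si H s w))"
proof -
 obtain m t where g: "grid 0 T m t" and sub: "insert s (endpoints H) \<subseteq> t ` {..m}"
 using grid_exists[of "insert s (endpoints H)" 0 T] finite_endpoints endpoints_range[OF H] s T_pos by auto
 obtain Xi where x: "simple (m, t, Xi)" "ALL s w. sv (m, t, Xi) s w = sv H s w"
 "ALL s w. si (m, t, Xi) s w = si H s w" using regrid[OF H g] sub by auto
 obtain K where K: "0 <= K" "ALL i<m. ALL w:space M. norm (Xi i w) <= K" using simple_bound[OF x(1)] by blast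
 obtain p where p: "p <= m" "s = t p" using sub by auto
 define Xi' where "Xi' i w = (if p <= i then ind A w *\<^sub>R Xi i w else 0)" for i w
 have r1: "simple (m, t, Xi')"
 proof (rule simple_integrand_gridI[OF g, where K = K])
 fix i assume i: "i < m"
 show "Xi' i : bm (F (t i))"
 proof (cases "p <= i")
 case True
 then have "A : sets (F (t i))" using F_mono[of s "t i"] A p grid_le[OF g, of p i] i by auto
 then show ?thesis unfolding Xi'_def using True simpleD(1)[OF x(1) i] by simp
 next
 case False
 then show ?thesis unfolding Xi'_def by simp
 qed
 fix w assume w: "w : space M"
 show "norm (Xi' i w) <= K" unfolding Xi'_def using K i w by (auto split: split_indicator)
 qed
 have r2: "sv (m, t, Xi') u w = (ind A w * ind {s<..T} u) *\<^sub>R sv (m, t, Xi) u w" if "u <= T" for u w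
 unfolding simple_value_def prod.case scaleR_sum_right
 proof (rule sum.cong)
 fix i assume "i : {..<m}"
 then have i: "i < m" by simp
 show "ind {t i<..t (Suc i)} u *\<^sub>R Xi' i w = (ind A w * ind {s<..T} u) *\<^sub>R ind {t i<..t (Suc i)} u *\<^sub>R Xi i w"
 proof (cases "p <= i")
 case True
 then show ?thesis using grid_le[OF g, of p i] i p that unfolding Xi'_def by (auto split: split_indicator)
 next
 case False
 then have "t (Suc i) <= s" using grid_le[OF g, of "Suc i" p] p by auto
 then show ?thesis using False unfolding Xi'_def by (auto split: split_indicator)
 qed
 qed simp
 have r3: "si (m, t, Xi') u w = ind A w * (si (m, t, Xi) (max s u) w - si (m, t, Xi) s w)" for u w
 unfolding simple_integral_def prod.case sum_subtractf[symmetric] sum_distrib_left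
 proof (rule sum.cong)
 fix i assume "i : {..<m}"
 then have i: "i < m" by simp
 show "Xi' i w \<bullet> (W (min u (t (Suc i))) w - W (min u (t i)) w) =
 ind A w *
 (Xi i w \<bullet> (W (min (max s u) (t (Suc i))) w - W (min (max s u) (t i)) w) -
 Xi i w \<bullet> (W (min s (t (Suc i))) w - W (min s (t i)) w))"
 proof (cases "p <= i")
 case True
 then have "s <= t i" "s <= t (Suc i)" using grid_le[OF g, of p i] grid_le[OF g, of p "Suc i"] i p by auto
 then have m: "min s (t i) = s" "min s (t (Suc i)) = s" by auto
 show ?thesis
 proof (cases "u <= s")
 case True
 then have "max s u = s" "min u (t i) = u" "min u (t (Suc i)) = u"
 using \<open>s <= t i\<close> \<open>s <= t (Suc i)\<close> by auto
 then show ?thesis using m by simp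
 next
 case False
 then have "max s u = u" by simp
 then show ?thesis using m True unfolding Xi'_def by simp
 qed
 next
 case False
 then have "t (Suc i) <= s" "t i <= s" using grid_le[OF g, of "Suc i" p] grid_le[OF g, of i p] p by auto
 then have "min (max s u) (t i) = t i" "min (max s u) (t (Suc i)) = t (Suc i)" "min s (t i) = t i" "min s (t (Suc i)) = t (Suc i)"
 by auto
 then show ?thesis using False unfolding Xi'_def by simp
 qed
 qed simp
 show ?thesis
 proof (intro exI[of _ "(m, t, Xi')"] conjI allI impI)
 show "sv (m, t, Xi') u w = (ind A w * ind {s<..T} u) *\<^sub>R sv H u w" if "u <= T" for u w
 using r2[OF that, of w] x(2) by simp
 show "si (m, t, Xi') u w = ind A w * (si H (max s u) w - si H s w)" for u w
 using r3[of u w] x(3) by simp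
 qed (rule r1)
qed

end

section \<open>Joint measurability, quadratic variation and the isometry\<close>

context wiener begin

abbreviation LT :: "real measure" where "LT == restrict_space lborel TI"
abbreviation NL :: "(real => ennreal) => ennreal" (binder "NL " 10) where "NL u. h u == nn_integral LT h"

lemma space_LT [simp]: "space LT = TI"
 by (simp add: space_restrict_space)

lemma finite_measure_LT: "finite_measure LT"
 by (rule finite_measureI) (simp add: emeasure_restrict_space emeasure_lborel_Icc_eq)

sublocale LT: finite_measure LT by (rule finite_measure_LT)

lemma nn_integral_LT:
 "(\<integral>\<^sup>+u\<in>{s..T}. g u \<partial>lborel) = (NL u. g u * ind {s..T} u)" if "0 <= s"
 using that by (subst nn_integral_restrict_space) (auto intro!: nn_integral_cong split: split_indicator)

definition jm :: "(real => 'a => 'b::topological_space) => bool" where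
 "jm Z <-> (%(u, w). Z u w) : bm (LT \<Otimes>\<^sub>M P)"

lemma predictable_generators:
 "{{0} \<times> A |A. A : sets (F 0)} Un {{s<..t} \<times> A |s t A. 0 <= s & s <= t & t <= T & A : sets (F s)}
 \<subseteq> Pow (TI \<times> space M)"
proof -
 have "A \<subseteq> space M" if "A : sets (F s)" for A s using sets.sets_into_space[OF that] by simp
 then show ?thesis using T_pos by fastforce
qed

lemma sets_predictable: "sets (PA) = sigma_sets (TI \<times> space M)
 ({{0} \<times> A |A. A : sets (F 0)} Un {{s<..t} \<times> A |s t A. 0 <= s & s <= t & t <= T & A : sets (F s)})"
 unfolding predictable_algebra_def by (rule sets_measure_of[OF predictable_generators])

lemma space_predictable [simp]: "space (PA) = TI \<times> space M"
 unfolding predictable_algebra_def by (rule space_measure_of[OF predictable_generators])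

lemma predictable_sets_subset:
 "sets (PA) \<subseteq> sets (LT \<Otimes>\<^sub>M P)"
proof -
 have 1: "{0} \<times> A : sets (LT \<Otimes>\<^sub>M P)" if "A : sets (F 0)" for A
 using that sets_F_le[of 0] T_pos by (intro pair_measureI) (auto simp: sets_restrict_space_iff)
 have 2: "{s<..t} \<times> A : sets (LT \<Otimes>\<^sub>M P)" if "A : sets (F s)" "0 <= s" "t <= T" for s t A
 proof (intro pair_measureI)
 have "{s<..t} \<subseteq> TI" using that by auto
 then show "{s<..t} : sets LT" by (simp add: sets_restrict_space_iff)
 qed (use that sets_F_le[of s] in auto)
 have sp: "TI \<times> space M = space (LT \<Otimes>\<^sub>M P)" by (simp add: space_pair_measure)
 show ?thesis unfolding sets_predictable sp
 by (rule sets.sigma_sets_subset) (use 1 2 in blast)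
qed

lemma predictable_jm: "pred Z ==> jm Z"
 unfolding predictable_process_def jm_def
 by (rule measurable_from_subalg[rotated])
 (use predictable_sets_subset in "auto simp: subalgebra_def space_pair_measure")

lemma jm_sv:
 assumes "simple H" shows "jm (sv H)"
proof -
 obtain m t Xi where H: "H = (m, t, Xi)" by (cases H)
 have "Xi i : bm P" if "i < m" for i
 using simpleD(1)[of m t Xi i] assms that unfolding H by (auto intro: mFP)
 then have [measurable]: "Xi i : bm P" if "i : {..<m}" for i using that by auto
 have [measurable]: "(%u. u) : bm LT" by (rule measurable_restrict_space1) simp
 have "(%x. ind {t i<..t (Suc i)} (fst x) *\<^sub>R Xi i (snd x)) : bm (LT \<Otimes>\<^sub>M P)" if "i : {..<m}" for i
 proof (rule borel_measurable_scaleR)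
 show "(%x. indicat_real {t i<..t (Suc i)} (fst x)) : bm (LT \<Otimes>\<^sub>M P)" by measurable
 show "(%x. Xi i (snd x)) : bm (LT \<Otimes>\<^sub>M P)" using that by measurable
 qed
 then show ?thesis unfolding jm_def H simple_value_def prod.case
 by (simp only: split_beta' fst_conv snd_conv borel_measurable_sum)
qed

lemma jm_nn_integral:
 assumes "(%(u, w). g u w) : bm (LT \<Otimes>\<^sub>M P)"
 shows "(%w. (NL u. g u w)) : bm P"
proof -
 have "(%(w, u). g u w) : bm (P \<Otimes>\<^sub>M LT)"
 using measurable_pair_swap[OF assms] by (simp add: split_beta')
 then show ?thesis using LT.borel_measurable_nn_integral[of "%w u. g u w" P] by simp
qed

text \<open>The quadratic variation over \<open>{s..T}\<close> of the integral of \<open>Z\<close>,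
  with values in \<open>ennreal\<close> so that it makes sense before finiteness is known.\<close>

definition Qv :: "real => (real => 'a => real ^ 'n) => 'a => ennreal" where
 "Qv s Z w = (\<integral>\<^sup>+u\<in>{s..T}. ennreal ((norm (Z u w))^2) \<partial>lborel)"

abbreviation EQ :: "(real => 'a => real ^ 'n) => ennreal" where "EQ Z == NN w. Qv 0 Z w"

lemma Qv_LT: "0 <= s ==> Qv s Z w = (NL u. ennreal ((norm (Z u w))^2) * ind {s..T} u)"
 unfolding Qv_def by (rule nn_integral_LT)

lemma jm_add: "jm Z ==> jm Z' ==> jm (%u w. Z u w + Z' u w :: real ^ 'n)"
 and jm_diff: "jm Z ==> jm Z' ==> jm (%u w. Z u w - Z' u w :: real ^ 'n)"
 and jm_scale: "jm Z ==> jm (%u w. c *\<^sub>R Z u w :: real ^ 'n)"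
 unfolding jm_def split_beta' by auto

lemma Qv_m:
 assumes "jm Z" "0 <= s" shows "Qv s Z : bm P"
proof -
 have [measurable]: "(%u. u) : bm LT" by (rule measurable_restrict_space1) simp
 have [measurable]: "(%(u, w). Z u w) : bm (LT \<Otimes>\<^sub>M P)" using assms unfolding jm_def by simp
 have "(%(u, w). ennreal ((norm (Z u w))^2) * ind {s..T} u) : bm (LT \<Otimes>\<^sub>M P)"
 by measurable
 from jm_nn_integral[OF this] show ?thesis unfolding Qv_LT[OF assms(2)] .
qed

lemma jm_section: "jm Z ==> w : space M ==> (%u. Z u w) : bm LT"
 unfolding jm_def using measurable_compose[OF measurable_Pair2'[of w P LT], of "%(u, w). Z u w" borel] by simp

lemma norm_add_square_le:
 fixes x y :: "'b::real_normed_vector"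
 assumes "0 < \<theta>"
 shows "(norm (x + y))^2 <= (1 + \<theta>) * (norm x)^2 + (1 + 1 / \<theta>) * (norm y)^2"
proof -
 have "(norm (x + y))^2 <= (norm x + norm y)^2" by (intro power_mono norm_triangle_ineq) auto
 also have "... = (norm x)^2 + (norm y)^2 + 2 * norm x * norm y" by (simp add: power2_sum)
 also have "2 * norm x * norm y <= \<theta> * (norm x)^2 + (norm y)^2 / \<theta>"
 proof -
 have "0 <= (\<theta> * norm x - norm y)^2 / \<theta>" using assms by simp
 also have "... = \<theta> * (norm x)^2 + (norm y)^2 / \<theta> - 2 * norm x * norm y"
 using assms by (simp add: power2_diff field_simps power2_eq_square)
 finally show ?thesis by simp
 qed
 finally show ?thesis by (simp add: algebra_simps)
qed

lemma Qv_add_le: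
 assumes Z: "jm Z" and Z': "jm Z'" and s: "0 <= s" and th: "0 < \<theta>" and w: "w : space M"
 shows "Qv s (%u w. Z u w + Z' u w) w <= ennreal (1 + \<theta>) * Qv s Z w + ennreal (1 + 1 / \<theta>) * Qv s Z' w"
proof -
 have [measurable]: "(%u. Z u w) : bm LT" "(%u. Z' u w) : bm LT"
 using jm_section[OF Z w] jm_section[OF Z' w] by auto
 have [measurable]: "(%u. u) : bm LT" by (rule measurable_restrict_space1) simp
 have "Qv s (%u w. Z u w + Z' u w) w <=
 (NL u. ennreal (1 + \<theta>) * (ennreal ((norm (Z u w))^2) * ind {s..T} u) + ennreal (1 + 1 / \<theta>) * (ennreal ((norm (Z' u w))^2) * ind {s..T} u))"
 unfolding Qv_LT[OF s]
 proof (rule nn_integral_mono)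
 fix u
 have "ennreal ((norm (Z u w + Z' u w))^2) <= ennreal ((1 + \<theta>) * (norm (Z u w))^2 + (1 + 1 / \<theta>) * (norm (Z' u w))^2)"
 by (intro ennreal_leI norm_add_square_le th)
 also have "... = ennreal (1 + \<theta>) * ennreal ((norm (Z u w))^2) + ennreal (1 + 1 / \<theta>) * ennreal ((norm (Z' u w))^2)"
 using th by (simp add: ennreal_plus ennreal_mult)
 finally show "ennreal ((norm (Z u w + Z' u w))^2) * ind {s..T} u <=
 ennreal (1 + \<theta>) * (ennreal ((norm (Z u w))^2) * ind {s..T} u) + ennreal (1 + 1 / \<theta>) * (ennreal ((norm (Z' u w))^2) * ind {s..T} u)"
 by (auto split: split_indicator)
 qed
 also have "... = ennreal (1 + \<theta>) * Qv s Z w + ennreal (1 + 1 / \<theta>) * Qv s Z' w"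
 unfolding Qv_LT[OF s] by (subst nn_integral_add) (auto simp: nn_integral_cmult)
 finally show ?thesis .
qed

lemma AE_LT_neq: "AE u in LT. u ~= a"
 using AE_lborel_singleton[of a] by (subst AE_restrict_space_iff) (auto elim: eventually_mono)

text \<open>Fatou's lemma for moving domains of integration. It serves for time intervals whose end
  points converge, so that almost every point of the limit interval lies in them eventually.\<close>

lemma LT_fatou:
 assumes h: "h : bm LT" and S: "!!n. S n : sets borel" and ev: "AE u in LT. u : S' --> (EV n. u : S n)"
 shows "(NL u. h u * ind S' u) <= liminf (%n. (NL u. h u * ind (S n) u))"
proof -
 have "(NL u. h u * ind S' u) <= (NL u. liminf (%n. h u * ind (S n) u))"
 proof (rule nn_integral_mono_AE)
 show "AE u in LT. h u * ind S' u <= liminf (%n. h u * ind (S n) u)"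
 using ev
 proof eventually_elim
 case (elim u)
 show ?case
 proof (cases "u : S'")
 case True
 with elim have "EV n. h u <= h u * ind (S n) u" by (auto elim: eventually_mono)
 from Liminf_bounded[OF this] show ?thesis using True by simp
 qed simp
 qed
 qed
 also have "... <= liminf (%n. (NL u. h u * ind (S n) u))"
 using S by (intro nn_integral_liminf borel_measurable_times_ennreal[OF h] measurable_restrict_space1) simp
 finally show ?thesis .
qed

lemma Qv_mono:
 assumes "!!u. u : {s..T} ==> norm (Z u w) <= norm (Z' u w)"
 shows "Qv s Z w <= Qv s Z' w"
 unfolding Qv_def using assms by (intro nn_integral_mono) (auto split: split_indicator intro!: ennreal_leI power_mono)

text \<open>The cells are disjoint, so at most one term of the sum is nonzero and there are no cross
  terms in the square.\<close>

lemma simple_value_square: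
 assumes g: "grid 0 T m t"
 shows "ennreal ((norm (sv (m, t, Xi) u w))^2) = (\<Sum>l<m. ennreal ((norm (Xi l w))^2) * ind {t l<..t (Suc l)} u)"
proof (cases "EX l<m. u : {t l<..t (Suc l)}")
 case True
 then obtain l where l: "l < m" "u : {t l<..t (Suc l)}" by auto
 have un: "u ~: {t k<..t (Suc k)}" if k: "k < m" "k ~= l" for k
 proof (cases "k < l")
 case True then have "t (Suc k) <= t l" using grid_le[OF g, of "Suc k" l] l by auto
 then show ?thesis using l by auto
 next
 case False then have "t (Suc l) <= t k" using grid_le[OF g, of "Suc l" k] k by auto
 then show ?thesis using l by auto
 qed
 have "sv (m, t, Xi) u w = (SUM k:{l}. ind {t k<..t (Suc k)} u *\<^sub>R Xi k w)"
 unfolding simple_value_def prod.case using l un by (intro sum.mono_neutral_right) auto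
 moreover have "(\<Sum>k<m. ennreal ((norm (Xi k w))^2) * ind {t k<..t (Suc k)} u) = (SUM k:{l}. ennreal ((norm (Xi k w))^2) * ind {t k<..t (Suc k)} u)"
 using l un by (intro sum.mono_neutral_right) auto
 moreover have "(SUM k:{l}. ind {t k<..t (Suc k)} u *\<^sub>R Xi k w) = ind {t l<..t (Suc l)} u *\<^sub>R Xi l w"
 "(SUM k:{l}. ennreal ((norm (Xi k w))^2) * ind {t k<..t (Suc k)} u) = ennreal ((norm (Xi l w))^2) * ind {t l<..t (Suc l)} u"
 by (simp_all only: sum.insert[OF finite.emptyI] sum.empty finite.emptyI empty_iff not_False_eq_True add_0_right)
 moreover have "ind {t l<..t (Suc l)} u = (1::real)" "ind {t l<..t (Suc l)} u = (1::ennreal)"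
 using l by auto
 ultimately show ?thesis by (simp only: scaleR_one mult_1_right)
next
 case False
 then have *: "ind {t l<..t (Suc l)} u = (0::real)" "ind {t l<..t (Suc l)} u = (0::ennreal)" if "l < m" for l using that by auto
 have "sv (m, t, Xi) u w = (\<Sum>l<m. 0)"
 unfolding simple_value_def prod.case using * by (intro sum.cong) auto
 moreover have "(\<Sum>l<m. ennreal ((norm (Xi l w))^2) * ind {t l<..t (Suc l)} u) = (\<Sum>l<m. 0)"
 using * by (intro sum.cong) auto
 ultimately show ?thesis by simp
qed

lemma Qv_simple:
 assumes g: "grid 0 T m t" and p: "p <= m"
 shows "Qv (t p) (sv (m, t, Xi)) w = ennreal (SUM l:{p..<m}. (norm (Xi l w))^2 * (t (Suc l) - t l))"
proof -
 have "Qv (t p) (sv (m, t, Xi)) w = (\<integral>\<^sup>+u. (\<Sum>l<m. ennreal ((norm (Xi l w))^2) * ind ({t l<..t (Suc l)} Int {t p..T}) u) \<partial>lborel)"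
 unfolding Qv_def simple_value_square[OF g]
 by (intro nn_integral_cong) (simp only: sum_distrib_right indicator_inter_arith mult.assoc)
 also have "... = (\<Sum>l<m. ennreal ((norm (Xi l w))^2) * emeasure lborel ({t l<..t (Suc l)} Int {t p..T}))"
 by (subst nn_integral_sum) (auto simp: nn_integral_cmult)
 also have "... = (SUM l:{p..<m}. ennreal ((norm (Xi l w))^2) * emeasure lborel ({t l<..t (Suc l)} Int {t p..T}))"
 proof (intro sum.mono_neutral_right ballI)
 fix l assume "l : {..<m} - {p..<m}"
 then have "t (Suc l) <= t p" using grid_le[OF g, of "Suc l" p] p by auto
 then have "{t l<..t (Suc l)} Int {t p..T} \<subseteq> {t p}" by auto
 then have "emeasure lborel ({t l<..t (Suc l)} Int {t p..T}) = 0"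
 using emeasure_mono[of _ "{t p}" lborel] by (metis borel_singleton emeasure_lborel_countable countable_empty countable_insert countable_subset)
 then show "ennreal ((norm (Xi l w))^2) * emeasure lborel ({t l<..t (Suc l)} Int {t p..T}) = 0" by simp
 qed auto
 also have "... = (SUM l:{p..<m}. ennreal ((norm (Xi l w))^2 * (t (Suc l) - t l)))"
 proof (intro sum.cong refl)
 fix l assume l: "l : {p..<m}"
 then have "t p <= t l" "t l <= t (Suc l)" "t (Suc l) <= T" 
 using grid_le[OF g, of p l] grid_le[OF g, of l "Suc l"] grid_bounds[OF g, of "Suc l"] by auto
 then have "{t l<..t (Suc l)} Int {t p..T} = {t l<..t (Suc l)}" by auto
 then show "ennreal ((norm (Xi l w))^2) * emeasure lborel ({t l<..t (Suc l)} Int {t p..T}) = ennreal ((norm (Xi l w))^2 * (t (Suc l) - t l))"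
 using \<open>t l <= t (Suc l)\<close> by (simp add: ennreal_mult)
 qed
 also have "... = ennreal (SUM l:{p..<m}. (norm (Xi l w))^2 * (t (Suc l) - t l))"
 using grid_le[OF g] by (intro sum_ennreal) (auto intro!: mult_nonneg_nonneg)
 finally show ?thesis .
qed

lemma Qv_simple_0:
 assumes g: "grid 0 T m t"
 shows "Qv 0 (sv (m, t, Xi)) w = ennreal (\<Sum>l<m. (norm (Xi l w))^2 * (t (Suc l) - t l))"
 using Qv_simple[OF g, of 0] g unfolding grid_def by (simp add: lessThan_atLeast0)

lemma simple_integral_grid:
 assumes g: "grid 0 T m t" and j: "j <= m"
 shows "si (m, t, Xi) (t j) w = (\<Sum>i<j. Xi i w \<bullet> (W (t (Suc i)) w - W (t i) w))"
proof -
 have "si (m, t, Xi) (t j) w = (\<Sum>i<j. Xi i w \<bullet> (W (min (t j) (t (Suc i))) w - W (min (t j) (t i)) w))"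
 unfolding simple_integral_def prod.case
 proof (intro sum.mono_neutral_right ballI)
 fix i assume "i : {..<m} - {..<j}"
 then have "t j <= t i" "t j <= t (Suc i)" using grid_le[OF g, of j i] grid_le[OF g, of j "Suc i"] by auto
 then have "min (t j) (t (Suc i)) = t j" "min (t j) (t i) = t j" by auto
 then show "Xi i w \<bullet> (W (min (t j) (t (Suc i))) w - W (min (t j) (t i)) w) = 0" by simp
 qed (use j in auto)
 also have "... = (\<Sum>i<j. Xi i w \<bullet> (W (t (Suc i)) w - W (t i) w))"
 proof (intro sum.cong refl)
 fix i assume "i : {..<j}"
 then have "t i <= t j" "t (Suc i) <= t j" using grid_le[OF g, of i j] grid_le[OF g, of "Suc i" j] j by auto
 then have "min (t j) (t (Suc i)) = t (Suc i)" "min (t j) (t i) = t i" by auto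
 then show "Xi i w \<bullet> (W (min (t j) (t (Suc i))) w - W (min (t j) (t i)) w) = Xi i w \<bullet> (W (t (Suc i)) w - W (t i) w)" by simp
 qed
 finally show ?thesis .
qed

context
 fixes m :: nat and t :: "nat => real" and Xi :: "nat => 'a => real ^ 'n" and K :: real
 assumes g: "grid 0 T m t" and simp: "simple (m, t, Xi)"
 and K: "!!i w. i < m ==> w : space M ==> norm (Xi i w) <= K"
begin

abbreviation inc :: "nat => 'a => real" where "inc i w == Xi i w \<bullet> (W (t (Suc i)) w - W (t i) w)"

lemma grid_step: "i < m ==> 0 <= t i" "i < m ==> t i <= t (Suc i)" "i < m ==> t (Suc i) <= T"
 using grid_bounds[OF g, of i] grid_bounds[OF g, of "Suc i"] grid_le[OF g, of i "Suc i"] by auto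

lemma inc_L2F: "i < m ==> L2F (t (Suc i)) (inc i)"
 by (rule increment_L2(1)[OF grid_step simpleD(1)[OF simp] K])

lemma inc_mean: "i < m ==> L2F (t i) X ==> (EE w. X w * inc i w) = 0"
 by (rule increment_mean[OF grid_step simpleD(1)[OF simp] K])

lemma simple_second_moment:
 "(EE w. (si (m, t, Xi) T w)^2) = (EE w. (\<Sum>l<m. (norm (Xi l w))^2 * (t (Suc l) - t l)))"
proof -
 have v: "(EE w. (inc i w)^2) = (EE w. (norm (Xi i w))^2 * (t (Suc i) - t i))" if i: "i < m" for i
 by (rule increment_L2(3)[OF grid_step[OF i] simpleD(1)[OF simp i] K[OF i]])
 have i: "integrable P (%w. (norm (Xi i w))^2 * (t (Suc i) - t i))" if "i < m" for i
 by (rule increment_L2(2)[OF grid_step[OF that] simpleD(1)[OF simp that] K[OF that]])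
 have "(EE w. (si (m, t, Xi) T w)^2) = (EE w. (\<Sum>i<m. inc i w)^2)"
 using simple_integral_grid[OF g, of m Xi] g unfolding grid_def by simp
 also have "... = (\<Sum>i<m. (EE w. (inc i w)^2))"
 by (rule mdiff_isometry[where t = t and m = m]) (use grid_step inc_L2F inc_mean in auto)
 also have "... = (\<Sum>i<m. (EE w. (norm (Xi i w))^2 * (t (Suc i) - t i)))" using v by simp
 also have "... = (EE w. (\<Sum>l<m. (norm (Xi l w))^2 * (t (Suc l) - t l)))"
 by (rule Bochner_Integration.integral_sum[symmetric]) (use i in auto)
 finally show ?thesis .
qed

lemma simple_grid_orth:
 assumes "j <= k" "k <= m" "L2F (t j) X"
 shows "(EE w. X w * si (m, t, Xi) (t k) w) = (EE w. X w * si (m, t, Xi) (t j) w)"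
 unfolding simple_integral_grid[OF g order_trans[OF assms(1,2)]] simple_integral_grid[OF g assms(2)]
 by (rule mdiff_orth[where t = t and m = m]) (use grid_step inc_L2F inc_mean assms in auto)

lemma simple_grid_L2F: "j <= m ==> L2F (t j) (si (m, t, Xi) (t j))"
proof -
 assume j: "j <= m"
 have "si (m, t, Xi) (t j) = (%w. \<Sum>i<j. inc i w)"
 by (rule ext) (rule simple_integral_grid[OF g j])
 then show ?thesis using mdiff_sum_L2F[of m t inc j] grid_step inc_L2F inc_mean j by simp
qed

end

text \<open>Any finite set of times can be added to the grid, and on the grid the integral is a sum
  of martingale differences. A property involving one or two times is read off a grid that contains
  them.\<close>

lemma si_L2mart:
 assumes H: "simple H" shows "L2mart (si H)"
proof -
 have *: "EX m t Xi K. grid 0 T m t & S \<subseteq> t ` {..m} & simple (m, t, Xi) &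
 (ALL i<m. ALL w:space M. norm (Xi i w) <= K) & (ALL s w. si (m, t, Xi) s w = si H s w)"
 if S: "finite S" "S \<subseteq> TI" for S
 proof -
 obtain m t where g: "grid 0 T m t" and sub: "S Un endpoints H \<subseteq> t ` {..m}"
 using grid_exists[of "S Un endpoints H" 0 T] finite_endpoints endpoints_range[OF H] S T_pos by auto
 obtain Xi where x: "simple (m, t, Xi)" 
 "ALL s w. si (m, t, Xi) s w = si H s w" using regrid[OF H g] sub by auto
 obtain K where K: "ALL i<m. ALL w:space M. norm (Xi i w) <= K" using simple_bound[OF x(1)] by blast
 show ?thesis using g sub x K by blast
 qed
 show ?thesis unfolding L2mart_def
 proof (intro conjI ballI allI impI)
 fix r assume r: "r : TI"
 obtain m t Xi K where g: "grid 0 T m t" "{r} \<subseteq> t ` {..m}" "simple (m, t, Xi)"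
 "ALL i<m. ALL w:space M. norm (Xi i w) <= K" "ALL s w. si (m, t, Xi) s w = si H s w"
 using *[of "{r}"] r by auto
 obtain j where j: "j <= m" "r = t j" using g(2) by auto
 have "si (m, t, Xi) r = si H r" using g(5) by (intro ext) auto
 then show "L2F r (si H r)"
 using simple_grid_L2F[OF g(1,3), of K j] g(4) j by auto
 next
 fix r s X assume a: "0 <= r & r <= s & s <= T & L2F r X"
 obtain m t Xi K where g: "grid 0 T m t" "{r, s} \<subseteq> t ` {..m}" "simple (m, t, Xi)"
 "ALL i<m. ALL w:space M. norm (Xi i w) <= K" "ALL s w. si (m, t, Xi) s w = si H s w"
 using *[of "{r, s}"] a by auto
 obtain j k where j: "j <= m" "r = t j" and k: "k <= m" "s = t k" using g(2) by auto
 have jk: "j <= k" using a j k grid_le_iff[OF g(1), of j k] by auto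
 show "(EE w. X w * si H s w) = (EE w. X w * si H r w)"
 using simple_grid_orth[OF g(1,3), of K j k X] g(4) g(5)[rule_format, symmetric] j k jk a by auto
 next
 obtain m t Xi where Heq: "H = (m, t, Xi)" by (cases H)
 have tr: "t i : TI" if "i <= m" for i using endpoints_range[OF H] that unfolding Heq endpoints_def by auto
 show "AE w in P. continuous_on TI (%s. si H s w)"
 using W_cont
 proof eventually_elim
 case (elim w)
 have "continuous_on TI (%s. W (min s c) w)" if "c : TI" for c
 by (rule continuous_on_compose2[OF elim]) (use that in "auto intro!: continuous_intros")
 then show ?case unfolding Heq simple_integral_def prod.case
 by (intro continuous_on_sum continuous_on_inner continuous_on_const continuous_on_diff) (use tr in auto)
 qed
 qed
qed

lemma simple_isometry:
 assumes H: "simple H"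
 shows "ennreal (EE w. (si H T w)^2) = (NN w. Qv 0 (sv H) w)"
proof -
 obtain m t where g: "grid 0 T m t" and sub: "endpoints H \<subseteq> t ` {..m}"
 using grid_exists[of "endpoints H" 0 T] finite_endpoints endpoints_range[OF H] T_pos by auto
 obtain Xi where x: "simple (m, t, Xi)" "ALL s w. sv (m, t, Xi) s w = sv H s w"
 "ALL s w. si (m, t, Xi) s w = si H s w" using regrid[OF H g] sub by auto
 obtain K where K: "ALL i<m. ALL w:space M. norm (Xi i w) <= K" using simple_bound[OF x(1)] by blast
 have eq: "sv (m, t, Xi) = sv H" using x(2) by (intro ext) auto
 have i: "integrable P (%w. (norm (Xi i w))^2 * (t (Suc i) - t i))" if "i < m" for i
 by (rule increment_L2(2)[OF grid_step[OF g x(1) K[rule_format] that] simpleD(1)[OF x(1) that], of K]) (use K that in auto)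
 have "(NN w. Qv 0 (sv H) w) = (NN w. ennreal (\<Sum>l<m. (norm (Xi l w))^2 * (t (Suc l) - t l)))"
 unfolding eq[symmetric] Qv_simple_0[OF g] ..
 also have "... = ennreal (EE w. (\<Sum>l<m. (norm (Xi l w))^2 * (t (Suc l) - t l)))"
 using i grid_le[OF g] by (intro nn_integral_eq_integral) (auto intro!: AE_I2 sum_nonneg mult_nonneg_nonneg)
 also have "... = ennreal (EE w. (si (m, t, Xi) T w)^2)"
 using simple_second_moment[OF g x(1), of K] K by simp
 finally show ?thesis using x(3) by simp
qed

end

section \<open>Convergence in probability and truncation of simple integrands\<close>

context wiener begin

lemma tip_eventually:
 assumes "tip X" "0 < \<epsilon>" "0 < \<delta>"
 shows "EX k0. ALL k>=k0. prob {w:space M. ennreal \<epsilon> < X k w} < \<delta>"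
proof -
 have "(%k. prob {w:space P. ennreal \<epsilon> < X k w}) ~> 0"
 using assms unfolding tends_to_0_in_probability_def by auto
 then have "EV k. prob {w:space P. ennreal \<epsilon> < X k w} < \<delta>"
 by (rule order_tendstoD(2)) (rule assms(3))
 then show ?thesis by (simp add: eventually_sequentially)
qed

lemma tip_add:
 assumes [measurable]: "!!k. X k : bm P" "!!k. Y k : bm P"
 and X: "tip X" and Y: "tip Y"
 shows "tip (%k w. X k w + Y k w)"
 unfolding tends_to_0_in_probability_def
proof (intro allI impI)
 fix e :: real assume e: "0 < e"
 have b: "prob {w:space P. ennreal e < X k w + Y k w} <= prob {w:space P. ennreal (e/2) < X k w} + prob {w:space P. ennreal (e/2) < Y k w}" for k
 proof -
 have "prob {w:space P. ennreal e < X k w + Y k w} <= prob ({w:space P. ennreal (e/2) < X k w} Un {w:space P. ennreal (e/2) < Y k w})"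
 proof (rule finite_measure_mono)
 show "{w:space P. ennreal e < X k w + Y k w} \<subseteq> {w:space P. ennreal (e/2) < X k w} Un {w:space P. ennreal (e/2) < Y k w}"
 proof (rule subsetI, rule ccontr)
 fix w assume w: "w : {w:space P. ennreal e < X k w + Y k w}"
 "w ~: {w:space P. ennreal (e/2) < X k w} Un {w:space P. ennreal (e/2) < Y k w}"
 then have "X k w + Y k w <= ennreal (e/2) + ennreal (e/2)" by (intro add_mono) auto
 also have "... = ennreal e" using e by (simp add: ennreal_plus[symmetric] del: ennreal_plus)
 finally show False using w by auto
 qed
 qed measurable
 also have "... <= prob {w:space P. ennreal (e/2) < X k w} + prob {w:space P. ennreal (e/2) < Y k w}"
 by (rule measure_Un_le) measurable
 finally show ?thesis .
 qed
 have l: "(%k. prob {w:space P. ennreal (e/2) < X k w} + prob {w:space P. ennreal (e/2) < Y k w}) ~> 0 + 0"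
 using X Y e unfolding tends_to_0_in_probability_def by (intro tendsto_add) auto
 show "(%k. prob {w:space P. ennreal e < X k w + Y k w}) ~> 0"
 by (rule tendsto_sandwich[OF _ _ tendsto_const]) (use b l in "auto intro!: always_eventually")
qed

lemma tip_subseq:
 assumes X[measurable]: "!!k. X k : bm P" and tip: "tip X"
 shows "EX r. strict_mono r & (AE w in P. (%k. X (r k) w) ~> 0)"
proof -
 have "EX k>m. prob {w:space P. ennreal ((1/2)^n) < X k w} < (1/2)^n" for m n :: nat
 proof -
 obtain k0 where k0: "!!k. k >= k0 ==> prob {w:space P. ennreal ((1/2)^n) < X k w} < (1/2)^n"
 using tip_eventually[OF tip, of "(1/2)^n" "(1/2)^n"] by auto
 show ?thesis by (intro exI[of _ "max k0 (Suc m)"] conjI k0) auto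
 qed
 then obtain g where g: "!!m n. g m n > m" "!!m n. prob {w:space P. ennreal ((1/2)^n) < X (g m n) w} < (1/2)^n" by metis
 define r where "r = rec_nat (g 0 0) (%n x. g x (Suc n))"
 have r1: "r (Suc n) > r n" for n unfolding r_def using g by auto
 have r2: "prob {w:space P. ennreal ((1/2)^n) < X (r n) w} < (1/2)^n" for n
 proof (cases n)
 case 0
 then show ?thesis using g(2)[of 0 0] unfolding r_def by simp
 next
 case (Suc k)
 then show ?thesis using g(2)[of "Suc k" "r k"] unfolding r_def by (simp only: nat.rec)
 qed
 have Am: "{w:space P. ennreal ((1/2)^n) < X (r n) w} : sets P" for n by measurable
 have "AE w in P. EV n. w : space P - {w:space P. ennreal ((1/2)^n) < X (r n) w}"
 proof (rule borel_cantelli_AE1)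
 show "summable (%n. prob {w:space P. ennreal ((1/2)^n) < X (r n) w})"
 by (rule summable_comparison_test[OF _ summable_geometric[of "1/2 :: real"]]) (use r2 in "auto intro: less_imp_le")
 qed (use Am in "auto simp: emeasure_eq_measure less_top[symmetric]")
 then have "AE w in P. (%k. X (r k) w) ~> 0"
 proof eventually_elim
 case (elim w)
 show ?case
 proof (rule tendsto_sandwich[of "%_. 0" _ _ "%n. ennreal ((1/2)^n)"])
 show "EV n. X (r n) w <= ennreal ((1/2)^n)"
 using elim by eventually_elim (auto simp: not_less)
 show "(%n. ennreal ((1/2)^n)) ~> 0"
 using tendsto_ennrealI[OF LIMSEQ_realpow_zero[of "1/2"]] by simp
 qed auto
 qed
 then show ?thesis using r1 by (auto intro!: exI[of _ r] simp: strict_mono_Suc_iff)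
qed

text \<open>The variation \<open>S (Suc i)\<close> up to the right end of cell \<open>i\<close> is
  already known at its left end, because the coefficient is. The integrand can thus be switched off
  before the variation exceeds \<open>b\<close>; it stays adapted and the bound holds without
  overshoot.\<close>

lemma simple_truncate:
 assumes H: "simple H" and b: "0 <= b"
 shows "EX H'. simple H' & (ALL w. Qv 0 (sv H') w <= ennreal b) &
 (ALL w. Qv 0 (sv H) w <= ennreal b -->
 (ALL u. sv H' u w = sv H u w) & (ALL u. si H' u w = si H u w))"
proof -
 obtain m t where g: "grid 0 T m t" and sub: "endpoints H \<subseteq> t ` {..m}"
 using grid_exists[of "endpoints H" 0 T] finite_endpoints endpoints_range[OF H] T_pos by auto
 obtain Xi where x: "simple (m, t, Xi)" "ALL s w. sv (m, t, Xi) s w = sv H s w"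
 "ALL s w. si (m, t, Xi) s w = si H s w" using regrid[OF H g] sub by auto
 obtain K where K: "0 <= K" "ALL i<m. ALL w:space M. norm (Xi i w) <= K" using simple_bound[OF x(1)] by blast
 define S where "S j w = (\<Sum>l<j. (norm (Xi l w))^2 * (t (Suc l) - t l))" for j w
 define Xi' where "Xi' i w = (if S (Suc i) w <= b then Xi i w else 0)" for i w
 have nn: "0 <= (norm (Xi l w))^2 * (t (Suc l) - t l)" if "l < m" for l w
 using grid_le[OF g, of l "Suc l"] that by (intro mult_nonneg_nonneg) auto
 have x': "simple (m, t, Xi')"
 proof (rule simple_integrand_gridI[OF g, where K = K])
 fix i assume i: "i < m"
 have "S (Suc i) : bm (F (t i))"
 unfolding S_def
 proof (rule borel_measurable_sum)
 fix l assume "l : {..<Suc i}"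
 then have "Xi l : bm (F (t i))"
 using simpleD(1)[OF x(1), of l] grid_le[OF g, of l i] i by (intro mF_mono[of "t l" "t i"]) auto
 then show "(%w. (norm (Xi l w))^2 * (t (Suc l) - t l)) : bm (F (t i))" by measurable
 qed
 then show "Xi' i : bm (F (t i))"
 unfolding Xi'_def using simpleD(1)[OF x(1) i] by measurable
 show "norm (Xi' i w) <= K" if "w : space M" for w using K i that unfolding Xi'_def by auto
 qed
 have le: "(\<Sum>l<j. (norm (Xi' l w))^2 * (t (Suc l) - t l)) <= S j w & (\<Sum>l<j. (norm (Xi' l w))^2 * (t (Suc l) - t l)) <= b"
 if "j <= m" for j w
 using that
 proof (induction j)
 case (Suc j)
 have S: "S (Suc j) w = S j w + (norm (Xi j w))^2 * (t (Suc j) - t j)" unfolding S_def by simp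
 show ?case using Suc S nn[of j w] unfolding Xi'_def by (cases "S (Suc j) w <= b") auto
 qed (use b in "auto simp: S_def")
 have Q1: "Qv 0 (sv (m, t, Xi')) w <= ennreal b" for w
 unfolding Qv_simple_0[OF g] using le[of m w] by (intro ennreal_leI) auto
 have eq: "Xi' i w = Xi i w" if "Qv 0 (sv H) w <= ennreal b" "i < m" for i w
 proof -
 have "sv (m, t, Xi) = sv H" using x(2) by (intro ext) auto
 then have "ennreal (S m w) <= ennreal b" using that(1) Qv_simple_0[OF g, of Xi w] unfolding S_def by simp
 then have "S m w <= b" using b by (simp add: ennreal_le_iff)
 moreover have "S (Suc i) w <= S m w" unfolding S_def using nn that(2) by (intro sum_mono2) auto
 ultimately show ?thesis unfolding Xi'_def by simp
 qed
 show ?thesis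
 proof (intro exI[of _ "(m, t, Xi')"] conjI allI impI)
 fix w u assume "Qv 0 (sv H) w <= ennreal b"
 note e = eq[OF this]
 have "sv (m, t, Xi') u w = sv (m, t, Xi) u w"
 unfolding simple_value_def prod.case by (intro sum.cong refl) (simp add: e)
 then show "sv (m, t, Xi') u w = sv H u w" using x(2) by simp
 have "si (m, t, Xi') u w = si (m, t, Xi) u w"
 unfolding simple_integral_def prod.case by (intro sum.cong refl) (simp add: e)
 then show "si (m, t, Xi') u w = si H u w" using x(3) by simp
 qed (use x' Q1 in auto)
qed

end

section \<open>The stochastic integral, its closure rules and its restriction to an event from some
  time on\<close>

context wiener begin

lemma Qv_diff_commute: "Qv s (Z ~- Z') = Qv s (Z' ~- Z)"
 unfolding Qv_def by (simp add: norm_minus_commute)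

lemma Qv_le_2:
 assumes Z: "jm Z" and Z': "jm Z'" and s: "0 <= s" and w: "w : space M"
 shows "Qv s Z w <= 2 * Qv s Z' w + 2 * Qv s (Z ~- Z') w"
 using Qv_add_le[OF Z' jm_diff[OF Z Z'] s zero_less_one w] by simp

lemma Qv_triangle_2:
 assumes Z: "jm Z" and Z': "jm Z'" and Z'': "jm Z''" and s: "0 <= s" and w: "w : space M"
 shows "Qv s (Z ~- Z'') w <= 2 * Qv s (Z ~- Z') w + 2 * Qv s (Z' ~- Z'') w"
 using Qv_add_le[OF jm_diff[OF Z Z'] jm_diff[OF Z' Z''] s zero_less_one w] by simp

lemma sintD:
 assumes "sint Z I"
 shows "pred Z" "jm Z" "AE w in P. Qv 0 Z w < \<infinity>"
 "!!t. t : TI ==> I t : bm (F t)" "!!t. t : TI ==> I t : bm P"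
 "AE w in P. continuous_on TI (%t. I t w)"
 "EX H. (ALL k. simple (H k)) &
 tip (%k. Qv 0 (Z ~- sv (H k))) &
 (ALL t:TI. tip (%k w. ennreal (abs (si (H k) t w - I t w))))"
proof -
 show "pred Z" using assms unfolding is_stochastic_integral_def by auto
 then show "jm Z" by (rule predictable_jm)
 have "AE w in M. set_integrable lborel TI (%s. (norm (Z s w))^2)"
 using assms unfolding is_stochastic_integral_def by auto
 then have "AE w in P. set_integrable lborel TI (%s. (norm (Z s w))^2)" by (rule AE_completion)
 then show "AE w in P. Qv 0 Z w < \<infinity>"
 proof eventually_elim
 case (elim w)
 then have "(\<integral>\<^sup>+u. ennreal (norm (ind TI u *\<^sub>R (norm (Z u w))\<^sup>2)) \<partial>lborel) < \<infinity>"
 unfolding set_integrable_def integrable_iff_bounded by simp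
 also have "(\<integral>\<^sup>+u. ennreal (norm (ind TI u *\<^sub>R (norm (Z u w))\<^sup>2)) \<partial>lborel) = Qv 0 Z w"
 unfolding Qv_def by (intro nn_integral_cong) (auto split: split_indicator)
 finally show ?case .
 qed
 show *: "!!t. t : TI ==> I t : bm (F t)" using assms unfolding is_stochastic_integral_def by auto
 show "!!t. t : TI ==> I t : bm P" using * by (rule mFP)
 show "AE w in P. continuous_on TI (%t. I t w)"
 using assms unfolding is_stochastic_integral_def by (auto intro: AE_completion)
 show "EX H. (ALL k. simple (H k)) &
 tip (%k. Qv 0 (Z ~- sv (H k))) &
 (ALL t:TI. tip (%k w. ennreal (abs (si (H k) t w - I t w))))"
 using assms unfolding is_stochastic_integral_def Qv_def[abs_def] by auto
qed

lemma prob_Un_le: "A : sets P ==> B : sets P ==> prob A <= x ==> prob B <= y ==> prob (A Un B) <= x + y"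
 using measure_Un_le[of A P B] by linarith

end

context wiener begin

lemma Qv_finite_integrable:
 assumes Z: "jm Z" and fin: "Qv 0 Z w < \<infinity>" and w: "w : space M"
 shows "set_integrable lborel TI (%s. (norm (Z s w))^2)"
proof -
 have "(%u. (norm (Z u w))^2) : bm (restrict_space lborel TI)"
 by (rule borel_measurable_power[OF measurable_compose[OF jm_section[OF Z w] borel_measurable_norm]])
 then have "(%u. ind TI u *\<^sub>R (norm (Z u w))\<^sup>2) : borel_measurable lborel"
 by (subst (asm) borel_measurable_restrict_space_iff) auto
 moreover have "(\<integral>\<^sup>+u. ennreal (norm (ind TI u *\<^sub>R (norm (Z u w))\<^sup>2)) \<partial>lborel) = Qv 0 Z w"
 unfolding Qv_def by (intro nn_integral_cong) (auto split: split_indicator)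
 ultimately show ?thesis unfolding set_integrable_def integrable_iff_bounded using fin by simp
qed

lemma sintI:
 assumes Z: "pred Z" and fin: "AE w in P. Qv 0 Z w < \<infinity>"
 and I: "!!t. t : TI ==> I t : bm (F t)" "AE w in P. continuous_on TI (%t. I t w)"
 and H: "!!k. simple (H k)"
 "tip (%k. Qv 0 (Z ~- sv (H k)))"
 "!!t. t:TI ==> tip (%k w. ennreal (abs (si (H k) t w - I t w)))"
 shows "sint Z I"
 unfolding is_stochastic_integral_def
proof (intro conjI ballI Z I(1))
 have "AE w in P. set_integrable lborel TI (%s. (norm (Z s w))^2)"
 using fin AE_space by eventually_elim (simp add: Qv_finite_integrable[OF predictable_jm[OF Z]])
 then show "AE w in M. set_integrable lborel TI (%s. (norm (Z s w))^2)" by (simp add: AE_completion_iff)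
 show "AE w in M. continuous_on TI (%t. I t w)" using I(2) by (simp add: AE_completion_iff)
 show "EX H. (ALL k. simple (H k)) &
 tip (%k w. \<integral>\<^sup>+s\<in>TI. ennreal ((norm (Z s w - sv (H k) s w))^2) \<partial>lborel) &
 (ALL t:TI. tip (%k w. ennreal (abs (si (H k) t w - I t w))))"
 using H unfolding Qv_def[abs_def] by (intro exI[of _ H] conjI allI ballI) simp_all
qed

lemma tip_mono:
 assumes "!!k. Y k : bm P" "tip Y" "!!k w. w : space M ==> X k w <= Y k w"
 shows "tip X"
 unfolding tends_to_0_in_probability_def
proof (intro allI impI)
 fix e :: real assume e: "0 < e"
 have "prob {w:space P. ennreal e < X k w} <= prob {w:space P. ennreal e < Y k w}" for k
 proof (rule finite_measure_mono)
 show "{w:space P. ennreal e < Y k w} : sets P" using assms(1) by (intro borel_measurable_less) auto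
 qed (use assms(3)[of _ k] in "auto intro: less_le_trans")
 then have 1: "EV k. prob {w:space P. ennreal e < X k w} <= prob {w:space P. ennreal e < Y k w}" by simp
 have 2: "(%k. prob {w:space P. ennreal e < Y k w}) ~> 0"
 using assms(2) e unfolding tends_to_0_in_probability_def by blast
 show "(%k. prob {w:space P. ennreal e < X k w}) ~> 0"
 by (rule tendsto_sandwich[OF _ 1 tendsto_const 2]) simp
qed

definition cutZ :: "real => 'a set => (real => 'a => real ^ 'n) => real => 'a => real ^ 'n" where
 "cutZ a A Z u w = (ind A w * ind {a<..T} u) *\<^sub>R Z u w"

text \<open>The integral process of \<open>cutZ\<close>; the \<open>max\<close> keeps it at 0 up to
  time \<open>a\<close>.\<close>

definition cutI :: "real => 'a set => (real => 'a => real) => real => 'a => real" where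
 "cutI a A I u w = ind A w * (I (max a u) w - I a w)"

lemma predictable_rectangle:
 assumes "0 <= a" "a <= b" "b <= T" "A : sets (F a)"
 shows "{a<..b} \<times> A : sets (PA)"
 unfolding sets_predictable using assms by (intro sigma_sets.Basic) blast

lemma predictable_cutZ:
 assumes Z: "pred Z" and a: "a : TI" and A: "A : sets (F a)"
 shows "pred (cutZ a A Z)"
proof -
 have [measurable]: "{a<..T} \<times> A : sets (PA)"
 using a A by (intro predictable_rectangle) auto
 have [measurable]: "(%(t, w). Z t w) : bm (PA)"
 using Z unfolding predictable_process_def .
 have "(%x. ind ({a<..T} \<times> A) x *\<^sub>R (case x of (t, w) => Z t w)) : bm (PA)"
 by measurable
 also have "(%x. indicat_real ({a<..T} \<times> A) x *\<^sub>R (case x of (t, w) => Z t w)) = (%(t, w). cutZ a A Z t w)"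
 unfolding cutZ_def by (auto simp: fun_eq_iff split: split_indicator)
 finally show ?thesis unfolding predictable_process_def .
qed

lemma cutI_measurable:
 assumes I: "!!t. t : TI ==> I t : bm (F t)" and a: "a : TI" and A: "A : sets (F a)" and t: "t : TI"
 shows "cutI a A I t : bm (F t)"
proof (cases "a <= t")
 case True
 have [measurable]: "A : sets (F t)" using A F_mono[OF True] by auto
 have [measurable]: "I t : bm (F t)" "I a : bm (F t)"
 using I[OF t] mF_mono[OF True I[OF a]] by auto
 show ?thesis unfolding cutI_def[abs_def] using True by (simp add: max_absorb2)
next
 case False
 then show ?thesis unfolding cutI_def[abs_def] by (simp add: max_absorb1)
qed

lemma cutI_cont:
 assumes I: "continuous_on TI (%t. I t w)" and a: "a : TI"
 shows "continuous_on TI (%t. cutI a A I t w)"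
proof -
 have "continuous_on TI (%t. I (max a t) w)"
 by (rule continuous_on_compose2[OF I]) (use a in "auto intro!: continuous_intros")
 then show ?thesis unfolding cutI_def by (intro continuous_intros)
qed

text \<open>Approximating integrands are restricted in the same way by
  \<open>simple_restrict\<close>. The restricted integral at \<open>t\<close> involves the original
  one at \<open>max a t\<close> and at \<open>a\<close>, so convergence at these two times is added
  up.\<close>

lemma sint_restrict:
 assumes sint: "sint Z I" and a: "a : TI" and A: "A : sets (F a)"
 shows "sint (cutZ a A Z) (cutI a A I)"
proof -
 note D = sintD[OF sint]
 obtain H where H: "!!k. simple (H k)"
 "tip (%k. Qv 0 (Z ~- sv (H k)))"
 "!!t. t:TI ==> tip (%k w. ennreal (abs (si (H k) t w - I t w)))"
 using D(7) by blast
 have "ALL k. EX H'. simple H' &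
 (ALL u<=T. ALL w. sv H' u w = (ind A w * ind {a<..T} u) *\<^sub>R sv (H k) u w) &
 (ALL u w. si H' u w = ind A w * (si (H k) (max a u) w - si (H k) a w))"
 using simple_restrict[OF H(1) a A] by blast
 from choice[OF this] obtain H' where H': "!!k. simple (H' k)"
 "!!k u w. u <= T ==> sv (H' k) u w = (ind A w * ind {a<..T} u) *\<^sub>R sv (H k) u w"
 "!!k u w. si (H' k) u w = ind A w * (si (H k) (max a u) w - si (H k) a w)"
 by blast
 have Im: "si (H k) t : bm P" "I t : bm P" if "t : TI" for k t
 using L2mart_m[OF si_L2mart[OF H(1)] that] D(5)[OF that] by auto
 have Ym: "(%w. ennreal (abs (si (H k) t w - I t w))) : bm P" if "t : TI" for t k
 using Im[OF that] by (intro measurable_compose[OF _ measurable_ennreal] borel_measurable_abs borel_measurable_diff) auto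
 show ?thesis
 proof (rule sintI[where H = H'])
 show "pred (cutZ a A Z)" by (rule predictable_cutZ[OF D(1) a A])
 show "AE w in P. Qv 0 (cutZ a A Z) w < \<infinity>"
 using D(3)
 proof eventually_elim
 case (elim w)
 have "Qv 0 (cutZ a A Z) w <= Qv 0 Z w" by (rule Qv_mono) (auto simp: cutZ_def split: split_indicator)
 then show ?case using elim by (rule le_less_trans)
 qed
 show "cutI a A I t : bm (F t)" if "t : TI" for t by (rule cutI_measurable[OF D(4) a A that])
 show "AE w in P. continuous_on TI (%t. cutI a A I t w)" using D(6) by eventually_elim (rule cutI_cont[OF _ a])
 show "tip (%k. Qv 0 (cutZ a A Z ~- sv (H' k)))"
 proof (rule tip_mono[OF _ H(2)])
 show "Qv 0 (Z ~- sv (H k)) : bm P" for k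
 by (intro Qv_m jm_diff D(2) jm_sv H(1)) simp
 show "Qv 0 (cutZ a A Z ~- sv (H' k)) w <= Qv 0 (Z ~- sv (H k)) w" for k w
 by (rule Qv_mono) (auto simp: cutZ_def H'(2) split: split_indicator)
 qed
 show "tip (%k w. ennreal (abs (si (H' k) t w - cutI a A I t w)))" if t: "t : TI" for t
 proof (rule tip_mono)
 have mt: "max a t : TI" using a t by auto
 show "tip (%k w. ennreal (abs (si (H k) (max a t) w - I (max a t) w)) + ennreal (abs (si (H k) a w - I a w)))"
 by (intro tip_add Ym H(3) mt a)
 show "(%w. ennreal (abs (si (H k) (max a t) w - I (max a t) w)) + ennreal (abs (si (H k) a w - I a w))) : bm P" for k
 by (intro borel_measurable_add Ym mt a)
 show "ennreal (abs (si (H' k) t w - cutI a A I t w)) <= ennreal (abs (si (H k) (max a t) w - I (max a t) w)) + ennreal (abs (si (H k) a w - I a w))" for k w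
 proof -
 have "abs (si (H' k) t w - cutI a A I t w) <= abs (si (H k) (max a t) w - I (max a t) w) + abs (si (H k) a w - I a w)"
 unfolding H'(3) cutI_def by (auto split: split_indicator)
 then show ?thesis by (simp add: ennreal_plus[symmetric] ennreal_leI del: ennreal_plus)
 qed
 qed
 qed (rule H'(1))
qed

end

section \<open>Linearity of the stochastic integral\<close>

context wiener begin

lemma tip_cmult:
 assumes X: "tip X" and c: "0 <= c"
 shows "tip (%k w. ennreal c * X k w)"
proof (cases "c = 0")
 case False
 then have c: "0 < c" using c by simp
 have "ennreal e < ennreal c * x <-> ennreal (e / c) < x" if "0 < e" for e x
 using c that by (cases x rule: ennreal_cases) (simp_all add: ennreal_mult[symmetric] ennreal_less_iff pos_divide_less_eq mult.commute ennreal_mult_top)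
 then show ?thesis using X c unfolding tends_to_0_in_probability_def by simp
qed (simp add: tends_to_0_in_probability_def)

lemma tip_L1:
 assumes X: "!!k. X k : bm P" and lim: "(%k. (NN w. X k w)) ~> 0"
 shows "tip X"
 unfolding tends_to_0_in_probability_def
proof (intro allI impI)
 fix e :: real assume e: "0 < e"
 have [measurable]: "X k : bm P" for k by (rule X)
 have le: "ennreal (prob {w:space P. ennreal e < X k w}) <= ennreal (1 / e) * (NN w. X k w)" for k
 proof -
 have "emeasure P {w:space P. ennreal e < X k w} <= emeasure P {w:space P. 1 <= ennreal (1 / e) * X k w}"
 proof (rule emeasure_mono)
 show "{w:space P. ennreal e < X k w} \<subseteq> {w:space P. 1 <= ennreal (1 / e) * X k w}"
 proof safe
 fix w assume "ennreal e < X k w"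
 then have "ennreal (1 / e) * ennreal e <= ennreal (1 / e) * X k w" by (intro mult_left_mono) auto
 then show "1 <= ennreal (1 / e) * X k w" using e by (simp add: ennreal_mult[symmetric])
 qed
 show "{w:space P. 1 <= ennreal (1 / e) * X k w} : sets P" by measurable
 qed
 also have "... <= ennreal (1 / e) * (NN w. X k w * ind (space P) w)"
 by (rule nn_integral_Markov_inequality) measurable
 also have "(NN w. X k w * ind (space P) w) = (NN w. X k w)"
 by (intro nn_integral_cong) (simp split: split_indicator)
 finally show ?thesis by (simp only: emeasure_eq_measure)
 qed
 have "(%k. ennreal (1 / e) * (NN w. X k w)) ~> ennreal (1 / e) * 0"
 by (intro ennreal_tendsto_cmult lim) simp
 then have "(%k. ennreal (1 / e) * (NN w. X k w)) ~> 0" by simp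
 from tendsto_sandwich[OF always_eventually[OF allI[OF zero_le]] always_eventually[OF allI[OF le]] tendsto_const this]
 have "(%k. ennreal (prob {w:space P. ennreal e < X k w})) ~> 0" .
 then show "(%k. prob {w:space P. ennreal e < X k w}) ~> 0"
 using tendsto_ennreal_iff[of "%k. prob {w:space P. ennreal e < X k w}" sequentially 0] by simp
qed

lemma simple_zero: "simple (0, (%_. 0), (%_ _. 0))"
 and simple_value_zero: "sv (0, (%_. 0), (%_ _. 0)) = (%_ _. 0)"
 and simple_integral_zero: "si (0, (%_. 0), (%_ _. 0)) = (%_ _. 0)"
 using T_pos by (auto simp: simple_integrand_def simple_value_def simple_integral_def fun_eq_iff)

lemma Qv_zero [simp]: "Qv s (%_ _. 0) = (%_. 0)"
 unfolding Qv_def by simp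

lemma sint_zero: "sint (%_ _. 0) (%_ _. 0)"
 by (rule sintI[where H = "%_. (0, (%_. 0), (%_ _. 0))"])
 (simp_all add: simple_zero simple_value_zero simple_integral_zero predictable_process_def tends_to_0_in_probability_def)

lemma Qv_sum_le_2:
 assumes "jm Z" "jm Z'" "0 <= s" "w : space M"
 shows "Qv s (%u w. Z u w + Z' u w) w <= 2 * Qv s Z w + 2 * Qv s Z' w"
 using Qv_add_le[OF assms(1,2,3) zero_less_one assms(4)] by simp

lemma Qv_scale: "Qv s (%u w. c *\<^sub>R Z u w) w = ennreal (c^2) * Qv s Z w" if "jm Z" "0 <= s" "w : space M"
proof -
 have [measurable]: "(%u. Z u w) : bm LT" by (rule jm_section[OF that(1,3)])
 have [measurable]: "{s..T} Int space LT : sets LT" by (rule sets.Int_space_eq2[THEN subst]) (auto simp: sets_restrict_space)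
 have [measurable]: "ind {s..T} : bm LT" by (intro borel_measurable_indicator') (auto simp: sets_restrict_space_iff)
 show ?thesis unfolding Qv_LT[OF that(2)]
 by (subst nn_integral_cmult[symmetric]) (auto intro!: nn_integral_cong simp: power_mult_distrib ennreal_mult mult.assoc)
qed

lemma sint_simple:
 assumes "sint Z I" "t : TI" "simple H"
 shows "(%w. ennreal (abs (si H t w - I t w))) : bm P"
 "Qv 0 (Z ~- sv H) : bm P"
proof -
 note [measurable] = L2mart_m[OF si_L2mart[OF assms(3)] assms(2)] sintD(5)[OF assms(1,2)]
 show "(%w. ennreal (abs (si H t w - I t w))) : bm P" by measurable
 show "Qv 0 (Z ~- sv H) : bm P"
 by (intro Qv_m jm_diff sintD(2)[OF assms(1)] jm_sv assms(3)) simp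
qed

lemma sint_add:
 assumes s: "sint Z I" and s': "sint Z' I'"
 shows "sint (%u w. Z u w + Z' u w) (%u w. I u w + I' u w)"
proof -
 note D = sintD[OF s] and D' = sintD[OF s']
 obtain H where H: "!!k. simple (H k)"
 "tip (%k. Qv 0 (Z ~- sv (H k)))"
 "!!t. t:TI ==> tip (%k w. ennreal (abs (si (H k) t w - I t w)))"
 using D(7) by blast
 obtain H' where H': "!!k. simple (H' k)"
 "tip (%k. Qv 0 (Z' ~- sv (H' k)))"
 "!!t. t:TI ==> tip (%k w. ennreal (abs (si (H' k) t w - I' t w)))"
 using D'(7) by blast
 have "ALL k. EX G. simple G & (ALL u w. sv G u w = sv (H k) u w + sv (H' k) u w) &
 (ALL u w. si G u w = si (H k) u w + si (H' k) u w)"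
 using simple_lincomb[OF H(1) H'(1), where a = 1 and b = 1] by simp
 from choice[OF this] obtain G where G: "!!k. simple (G k)"
 "!!k u w. sv (G k) u w = sv (H k) u w + sv (H' k) u w"
 "!!k u w. si (G k) u w = si (H k) u w + si (H' k) u w"
 by blast
 note [measurable] = D(1)[unfolded predictable_process_def] D'(1)[unfolded predictable_process_def]
 show ?thesis
 proof (rule sintI[where H = G])
 show "pred (%u w. Z u w + Z' u w)"
 using borel_measurable_add[OF D(1)[unfolded predictable_process_def] D'(1)[unfolded predictable_process_def]]
 unfolding predictable_process_def by (simp add: case_prod_beta')
 show "AE w in P. Qv 0 (%u w. Z u w + Z' u w) w < \<infinity>"
 using D(3) D'(3) AE_space
 proof eventually_elim
 case (elim w)
 have "Qv 0 (%u w. Z u w + Z' u w) w <= 2 * Qv 0 Z w + 2 * Qv 0 Z' w" using Qv_sum_le_2[OF D(2) D'(2)] elim by simp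
 also have "... < \<infinity>" using elim by (simp add: ennreal_mult_less_top)
 finally show ?case .
 qed
 show "(%w. I t w + I' t w) : bm (F t)" if "t : TI" for t
 using D(4)[OF that] D'(4)[OF that] by simp
 show "AE w in P. continuous_on TI (%t. I t w + I' t w)"
 using D(6) D'(6) by eventually_elim (intro continuous_intros)
 show "tip (%k. Qv 0 (%u w. Z u w + Z' u w - sv (G k) u w))"
 proof (rule tip_mono[OF _ tip_add[OF _ _ tip_cmult[OF H(2), of 2] tip_cmult[OF H'(2), of 2]]])
 have m: "Qv 0 (Z ~- sv (H k)) : bm P" "Qv 0 (Z' ~- sv (H' k)) : bm P" for k
 using sint_simple(2)[OF s _ H(1), of 0] sint_simple(2)[OF s' _ H'(1), of 0] T_pos by auto
 show "(%w. ennreal 2 * Qv 0 (Z ~- sv (H k)) w + ennreal 2 * Qv 0 (Z' ~- sv (H' k)) w) : bm P"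
 "(%w. ennreal 2 * Qv 0 (Z ~- sv (H k)) w) : bm P"
 "(%w. ennreal 2 * Qv 0 (Z' ~- sv (H' k)) w) : bm P" for k
 using m by simp_all
 show "Qv 0 (%u w. Z u w + Z' u w - sv (G k) u w) w <= ennreal 2 * Qv 0 (Z ~- sv (H k)) w + ennreal 2 * Qv 0 (Z' ~- sv (H' k)) w"
 if "w : space M" for k w
 using Qv_sum_le_2[OF jm_diff[OF D(2) jm_sv[OF H(1)]] jm_diff[OF D'(2) jm_sv[OF H'(1)]] order_refl that]
 by (simp add: G(2) algebra_simps)
 qed simp_all
 show "tip (%k w. ennreal (abs (si (G k) t w - (I t w + I' t w))))" if t: "t : TI" for t
 proof (rule tip_mono[OF _ tip_add[OF _ _ H(3)[OF t] H'(3)[OF t]]])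
 show "ennreal (abs (si (G k) t w - (I t w + I' t w))) <= ennreal (abs (si (H k) t w - I t w)) + ennreal (abs (si (H' k) t w - I' t w))" for k w
 unfolding G(3) by (simp add: ennreal_plus[symmetric] ennreal_leI del: ennreal_plus)
 qed (intro borel_measurable_add sint_simple(1)[OF s t H(1)] sint_simple(1)[OF s' t H'(1)])+
 qed (rule G(1))
qed

lemma sint_scale:
 assumes s: "sint Z I"
 shows "sint (%u w. c *\<^sub>R Z u w) (%u w. c * I u w)"
proof -
 note D = sintD[OF s]
 obtain H where H: "!!k. simple (H k)"
 "tip (%k. Qv 0 (Z ~- sv (H k)))"
 "!!t. t:TI ==> tip (%k w. ennreal (abs (si (H k) t w - I t w)))"
 using D(7) by blast
 have "ALL k. EX G. simple G & (ALL u w. sv G u w = c *\<^sub>R sv (H k) u w) &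
 (ALL u w. si G u w = c * si (H k) u w)"
 using simple_lincomb[OF H(1) H(1), where a = c and b = 0] by simp
 from choice[OF this] obtain G where G: "!!k. simple (G k)"
 "!!k u w. sv (G k) u w = c *\<^sub>R sv (H k) u w"
 "!!k u w. si (G k) u w = c * si (H k) u w"
 by blast
 show ?thesis
 proof (rule sintI[where H = G])
 show "pred (%u w. c *\<^sub>R Z u w)"
 using borel_measurable_scaleR[OF borel_measurable_const D(1)[unfolded predictable_process_def]]
 unfolding predictable_process_def by (simp add: case_prod_beta')
 show "AE w in P. Qv 0 (%u w. c *\<^sub>R Z u w) w < \<infinity>"
 using D(3) AE_space by eventually_elim (simp add: Qv_scale[OF D(2)] ennreal_mult_less_top)
 show "(%w. c * I t w) : bm (F t)" if "t : TI" for t using D(4)[OF that] by simp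
 show "AE w in P. continuous_on TI (%t. c * I t w)"
 using D(6) by eventually_elim (intro continuous_intros)
 show "tip (%k. Qv 0 (%u w. c *\<^sub>R Z u w - sv (G k) u w))"
 proof (rule tip_mono[OF _ tip_cmult[OF H(2), of "c^2"]])
 show "(%w. ennreal (c^2) * Qv 0 (Z ~- sv (H k)) w) : bm P" for k
 using sint_simple(2)[OF s _ H(1), of 0] T_pos by simp
 show "Qv 0 (%u w. c *\<^sub>R Z u w - sv (G k) u w) w <= ennreal (c^2) * Qv 0 (Z ~- sv (H k)) w"
 if "w : space M" for k w
 using Qv_scale[OF jm_diff[OF D(2) jm_sv[OF H(1)]] order_refl that, of c]
 by (simp add: G(2) scaleR_diff_right)
 qed simp_all
 show "tip (%k w. ennreal (abs (si (G k) t w - c * I t w)))" if t: "t : TI" for t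
 proof -
 have "abs (si (G k) t w - c * I t w) = abs c * abs (si (H k) t w - I t w)" for k w
 unfolding G(3) abs_mult[symmetric] by (simp add: algebra_simps)
 then show ?thesis using tip_cmult[OF H(3)[OF t], of "abs c"] by (simp add: ennreal_mult)
 qed
 qed (rule G(1))
qed

lemma sint_diff:
 assumes "sint Z I" "sint Z' I'"
 shows "sint (Z ~- Z') (I ~- I')"
 using sint_add[OF assms(1) sint_scale[OF assms(2), of "-1"]] by simp

lemma sint_sum:
 assumes "finite K" "!!k. k : K ==> sint (Z k) (I k)"
 shows "sint (%u w. SUM k:K. c k *\<^sub>R Z k u w) (%u w. SUM k:K. c k * I k u w)"
 using assms
proof (induction K rule: finite_induct)
 case empty
 show ?case using sint_zero by (simp only: sum.empty)
next
 case (insert k K)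
 have "sint (%u w. c k *\<^sub>R Z k u w + (SUM k:K. c k *\<^sub>R Z k u w)) (%u w. c k * I k u w + (SUM k:K. c k * I k u w))"
 using insert.IH insert.prems by (intro sint_add[OF sint_scale]) blast+
 then show ?case using insert.hyps by (simp only: sum.insert[OF insert.hyps])
qed

end

section \<open>Quantitative convergence and the square-integrable theory\<close>

context wiener begin

lemma ennreal_two: "0 <= a ==> 0 <= b ==> 2 * ennreal a + 2 * ennreal b = ennreal (2 * a + 2 * b)"
 by (simp add: ennreal_mult)

text \<open>Truncation at variation \<open>b\<close> alters the integral only where the variation
  exceeds \<open>b\<close>; the truncated integral has second moment at most \<open>b\<close>, and
  Chebyshev's inequality gives the other term.\<close>

lemma simple_prob:
 assumes H: "simple H" and t: "t : TI" and e: "0 < e" and b: "0 <= b"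
 shows "prob {w:space P. e < abs (si H t w)} <= prob {w:space P. ennreal b < Qv 0 (sv H) w} + b / e^2"
proof -
 obtain H' where H': "simple H'" "!!w. Qv 0 (sv H') w <= ennreal b"
 "!!w u. Qv 0 (sv H) w <= ennreal b ==> si H' u w = si H u w"
 using simple_truncate[OF H b] by blast
 note N = si_L2mart[OF H'(1)]
 note [measurable] = L2mart_m[OF si_L2mart[OF H] t] L2mart_m[OF N t]
 have [measurable]: "Qv 0 (sv H) : bm P" by (intro Qv_m jm_sv H) simp
 have "ennreal (EE w. (si H' T w)^2) <= (NN w. ennreal b)"
 unfolding simple_isometry[OF H'(1)] by (intro nn_integral_mono H'(2))
 then have i: "(EE w. (si H' t w)^2) <= b"
 using L2mart_square_le[OF N t] b by (simp add: emeasure_space_1[simplified] ennreal_le_iff)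
 have "prob {w:space P. e < abs (si H' t w)} <= prob {w:space P. e^2 <= (si H' t w)^2}"
 by (rule finite_measure_mono, (use e in "auto simp: abs_le_square_iff[symmetric]")[1], measurable)
 also have "... <= (EE w. (si H' t w)^2) / e^2"
 using integral_Markov_inequality_measure[OF L2F_square[OF L2mart_L2F[OF N t]], of "{}" "e^2"] e by auto
 also have "... <= b / e^2" using i by (intro divide_right_mono) auto
 finally have 1: "prob {w:space P. e < abs (si H' t w)} <= b / e^2" .
 have "prob {w:space P. e < abs (si H t w)} <=
 prob ({w:space P. ennreal b < Qv 0 (sv H) w} Un {w:space P. e < abs (si H' t w)})"
 by (rule finite_measure_mono, (use H'(3) in "auto simp: not_le[symmetric]")[1], measurable)
 also have "... <= prob {w:space P. ennreal b < Qv 0 (sv H) w} + b / e^2"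
 by (rule prob_Un_le[OF _ _ order_refl 1]) measurable
 finally show ?thesis .
qed

text \<open>The definition of the integral speaks of one approximating sequence; this controls every
  simple integrand close to \<open>Z\<close>. It is \<open>simple_prob\<close> for the difference of
  \<open>G\<close> and an approximant \<open>H k\<close>, with \<open>k\<close> tending to infinity.
  The variation of the difference is at most twice \<open>d\<close> plus twice \<open>d\<close>,
  hence the factor 4.\<close>

lemma sint_simple_prob:
 assumes s: "sint Z I" and G: "simple G" and t: "t : TI" and e: "0 < e" and d: "0 < d"
 shows "prob {w:space P. 2 * e < abs (si G t w - I t w)} <= prob {w:space P. ennreal d < Qv 0 (Z ~- sv G) w} + 4 * d / e^2"
proof -
 note D = sintD[OF s]
 obtain H where H: "!!k. simple (H k)"
 "tip (%k. Qv 0 (Z ~- sv (H k)))"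
 "!!t. t:TI ==> tip (%k w. ennreal (abs (si (H k) t w - I t w)))"
 using D(7) by blast
 define q where "q k = Qv 0 (Z ~- sv (H k))" for k
 define g where "g = Qv 0 (Z ~- sv G)"
 note [measurable] = sint_simple(2)[OF s t H(1), folded q_def] sint_simple(2)[OF s t G, folded g_def] D(5)[OF t]
 L2mart_m[OF si_L2mart[OF G] t] L2mart_m[OF si_L2mart[OF H(1)] t] sint_simple(1)[OF s t H(1)]
 define p where "p k = prob {w:space P. ennreal d < q k w}" for k
 define r where "r k = prob {w:space P. ennreal e < ennreal (abs (si (H k) t w - I t w))}" for k
 have step: "prob {w:space P. 2 * e < abs (si G t w - I t w)} <= prob {w:space P. ennreal d < g w} + 4 * d / e^2 + p k + r k" for k
 proof -
 obtain K where K: "simple K" "!!u w. sv K u w = 1 *\<^sub>R sv G u w + (-1) *\<^sub>R sv (H k) u w"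
 "!!u w. si K u w = 1 * si G u w + (-1) * si (H k) u w"
 using simple_lincomb[OF G H(1), of 1 "-1" k] by blast
 have Kq: "Qv 0 (sv K) w <= 2 * g w + 2 * q k w" if w: "w : space M" for w
 proof -
 have "sv K = (sv G ~- sv (H k))" using K(2) by auto
 then show ?thesis using Qv_triangle_2[OF jm_sv[OF G] D(2) jm_sv[OF H(1)] order_refl w]
 unfolding g_def q_def by (simp add: Qv_diff_commute[of 0 "sv G"])
 qed
 have [measurable]: "Qv 0 (sv K) : bm P" by (intro Qv_m jm_sv K(1)) simp
 note [measurable] = L2mart_m[OF si_L2mart[OF K(1)] t]
 have "ennreal d < g w \<or> ennreal d < q k w" if "ennreal (4 * d) < Qv 0 (sv K) w" "w : space M" for w
 proof (rule ccontr)
 assume "\<not> ?thesis"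
 then have "2 * g w + 2 * q k w <= 2 * ennreal d + 2 * ennreal d" by (intro add_mono mult_left_mono) auto
 also have "... = ennreal (4 * d)" using ennreal_two[of d d] d by simp
 finally show False using Kq[OF that(2)] that(1) by simp
 qed
 then have "prob {w:space P. ennreal (4 * d) < Qv 0 (sv K) w} <= prob ({w:space P. ennreal d < g w} Un {w:space P. ennreal d < q k w})"
 by (intro finite_measure_mono, (auto)[1], measurable)
 also have "... <= prob {w:space P. ennreal d < g w} + p k" unfolding p_def by (rule prob_Un_le[OF _ _ order_refl order_refl]) measurable
 finally have 1: "prob {w:space P. e < abs (si K t w)} <= prob {w:space P. ennreal d < g w} + p k + 4 * d / e^2"
 using simple_prob[OF K(1) t e, of "4 * d"] d by simp
 have "2 * e < abs (si G t w - I t w) ==> e < abs (si K t w) \<or> e < abs (si (H k) t w - I t w)" for w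
 unfolding K(3) by linarith
 then have "prob {w:space P. 2 * e < abs (si G t w - I t w)} <=
 prob ({w:space P. e < abs (si K t w)} Un {w:space P. ennreal e < ennreal (abs (si (H k) t w - I t w))})"
 using e by (intro finite_measure_mono, (auto simp: ennreal_less_iff)[1], measurable)
 also have "... <= (prob {w:space P. ennreal d < g w} + p k + 4 * d / e^2) + r k" unfolding r_def by (rule prob_Un_le[OF _ _ 1 order_refl]) measurable
 finally show ?thesis by simp
 qed
 have "p ~> 0" "r ~> 0" unfolding p_def r_def q_def using H(2) H(3)[OF t] d e unfolding tends_to_0_in_probability_def by blast+
 then have "(%k. prob {w:space P. ennreal d < g w} + 4 * d / e^2 + p k + r k) ~> prob {w:space P. ennreal d < g w} + 4 * d / e^2 + 0 + 0"
 by (intro tendsto_intros)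
 from LIMSEQ_le_const[OF this] step show ?thesis unfolding g_def by auto
qed

lemma tip_AE:
 assumes X[measurable]: "!!k. X k : bm P" and lim: "AE w in P. (%k. X k w) ~> 0"
 shows "tip X"
 unfolding tends_to_0_in_probability_def
proof (intro allI impI)
 fix e :: real assume e: "0 < e"
 have [simp]: "{w : space M. ennreal e < X k w} : sets P" for k using borel_measurable_less[OF borel_measurable_const X] by simp
 have "(%k. (EE w. ind {w:space P. ennreal e < X k w} w)) ~> ((EE w. 0) :: real)"
 proof (rule integral_dominated_convergence[where w = "%_. 1"])
 show "AE w in P. (%k. ind {w:space P. ennreal e < X k w} w) ~> (0 :: real)"
 using lim
 proof eventually_elim
 case (elim w)
 have "EV k. X k w < ennreal e" by (rule order_tendstoD(2)[OF elim]) (use e in simp)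
 then have "EV k. ind {w:space P. ennreal e < X k w} w = (0 :: real)" by eventually_elim (auto split: split_indicator)
 then show ?case by (rule tendsto_eventually)
 qed
 qed (simp_all add: borel_measurable_indicator)
 moreover have "{w:space M. ennreal e < X k w} Int space M = {w:space M. ennreal e < X k w}" for k by auto
 ultimately show "(%k. prob {w:space P. ennreal e < X k w}) ~> 0" by simp
qed

lemma sint_tip:
 assumes s: "!!n. sint (Zn n) (In n)" and G: "!!n. simple (G n)"
 and q: "tip (%n. Qv 0 (Zn n ~- sv (G n)))" and t: "t : TI"
 shows "tip (%n w. ennreal (abs (si (G n) t w - In n t w)))"
 unfolding tends_to_0_in_probability_def
proof (intro allI impI, rule LIMSEQ_I)
 fix b r :: real assume b: "0 < b" and r: "0 < r"
 define d where "d = r * (b / 2)^2 / 8"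
 have d: "0 < d" "4 * d / (b / 2)\<^sup>2 = r / 2" unfolding d_def using b r by auto
 obtain n0 where n0: "ALL n>=n0. prob {w:space M. ennreal d < Qv 0 (Zn n ~- sv (G n)) w} < r / 2"
 using tip_eventually[OF q d(1)] r half_gt_zero by blast
 have "prob {w:space P. ennreal b < ennreal (abs (si (G n) t w - In n t w))} < r" if "n >= n0" for n
 using sint_simple_prob[OF s G t half_gt_zero[OF b] d(1), of n n] n0[rule_format, OF that] b unfolding d(2) by (simp add: ennreal_less_iff)
 then show "EX n0. ALL n>=n0. norm (prob {w:space P. ennreal b < ennreal (abs (si (G n) t w - In n t w))} - 0) < r" by auto
qed

text \<open>A diagonal argument: each \<open>Zn n\<close> is replaced by a simple integrand whose
  error exceeds \<open>1 / (n + 1)\<close> with probability at most \<open>1 / (n + 1)\<close>. By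
  \<open>sint_tip\<close> the simple integrals then follow the \<open>In n\<close>
  automatically.\<close>

lemma sint_closed:
 assumes s: "!!n. sint (Zn n) (In n)" and Z: "pred Z" "AE w in P. Qv 0 Z w < \<infinity>"
 and I: "!!t. t : TI ==> I t : bm (F t)" "AE w in P. continuous_on TI (%t. I t w)"
 and qz: "tip (%n. Qv 0 (Z ~- Zn n))"
 and qi: "!!t. t : TI ==> tip (%n w. ennreal (abs (In n t w - I t w)))"
 shows "sint Z I"
proof -
 note D = sintD[OF s]
 have jZ: "jm Z" by (rule predictable_jm[OF Z(1)])
 define e where "e n = 1 / real (Suc n)" for n
 have e0: "0 < e n" for n unfolding e_def by simp
 have el: "e ~> 0" unfolding e_def using LIMSEQ_Suc[OF lim_1_over_n] by simp
 have "EX G. simple G & prob {w:space P. ennreal (e n) < Qv 0 (Zn n ~- sv G) w} <= e n" for n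
 proof -
 obtain H where H: "!!k. simple (H k)" "tip (%k. Qv 0 (Zn n ~- sv (H k)))"
 using D(7)[of n] by blast
 from tip_eventually[OF H(2) e0 e0, of n n] obtain k where "ALL j>=k. prob {w:space M. ennreal (e n) < Qv 0 (Zn n ~- sv (H j)) w} < e n" ..
 then show ?thesis using H(1) by (intro exI[of _ "H k"]) (auto intro: less_imp_le)
 qed
 then have "EX G. ALL n. simple (G n) & prob {w:space P. ennreal (e n) < Qv 0 (Zn n ~- sv (G n)) w} <= e n"
 by (intro choice) blast
 then obtain G where G: "!!n. simple (G n)" "!!n. prob {w:space P. ennreal (e n) < Qv 0 (Zn n ~- sv (G n)) w} <= e n" by blast
 define q where "q n = Qv 0 (Zn n ~- sv (G n))" for n
 have T0: "0 : TI" using T_pos by simp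
 have qm[measurable]: "q n : bm P" for n unfolding q_def by (rule sint_simple(2)[OF s T0 G(1)])
 have zm: "Qv 0 (Z ~- Zn n) : bm P" for n by (intro Qv_m jm_diff jZ D(2)) simp
 have tq: "tip (%n. q n)"
 unfolding tends_to_0_in_probability_def
 proof (intro allI impI)
 fix d :: real assume d: "0 < d"
 have "EV n. e n < d" using order_tendstoD(2)[OF el d] .
 then have "EV n. prob {w:space P. ennreal d < q n w} <= e n"
 proof eventually_elim
 case (elim n)
 have "prob {w:space P. ennreal d < q n w} <= prob {w:space P. ennreal (e n) < q n w}"
 using ennreal_leI[OF less_imp_le[OF elim]] by (intro finite_measure_mono, (auto intro: le_less_trans)[1], measurable)
 then show ?case using G(2)[of n] unfolding q_def by simp
 qed
 from tendsto_sandwich[OF always_eventually[OF allI[OF measure_nonneg]] this tendsto_const el]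
 show "(%n. prob {w:space P. ennreal d < q n w}) ~> 0" .
 qed
 show ?thesis
 proof (rule sintI[where H = G])
 show "tip (%k. Qv 0 (Z ~- sv (G k)))"
 proof (rule tip_mono)
 show "tip (%n w. ennreal 2 * Qv 0 (Z ~- Zn n) w + ennreal 2 * q n w)"
 using zm qm by (intro tip_add tip_cmult qz tq borel_measurable_times_ennreal borel_measurable_const) auto
 show "Qv 0 (Z ~- sv (G n)) w <= ennreal 2 * Qv 0 (Z ~- Zn n) w + ennreal 2 * q n w" if "w : space M" for n w
 using Qv_triangle_2[OF jZ D(2) jm_sv[OF G(1)] order_refl that] unfolding q_def by simp
 qed (use zm qm in "intro borel_measurable_add borel_measurable_times_ennreal borel_measurable_const; simp")
 show "tip (%n w. ennreal (abs (si (G n) t w - I t w)))" if t: "t : TI" for t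
 proof -
 have [measurable]: "I t : bm P" by (rule mFP[OF I(1)[OF t]])
 note [measurable] = sint_simple(1)[OF s t G(1)] D(5)[OF t]
 note g = sint_tip[OF s G(1) tq[unfolded q_def[abs_def]] t]
 show ?thesis
 proof (rule tip_mono[OF _ tip_add[OF _ _ g qi[OF t]]])
 show "ennreal (abs (si (G n) t w - I t w)) <= ennreal (abs (si (G n) t w - In n t w)) + ennreal (abs (In n t w - I t w))" for n w
 by (simp add: ennreal_plus[symmetric] ennreal_leI del: ennreal_plus)
 qed measurable
 qed
 qed (use Z I G in auto)
qed

text \<open>Approximation in probability is improved to approximation in mean. The approximants are
  truncated at variation \<open>R\<close>, so the error is at most \<open>2 * Q + 2 * R\<close>.
  Where \<open>R <= 4 * Q\<close> this is at most \<open>10 * Q\<close>, whose mean there is small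
  for large \<open>R\<close>. Where \<open>4 * Q < R\<close> the truncation is eventually inactive,
  since \<open>2 * Q + 2 * x k <= R\<close> as soon as \<open>4 * x k < R\<close>, and dominated
  convergence applies.\<close>

lemma simple_dense:
 assumes s: "sint Z I" and fin: "EQ Z < \<infinity>" and e: "0 < (e::real)"
 shows "EX G. simple G & EQ (Z ~- sv G) <= ennreal e"
proof -
 note D = sintD[OF s]
 have T0: "0 : TI" using T_pos by simp
 obtain H0 where H0: "!!k. simple (H0 k)" "tip (%k. Qv 0 (Z ~- sv (H0 k)))"
 using D(7) by blast
 obtain r where r: "AE w in P. (%k. Qv 0 (%u w. Z u w - sv (H0 (r k)) u w) w) ~> 0"
 using tip_subseq[OF sint_simple(2)[OF s T0 H0(1)] H0(2)] by blast
 define Q where "Q = Qv 0 Z"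
 have [measurable]: "Q : bm P" unfolding Q_def by (rule Qv_m[OF D(2)]) simp
 have "(%R. (NN w. 10 * Q w * ind {w. of_nat (Suc R) <= 4 * Q w} w)) ~> (NN w. 0)"
 proof (rule nn_integral_dominated_convergence[where w = "%w. 10 * Q w"])
 show "AE w in P. (%R. 10 * Q w * ind {w. of_nat (Suc R) <= 4 * Q w} w) ~> 0"
 using D(3) unfolding Q_def[symmetric]
 proof eventually_elim
 case (elim w)
 then obtain N :: nat where N: "4 * Q w < of_nat N" using ennreal_Ex_less_of_nat[of "4 * Q w"] by (auto simp: ennreal_mult_less_top)
 have "10 * Q w * ind {w. of_nat (Suc R) <= 4 * Q w} w = 0" if "N <= R" for R
 proof -
 have "of_nat N <= (of_nat (Suc R) :: ennreal)" using that by (intro of_nat_mono) simp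
 from less_le_trans[OF N this] show ?thesis by (simp add: linorder_not_le)
 qed
 then show ?case by (intro tendsto_eventually) (auto simp: eventually_sequentially)
 qed
 show "(NN w. 10 * Q w) < \<infinity>" using fin unfolding Q_def[symmetric] by (simp add: nn_integral_cmult ennreal_mult_less_top)
 show "AE w in P. 10 * Q w * ind {w. of_nat (Suc R) <= 4 * Q w} w <= 10 * Q w" for R by (auto split: split_indicator)
 qed measurable
 then have "EV R. (NN w. 10 * Q w * ind {w. of_nat (Suc R) <= 4 * Q w} w) < ennreal (e / 2)"
 by (rule order_tendstoD) (use e in simp)
 then obtain R0 where R0: "(NN w. 10 * Q w * ind {w. of_nat (Suc R0) <= 4 * Q w} w) < ennreal (e / 2)"
 by (auto simp: eventually_sequentially)
 define R :: ennreal where "R = of_nat (Suc R0)"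
 have Req: "ennreal (real (Suc R0)) = R" unfolding R_def by (rule ennreal_of_nat_eq_real_of_nat[symmetric])
 have R1: "1 <= R" "R < \<infinity>" unfolding Req[symmetric] by (simp_all only: ennreal_1[symmetric] ennreal_leI ennreal_less_top infinity_ennreal_def)
 have "ALL k. EX G. simple G & (ALL w. Qv 0 (sv G) w <= R & (Qv 0 (sv (H0 (r k))) w <= R --> (ALL u. sv G u w = sv (H0 (r k)) u w)))"
 using simple_truncate[OF H0(1), of "real (Suc R0)"] unfolding Req by (metis of_nat_0_le_iff)
 from choice[OF this] obtain G where G: "!!k. simple (G k)" "!!k w. Qv 0 (sv (G k)) w <= R"
 "!!k w u. Qv 0 (sv (H0 (r k))) w <= R ==> sv (G k) u w = sv (H0 (r k)) u w" by blast
 define X where "X k = Qv 0 (Z ~- sv (G k))" for k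
 define D' where "D' w = 2 * Q w + 2 * R" for w
 have [measurable]: "X k : bm P" for k unfolding X_def by (rule sint_simple(2)[OF s T0 G(1)])
 have [measurable]: "D' : bm P" unfolding D'_def by measurable
 have XD: "X k w <= D' w" if "w : space M" for k w
 proof -
 have "X k w <= 2 * Q w + 2 * Qv 0 (sv (G k)) w"
 using Qv_triangle_2[OF D(2) _ jm_sv[OF G(1)] order_refl that, of "%_ _. 0" k] Qv_diff_commute[of 0 "%_ _. 0" "sv (G k)"]
 unfolding X_def Q_def by (simp add: jm_def)
 then show ?thesis unfolding D'_def using G(2)[of k w] by (auto elim!: order_trans intro!: add_left_mono mult_left_mono)
 qed
 have "(%k. (NN w. X k w * ind {w. 4 * Q w < R} w)) ~> (NN w. 0)"
 proof (rule nn_integral_dominated_convergence[where w = D'])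
 show "AE w in P. (%k. X k w * ind {w. 4 * Q w < R} w) ~> 0"
 using r AE_space
 proof eventually_elim
 case (elim w)
 define x where "x k = Qv 0 (%u w. Z u w - sv (H0 (r k)) u w) w" for k
 have w: "w : space M" using elim by simp
 have l: "x ~> 0" using elim(1) unfolding x_def .
 have "(%k. ennreal 4 * x k) ~> ennreal 4 * 0" by (intro ennreal_tendsto_cmult l) simp
 then have "EV k. 4 * x k < R" using R1 by (intro order_tendstoD(2)[where y = 0]) (auto simp: less_le_trans[OF zero_less_one])
 then have "EV k. X k w * ind {w. 4 * Q w < R} w <= x k"
 proof eventually_elim
 case (elim k)
 show ?case
 proof (cases "4 * Q w < R")
 case True
 have "Qv 0 (sv (H0 (r k))) w <= 2 * Q w + 2 * x k"
 using Qv_le_2[OF jm_sv[OF H0(1)] D(2) order_refl w, of "r k"] unfolding x_def Q_def by (subst (asm) Qv_diff_commute)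
 also have "... <= R"
 proof -
 have "2 * (2 * Q w + 2 * x k) <= 2 * R"
 using add_mono[OF less_imp_le[OF True] less_imp_le[OF elim]] by (simp add: distrib_left mult.assoc[symmetric] mult_2[of R])
 then show ?thesis by (subst (asm) ennreal_mult_le_mult_iff) auto
 qed
 finally show ?thesis using G(3)[of k w] True unfolding X_def x_def Qv_def by simp
 qed simp
 qed
 from tendsto_sandwich[OF always_eventually[OF allI[OF zero_le]] this tendsto_const l] show ?case .
 qed
 have "(NN w. D' w) = 2 * (NN w. Q w) + 2 * R" unfolding D'_def
 by (subst nn_integral_add) (auto simp: nn_integral_cmult emeasure_space_1[simplified])
 then show "(NN w. D' w) < \<infinity>" using fin R1 unfolding Q_def[symmetric] by (simp add: ennreal_mult_less_top)
 show "AE w in P. X k w * ind {w. 4 * Q w < R} w <= D' w" for k using XD by (intro AE_I2) (auto split: split_indicator)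
 qed measurable
 then have "EV k. (NN w. X k w * ind {w. 4 * Q w < R} w) < ennreal (e / 2)"
 by (rule order_tendstoD) (use e in simp)
 then obtain k where k: "(NN w. X k w * ind {w. 4 * Q w < R} w) < ennreal (e / 2)" unfolding eventually_sequentially by blast
 have "(NN w. X k w) <= (NN w. 10 * Q w * ind {w. R <= 4 * Q w} w + X k w * ind {w. 4 * Q w < R} w)"
 proof (rule nn_integral_mono)
 fix w assume w: "w : space P"
 show "X k w <= 10 * Q w * ind {w. R <= 4 * Q w} w + X k w * ind {w. 4 * Q w < R} w"
 proof (cases "R <= 4 * Q w")
 case True
 have "2 * R <= 2 * (4 * Q w)" using True by (intro mult_left_mono) auto
 then have "D' w <= 2 * Q w + 2 * (4 * Q w)" unfolding D'_def by (intro add_left_mono)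
 also have "... = 10 * Q w" by (cases "Q w" rule: ennreal_cases) (simp_all add: ennreal_mult[symmetric] ennreal_plus[symmetric] ennreal_numeral[symmetric] ennreal_mult_top del: ennreal_plus ennreal_numeral)
 finally show ?thesis using XD[of w k] w True by (simp add: linorder_not_less[symmetric])
 qed (simp add: not_le)
 qed
 also have "... = (NN w. 10 * Q w * ind {w. R <= 4 * Q w} w) + (NN w. X k w * ind {w. 4 * Q w < R} w)"
 by (rule nn_integral_add) measurable
 also have "... <= ennreal (e / 2) + ennreal (e / 2)" using R0 k unfolding R_def by (intro add_mono less_imp_le) auto
 finally have "(NN w. X k w) <= ennreal e" using e by (simp add: ennreal_plus[symmetric] del: ennreal_plus)
 then show ?thesis using G(1) unfolding X_def by blast
qed

lemma L2mart_cong: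
 assumes N: "L2mart N" and I: "!!t. t : TI ==> I t : bm (F t)" "AE w in P. continuous_on TI (%t. I t w)"
 and eq: "!!t. t : TI ==> AE w in P. N t w = I t w"
 shows "L2mart I"
 unfolding L2mart_def
proof (intro conjI ballI allI impI I(2))
 show "L2F t (I t)" if "t : TI" for t by (rule L2F_AE[OF L2mart_L2F[OF N that] eq[OF that]])
 fix s t X assume *: "0 <= s & s <= t & t <= T & L2F s X"
 have c: "(EE w. X w * I r w) = (EE w. X w * N r w)" if "r : TI" for r
 proof (rule integral_cong_AE)
 show "AE w in P. X w * I r w = X w * N r w" using eq[OF that] by eventually_elim simp
 qed (use * L2F_mP[of s X] mFP[OF I(1)[OF that]] L2mart_m[OF N that] in auto)
 show "(EE w. X w * I t w) = (EE w. X w * I s w)"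
 using L2mart_orth[OF N, of s t X] * c[of t] c[of s] by simp
qed

lemma tip_AE_unique:
 assumes X: "!!k. X k : bm P" "Y : bm P"
 and lim: "AE w in P. (%k. X k w) ~> Y' w" and tip: "tip (%k w. ennreal (abs (X k w - Y w)))"
 shows "AE w in P. Y' w = (Y w :: real)"
proof -
 have "(%w. ennreal (abs (X k w - Y w))) : bm P" for k using X by simp
 from tip_subseq[OF this tip] obtain r where r: "strict_mono r" "AE w in P. (%k. ennreal (abs (X (r k) w - Y w))) ~> 0" by blast
 show ?thesis using r(2) lim
 proof eventually_elim
 case (elim w)
 from elim(1) have "(%k. abs (X (r k) w - Y w)) ~> 0" using tendsto_ennreal_iff[of "%k. abs (X (r k) w - Y w)" sequentially 0] by simp
 then have "(%k. X (r k) w) ~> Y w" by (simp add: tendsto_rabs_zero_iff LIM_zero_iff)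
 moreover have "(%k. X (r k) w) ~> Y' w" using LIMSEQ_subseq_LIMSEQ[OF elim(2) r(1)] by (simp add: o_def)
 ultimately show ?case using LIMSEQ_unique by blast
 qed
qed

lemma Qv_triangle_int:
 assumes Z: "jm Z" and Z': "jm Z'" and Z'': "jm Z''"
 shows "(NN w. Qv 0 (Z ~- Z'') w) <= 2 * (NN w. Qv 0 (Z ~- Z') w) + 2 * (NN w. Qv 0 (Z' ~- Z'') w)"
proof -
 have m: "Qv 0 (Z ~- Z') : bm P" "Qv 0 (Z' ~- Z'') : bm P"
 by (intro Qv_m jm_diff assms; simp)+
 have "(NN w. Qv 0 (Z ~- Z'') w) <= (NN w. 2 * Qv 0 (Z ~- Z') w + 2 * Qv 0 (Z' ~- Z'') w)"
 by (intro nn_integral_mono Qv_triangle_2 assms) auto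
 then show ?thesis using m by (simp add: nn_integral_add nn_integral_cmult)
qed

lemma simple_diff_isometry:
 assumes G: "simple G" and G': "simple G'"
 shows "ennreal (EE w. (si G T w - si G' T w)^2) = (NN w. Qv 0 (sv G ~- sv G') w)"
proof -
 obtain G'' where "simple G''" "!!u w. sv G'' u w = sv G u w - sv G' u w"
 "!!u w. si G'' u w = si G u w - si G' u w"
 using simple_lincomb[OF G G', where a = 1 and b = "-1"] by auto
 then show ?thesis using simple_isometry[of G''] unfolding Qv_def by simp
qed

text \<open>Along a fast sequence of simple integrands the integrals converge uniformly in time to a
  continuous martingale. The limit in probability identifies it at each time with the given version
  \<open>I\<close>, which inherits the martingale property.\<close>

lemma sint_L2:
 assumes s: "sint Z I" and fin: "(EQ Z) < \<infinity>"
 shows "L2mart I" and "EX G. (ALL j. simple (G j)) &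
 (ALL j. (NN w. Qv 0 (Z ~- sv (G j)) w) <= ennreal ((1 / 16) ^ Suc j)) &
 (ALL j. (EE w. (si (G j) T w - I T w)^2) <= 4 * (1 / 16) ^ j)"
proof -
 note D = sintD[OF s]
 have T0: "0 : TI" "T : TI" using T_pos by auto
 have "ALL j. EX G. simple G & EQ (Z ~- sv G) <= ennreal ((1 / 16) ^ Suc j)" by (intro allI simple_dense[OF s fin]) simp
 from choice[OF this] obtain G where G: "!!j. simple (G j)"
 and Qle: "!!j. EQ (Z ~- sv (G j)) <= ennreal ((1 / 16) ^ Suc j)" by blast
 have p0: "(%j. (1 / 16 :: real) ^ j) ~> 0" by (rule LIMSEQ_realpow_zero) auto
 have fast: "(EE w. (si (G (Suc j)) T w - si (G j) T w)^2) <= (1 / 16) ^ j" for j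
 proof -
 have "ennreal (EE w. (si (G (Suc j)) T w - si (G j) T w)^2)
 <= 2 * (NN w. Qv 0 (%u w. sv (G (Suc j)) u w - Z u w) w) + 2 * (NN w. Qv 0 (Z ~- sv (G j)) w)"
 unfolding simple_diff_isometry[OF G G] by (intro Qv_triangle_int D(2) jm_sv G)
 also have "... <= 2 * ennreal ((1 / 16) ^ Suc (Suc j)) + 2 * ennreal ((1 / 16) ^ Suc j)"
 using Qle[of j] Qle[of "Suc j"] by (subst Qv_diff_commute) (intro add_mono mult_mono, auto)
 also have "... = ennreal (2 * (1 / 16) ^ Suc (Suc j) + 2 * (1 / 16) ^ Suc j)"
 by (rule ennreal_two) simp_all
 also have "... <= ennreal ((1 / 16) ^ j)" by (intro ennreal_leI) simp
 finally show ?thesis by simp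
 qed
 obtain N where N: "L2mart N" "AE w in P. uniform_limit TI (%n t. si (G n) t w) (%t. N t w) sequentially"
 "!!n. (EE w. (si (G n) T w - N T w)^2) <= 4 * (1 / 16) ^ n"
 using L2mart_fast_limit[of "%n. si (G n)", OF si_L2mart[OF G] fast] by blast
 have tipG: "tip (%j. Qv 0 (Z ~- sv (G j)))"
 proof (rule tip_L1[OF sint_simple(2)[OF s T0(1) G]])
 have "(%j. (1 / 16 :: real) ^ Suc j) ~> 0" using LIMSEQ_Suc[OF p0] .
 then have l: "(%j. ennreal ((1 / 16) ^ Suc j)) ~> 0" using tendsto_ennrealI[of "%j. (1 / 16) ^ Suc j" 0 sequentially] by simp
 from tendsto_sandwich[OF always_eventually[OF allI[OF zero_le]] always_eventually[OF allI[OF Qle]] tendsto_const l]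
 show "(%j. EQ (Z ~- sv (G j))) ~> 0" .
 qed
 have eq: "AE w in P. N t w = I t w" if t: "t : TI" for t
 proof (rule tip_AE_unique)
 show "si (G j) t : bm P" for j by (rule L2mart_m[OF si_L2mart[OF G] t])
 show "I t : bm P" by (rule D(5)[OF t])
 show "AE w in P. (%j. si (G j) t w) ~> N t w"
 using N(2) by eventually_elim (rule tendsto_uniform_limitI[OF _ t])
 qed (rule sint_tip[OF s G tipG t])
 show "L2mart I" by (rule L2mart_cong[OF N(1) D(4) D(6) eq])
 have "(EE w. (si (G j) T w - I T w)^2) = (EE w. (si (G j) T w - N T w)^2)" for j
 proof (rule integral_cong_AE)
 show "AE w in P. (si (G j) T w - I T w)^2 = (si (G j) T w - N T w)^2" using eq[OF T0(2)] by eventually_elim simp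
 qed (use D(5)[OF T0(2)] L2mart_m[OF N(1) T0(2)] L2mart_m[OF si_L2mart[OF G] T0(2)] in auto)
 then show "EX G. (ALL j. simple (G j)) &
 (ALL j. (NN w. Qv 0 (Z ~- sv (G j)) w) <= ennreal ((1 / 16) ^ Suc j)) &
 (ALL j. (EE w. (si (G j) T w - I T w)^2) <= 4 * (1 / 16) ^ j)"
 using G Qle N(3) by (intro exI[of _ G]) simp
qed

text \<open>The Hilbert space argument for nearest points, along decreasing sets. The infima over
  \<open>K n\<close> increase to a finite limit \<open>L\<close>; two near-minimizers far out admit
  a \<open>z\<close> (their midpoint) in the same set, whose \<open>q\<close> is almost
  \<open>L\<close>, and the parallelogram inequality makes them close. Tolerances of
  \<open>e / 8\<close> add up to \<open>4 * e / 8 + 4 * e / 8\<close>.\<close>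

lemma almost_minimizing_sequence:
 fixes q :: "'v => real" and d :: "'v => 'v => real" and K :: "nat => 'v set"
 assumes K: "!!m n. m <= n ==> K n \<subseteq> K m" and q0: "!!x. 0 <= q x" and B: "!!n. EX x:K n. q x <= B"
 and par: "!!n x y. x : K n ==> y : K n ==> EX z:K n. d x y <= 2 * q x + 2 * q y - 4 * q z"
 and e: "!!n. 0 < e n" "decseq e"
 shows "EX x. ALL n. x n : K n & d (x n) (x (Suc n)) <= e n"
proof -
 define m where "m n = Inf (q ` K n)" for n
 have bdd: "bdd_below (q ` K n)" for n using q0 by (intro bdd_belowI[of _ 0]) auto
 have ne: "q ` K n ~= {}" for n using B by blast
 have le: "m n <= q x" if "x : K n" for x n unfolding m_def using bdd that by (intro cInf_lower) auto
 have inc: "m i <= m n" if "i <= n" for i n unfolding m_def using K[OF that] ne bdd by (intro cInf_superset_mono) auto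
 have mB: "m n <= B" for n using B[of n] le by (meson order_trans)
 define L where "L = (SUP n. m n)"
 have bddL: "bdd_above (range m)" using mB by (intro bdd_aboveI[of _ B]) auto
 have mL: "m n <= L" for n unfolding L_def using bddL by (intro cSUP_upper) auto
 have "EX N. L - e n / 8 < m N" for n
 using less_cSUP_iff[OF UNIV_not_empty bddL, of "L - e n / 8"] e(1)[of n] unfolding L_def by simp
 then obtain N where N: "!!n. L - e n / 8 < m (N n)" by metis
 \<comment> \<open>Adding up the \<open>N i\<close> gives one index function that is increasing and
   exceeds both \<open>n\<close> and \<open>N n\<close>.\<close>
 define r where "r n = n + (SUM i<=n. N i)" for n
 have r: "n <= r n" "N n <= r n" "r n <= r (Suc n)" for n unfolding r_def by (auto simp: member_le_sum trans_le_add2)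
 have "EX x:K (r n). q x < m (r n) + e n / 8" for n
 proof -
 have "EX y:q ` K (r n). y < m (r n) + e n / 8"
 unfolding m_def using e(1)[of n] by (intro cInf_lessD ne) simp
 then show ?thesis by blast
 qed
 then obtain x where x: "!!n. x n : K (r n)" "!!n. q (x n) < m (r n) + e n / 8" by metis
 have "d (x n) (x (Suc n)) <= e n" for n
 proof -
 have "x (Suc n) : K (r n)" using x(1)[of "Suc n"] K[OF r(3)] by blast
 from par[OF x(1) this] obtain z where z: "z : K (r n)" "d (x n) (x (Suc n)) <= 2 * q (x n) + 2 * q (x (Suc n)) - 4 * q z" by blast
 have "L - e n / 8 < m (r n)" using N[of n] inc[OF r(2)[of n]] by linarith
 moreover have "e (Suc n) <= e n" using e(2) by (simp add: decseq_Suc_iff)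
 ultimately show ?thesis using z(2) le[OF z(1)] x(2)[of n] x(2)[of "Suc n"] mL[of "r n"] mL[of "r (Suc n)"] by linarith
 qed
 moreover have "x n : K n" for n using x(1) K[OF r(1)] by blast
 ultimately show ?thesis by blast
qed

text \<open>The coefficients of finite convex combinations of the tail from index \<open>n\<close>
  on, as they occur in Mazur's lemma. Sums over \<open>nat\<close> are then sums over the
  support.\<close>

definition weights :: "nat => (nat => real) set" where
 "weights n = {c. finite {k. c k ~= 0} & (ALL k. 0 <= c k) & (ALL k<n. c k = 0) & (\<Sum>k | c k ~= 0. c k) = 1}"

lemma sum_support:
 assumes "finite S" "{k. c k ~= 0} \<subseteq> S" "!!k. c k = 0 ==> g k = 0"
 shows "(\<Sum>k | c k ~= 0. g k) = sum g S"
 using assms by (intro sum.mono_neutral_left) auto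

lemma conv_weights_midpoint:
 assumes "c : weights n" "c' : weights n"
 shows "(%k. (c k + c' k) / 2) : weights n"
proof -
 define S where "S = {k. c k ~= 0} Un {k. c' k ~= 0}"
 have S: "finite S" "{k. c k ~= 0} \<subseteq> S" "{k. c' k ~= 0} \<subseteq> S" "{k. (c k + c' k) / 2 ~= 0} \<subseteq> S"
 using assms unfolding S_def weights_def by auto
 have "(\<Sum>k | (c k + c' k) / 2 ~= 0. (c k + c' k) / 2) = (SUM k:S. (c k + c' k) / 2)" using S by (intro sum_support) auto
 also have "... = ((SUM k:S. c k) + (SUM k:S. c' k)) / 2" by (simp add: sum.distrib sum_divide_distrib[symmetric])
 also have "(SUM k:S. c k) = 1" using assms(1) sum_support[OF S(1,2), of c] unfolding weights_def by simp
 also have "(SUM k:S. c' k) = 1" using assms(2) sum_support[OF S(1,3), of c'] unfolding weights_def by simp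
 finally show ?thesis using assms finite_subset[OF S(4,1)] unfolding weights_def by simp
qed

lemma conv_weights_tendsto:
 fixes y :: "nat => real"
 assumes c: "!!n. c n : weights n" and y: "y ~> l"
 shows "(%n. \<Sum>k | c n k ~= 0. c n k * y k) ~> l"
proof (rule LIMSEQ_I)
 fix e :: real assume e: "0 < e"
 then obtain N where N: "!!k. N <= k ==> norm (y k - l) < e / 2" using LIMSEQ_D[OF y, of "e / 2"] by auto
 have "norm ((\<Sum>k | c n k ~= 0. c n k * y k) - l) < e" if n: "N <= n" for n
 proof -
 have c': "finite {k. c n k ~= 0}" "!!k. 0 <= c n k" "!!k. k < n ==> c n k = 0" "(\<Sum>k | c n k ~= 0. c n k) = 1"
 using c[of n] unfolding weights_def by auto
 have "(\<Sum>k | c n k ~= 0. c n k * y k) - l = (\<Sum>k | c n k ~= 0. c n k * y k) - (\<Sum>k | c n k ~= 0. c n k) * l" using c'(4) by simp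
 also have "... = (\<Sum>k | c n k ~= 0. c n k * (y k - l))" by (simp add: sum_distrib_right sum_subtractf right_diff_distrib)
 finally have "norm ((\<Sum>k | c n k ~= 0. c n k * y k) - l) <= (\<Sum>k | c n k ~= 0. norm (c n k * (y k - l)))" by (simp add: sum_abs)
 also have "... <= (\<Sum>k | c n k ~= 0. c n k * (e / 2))"
 proof (intro sum_mono)
 fix k assume "k : {k. c n k ~= 0}"
 then have "N <= k" using c'(3)[of k] n by (cases "k < n") auto
 from mult_left_mono[OF less_imp_le[OF N[OF this]] c'(2)[of k]]
 show "norm (c n k * (y k - l)) <= c n k * (e / 2)" using c'(2)[of k] by (simp add: abs_mult)
 qed
 also have "... = e / 2" by (simp only: sum_distrib_right[symmetric] c'(4) mult_1)
 finally show ?thesis using e by simp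
 qed
 then show "EX N. ALL n>=N. norm ((\<Sum>k | c n k ~= 0. c n k * y k) - l) < e" by blast
qed

lemma ennreal_four: "0 <= x ==> 4 * ennreal x = ennreal (4 * x)"
 by (simp add: ennreal_mult)

text \<open>Together with \<open>sint_energy\<close> this says that the second moment and the
  expected variation are comparable. The constant 4 instead of an equality comes from splitting
  squares, which avoids the limit of cross terms in the isometry of simple integrals.\<close>

lemma sint_second_moment:
 assumes s: "sint Z I" and fin: "(EQ Z) < \<infinity>"
 shows "ennreal (EE w. (I T w)^2) <= 4 * (EQ Z)"
proof -
 have TT: "T : TI" using T_pos by simp
 note D = sintD[OF s]
 obtain G where G: "!!j. simple (G j)"
 "!!j. (NN w. Qv 0 (Z ~- sv (G j)) w) <= ennreal ((1 / 16) ^ Suc j)"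
 "!!j. (EE w. (si (G j) T w - I T w)^2) <= 4 * (1 / 16) ^ j" using sint_L2(2)[OF s fin] by blast
 have N: "L2mart I" by (rule sint_L2(1)[OF s fin])
 obtain q where q: "(EQ Z) = ennreal q" "0 <= q" using fin by (cases "NN w. Qv 0 Z w" rule: ennreal_cases) auto
 have "(EE w. (I T w)^2) <= 4 * q + 12 * (1 / 16) ^ j" for j
 proof -
 note S = si_L2mart[OF G(1)[of j]]
 have "(EE w. ((I T w - si (G j) T w) + si (G j) T w)^2) <= 2 * (EE w. (I T w - si (G j) T w)^2) + 2 * (EE w. (si (G j) T w)^2)"
 using L2F_mP[OF L2mart_L2F[OF L2mart_diff[OF N S] TT]] L2F_mP[OF L2mart_L2F[OF S TT]]
 L2F_square[OF L2mart_L2F[OF L2mart_diff[OF N S] TT]] L2F_square[OF L2mart_L2F[OF S TT]] by (rule square_add_le(2))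
 moreover have "(EE w. (I T w - si (G j) T w)^2) <= 4 * (1 / 16) ^ j" using G(3)[of j] by (simp add: power2_commute)
 moreover have "ennreal (EE w. (si (G j) T w)^2) <= ennreal (2 * q + 2 * (1 / 16) ^ Suc j)"
 proof -
 have "ennreal (EE w. (si (G j) T w)^2) <= (NN w. 2 * Qv 0 Z w + 2 * Qv 0 (sv (G j) ~- Z) w)"
 unfolding simple_isometry[OF G(1)] by (intro nn_integral_mono Qv_le_2 D(2) jm_sv G(1)) auto
 also have "... = 2 * ennreal q + 2 * (NN w. Qv 0 (Z ~- sv (G j)) w)"
 using Qv_m[OF D(2), of 0] Qv_m[OF jm_diff[OF D(2) jm_sv[OF G(1)]], of 0 j] q
 by (subst Qv_diff_commute) (simp add: nn_integral_add nn_integral_cmult)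
 also have "... <= 2 * ennreal q + 2 * ennreal ((1 / 16) ^ Suc j)" by (intro add_left_mono mult_left_mono G(2)) simp
 also have "... = ennreal (2 * q + 2 * (1 / 16) ^ Suc j)" by (rule ennreal_two) (use q in simp_all)
 finally show ?thesis .
 qed
 then have "(EE w. (si (G j) T w)^2) <= 2 * q + 2 * (1 / 16) ^ Suc j" using q by (subst (asm) ennreal_le_iff) simp_all
 ultimately show ?thesis using zero_le_power[of "1 / 16 :: real" j] unfolding diff_add_cancel power_Suc by linarith
 qed
 moreover have "(%j. 4 * q + 12 * (1 / 16) ^ j) ~> 4 * q + 12 * 0" by (intro tendsto_intros LIMSEQ_realpow_zero) auto
 ultimately have "(EE w. (I T w)^2) <= 4 * q" using LIMSEQ_le_const[of "%j. 4 * q + 12 * (1 / 16) ^ j" "4 * q"] by auto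
 then show ?thesis unfolding q(1) using q(2) by (simp add: ennreal_mult[symmetric] ennreal_leI flip: ennreal_numeral)
qed

text \<open>The weights \<open>2 ^ n\<close> turn the rate in mean into pointwise control: the
  weighted sum of squared gaps has finite mean, so for almost all times and paths the gaps are at
  most a constant times \<open>(sqrt (1 / 2)) ^ n\<close>. The limit is taken as \<open>lim\<close>
  everywhere, which makes it predictable without exceptional sets.\<close>

lemma predictable_fast_limit:
 assumes Z: "!!n. pred (Zn n)"
 and fast: "!!n. (NN w. Qv 0 (Zn n ~- Zn (Suc n)) w) <= ennreal ((1 / 16) ^ Suc n)"
 shows "EX Z. pred Z & (AE w in P. AE u in LT. (%n. Zn n u w) ~> Z u w) &
 (ALL n. (NN w. Qv 0 (Zn n ~- Z) w) <= ennreal ((1 / 4) * (1 / 16) ^ n))"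
proof -
 define Z where "Z u w = lim (%n. Zn n u w)" for u w
 have jm: "jm (Zn n)" for n by (rule predictable_jm[OF assms(1)])
 have Zp: "pred Z"
 using borel_measurable_lim_metric[of "%n (u, w). Zn n u w" "PA"] assms(1)
 unfolding predictable_process_def Z_def by (simp add: case_prod_beta')
 define D where "D n u w = ennreal ((norm (Zn n u w - Zn (Suc n) u w))^2)" for n u w
 have QD: "Qv 0 (Zn n ~- Zn (Suc n)) w = (NL u. D n u w)" for n w
 unfolding Qv_LT[OF order_refl] D_def by (intro nn_integral_cong) (simp split: split_indicator)
 have Dm: "(%u. D n u w) : bm LT" if "w : space M" for n w
 unfolding D_def using jm_section[OF jm_diff[OF jm jm] that, of n "Suc n"] by simp
 have Qm: "Qv 0 (Zn n ~- Zn m) : bm P" for n m by (intro Qv_m jm_diff jm) simp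
 have pow: "2 ^ n * ennreal x = ennreal (2 ^ n * x)" if "0 <= x" for n x
 using that by (simp add: ennreal_mult ennreal_power[symmetric])
 define Sw where "Sw w = (\<Sum>n. 2 ^ n * Qv 0 (Zn n ~- Zn (Suc n)) w)" for w
 have Sm: "Sw : bm P"
 unfolding Sw_def using Qm by (intro borel_measurable_suminf_order) simp
 have S1: "(NN w. Sw w) = (\<Sum>n. 2 ^ n * (NN w. Qv 0 (Zn n ~- Zn (Suc n)) w))"
 unfolding Sw_def using Qm by (subst nn_integral_suminf) (simp_all add: nn_integral_cmult)
 have S2: "(\<Sum>n. 2 ^ n * (NN w. Qv 0 (Zn n ~- Zn (Suc n)) w)) <= (\<Sum>n. ennreal ((1 / 8) ^ n))"
 proof (intro suminf_le summableI)
 fix n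
 have "2 ^ n * (NN w. Qv 0 (Zn n ~- Zn (Suc n)) w) <= 2 ^ n * ennreal ((1 / 16) ^ Suc n)" by (intro mult_left_mono fast) simp
 also have "... = ennreal (2 ^ n * (1 / 16) ^ Suc n)" by (rule pow) simp
 also have "... <= ennreal ((1 / 8) ^ n)"
 proof (rule ennreal_leI)
 have "2 ^ n * (1 / 16 :: real) ^ Suc n = (1 / 8) ^ n / 16" by (simp add: power_mult_distrib[symmetric])
 also have "... <= (1 / 8) ^ n" by simp
 finally show "2 ^ n * (1 / 16 :: real) ^ Suc n <= (1 / 8) ^ n" .
 qed
 finally show "2 ^ n * (NN w. Qv 0 (Zn n ~- Zn (Suc n)) w) <= ennreal ((1 / 8) ^ n)" .
 qed
 have "(\<Sum>n. ennreal ((1 / 8) ^ n)) = ennreal (\<Sum>n. (1 / 8) ^ n)" by (intro suminf_ennreal2) simp_all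
 then have S3: "(\<Sum>n. ennreal ((1 / 8) ^ n)) < \<infinity>" by (simp only: infinity_ennreal_def ennreal_less_top)
 have S: "(NN w. Sw w) < \<infinity>" unfolding S1 by (rule le_less_trans[OF S2 S3])
 have "AE w in P. Sw w ~= \<infinity>"
 by (rule nn_integral_PInf_AE[OF Sm less_imp_neq[OF S]])
 then have conv: "AE w in P. AE u in LT. (%n. Zn n u w) ~> Z u w"
 using AE_space
 proof eventually_elim
 case (elim w)
 then have w: "w : space M" by simp
 have "(NL u. (\<Sum>n. 2 ^ n * D n u w)) = (\<Sum>n. (NL u. 2 ^ n * D n u w))"
 using Dm[OF w] by (intro nn_integral_suminf) simp
 also have "... = Sw w" unfolding Sw_def QD by (intro suminf_cong nn_integral_cmult Dm w)
 finally have "(NL u. (\<Sum>n. 2 ^ n * D n u w)) ~= \<infinity>" using elim(1) by (simp only:) simp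
 then have "AE u in LT. (\<Sum>n. 2 ^ n * D n u w) ~= \<infinity>"
 using Dm[OF w] by (intro nn_integral_PInf_AE borel_measurable_suminf_order) auto
 then show ?case
 proof eventually_elim
 case (elim u)
 then obtain C where C: "(\<Sum>n. 2 ^ n * D n u w) = ennreal C" "0 <= C" by (cases "\<Sum>n. 2 ^ n * D n u w" rule: ennreal_cases) auto
 have bnd: "norm (Zn (Suc n) u w - Zn n u w) <= sqrt C * (sqrt (1 / 2)) ^ n" for n
 proof -
 have "2 ^ n * D n u w <= ennreal C" unfolding C(1)[symmetric] using sum_le_suminf[OF summableI, of "{n}" "%n. 2 ^ n * D n u w"] by simp
 also have "2 ^ n * D n u w = ennreal (2 ^ n * (norm (Zn n u w - Zn (Suc n) u w))^2)"
 unfolding D_def by (rule pow) simp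
 finally have "2 ^ n * (norm (Zn n u w - Zn (Suc n) u w))^2 <= C" using C(2) by simp
 then have "(norm (Zn (Suc n) u w - Zn n u w))^2 <= C * (1 / 2) ^ n" by (simp add: norm_minus_commute power_divide field_simps)
 then have "norm (Zn (Suc n) u w - Zn n u w) <= sqrt (C * (1 / 2) ^ n)" by (rule real_le_rsqrt)
 then show ?thesis by (simp add: real_sqrt_mult real_sqrt_power)
 qed
 have "summable (%n. sqrt C * (sqrt (1 / 2)) ^ n)" by (intro summable_mult summable_geometric) (simp add: real_sqrt_divide)
 then have "summable (%n. Zn (Suc n) u w - Zn n u w)" by (rule summable_comparison_test'[where N = 0]) (use bnd in auto)
 then have "convergent (%n. Zn 0 u w + (\<Sum>i<n. Zn (Suc i) u w - Zn i u w))"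
 by (intro convergent_add convergent_const) (simp add: summable_iff_convergent)
 then have "convergent (%n. Zn n u w)" using sum_lessThan_telescope[of "%i. Zn i u w"] by simp
 then show ?case unfolding Z_def by (simp add: convergent_LIMSEQ_iff)
 qed
 qed
 have gap: "(NN w. Qv 0 (Zn n ~- Zn (n + m)) w) <= ennreal ((1 / 4) * (1 / 16) ^ n)" for n m
 proof (induction m arbitrary: n)
 case 0
 show ?case by simp
 next
 case (Suc m)
 have "(NN w. Qv 0 (Zn n ~- Zn (n + Suc m)) w) <= 2 * (NN w. Qv 0 (Zn n ~- Zn (Suc n)) w) + 2 * (NN w. Qv 0 (Zn (Suc n) ~- Zn (Suc n + m)) w)"
 using Qv_triangle_int[OF jm jm jm, of n "n + Suc m" "Suc n"] by simp
 also have "... <= 2 * ennreal ((1 / 16) ^ Suc n) + 2 * ennreal ((1 / 4) * (1 / 16) ^ Suc n)"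
 by (intro add_mono mult_left_mono fast Suc.IH) simp_all
 also have "... = ennreal (2 * (1 / 16) ^ Suc n + 2 * ((1 / 4) * (1 / 16) ^ Suc n))" by (rule ennreal_two) simp_all
 also have "... <= ennreal ((1 / 4) * (1 / 16) ^ n)" by (intro ennreal_leI) simp
 finally show ?case .
 qed
 have "(NN w. Qv 0 (Zn n ~- Z) w) <= ennreal ((1 / 4) * (1 / 16) ^ n)" for n
 proof -
 have "(NN w. Qv 0 (Zn n ~- Z) w) <= (NN w. liminf (%m. Qv 0 (Zn n ~- Zn (n + m)) w))"
 proof (rule nn_integral_mono_AE)
 show "AE w in P. Qv 0 (Zn n ~- Z) w <= liminf (%m. Qv 0 (Zn n ~- Zn (n + m)) w)"
 using conv AE_space
 proof eventually_elim
 case (elim w)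
 have w: "w : space M" using elim(2) by simp
 have Q: "Qv 0 (Zn n ~- Y) w = (NL u. ennreal ((norm (Zn n u w - Y u w))^2))" for Y
 unfolding Qv_LT[OF order_refl] by (intro nn_integral_cong) (simp split: split_indicator)
 have "Qv 0 (Zn n ~- Z) w <= (NL u. liminf (%m. ennreal ((norm (Zn n u w - Zn (n + m) u w))^2)))"
 unfolding Q
 proof (rule nn_integral_mono_AE)
 show "AE u in LT. ennreal ((norm (Zn n u w - Z u w))^2) <= liminf (%m. ennreal ((norm (Zn n u w - Zn (n + m) u w))^2))"
 using elim(1)
 proof eventually_elim
 case (elim u)
 have "(%m. Zn (n + m) u w) ~> Z u w" using LIMSEQ_ignore_initial_segment[OF elim, of n] by (simp add: add.commute)
 then have "(%m. ennreal ((norm (Zn n u w - Zn (n + m) u w))^2)) ~> ennreal ((norm (Zn n u w - Z u w))^2)"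
 by (intro tendsto_ennrealI tendsto_intros)
 from lim_imp_Liminf[OF sequentially_bot this] show ?case by simp
 qed
 qed
 also have "... <= liminf (%m. Qv 0 (Zn n ~- Zn (n + m)) w)"
 unfolding Q by (rule nn_integral_liminf) (use jm_section[OF jm_diff[OF jm jm] w] in simp)
 finally show ?case .
 qed
 qed
 also have "... <= liminf (%m. (NN w. Qv 0 (Zn n ~- Zn (n + m)) w))" by (rule nn_integral_liminf[OF Qm])
 also have "... <= ennreal ((1 / 4) * (1 / 16) ^ n)"
 by (rule Liminf_le) (use gap in simp_all)
 finally show ?thesis .
 qed
 with Zp conv show ?thesis by blast
qed

lemma sint_fast_limit:
 assumes s: "!!n. sint (Zn n) (In n)" and fin: "!!n. (NN w. Qv 0 (Zn n) w) < \<infinity>"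
 and fast: "!!n. (NN w. Qv 0 (Zn n ~- Zn (Suc n)) w) <= ennreal ((1 / 16) ^ Suc n)"
 shows "EX Z I. sint Z I & (EQ Z) < \<infinity> &
 (AE w in P. AE u in LT. (%n. Zn n u w) ~> Z u w) &
 (AE w in P. uniform_limit TI (%n t. In n t w) (%t. I t w) sequentially)"
proof -
 note D = sintD[OF s]
 obtain Z where Z: "pred Z" "AE w in P. AE u in LT. (%n. Zn n u w) ~> Z u w"
 "!!n. (NN w. Qv 0 (Zn n ~- Z) w) <= ennreal ((1 / 4) * (1 / 16) ^ n)"
 using predictable_fast_limit[of Zn, OF D(1) fast] by blast
 have jZ: "jm Z" by (rule predictable_jm[OF Z(1)])
 have N: "L2mart (In n)" for n by (rule sint_L2(1)[OF s fin])
 have "(EE w. (In (Suc n) T w - In n T w)^2) <= (1 / 16) ^ n" for n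
 proof -
 have "ennreal (EE w. (In n T w - In (Suc n) T w)^2) <= 4 * (NN w. Qv 0 (Zn n ~- Zn (Suc n)) w)"
 by (rule sint_second_moment[OF sint_diff[OF s s]]) (rule le_less_trans[OF fast], simp)
 also have "... <= 4 * ennreal ((1 / 16) ^ Suc n)" by (intro mult_left_mono fast) simp
 also have "... = ennreal (4 * (1 / 16) ^ Suc n)" by (rule ennreal_four) simp
 also have "... <= ennreal ((1 / 16) ^ n)" by (intro ennreal_leI) simp
 finally have "(EE w. (In n T w - In (Suc n) T w)^2) <= (1 / 16) ^ n" by (subst (asm) ennreal_le_iff) simp_all
 then show ?thesis by (simp add: power2_commute)
 qed
 from L2mart_fast_limit[of In, OF N this] obtain I where I: "L2mart I"
 "AE w in P. uniform_limit TI (%n t. In n t w) (%t. I t w) sequentially" "!!n. (EE w. (In n T w - I T w)^2) <= 4 * (1 / 16) ^ n" by blast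
 have QZ: "(EQ Z) < \<infinity>"
 proof -
 have "(EQ Z) <= (NN w. 2 * Qv 0 (Zn 0) w + 2 * Qv 0 (Z ~- Zn 0) w)"
 by (intro nn_integral_mono Qv_le_2 D(2) jZ) auto
 also have "... = 2 * (NN w. Qv 0 (Zn 0) w) + 2 * (NN w. Qv 0 (Zn 0 ~- Z) w)"
 using Qv_m[OF D(2)] Qv_m[OF jm_diff[OF D(2) jZ]]
 by (subst Qv_diff_commute) (simp add: nn_integral_add nn_integral_cmult)
 also have "... < \<infinity>" using fin[of 0] le_less_trans[OF Z(3)[of 0], of \<infinity>] by (simp add: ennreal_mult_less_top)
 finally show ?thesis .
 qed
 have "sint Z I"
 proof (rule sint_closed[OF s Z(1)])
 show "AE w in P. Qv 0 Z w < \<infinity>"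
 using nn_integral_PInf_AE[OF Qv_m[OF jZ order_refl]] QZ by (simp add: less_top)
 show Im: "I t : bm (F t)" if "t : TI" for t by (rule L2F_m[OF L2mart_L2F[OF I(1) that]])
 show "AE w in P. continuous_on TI (%t. I t w)" by (rule L2mart_cont[OF I(1)])
 show "tip (%n. Qv 0 (Z ~- Zn n))"
 proof (subst Qv_diff_commute, rule tip_L1)
 have "(%n. ennreal ((1 / 4) * (1 / 16) ^ n)) ~> ennreal ((1 / 4) * 0)" by (intro tendsto_ennrealI tendsto_mult tendsto_const LIMSEQ_realpow_zero) auto
 then have "(%n. ennreal ((1 / 4) * (1 / 16) ^ n)) ~> 0" by simp
 from tendsto_sandwich[OF always_eventually[OF allI[OF zero_le]] always_eventually[OF allI[OF Z(3)]] tendsto_const this]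
 show "(%n. EQ (Zn n ~- Z)) ~> 0" .
 qed (intro Qv_m jm_diff jZ D(2) order_refl)
 show "tip (%n w. ennreal (abs (In n t w - I t w)))" if t: "t : TI" for t
 proof (rule tip_AE)
 show "(%w. ennreal (abs (In n t w - I t w))) : bm P" for n using D(5)[OF t, of n] mFP[OF Im[OF t]] by simp
 show "AE w in P. (%n. ennreal (abs (In n t w - I t w))) ~> 0"
 using I(2)
 proof eventually_elim
 case (elim w)
 from tendsto_ennrealI[OF tendsto_rabs_zero[OF LIM_zero[OF tendsto_uniform_limitI[OF elim t]]]] show ?case by simp
 qed
 qed
 qed
 then show ?thesis using QZ Z(2) I(2) by blast
qed

text \<open>The converse estimate. It is what converts a bound on the integral process into a bound
  on the integrand in \<open>energy_0\<close>.\<close>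

lemma sint_energy:
 assumes s: "sint Z I" and fin: "EQ Z < \<infinity>"
 shows "EQ Z <= 4 * ennreal (EE w. (I T w)^2)"
proof -
 note D = sintD[OF s]
 obtain G where G: "!!j. simple (G j)" "!!j. EQ (Z ~- sv (G j)) <= ennreal ((1 / 16) ^ Suc j)"
 "!!j. (EE w. (si (G j) T w - I T w)^2) <= 4 * (1 / 16) ^ j" using sint_L2(2)[OF s fin] by blast
 have TT: "T : TI" using T_pos by simp
 define e where "e j = (1 / 16 :: real) ^ j" for j :: nat
 have e0: "0 <= e j" for j unfolding e_def by simp
 have el: "e ~> 0" unfolding e_def by (rule LIMSEQ_realpow_zero) auto
 note L = L2mart_L2F[OF sint_L2(1)[OF s fin] TT]
 have "EQ Z <= 4 * ennreal (EE w. (I T w)^2) + ennreal (18 * e j)" for j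
 proof -
 have LG: "L2F T (%w. si (G j) T w - I T w)" using L2mart_L2F[OF si_L2mart[OF G(1)] TT] L by (rule L2F_diff)
 have "(EE w. ((si (G j) T w - I T w) + I T w)^2) <= 2 * (EE w. (si (G j) T w - I T w)^2) + 2 * (EE w. (I T w)^2)"
 by (rule square_add_le(2)[OF L2F_mP[OF LG] L2F_mP[OF L] L2F_square[OF LG] L2F_square[OF L]])
 then have g: "(EE w. (si (G j) T w)^2) <= 8 * e j + 2 * (EE w. (I T w)^2)" using G(3)[of j] unfolding e_def by simp
 have "EQ Z <= (NN w. 2 * Qv 0 (sv (G j)) w + 2 * Qv 0 (Z ~- sv (G j)) w)"
 by (intro nn_integral_mono Qv_le_2 D(2) jm_sv G(1)) auto
 also have "... = 2 * EQ (sv (G j)) + 2 * EQ (Z ~- sv (G j))"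
 using Qv_m[OF jm_sv[OF G(1)], of 0] sint_simple(2)[OF s TT G(1)] by (simp add: nn_integral_add nn_integral_cmult)
 also have "... <= 2 * ennreal (8 * e j + 2 * (EE w. (I T w)^2)) + 2 * ennreal (e j)"
 unfolding simple_isometry[OF G(1), symmetric] using g G(2)[of j] e0[of j]
 by (intro add_mono mult_left_mono ennreal_leI) (auto intro: order_trans simp: e_def ennreal_leI)
 also have "... = 4 * ennreal (EE w. (I T w)^2) + ennreal (18 * e j)"
 using e0[of j] by (subst ennreal_two) (auto simp: ennreal_four ennreal_plus[symmetric] simp del: ennreal_plus)
 finally show ?thesis .
 qed
 moreover have "(%j. 4 * ennreal (EE w. (I T w)^2) + ennreal (18 * e j)) ~> 4 * ennreal (EE w. (I T w)^2) + ennreal (18 * 0)"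
 by (intro tendsto_add tendsto_const tendsto_ennrealI tendsto_mult el)
 ultimately show ?thesis using LIMSEQ_le_const by (metis (no_types, lifting) add.right_neutral ennreal_0 mult_zero_right)
qed

end

section \<open>The heat semigroup and continuous martingales with prescribed terminal value\<close>

context wiener begin

text \<open>The conditional mean of \<open>g (W t)\<close> given \<open>W u = x\<close>.\<close>

definition heat :: "(real ^ 'n => real) => real => real => real ^ 'n => real" where
 "heat g t u x = (\<integral>y. g (x + y) \<partial>gauss (t - u))"

lemma heat_eq:
 assumes g: "continuous_on UNIV g" and u: "0 <= u" "u <= t" "t <= T"
 shows "heat g t u x = (EE w. g (x + (W t w - W u w)))"
proof -
 have [measurable]: "g : borel_measurable borel" using g by (rule borel_measurable_continuous_onI)
 have [measurable]: "(%w. W t w - W u w) : bm P"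
 using u by (intro borel_measurable_diff mFP[OF W_F[of _ t]]) auto
 show ?thesis unfolding heat_def distr_increment[OF u, symmetric] by (subst integral_distr) auto
qed

lemma heat_end: "continuous_on UNIV g ==> heat g t t x = g x"
 unfolding heat_def gauss_def
 by (simp, subst integral_return) (auto intro!: borel_measurable_continuous_onI continuous_intros continuous_on_compose2[of UNIV g])

text \<open>Written as an expectation over the given Brownian motion, the Gaussian average is
  jointly continuous in time and space by path continuity and dominated convergence; its density is
  not touched.\<close>

lemma heat_cont:
 assumes g: "continuous_on UNIV g" "!!x. abs (g x) <= 1" and t: "t : TI"
 shows "continuous_on ({0..t} \<times> UNIV) (%(u, x). heat g t u x)"
proof (rule continuous_on_sequentiallyI)
 fix z :: "nat => real \<times> (real ^ 'n)" and a
 assume z: "ALL n. z n : {0..t} \<times> UNIV" and a: "a : {0..t} \<times> UNIV" and lim: "z ~> a"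
 have [measurable]: "g : borel_measurable borel" using g(1) by (rule borel_measurable_continuous_onI)
 have [measurable]: "W r : bm P" if "r : TI" for r using that by (intro mFP[OF W_F[of r r]]) auto
 have in_t: "fst (z n) : {0..t}" "fst a : {0..t}" for n using z a by (auto simp: mem_Times_iff)
 have in_T: "fst (z n) <= T" "fst a <= T" for n using in_t(1)[of n] in_t(2) t by auto
 have W[measurable]: "W (fst (z n)) : bm P" "W (fst a) : bm P" "W t : bm P" for n
 using in_t in_T t by (auto intro!: mFP[OF W_F[of _ t]])
 have "(%n. (EE w. g (snd (z n) + (W t w - W (fst (z n)) w)))) ~> (EE w. g (snd a + (W t w - W (fst a) w)))"
 proof (rule integral_dominated_convergence[where w = "%_. 1"])
 show "AE w in P. (%n. g (snd (z n) + (W t w - W (fst (z n)) w))) ~> g (snd a + (W t w - W (fst a) w))"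
 using W_cont
 proof eventually_elim
 case (elim w)
 have "(%n. W (fst (z n)) w) ~> W (fst a) w"
 by (rule continuous_on_tendsto_compose[OF elim tendsto_fst[OF lim]]) (use in_t in_T t in auto)
 then have "(%n. snd (z n) + (W t w - W (fst (z n)) w)) ~> snd a + (W t w - W (fst a) w)"
 by (intro tendsto_intros tendsto_snd[OF lim])
 then show ?case by (rule continuous_on_tendsto_compose[OF g(1)]) auto
 qed
 qed (use g(2) in auto)
 then show "(%n. case z n of (u, x) => heat g t u x) ~> (case a of (u, x) => heat g t u x)"
 using in_t t by (simp add: case_prod_beta' heat_eq[OF g(1)])
qed

lemma heat_le:
 assumes g: "continuous_on UNIV g" "!!x. abs (g x) <= 1" and u: "u : {0..t}" "t : TI"
 shows "continuous_on UNIV (heat g t u)" "abs (heat g t u x) <= 1"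
proof -
 have "continuous_on UNIV ((%(u, x). heat g t u x) \<circ> (%x. (u, x)))"
 by (intro continuous_on_compose continuous_intros continuous_on_subset[OF heat_cont[OF g u(2)]]) (use u in auto)
 then show "continuous_on UNIV (heat g t u)" by (simp add: o_def)
 have [measurable]: "g : borel_measurable borel" using g(1) by (rule borel_measurable_continuous_onI)
 have [measurable]: "W u : bm P" "W t : bm P"
 using u by (auto intro!: mFP[OF W_F[of _ t]])
 have "abs ((EE w. g (x + (W t w - W u w)))) <= (EE w. abs (g (x + (W t w - W u w))))" by (rule integral_abs_bound)
 also have "... <= (EE w. 1)" by (intro integral_mono integrable_const integrable_abs integrable_const_bound[where B = 1]) (use g(2) in auto)
 finally show "abs (heat g t u x) <= 1" using u by (simp add: heat_eq[OF g(1)] prob_space[simplified])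
qed

lemma heat_expect:
 assumes g: "continuous_on UNIV g" "!!x. abs (g x) <= 1" and u: "u : {0..t}" "t : TI" and X: "L2F u X"
 shows "(EE w. X w * g (W t w)) = (EE w. X w * heat g t u (W u w))"
proof -
 have [measurable]: "g : borel_measurable borel" using g(1) by (rule borel_measurable_continuous_onI)
 have [measurable]: "X : bm (F u)" "W u : bm (F u)" using L2F_m[OF X] W_F[of u u] u by auto
 have [measurable]: "X : bm P" "W t : bm P" using L2F_mP[OF X] mFP[OF W_F[of t t]] u by auto
 define \<Phi> where "\<Phi> = (%(w, y). X w * g (W u w + y))"
 have "(EE w. \<Phi> (w, W t w - W u w)) = (EE w. (\<integral>y. \<Phi> (w, y) \<partial>gauss (t - u)))"
 proof (rule core_lebesgue)
 show "\<Phi> : bm (F u \<Otimes>\<^sub>M borel)" unfolding \<Phi>_def by measurable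
 show "integrable P (%w. \<Phi> (w, W t w - W u w))" unfolding \<Phi>_def
 by (rule Bochner_Integration.integrable_bound[OF L2F_integrable[OF X]])
 (use g(2) in "auto simp: abs_mult intro!: AE_I2 mult_left_le")
 qed (use u in auto)
 then show ?thesis unfolding \<Phi>_def heat_def by simp
qed

lemma L2martI:
 assumes L: "!!t. t : TI ==> L2F t (N t)" and c: "AE w in P. continuous_on TI (%t. N t w)"
 and eq: "!!t X. t : TI ==> L2F t X ==> (EE w. X w * N T w) = (EE w. X w * N t w)"
 shows "L2mart N"
 unfolding L2mart_def
proof (intro conjI ballI allI impI L c)
 fix s t X assume *: "0 <= s & s <= t & t <= T & L2F s X"
 then show "(EE w. X w * N t w) = (EE w. X w * N s w)" using eq[of t X] eq[of s X] L2F_mono[of s X t] by simp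
qed

text \<open>The difference \<open>D\<close> between the martingale at \<open>s\<close> and
  \<open>X\<close> is known at \<open>s\<close>, so it may itself serve as test variable; this gives
  second moment zero.\<close>

lemma L2mart_const_after:
 assumes N: "L2mart N" and s: "s : TI" and X: "X : bm (F s)" and eq: "AE w in P. N T w = X w"
 shows "AE w in P. N s w = X w"
proof -
 have TT: "T : TI" using T_pos by simp
 note NT = L2mart_L2F[OF N TT] and Ns = L2mart_L2F[OF N s]
 have X2: "L2F s X" unfolding L2F_def
 using L2F_AE[OF NT eq] X by (simp add: L2F_def)
 define D where "D w = N s w - X w" for w
 have D: "L2F s D" unfolding D_def by (rule L2F_diff[OF Ns X2])
 have "(EE w. (D w)^2) = (EE w. D w * N s w) - (EE w. D w * X w)"
 unfolding Bochner_Integration.integral_diff[OF L2F_mult[OF D Ns] L2F_mult[OF D X2], symmetric]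
 by (intro Bochner_Integration.integral_cong) (simp_all add: D_def power2_eq_square algebra_simps)
 also have "(EE w. D w * X w) = (EE w. D w * N T w)"
 using eq by (intro integral_cong_AE borel_measurable_times L2F_mP[OF D] L2F_mP[OF X2] L2F_mP[OF NT]) auto
 also have "(EE w. D w * N s w) - (EE w. D w * N T w) = 0" using L2mart_orth[OF N, of s T D] s D by simp
 finally have "AE w in P. (D w)^2 = 0" using L2F_square[OF D] by (subst (asm) integral_nonneg_eq_0_iff_AE) auto
 then show ?thesis by eventually_elim (simp add: D_def)
qed

text \<open>\<open>X\<close> closes a continuous martingale. This is weaker than being a stochastic
  integral: no integrand is produced, only continuity in time.\<close>

definition mrep :: "('a => real) => bool" where
 "mrep X <-> (EX N. L2mart N & (AE w in P. N T w = X w))"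

lemma mrep_AE: assumes "mrep X" "AE w in P. X w = Y w" shows "mrep Y"
proof -
 obtain N where N: "L2mart N" "AE w in P. N T w = X w" using assms(1) unfolding mrep_def by blast
 have "AE w in P. N T w = Y w" using N(2) assms(2) by eventually_elim simp
 with N(1) show ?thesis unfolding mrep_def by blast
qed

lemma mrep_const: "mrep (%_. c)"
 unfolding mrep_def by (intro exI[of _ "%_ _. c"]) (auto intro!: L2martI)

lemma mrep_lin: assumes "mrep X" "mrep Y" shows "mrep (%w. X w + c * Y w)"
proof -
 obtain N N' where N: "L2mart N" "AE w in P. N T w = X w" "L2mart N'" "AE w in P. N' T w = Y w" using assms unfolding mrep_def by blast
 have "AE w in P. N T w + c * N' T w = X w + c * Y w" using N(2,4) by eventually_elim simp
 with L2mart_add[OF N(1) L2mart_cmult[OF N(3), of c]] show ?thesis unfolding mrep_def by blast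
qed

lemma mrep_limit:
 assumes X: "!!n. mrep (X n)" "!!n w. w : space M ==> abs (X n w) <= C" and Xm: "!!n. X n : bm P"
 and lim: "!!w. w : space M ==> (%n. X n w) ~> Y w"
 shows "mrep Y"
proof -
 have "ALL n. EX N. L2mart N & (AE w in P. N T w = X n w)" using X(1) unfolding mrep_def by blast
 from choice[OF this] obtain N where N: "!!n. L2mart (N n)" "!!n. AE w in P. N n T w = X n w" by blast
 have TT: "T : TI" using T_pos by simp
 have [measurable]: "N n T : bm P" "X n : bm P" for n using L2mart_m[OF N(1) TT] Xm by auto
 have Ym[measurable]: "Y : bm P" by (rule borel_measurable_LIMSEQ_metric[OF Xm]) (use lim in simp)
 have Yb: "abs (Y w) <= C" if "w : space M" for w
 by (rule LIMSEQ_le_const2[OF tendsto_rabs[OF lim[OF that]]]) (use X(2) that in auto)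
 have eq: "(EE w. (N n T w - Y w)^2) = (EE w. (X n w - Y w)^2)" for n
 using N(2)[of n] by (intro integral_cong_AE) auto
 have b: "(X n w - Y w)^2 <= (2 * C)^2" if "w : space M" for n w
 proof -
 have "abs (X n w - Y w) <= abs (2 * C)" using X(2)[OF that, of n] Yb[OF that] by linarith
 then show ?thesis by (simp only: abs_le_square_iff)
 qed
 have "(%n. (EE w. (X n w - Y w)^2)) ~> (EE w. 0)"
 proof (rule integral_dominated_convergence[where w = "%_. (2 * C)^2"])
 show "AE w in P. (%n. (X n w - Y w)^2) ~> 0"
 proof (rule AE_I2)
 fix w assume "w : space P"
 then have "(%n. (X n w - Y w)^2) ~> (Y w - Y w)^2" by (intro tendsto_intros lim) simp
 then show "(%n. (X n w - Y w)^2) ~> 0" by simp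
 qed
 qed (use b in auto)
 then have l: "(%n. (EE w. (N n T w - Y w)^2)) ~> 0" unfolding eq by simp
 have i: "integrable P (%w. (N n T w - Y w)^2)" for n
 proof -
 have "integrable P (%w. (X n w - Y w)^2)" by (rule integrable_const_bound[where B = "(2 * C)^2"]) (use b in auto)
 then show ?thesis by (rule integrable_cong_AE_imp) (use N(2)[of n] in auto)
 qed
 from L2mart_limit[OF N(1) Ym i l] show ?thesis unfolding mrep_def by blast
qed

text \<open>One step of the Markov property extends a martingale past the last observation time \<open>s\<close>.\<close>
lemma mrep_extend:
 assumes g: "continuous_on UNIV g" "!!x. abs (g x) <= 1" and st: "0 <= s" "s <= t" "t <= T"
 and X: "X : bm (F s)" "!!w. w : space M ==> abs (X w) <= 1"
 and rep: "mrep (%w. X w * heat g t s (W s w))"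
 shows "mrep (%w. X w * g (W t w))"
proof -
 have s: "s : TI" and t: "t : TI" and TT: "T : TI" using st T_pos by auto
 obtain N1 where N1: "L2mart N1" "AE w in P. N1 T w = X w * heat g t s (W s w)" using rep unfolding mrep_def by blast
 define H where "H u w = X w * heat g t u (W u w)" for u w
 have Hm: "L2F u (H u)" if "u : {s..t}" for u
 proof (rule L2F_bounded[where C = 1])
 have [measurable]: "X : bm (F u)" "W u : bm (F u)" using mF_mono[OF _ X(1)] W_F[of u u] that st by auto
 have [measurable]: "heat g t u : borel_measurable borel" using heat_le(1)[OF g, of u t] that st by (intro borel_measurable_continuous_onI) auto
 show "H u : bm (F u)" unfolding H_def by measurable
 show "AE w in P. abs (H u w) <= 1"
 unfolding H_def using heat_le(2)[OF g, of u t] that st X(2) by (auto simp: abs_mult intro!: AE_I2 mult_le_one)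
 qed
 have N1s: "AE w in P. N1 s w = H s w"
 using L2mart_const_after[OF N1(1) s L2F_m[OF Hm[of s]]] N1(2) st unfolding H_def by simp
 \<comment> \<open>\<open>N1\<close> up to \<open>s\<close>, then the heat martingale
   \<open>H\<close> up to \<open>t\<close>, then a constant. Almost surely
   \<open>N1 s = H s\<close>, so subtracting \<open>N1 s\<close> glues the pieces into one formula
   that is continuous in \<open>u\<close>.\<close>
 define N where "N u w = N1 (min u s) w + H (max s (min u t)) w - N1 s w" for u w
 have lo: "AE w in P. N u w = N1 u w" if "u <= s" for u
 using N1s by eventually_elim (use that st in "simp add: N_def max_absorb1")
 have mid: "AE w in P. N u w = H u w" if "u : {s..t}" for u
 using N1s by eventually_elim (use that st in "simp add: N_def max_absorb2 min_absorb1 min_absorb2")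
 have hi: "AE w in P. N u w = H t w" if "t <= u" for u
 using N1s by eventually_elim (use that st in "simp add: N_def max_absorb2 min_absorb1 min_absorb2")
 have Ht: "H t w = X w * g (W t w)" for w unfolding H_def heat_end[OF g(1)] ..
 have tt: "t : {s..t}" using st by simp
 have L: "L2F u (N u)" if u: "u : TI" for u
 proof -
 consider "u <= s" | "u : {s..t}" | "t <= u" by force
 then show ?thesis
 proof cases
 case 1
 show ?thesis using lo[OF 1] by (intro L2F_AE[OF L2mart_L2F[OF N1(1) u]]) auto
 next
 case 2
 show ?thesis using mid[OF 2] by (intro L2F_AE[OF Hm[OF 2]]) auto
 next
 case 3
 show ?thesis using hi[OF 3] st by (intro L2F_AE[OF L2F_mono[OF Hm[of t] 3]]) auto
 qed
 qed
 have "L2mart N"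
 proof (rule L2martI[OF L])
 show "AE w in P. continuous_on TI (%u. N u w)"
 using L2mart_cont[OF N1(1)] W_cont
 proof eventually_elim
 case (elim w)
 have 1: "continuous_on TI (%u. N1 (min u s) w)"
 by (rule continuous_on_compose2[OF elim(1)]) (use st in "auto intro!: continuous_intros")
 have "continuous_on TI (%u. W (max s (min u t)) w)"
 by (rule continuous_on_compose2[OF elim(2)]) (use st in "auto intro!: continuous_intros")
 then have "continuous_on TI (%u. (max s (min u t), W (max s (min u t)) w))"
 by (intro continuous_on_Pair continuous_intros)
 then have "continuous_on TI (%u. case (max s (min u t), W (max s (min u t)) w) of (u, x) => heat g t u x)"
 by (rule continuous_on_compose2[OF heat_cont[OF g t]]) (use st in auto)
 then show ?case unfolding N_def H_def using 1 by (auto intro!: continuous_intros)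
 qed
 fix u Y assume u: "u : TI" and Y: "L2F u Y"
 have Ym: "Y : bm P" by (rule L2F_mP[OF Y])
 have cong: "(EE w. Y w * A w) = (EE w. Y w * B w)" if "AE w in P. A w = B w" "A : bm P" "B : bm P" for A B
 using that Ym by (intro integral_cong_AE) auto
 note Nm = L2F_mP[OF L]
 have NT: "(EE w. Y w * N T w) = (EE w. Y w * X w * g (W t w))"
 unfolding cong[OF hi[OF st(3)] Nm[OF TT] L2F_mP[OF Hm[OF tt]]] Ht by (simp add: mult.assoc)
 consider "u <= s" | "u : {s..t}" | "t <= u" by force
 then show "(EE w. Y w * N T w) = (EE w. Y w * N u w)"
 proof cases
 case 1
 have "L2F s (%w. X w * Y w)" by (rule L2F_bounded_mult[where C = 1]) (use L2F_mono[OF Y 1] X in auto)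
 then have "(EE w. Y w * X w * g (W t w)) = (EE w. Y w * H s w)"
 using heat_expect[OF g, of s t "%w. X w * Y w"] st unfolding H_def by (simp add: mult_ac)
 also have "... = (EE w. Y w * N1 s w)"
 using cong[OF N1s] L2mart_m[OF N1(1) s] L2F_mP[OF Hm[of s]] st by simp
 also have "... = (EE w. Y w * N1 u w)" using L2mart_orth[OF N1(1), of u s Y] u 1 st Y by simp
 also have "... = (EE w. Y w * N u w)" using cong[OF lo[OF 1] Nm[OF u] L2mart_m[OF N1(1) u]] by simp
 finally show ?thesis using NT by simp
 next
 case 2
 have "L2F u (%w. X w * Y w)"
 by (rule L2F_bounded_mult[where C = 1]) (use Y X mF_mono[OF _ X(1), of u] 2 in auto)
 then have "(EE w. Y w * X w * g (W t w)) = (EE w. Y w * H u w)"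
 using heat_expect[OF g, of u t "%w. X w * Y w"] 2 st unfolding H_def by (simp add: mult_ac)
 also have "... = (EE w. Y w * N u w)" using cong[OF mid[OF 2] Nm[OF u] L2F_mP[OF Hm[OF 2]]] by simp
 finally show ?thesis using NT by simp
 next
 case 3
 have "AE w in P. N T w = N u w" using hi[OF 3] hi[OF st(3)] by eventually_elim simp
 then show ?thesis by (rule cong[OF _ Nm[OF TT] Nm[OF u]])
 qed
 qed
 moreover have "AE w in P. N T w = X w * g (W t w)" using hi[OF st(3)] by (simp add: Ht)
 ultimately show ?thesis unfolding mrep_def by blast
qed

text \<open>Induction on the largest time \<open>b\<close>: averaging over the last increment
  replaces the factor at \<open>b\<close> by its heat evolution at the preceding time
  \<open>s\<close>, where it is absorbed into the factor \<open>g s\<close>. Time 0 is always among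
  the observation times so that a preceding time exists.\<close>

lemma mrep_prod:
 assumes A: "finite A" "A \<subseteq> {0<..T}" and g: "!!t. continuous_on UNIV (g t)" "!!t x. abs (g t x) <= (1::real)"
 shows "mrep (%w. \<Prod>t\<in>insert 0 A. g t (W t w))"
 using A g
proof (induction A arbitrary: g rule: finite_linorder_max_induct)
 case empty
 have "AE w in P. g 0 0 = (\<Prod>t\<in>{0}. g t (W t w))" using W_0 by eventually_elim simp
 then show ?case by (rule mrep_AE[OF mrep_const])
next
 case (insert b A)
 define s where "s = Max (insert 0 A)"
 have s: "s : insert 0 A" "!!a. a : insert 0 A ==> a <= s" unfolding s_def
 by (rule Max_in; use insert.hyps(1) in simp) (use insert.hyps(1) in "auto intro: Max_ge")
 have b: "b : {0<..T}" "s < b" "0 <= s" using insert.prems(1) s(1) insert.hyps(2) s(2)[of 0] by auto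
 define X where "X w = (\<Prod>t\<in>insert 0 A. g t (W t w))" for w
 define g' where "g' = g(s := %x. g s x * heat (g b) b s x)"
 note h = heat_le[OF insert.prems(2,3), of s b b]
 have g': "continuous_on UNIV (g' t)" "abs (g' t x) <= 1" for t x
 using insert.prems(2,3) h b unfolding g'_def by (auto intro!: continuous_intros mult_le_one simp: abs_mult)
 have "mrep (%w. \<Prod>t\<in>insert 0 A. g' t (W t w))" by (rule insert.IH) (use insert.prems(1) g' in auto)
 also have "(%w. \<Prod>t\<in>insert 0 A. g' t (W t w)) = (%w. X w * heat (g b) b s (W s w))"
 proof
 fix w
 have "(\<Prod>t\<in>insert 0 A. g' t (W t w)) = g' s (W s w) * (\<Prod>t\<in>insert 0 A - {s}. g' t (W t w))"
 using s(1) insert.hyps(1) by (intro prod.remove) auto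
 also have "(\<Prod>t\<in>insert 0 A - {s}. g' t (W t w)) = (\<Prod>t\<in>insert 0 A - {s}. g t (W t w))"
 by (intro prod.cong) (auto simp: g'_def)
 also have "g' s (W s w) * (\<Prod>t\<in>insert 0 A - {s}. g t (W t w)) = (g s (W s w) * (\<Prod>t\<in>insert 0 A - {s}. g t (W t w))) * heat (g b) b s (W s w)"
 by (simp add: g'_def)
 also have "g s (W s w) * (\<Prod>t\<in>insert 0 A - {s}. g t (W t w)) = X w"
 unfolding X_def using s(1) insert.hyps(1) by (intro prod.remove[symmetric]) auto
 finally show "(\<Prod>t\<in>insert 0 A. g' t (W t w)) = X w * heat (g b) b s (W s w)" .
 qed
 finally have rep: "mrep (%w. X w * heat (g b) b s (W s w))" .
 have "mrep (%w. X w * g b (W b w))"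
 proof (rule mrep_extend[OF insert.prems(2,3) _ _ _ _ _ rep])
 have "(%w. g t (W t w)) : bm (F s)" if "t : insert 0 A" for t
 using that s(2)[OF that] insert.prems(1) T_pos
 by (intro measurable_compose[OF W_F borel_measurable_continuous_onI[OF insert.prems(2)]]) auto
 then show "X : bm (F s)" unfolding X_def by (intro borel_measurable_prod) auto
 show "abs (X w) <= 1" for w unfolding X_def abs_prod by (intro prod_le_1) (use insert.prems(3) in auto)
 qed (use b in auto)
 moreover have "(\<Prod>t\<in>insert 0 (insert b A). g t (W t w)) = X w * g b (W b w)" for w
 proof -
 have "b ~: insert 0 A" using b s(2) by force
 then show ?thesis unfolding X_def using insert.hyps(1) by (subst insert_commute) simp
 qed
 ultimately show ?case by simp
qed

lemma open_indicator_limit: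
 fixes U :: "'b::metric_space set"
 assumes "open U"
 shows "EX g. (ALL n. continuous_on UNIV (g n)) & (ALL n x. abs (g n x) <= (1::real)) & (ALL x. (%n::nat. g n x) ~> ind U x)"
proof (cases "U = UNIV")
 case True
 then show ?thesis by (intro exI[of _ "%_ _. 1"]) auto
next
 case False
 define g where "g n x = min 1 (real n * infdist x (- U))" for n x
 have "(%n. g n x) ~> ind U x" for x
 proof (cases "x : U")
 case True
 have d: "0 < infdist x (- U)" using True False assms by (intro infdist_pos_not_in_closed) auto
 obtain N :: nat where N: "1 / infdist x (- U) < real N" using reals_Archimedean2 by blast
 have "g n x = 1" if "N <= n" for n
 proof -
 have "1 <= real N * infdist x (- U)" using N d by (simp add: pos_divide_less_eq)
 also have "... <= real n * infdist x (- U)" using that d by (intro mult_right_mono) auto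
 finally show ?thesis unfolding g_def by simp
 qed
 then show ?thesis using True by (intro tendsto_eventually) (auto simp: eventually_sequentially)
 next
 case False
 then show ?thesis unfolding g_def by simp
 qed
 moreover have "continuous_on UNIV (g n)" for n unfolding g_def by (intro continuous_intros continuous_on_infdist)
 moreover have "abs (g n x) <= 1" for n x unfolding g_def by (simp add: infdist_nonneg)
 ultimately show ?thesis by (intro exI[of _ g]) auto
qed

text \<open>Open sets make the family stable under intersection and their indicators limits of
  continuous functions. Time 0 is left out because \<open>W 0\<close> is almost surely
  constant.\<close>

definition cylinders :: "'a set set" where
 "cylinders = {{w:space M. ALL t:A. W t w : U t} | A U. finite A & A \<subseteq> {0<..T} & (ALL t. open (U t))}"

lemma mrep_cylinder:
 assumes "C : cylinders" shows "mrep (ind C)"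
proof -
 obtain A U where C: "C = {w:space M. ALL t:A. W t w : U t}" and A: "finite A" "A \<subseteq> {0<..T}" and U: "!!t. open (U t)"
 using assms unfolding cylinders_def by blast
 have "ALL t. EX g. (ALL n. continuous_on UNIV (g n)) & (ALL n x. abs (g n x) <= (1::real)) & (ALL x. (%n::nat. g n x) ~> ind (U t) x)"
 using open_indicator_limit[OF U] by blast
 from choice[OF this] obtain g where g: "!!t n. continuous_on UNIV (g t n)" "!!t n x. abs (g t n x) <= (1::real)"
 "!!t x. (%n::nat. g t n x) ~> ind (U t) x" by blast
 define g' where "g' n t = (if t = 0 then (%_. 1) else g t n)" for n t
 have g': "continuous_on UNIV (g' n t)" "abs (g' n t x) <= 1" for n t x using g unfolding g'_def by auto
 have p: "(\<Prod>t\<in>insert 0 A. g' n t (W t w)) = (\<Prod>t\<in>A. g t n (W t w))" for n w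
 proof -
 have "0 ~: A" using A by auto
 then show ?thesis using A by (auto simp: g'_def intro!: prod.cong)
 qed
 show ?thesis
 proof (rule mrep_limit[where C = 1])
 show "mrep (%w. \<Prod>t\<in>insert 0 A. g' n t (W t w))" for n by (rule mrep_prod[OF A g'])
 show "abs (\<Prod>t\<in>insert 0 A. g' n t (W t w)) <= 1" for n w unfolding abs_prod by (intro prod_le_1) (use g'(2) in auto)
 show "(%w. \<Prod>t\<in>insert 0 A. g' n t (W t w)) : bm P" for n
 proof (intro borel_measurable_prod)
 fix t assume "t : insert 0 A"
 then show "(%w. g' n t (W t w)) : bm P" using A T_pos
 by (intro measurable_compose[OF mFP[OF W_F[of t T]] borel_measurable_continuous_onI[OF g'(1)]]) auto
 qed
 show "(%n. \<Prod>t\<in>insert 0 A. g' n t (W t w)) ~> ind C w" if "w : space M" for w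
 proof -
 have "(%n. \<Prod>t\<in>A. g t n (W t w)) ~> (\<Prod>t\<in>A. ind (U t) (W t w))" by (intro tendsto_prod g(3))
 moreover have "(\<Prod>t\<in>A. ind (U t) (W t w)) = (ind C w :: real)"
 proof (cases "ALL t:A. W t w : U t")
 case False
 then show ?thesis using A that by (auto simp: C indicator_def intro!: prod_zero bexI)
 qed (use that in "simp add: C")
 ultimately show ?thesis unfolding p by simp
 qed
 qed
qed

text \<open>Dynkin's argument: \<open>mrep\<close> is linear and closed under bounded limits, which
  covers complements and disjoint unions. What remains is the return from the sigma-algebra of
  cylinders to \<open>F T\<close>, up to null sets.\<close>

lemma mrep_indicator:
 assumes A: "A : sets (F T)" shows "mrep (ind A)"
proof -
 have sub: "cylinders \<subseteq> Pow (space M)" unfolding cylinders_def by auto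
 have Cs: "C : sets P" if "C : sigma_sets (space M) cylinders" for C
 proof -
 have "cylinders \<subseteq> sets P"
 proof
 fix C assume "C : cylinders"
 then obtain A U where C: "C = {w:space M. ALL t:A. W t w : U t}" "finite A" "A \<subseteq> {0<..T}" "!!t. open (U t)"
 unfolding cylinders_def by blast
 have "{w:space P. W t w : U t} : sets P" if "t : A" for t
 using measurable_sets[OF mFP[OF W_F[of t T]] borel_open[OF C(4)], of t] C(3) that by (auto simp: vimage_def Int_def conj_commute)
 then have "{w:space P. ALL t:A. W t w : U t} : sets P" using C(2) by (intro sets.sets_Collect_finite_All) auto
 then show "C : sets P" unfolding C(1) by simp
 qed
 then show ?thesis using that sets.sigma_sets_subset[of cylinders P] by auto
 qed
 have Int: "Int_stable cylinders"
 proof (rule Int_stableI)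
 fix C D assume "C : cylinders" "D : cylinders"
 then obtain A U B V where C: "C = {w:space M. ALL t:A. W t w : U t}" "finite A" "A \<subseteq> {0<..T}" "!!t. open (U t)"
 and D: "D = {w:space M. ALL t:B. W t w : V t}" "finite B" "B \<subseteq> {0<..T}" "!!t. open (V t)"
 unfolding cylinders_def by blast
 have "C Int D = {w:space M. ALL t:A Un B. W t w : (if t : A then U t else UNIV) Int (if t : B then V t else UNIV)}"
 unfolding C(1) D(1) by auto
 moreover have "ALL t. open ((if t : A then U t else UNIV) Int (if t : B then V t else UNIV))" using C(4) D(4) by auto
 ultimately show "C Int D : cylinders" unfolding cylinders_def using C(2,3) D(2,3)
 by (intro CollectI exI[of _ "A Un B"] exI[of _ "%t. (if t : A then U t else UNIV) Int (if t : B then V t else UNIV)"] conjI) auto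
 qed
 have main: "mrep (ind C)" if "C : sigma_sets (space M) cylinders" for C
 using that
 proof (induction rule: sigma_sets_induct_disjoint[OF Int sub, consumes 1, case_names basic empty compl union])
 case (basic C)
 then show ?case by (rule mrep_cylinder)
 next
 case empty
 show ?case using mrep_const[of 0] by (simp add: indicator_def)
 next
 case (compl C)
 have "mrep (%w. 1 + (-1) * ind C w)" by (rule mrep_lin[OF mrep_const compl(2)])
 then show ?case by (rule mrep_AE) (auto simp: indicator_def intro!: AE_I2)
 next
 case (union C)
 have C: "C i : sets P" for i using union(2) Cs by auto
 have s: "(\<Sum>i<n. ind (C i) w) = (ind (\<Union>i<n. C i) w :: real)" for n w
 proof (rule indicator_UN_disjoint[symmetric])
 show "disjoint_family_on C {..<n}" using union(1) unfolding disjoint_family_on_def by blast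
 qed simp
 show ?case
 proof (rule mrep_limit[where C = 1])
 show "mrep (%w. \<Sum>i<n. ind (C i) w)" for n
 proof (induction n)
 case (Suc n)
 from mrep_lin[OF this union(3)[of n], of 1] show ?case by simp
 qed (simp add: mrep_const)
 show "abs (\<Sum>i<n. ind (C i) w) <= (1 :: real)" for n w unfolding s by (auto split: split_indicator)
 show "(%w. \<Sum>i<n. ind (C i) w :: real) : bm P" for n using C by auto
 show "(%n. \<Sum>i<n. ind (C i) w) ~> (ind (\<Union>i. C i) w :: real)" for w
 unfolding s by (rule LIMSEQ_indicator_UN)
 qed
 qed
 have Wm: "W s : bm (sigma (space M) cylinders)" if "s : {0<..T}" for s
 proof (rule borel_measurableI)
 fix S :: "(real ^ 'n) set" assume S: "open S"
 have "W s -` S Int space M = {w:space M. ALL t:{s}. W t w : S}" by auto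
 also have "... : cylinders" unfolding cylinders_def using that S by (intro CollectI exI[of _ "{s}"] exI[of _ "%_. S"]) auto
 finally show "W s -` S Int space (sigma (space M) cylinders) : sets (sigma (space M) cylinders)"
 using sub by (simp add: space_measure_of_conv sigma_sets.Basic)
 qed
 \<comment> \<open>At time 0 the almost sure value replaces \<open>W 0\<close>, so that every
   coordinate becomes measurable for the cylinders.\<close>
 define W' where "W' s w = (if s = 0 then 0 else W s w)" for s w
 have W'm: "W' s : bm (sigma (space M) cylinders)" if "s : TI" for s
 using Wm[of s] that unfolding W'_def by (cases "s = 0") auto
 have "EX B:sigma_sets (space M) cylinders. AE w in P. w : C <-> w : B" if "C : sets (generated_filtration T (space M) W T)" for C
 proof -
 have gs: "{W s -` B Int space M | s B. s : TI & s <= T & B : sets borel} \<subseteq> Pow (space M)" by auto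
 have "C : sigma_sets (space M) {W s -` B Int space M | s B. s : TI & s <= T & B : sets borel}"
 using that unfolding generated_filtration_def sets_measure_of[OF gs] .
 then show ?thesis
 proof (induction rule: sigma_sets.induct)
 case (Basic C)
 then obtain s B where sB: "C = W s -` B Int space M" "s : TI" "B : sets borel" by blast
 have "W' s -` B Int space M : sigma_sets (space M) cylinders"
 using measurable_sets[OF W'm[OF sB(2)] sB(3)] sub by (simp add: space_measure_of_conv)
 moreover have "AE w in P. w : C <-> w : W' s -` B Int space M"
 using W_0 by eventually_elim (auto simp: sB(1) W'_def)
 ultimately show ?case by blast
 next
 case Empty
 show ?case by (intro bexI[of _ "{}"] sigma_sets.Empty) simp
 next
 case (Compl C)
 then obtain B where B: "B : sigma_sets (space M) cylinders" "AE w in P. w : C <-> w : B" by blast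
 have "AE w in P. w : space M - C <-> w : space M - B" using B(2) by eventually_elim auto
 with sigma_sets.Compl[OF B(1)] show ?case by blast
 next
 case (Union C)
 then have "ALL i. EX B. B : sigma_sets (space M) cylinders & (AE w in P. w : C i <-> w : B)" by blast
 from choice[OF this] obtain B where B: "!!i. B i : sigma_sets (space M) cylinders" "!!i. AE w in P. w : C i <-> w : B i" by blast
 have "AE w in P. ALL i. w : C i <-> w : B i" using B(2) by (simp add: AE_all_countable)
 then have "AE w in P. w : (\<Union>i. C i) <-> w : (\<Union>i. B i)" by eventually_elim auto
 with sigma_sets.Union[of B, OF B(1)] show ?case by blast
 qed
 qed
 moreover obtain A' where A': "A' : sets (generated_filtration T (space M) W T)" "AE w in P. w : A <-> w : A'" using F_rep[OF A] by blast
 ultimately obtain B where B: "B : sigma_sets (space M) cylinders" "AE w in P. w : A' <-> w : B" by blast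
 have "AE w in P. ind B w = (ind A w :: real)" using A'(2) B(2) by eventually_elim (auto simp: indicator_def)
 then show ?thesis by (rule mrep_AE[OF main[OF B(1)]])
qed

lemma mrep_bounded:
 assumes X: "X : bm (F T)" "!!w. 0 <= X w" and b: "!!w. w : space M ==> X w <= C"
 shows "mrep X"
proof -
 \<comment> \<open>The bound is quantified inside the induction, since the functions that occur in
   it have different bounds.\<close>
 have "ALL C. (ALL w:space M. X w <= C) --> mrep X"
 using X
 proof (induction rule: borel_measurable_induct_real)
 case (set A)
 then show ?case using mrep_indicator by blast
 next
 case (mult u c)
 show ?case
 proof (intro allI impI)
 fix C assume C: "ALL w:space M. c * u w <= C"
 show "mrep (%w. c * u w)"
 proof (cases "c = 0")
 case False
 then have "ALL w:space M. u w <= C / c" using C mult(1) by (simp add: pos_le_divide_eq mult.commute)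
 then have "mrep u" using mult(4) by blast
 from mrep_lin[OF mrep_const[of 0] this, of c] show ?thesis by simp
 qed (simp add: mrep_const)
 qed
 next
 case (add u v)
 show ?case
 proof (intro allI impI)
 fix C assume C: "ALL w:space M. v w + u w <= C"
 have "ALL w:space M. u w <= C" "ALL w:space M. v w <= C" using C add by (auto intro: order_trans[rotated])
 then have "mrep v" "mrep u" using add by blast+
 from mrep_lin[OF this, of 1] show "mrep (%w. v w + u w)" by simp
 qed
 next
 case (seq U)
 show ?case
 proof (intro allI impI)
 fix C assume C: "ALL w:space M. X w <= C"
 have le: "U i w <= X w" if "w : space M" for i w
 by (rule LIMSEQ_le_const[OF seq(4)]) (use that seq(3) in "auto simp: incseq_def le_fun_def")
 have UC: "ALL w:space M. U i w <= C" for i using le C by (meson order_trans)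
 show "mrep X"
 proof (rule mrep_limit[where C = C])
 show "mrep (U i)" for i using seq(5) UC by blast
 show "abs (U i w) <= C" if "w : space M" for i w using UC seq(2) that by (simp add: abs_of_nonneg)
 show "U i : bm P" for i by (rule mFP[OF seq(1)])
 show "(%i. U i w) ~> X w" if "w : space M" for w using seq(4) that by simp
 qed
 qed
 qed
 then show ?thesis using b by blast
qed

text \<open>A variable known at every time after \<open>t\<close> closes a continuous martingale
  that equals it at all those times; by continuity it equals the variable at \<open>t\<close> as
  well, where the martingale is adapted.\<close>

lemma F_right_continuous:
 fixes X :: "'a => real"
 assumes t: "0 <= t" "t < T" and X: "!!s. t < s ==> s <= T ==> X : bm (F s)" and b: "AE w in P. abs (X w) <= C"
 shows "X : bm (F t)"
proof -
 \<comment> \<open>\<open>mrep_bounded\<close> asks for a nonnegative variable that is bounded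
   everywhere, so \<open>X\<close> is shifted by \<open>C\<close> and clipped, which changes it on a
   null set only.\<close>
 define X' where "X' w = max 0 (min (X w + C) (2 * C))" for w
 have X'm: "X' : bm (F s)" if "t < s" "s <= T" for s unfolding X'_def using X[OF that] by simp
 have eq: "AE w in P. X' w = X w + C" using b by eventually_elim (auto simp: X'_def)
 have "mrep X'" by (rule mrep_bounded[OF X'm[OF t(2) order_refl], where C = "max 0 (2 * C)"]) (auto simp: X'_def)
 then obtain N where N: "L2mart N" "AE w in P. N T w = X' w" unfolding mrep_def by blast
 define s where "s n = t + (T - t) * inverse (real (Suc n))" for n
 have s: "t < s n" "s n <= T" for n
 proof -
 show "t < s n" unfolding s_def using t by simp
 have "(T - t) * inverse (real (Suc n)) <= (T - t) * 1" using t by (intro mult_left_mono) (auto simp: inverse_le_1_iff)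
 then show "s n <= T" unfolding s_def by simp
 qed
 have s0: "s n : TI" for n using s[of n] t by auto
 have "s ~> t + (T - t) * 0" unfolding s_def by (intro tendsto_intros LIMSEQ_inverse_real_of_nat)
 then have lim: "s ~> t" by simp
 have "AE w in P. ALL n. N (s n) w = X' w"
 unfolding AE_all_countable using L2mart_const_after[OF N(1) s0 X'm[OF s] N(2)] by blast
 then have "AE w in P. N t w - C = X w"
 using L2mart_cont[OF N(1)] eq
 proof eventually_elim
 case (elim w)
 have "(%n. N (s n) w) ~> N t w"
 by (rule continuous_on_tendsto_compose[OF elim(2) lim]) (use s0 t in auto)
 then have "(%n. X' w) ~> N t w" unfolding elim(1)[rule_format] .
 from LIMSEQ_unique[OF this tendsto_const] show ?case using elim(3) by simp
 qed
 moreover have "(%w. N t w - C) : bm (F t)" using L2F_m[OF L2mart_L2F[OF N(1), of t]] t by simp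
 ultimately show ?thesis by (rule borel_F_AE[rotated])
qed

end

section \<open>Predictability of adapted continuous and increasing processes\<close>

lemma rcll_right_sequence:
 assumes "rcll T x" "0 <= t" "t < T" "s ~> t" "!!n. t < s n"
 shows "(%n. x (s n)) ~> x t"
proof -
 have "(x \<longlongrightarrow> x t) (at_right t)" using assms(1-3) unfolding rcll_def by auto
 moreover have "filterlim s (at_right t) sequentially"
 using assms(4,5) by (intro filterlim_at_withinI) (auto simp: eventually_sequentially less_imp_neq intro!: always_eventually)
 ultimately show ?thesis by (rule filterlim_compose)
qed

lemma rational_sequence:
 fixes t r :: real assumes "t < r"
 shows "EX q. q ~> t & (ALL n. q n : \<rat> & t < q n & q n < r)"
proof -
 have "EX q:\<rat>. t < q & q < min r (t + inverse (real (Suc n)))" for n using assms by (intro Rats_dense_in_real) simp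
 then obtain q where q: "!!n. q n : \<rat>" "!!n. t < q n" "!!n. q n < min r (t + inverse (real (Suc n)))" by metis
 have "(%n. t + inverse (real (Suc n))) ~> t + 0" by (intro tendsto_intros LIMSEQ_inverse_real_of_nat)
 then have l: "(%n. t + inverse (real (Suc n))) ~> t" by simp
 have 1: "t <= q n" "q n <= t + inverse (real (Suc n))" for n using q(2,3)[of n] by auto
 from tendsto_sandwich[OF always_eventually[OF allI[OF 1(1)]] always_eventually[OF allI[OF 1(2)]] tendsto_const l]
 show ?thesis using q by (intro exI[of _ q]) auto
qed

context wiener begin

text \<open>The process is frozen on each dyadic cell at its value at the left end, which is
  predictable, and continuity of the paths gives convergence. \<open>lim\<close> defines the version
  on the exceptional set too.\<close>

lemma continuous_predictable:
 fixes X :: "real => 'a => real"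
 assumes X: "!!t. t : TI ==> X t : bm (F t)" and c: "AE w in P. continuous_on TI (%t. X t w)"
 shows "EX X'. pred X' & (AE w in P. ALL t:TI. X' t w = X t w)"
proof -
 define h where "h n = T / 2 ^ n" for n :: nat
 have h: "0 < h n" for n unfolding h_def using T_pos by simp
 \<comment> \<open>The ceiling minus one selects the cell that is open on the left and closed on the
   right, the shape of the predictable rectangles.\<close>
 define j where "j n t = nat \<lceil>t / h n\<rceil> - 1" for n t
 define d where "d n t = (if t = 0 then 0 else h n * real (j n t))" for n t
 have j: "h n * real (j n t) < t & t <= h n * real (Suc (j n t))" if t: "0 < t" for n t
 proof -
 have "0 < t / h n" using t h by simp
 then have "1 <= \<lceil>t / h n\<rceil>" by simp
 then have "real (Suc (j n t)) = real_of_int \<lceil>t / h n\<rceil>" unfolding j_def by (simp add: of_nat_diff nat_le_iff)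
 then have 1: "real (j n t) < t / h n" "t / h n <= real (Suc (j n t))"
 using ceiling_correct[of "t / h n"] by simp_all
 show ?thesis using 1 h[of n] by (simp add: pos_less_divide_eq pos_divide_le_eq mult.commute)
 qed
 have j_eq: "j n t = i" if "h n * real i < t" "t <= h n * real (Suc i)" for n t i
 proof -
 have "0 < t" using that(1) h[of n] by (intro le_less_trans[of 0 "h n * real i"]) auto
 note 1 = j[OF this, of n]
 have "h n * real i < h n * real (Suc (j n t))" "h n * real (j n t) < h n * real (Suc i)" using 1 that by linarith+
 then have "real i < real (Suc (j n t))" "real (j n t) < real (Suc i)" using h[of n] by (simp_all only: mult_less_cancel_left_pos)
 then show ?thesis by simp
 qed
 have jl: "j n t < 2 ^ n" if "0 < t" "t <= T" for n t
 proof -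
 have "h n * real (j n t) < h n * 2 ^ n" using j[OF that(1), of n] that(2) unfolding h_def by simp
 then have "real (j n t) < 2 ^ n" using h[of n] by (simp only: mult_less_cancel_left_pos)
 then show ?thesis by (metis of_nat_less_iff of_nat_numeral of_nat_power)
 qed
 have hT: "h n * 2 ^ n = T" for n unfolding h_def by simp
 define Xn where "Xn n t w = X (d n t) w" for n t w
 have Xn: "pred (Xn n)" for n
 unfolding predictable_process_def
 proof (rule measurableI)
 fix B :: "real set" assume B: "B : sets borel"
 have 0: "{0} \<times> (X 0 -` B Int space M) : sets (PA)"
 unfolding sets_predictable using measurable_sets[OF X[of 0] B] T_pos by (intro sigma_sets.Basic) auto
 have 1: "{h n * real i<..h n * real (Suc i)} \<times> (X (h n * real i) -` B Int space M) : sets (PA)" if "i < 2 ^ n" for i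
 proof -
 have "real (Suc i) <= 2 ^ n" using that by (metis Suc_leI of_nat_le_iff of_nat_numeral of_nat_power)
 then have le: "h n * real (Suc i) <= T" using mult_left_mono[of "real (Suc i)" "2 ^ n" "h n"] h[of n] hT by simp
 have a: "0 <= h n * real i" "h n * real i <= h n * real (Suc i)" using h[of n] by auto
 show ?thesis using measurable_sets[OF X[of "h n * real i"] B] a le by (intro predictable_rectangle) auto
 qed
 have "(%(t, w). Xn n t w) -` B Int space (PA) =
 {0} \<times> (X 0 -` B Int space M) Un (\<Union>i<2 ^ n. {h n * real i<..h n * real (Suc i)} \<times> (X (h n * real i) -` B Int space M))" (is "?L = ?R")
 proof
 show "?L \<subseteq> ?R"
 proof safe
 fix t w assume w: "Xn n t w : B" "(t, w) : space (PA)"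
 "(t, w) ~: (\<Union>i<2 ^ n. {h n * real i<..h n * real (Suc i)} \<times> (X (h n * real i) -` B Int space M))"
 show "t = 0" using w j[of t n] jl[of t n] unfolding Xn_def d_def by (cases "t = 0") force+
 then show "w : X 0 -` B" "w : space M" using w unfolding Xn_def d_def by auto
 qed
 show "?R \<subseteq> ?L"
 proof (intro Un_least UN_least)
 show "{0} \<times> (X 0 -` B Int space M) \<subseteq> ?L" using T_pos by (auto simp: Xn_def d_def)
 fix i :: nat assume "i : {..<2 ^ n}"
 then have "real (Suc i) <= 2 ^ n" by (metis Suc_leI lessThan_iff of_nat_le_iff of_nat_numeral of_nat_power)
 then have le: "h n * real (Suc i) <= T" using mult_left_mono[of "real (Suc i)" "2 ^ n" "h n"] h[of n] hT by simp
 have "Xn n t w : B & t : TI" if "h n * real i < t" "t <= h n * real (Suc i)" "X (h n * real i) w : B" for t w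
 proof -
 have "0 <= h n * real i" using h[of n] by simp
 then show ?thesis using that j_eq[of n i t] le by (auto simp: Xn_def d_def)
 qed
 then show "{h n * real i<..h n * real (Suc i)} \<times> (X (h n * real i) -` B Int space M) \<subseteq> ?L" by auto
 qed
 qed
 then show "(%(t, w). Xn n t w) -` B Int space (PA) : sets (PA)"
 using 0 1 by (auto intro!: sets.Un sets.finite_UN)
 qed simp
 define X' :: "real => 'a => real" where "X' t w = lim (%n. Xn n t w)" for t w
 have "pred X'"
 using borel_measurable_lim_metric[of "%n (u, w). Xn n u w" "PA"] Xn
 unfolding predictable_process_def X'_def by (simp add: case_prod_beta')
 moreover have "AE w in P. ALL t:TI. X' t w = X t w"
 using c
 proof eventually_elim
 case (elim w)
 show ?case
 proof
 fix t assume t: "t : TI"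
 have dT: "d n t : TI" "abs (d n t - t) <= h n" for n
 using t j[of t n] h[of n] unfolding d_def by (auto simp: algebra_simps)
 have "h ~> T * 0" unfolding h_def divide_inverse power_inverse[symmetric] by (intro tendsto_intros LIMSEQ_realpow_zero) auto
 then have h0: "h ~> 0" by simp
 have "(%n. d n t - t) ~> 0" by (rule Lim_null_comparison[OF _ h0]) (use dT(2) in simp)
 then have "(%n. d n t) ~> t" by (simp add: LIM_zero_iff)
 then have "(%n. X (d n t) w) ~> X t w" by (rule continuous_on_tendsto_compose[OF elim]) (use dT t in auto)
 then show "X' t w = X t w" unfolding X'_def Xn_def by (rule limI)
 qed
 qed
 ultimately show ?thesis by blast
qed

text \<open>A supermartingale that has dropped below \<open>e\<close> has mean below
  \<open>e\<close> from then on. The induction removes the smallest time \<open>q\<close>: on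
  \<open>B1\<close> the drop occurs at \<open>q\<close>, and on \<open>B2\<close> the remaining
  times are used.\<close>

lemma first_hit_bound:
 assumes Q: "finite Q" "!!q. q : Q ==> 0 <= q & q <= r" and r: "r <= T" and e: "0 < e"
 and U: "!!t. t : TI ==> L2F t (U t)"
 and sup: "!!s t B. 0 <= s ==> s <= t ==> t <= T ==> B : sets (F s) ==> (EE w. ind B w * U t w) <= (EE w. ind B w * U s w)"
 and B: "B : sets P" "!!q. q : Q ==> B : sets (F q)"
 shows "(EE w. ind {w:B. EX q:Q. U q w < e} w * U r w) <= e * prob B"
 using Q B
proof (induction Q arbitrary: B rule: finite_linorder_min_induct)
 case empty
 then show ?case using e by simp
next
 case (insert q Q)
 have q: "0 <= q" "q <= r" using insert.prems(1) by auto
 have Uq: "U q : bm (F q)" using L2F_m[OF U] q r by auto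
 define B1 where "B1 = {w:B. U q w < e}"
 define B2 where "B2 = {w:B. \<not> U q w < e}"
 have Bq: "B : sets (F q)" using insert.prems(3) by simp
 have BM: "B \<subseteq> space M" using sets.sets_into_space[OF Bq] by simp
 have [measurable]: "B : sets (F q)" "U q : bm (F q)" by fact+
 have "B1 = B Int {w:space (F q). U q w < e}" "B2 = B Int {w:space (F q). \<not> U q w < e}" using BM unfolding B1_def B2_def by auto
 moreover have "B Int {w:space (F q). U q w < e} : sets (F q)" "B Int {w:space (F q). \<not> U q w < e} : sets (F q)" by measurable
 ultimately have B12: "B1 : sets (F q)" "B2 : sets (F q)" by simp_all
 then have P12: "B1 : sets P" "B2 : sets P" using sets_F_le by auto
 have Ur: "L2F r (U r)" using U[of r] q r by simp
 have B2Q: "B2 : sets (F q')" if "q' : Q" for q' using bspec[OF insert.hyps(2) that] F_mono[of q q'] B12(2) by auto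
 define C where "C = {w:B2. EX q:Q. U q w < e}"
 have CP: "C : sets P"
 proof -
 have "{w:space P. U q' w < e} : sets P" if "q' : Q" for q'
 using L2F_mP[OF U[of q']] insert.prems(1)[of q'] that r by (intro borel_measurable_less) auto
 then have "{w:space P. EX q:Q. U q w < e} : sets P" using insert.hyps(1) by (intro sets.sets_Collect_finite_Ex) auto
 then have "B2 Int {w:space P. EX q:Q. U q w < e} : sets P" using P12(2) by (rule sets.Int[rotated])
 moreover have "C = B2 Int {w:space P. EX q:Q. U q w < e}" unfolding C_def B2_def using BM by auto
 ultimately show ?thesis by simp
 qed
 have iU: "integrable P (%w. ind D w * U t w)" if "D : sets P" "t : TI" for D t
 using integrable_real_mult_indicator[OF that(1) L2F_integrable[OF U[OF that(2)]]] by (simp add: mult.commute)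
 have rT: "r : TI" "q : TI" using q r by auto
 have "(EE w. ind {w:B. EX q:insert q Q. U q w < e} w * U r w) = (EE w. ind B1 w * U r w + ind C w * U r w)"
 by (intro Bochner_Integration.integral_cong) (auto simp: B1_def B2_def C_def split: split_indicator)
 also have "... = (EE w. ind B1 w * U r w) + (EE w. ind C w * U r w)"
 by (intro Bochner_Integration.integral_add iU P12 CP rT)
 also have "... <= e * prob B1 + e * prob B2"
 proof (rule add_mono)
 have "(EE w. ind B1 w * U r w) <= (EE w. ind B1 w * U q w)" by (rule sup[OF q r B12(1)])
 also have "... <= (EE w. e * ind B1 w)"
 using P12(1) by (intro integral_mono iU rT) (auto simp: B1_def emeasure_eq_measure split: split_indicator)
 also have "... = e * prob B1" using P12(1) sets.sets_into_space[OF P12(1)] by (simp add: Int_absorb2)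
 finally show "(EE w. ind B1 w * U r w) <= e * prob B1" .
 show "(EE w. ind C w * U r w) <= e * prob B2"
 unfolding C_def by (rule insert.IH[OF _ P12(2) B2Q]) (use insert.prems(1) in auto)
 qed
 also have "... = e * prob B"
 proof -
 have "prob (B1 Un B2) = prob B1 + prob B2" by (rule finite_measure_Union[OF P12]) (auto simp: B1_def B2_def)
 moreover have "B1 Un B2 = B" unfolding B1_def B2_def by auto
 ultimately show ?thesis by (simp add: algebra_simps)
 qed
 finally show ?case .
qed

text \<open>Right-continuity makes the level attained at the passage time. The default
  \<open>T + 1\<close> means never and exceeds every \<open>t\<close> in question.\<close>

lemma first_passage_iff:
 fixes x :: "real => real"
 assumes x: "rcll T x" "mono_on TI x" and t: "t : TI"
 shows "Inf ({t:TI. a <= x t} Un {T + 1}) <= t <-> a <= x t"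
proof
 define S where "S = {t:TI. a <= x t} Un {T + 1}"
 have bdd: "bdd_below S" using T_pos by (intro bdd_belowI[of _ 0]) (auto simp: S_def)
 show "Inf ({t:TI. a <= x t} Un {T + 1}) <= t" if "a <= x t"
 using that t bdd unfolding S_def by (intro cInf_lower) auto
 assume le: "Inf ({t:TI. a <= x t} Un {T + 1}) <= t"
 show "a <= x t"
 proof (rule ccontr)
 assume less: "\<not> a <= x t"
 have "EX d>t. ALL s:S. d <= s"
 proof (cases "t = T")
 case True
 have "T + 1 <= s" if "s : S" for s using that less mono_onD[OF x(2), of s T] T_pos unfolding S_def True by auto
 then show ?thesis unfolding True by (intro exI[of _ "T + 1"]) auto
 next
 case False
 then have tT: "t < T" using t by simp
 have "(x \<longlongrightarrow> x t) (at_right t)" using x(1) t tT unfolding rcll_def by auto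
 then have "\<forall>\<^sub>F s in at_right t. x s < a" by (rule order_tendstoD) (use less in simp)
 then obtain d where d: "t < d" "!!s. t < s ==> s < d ==> x s < a" unfolding eventually_at_right_field by blast
 have "min d T <= s" if "s : S" for s
 proof (rule ccontr)
 assume "\<not> min d T <= s"
 then have s: "s : TI" "a <= x s" "s < d" using that unfolding S_def by auto
 show False using s d(2)[of s] mono_onD[OF x(2) s(1) t] less by (cases "t < s") auto
 qed
 then show ?thesis using d(1) tT by (intro exI[of _ "min d T"]) auto
 qed
 then obtain d where d: "t < d" "!!s. s : S ==> d <= s" by blast
 have "d <= Inf S" by (rule cInf_greatest) (use d(2) in "auto simp: S_def")
 then show False using le d(1) unfolding S_def by simp
 qed
qed

text \<open>The potential \<open>E((\<tau> - t)\<^sup>+ | F\<^sub>t)\<close> of the first passage time \<open>\<tau>\<close> is continuous and vanishes exactly from \<open>\<tau>\<close> on.\<close>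
lemma passage_predictable:
 fixes A :: "real => 'a => real"
 assumes A: "!!t. t : TI ==> A t : bm (F t)"
 and reg: "!!w. w : space M ==> rcll T (%t. A t w) & mono_on TI (%t. A t w)"
 shows "EX U'. pred U' & (AE w in P. ALL t:TI. U' t w = (0::real) <-> a <= A t w)"
proof -
 define \<tau> where "\<tau> w = Inf ({t:TI. a <= A t w} Un {T + 1})" for w
 have iff: "\<tau> w <= t <-> a <= A t w" if "w : space M" "t : TI" for w t
 unfolding \<tau>_def using reg[OF that(1)] that(2) by (intro first_passage_iff) auto
 have bdd: "bdd_below ({t:TI. a <= A t w} Un {T + 1})" for w using T_pos by (intro bdd_belowI[of _ 0]) auto
 have bnd: "0 <= \<tau> w" "\<tau> w <= T + 1" for w unfolding \<tau>_def
 by (rule cInf_greatest; use T_pos in auto) (rule cInf_lower[OF _ bdd], simp)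
 have dich: "\<tau> w <= T \<or> \<tau> w = T + 1" for w
 proof (cases "{t:TI. a <= A t w} = {}")
 case False
 then obtain t where "t : TI" "a <= A t w" by auto
 then have "\<tau> w <= t" unfolding \<tau>_def by (intro cInf_lower[OF _ bdd]) auto
 then show ?thesis using \<open>t : TI\<close> by auto
 next
 case True
 show ?thesis unfolding \<tau>_def True by simp
 qed
 have lev: "{w:space M. \<tau> w <= s} : sets (F t)" if "s <= t" "s : TI" for s t
 proof -
 have [measurable]: "A s : bm (F t)" by (rule mF_mono[OF that(1) A[OF that(2)]])
 have "{w:space (F t). a <= A s w} : sets (F t)" by measurable
 also have "{w:space (F t). a <= A s w} = {w:space M. \<tau> w <= s}" using iff that by auto
 finally show ?thesis .
 qed
 have all: "space M : sets (F t)" for t using sets.top[of "F t"] by simp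
 have \<tau>m: "\<tau> : bm (F T)"
 unfolding borel_measurable_iff_le
 proof
 fix s
 consider "s < 0" | "s : TI" | "T < s" "s < T + 1" | "T + 1 <= s" by force
 then show "{w:space (F T). \<tau> w <= s} : sets (F T)"
 proof cases
 case 1
 then have e: "{w:space (F T). \<tau> w <= s} = {}" using bnd(1) by (auto simp: not_le intro: less_le_trans)
 show ?thesis unfolding e by simp
 next
 case 2
 then show ?thesis using lev[of s T] by simp
 next
 case 3
 have "\<tau> w <= s <-> \<tau> w <= T" for w using dich[of w] 3 by auto
 then show ?thesis using lev[of T T] T_pos by simp
 next
 case 4
 have "\<tau> w <= s" for w using bnd(2)[of w] 4 by linarith
 then show ?thesis using all[of T] by simp
 qed
 qed
 have minm: "(%w. min t (\<tau> w)) : bm (F t)" if t: "t : TI" for t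
 unfolding borel_measurable_iff_le
 proof
 fix s
 consider "t <= s" | "s < 0" "s < t" | "s : TI" "s < t" using t by force
 then show "{w:space (F t). min t (\<tau> w) <= s} : sets (F t)"
 proof cases
 case 2
 then have e: "{w:space (F t). min t (\<tau> w) <= s} = {}" using bnd(1) by (auto simp: not_le min_le_iff_disj intro: less_le_trans)
 show ?thesis unfolding e by simp
 next
 case 3
 then show ?thesis using lev[of s t] by (simp add: min_le_iff_disj)
 qed (use all[of t] in "simp add: min_le_iff_disj")
 qed
 have "mrep \<tau>" by (rule mrep_bounded[OF \<tau>m bnd])
 then obtain N where N: "L2mart N" "AE w in P. N T w = \<tau> w" unfolding mrep_def by blast
 define U where "U t w = N t w - min t (\<tau> w)" for t w
 have m2: "L2F t (%w. min t (\<tau> w))" if "t : TI" for t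
 proof (rule L2F_bounded[OF minm[OF that], where C = "T + 1"])
 have "abs (min t (\<tau> w)) <= T + 1" for w using bnd[of w] that T_pos by auto
 then show "AE w in P. abs (min t (\<tau> w)) <= T + 1" by simp
 qed
 have \<tau>2: "L2F T \<tau>" by (rule L2F_bounded[OF \<tau>m, where C = "T + 1"]) (use bnd in auto)
 have U: "L2F t (U t)" if "t : TI" for t unfolding U_def by (rule L2F_diff[OF L2mart_L2F[OF N(1) that] m2[OF that]])
 have key: "(EE w. X w * U t w) = (EE w. X w * (\<tau> w - min t (\<tau> w)))" if t: "t : TI" and X: "L2F t X" for t X
 proof -
 note i = L2F_mult[OF X L2mart_L2F[OF N(1) t]] L2F_mult[OF X m2[OF t]] L2F_mult[OF X \<tau>2]
 have "(EE w. X w * U t w) = (EE w. X w * N t w) - (EE w. X w * min t (\<tau> w))"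
 unfolding U_def right_diff_distrib using i by simp
 also have "(EE w. X w * N t w) = (EE w. X w * N T w)" using L2mart_orth[OF N(1), of t T X] t X by simp
 also have "... = (EE w. X w * \<tau> w)"
 using N(2) L2F_mP[OF X] L2F_mP[OF \<tau>2] L2mart_m[OF N(1), of T] T_pos by (intro integral_cong_AE) auto
 also have "... - (EE w. X w * min t (\<tau> w)) = (EE w. X w * (\<tau> w - min t (\<tau> w)))"
 unfolding right_diff_distrib using i by simp
 finally show ?thesis .
 qed
 have zero: "AE w in P. \<tau> w <= t --> U t w = 0" if t: "t : TI" for t
 proof -
 define B where "B = {w:space M. \<tau> w <= t}"
 have X: "L2F t (%w. ind B w * U t w)" using lev[of t t] t unfolding B_def by (intro L2F_indicator_mult U) auto
 have "(EE w. ind B w * U t w * U t w) = (EE w. 0)"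
 unfolding key[OF t X] by (intro Bochner_Integration.integral_cong) (auto simp: B_def split: split_indicator)
 moreover have "(ind B w * U t w)^2 = ind B w * U t w * U t w" for w
 by (simp add: power2_eq_square split: split_indicator)
 ultimately have "(EE w. (ind B w * U t w)^2) = 0" by simp
 then have "AE w in P. (ind B w * U t w)^2 = 0" using L2F_square[OF X] by (subst (asm) integral_nonneg_eq_0_iff_AE) auto
 then show ?thesis using AE_space by eventually_elim (auto simp: B_def)
 qed
 have pos: "AE w in P. t < \<tau> w --> 0 < U t w" if t: "t : TI" for t
 proof -
 define B where "B = {w:space M. t < \<tau> w & U t w <= 0}"
 have [measurable]: "U t : bm (F t)" by (rule L2F_m[OF U[OF t]])
 have "B = {w:space (F t). U t w <= 0} - {w:space M. \<tau> w <= t}" unfolding B_def by auto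
 moreover have "{w:space (F t). U t w <= 0} : sets (F t)" by measurable
 ultimately have B: "B : sets (F t)" using lev[of t t] t by auto
 have X: "L2F t (ind B)" by (rule L2F_indicator[OF B])
 have "(EE w. ind B w * U t w) <= (EE w. 0)"
 by (intro integral_mono L2F_mult[OF X U[OF t]]) (auto simp: B_def split: split_indicator)
 then have le: "(EE w. ind B w * (\<tau> w - min t (\<tau> w))) <= 0" unfolding key[OF t X] by simp
 have nn: "AE w in P. 0 <= ind B w * (\<tau> w - min t (\<tau> w))" by auto
 have "integrable P (%w. ind B w * (\<tau> w - min t (\<tau> w)))"
 by (rule L2F_mult[OF X L2F_diff[OF \<tau>2 L2F_mono[OF m2[OF t]]]]) (use t in simp)
 then have "AE w in P. ind B w * (\<tau> w - min t (\<tau> w)) = 0"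
 using integral_nonneg_eq_0_iff_AE[OF _ nn] integral_nonneg_AE[OF nn] le by auto
 then show ?thesis using AE_space by eventually_elim (auto simp: B_def not_le split: split_indicator_asm)
 qed
 have sup: "(EE w. ind B w * U t w) <= (EE w. ind B w * U s w)"
 if "0 <= s" "s <= t" "t <= T" "B : sets (F s)" for s t B
 proof -
 have s: "s : TI" and t: "t : TI" using that by auto
 have X: "L2F s (ind B)" "L2F t (ind B)" using that F_mono[of s t] by (auto intro!: L2F_indicator)
 show ?thesis unfolding key[OF s X(1)] key[OF t X(2)]
 proof (rule integral_mono)
 show "integrable P (%w. ind B w * (\<tau> w - min t (\<tau> w)))" "integrable P (%w. ind B w * (\<tau> w - min s (\<tau> w)))"
 using that by (auto intro!: L2F_mult[OF X(1) L2F_diff[OF \<tau>2 L2F_mono[OF m2]]])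
 qed (use that in "auto split: split_indicator")
 qed
 \<comment> \<open>Countably many times that approximate every \<open>t < T\<close> from the right;
   \<open>T\<close> itself is added because it need not be rational.\<close>
 define D where "D = (\<rat> Int TI) Un {T}"
 have D: "countable D" "D ~= {}" "T : D" unfolding D_def by (auto intro: countable_subset[OF _ countable_rat])
 define d where "d = from_nat_into D"
 have d: "range d = D" unfolding d_def using D by simp
 have DT: "D \<subseteq> TI" unfolding D_def using T_pos by auto
 have dT: "d i : TI" for i by (rule subsetD[OF DT]) (use d in auto)
 \<comment> \<open>A nonnegative supermartingale cannot recover from values near 0. If
   \<open>U\<close> came arbitrarily close to 0 before \<open>r\<close> on the event
   \<open>E0\<close>, then \<open>first_hit_bound\<close> would give it mean at most
   \<open>e\<close> at time \<open>r\<close> on \<open>E0\<close> for every \<open>e\<close>,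
   against \<open>0 < U r\<close> on \<open>r < \<tau>\<close>. Continuity alone would not exclude a
   zero before \<tau>.\<close>
 have stay: "AE w in P. r < \<tau> w --> (EX e>0. ALL q:D. q <= r --> e <= U q w)" if r: "r : TI" for r
 proof -
 define E where "E n e = {w:space M. EX q:d ` {..<n} Int {..r}. U q w < e}" for n e
 define E0 where "E0 = {w:space M. ALL k. EX i. d i <= r & U (d i) w < inverse (real (Suc k))}"
 have Um: "U q : bm P" if "q : TI" for q by (rule L2F_mP[OF U[OF that]])
 note Ur = Um[OF r]
 have lt: "{w:space P. U (d i) w < e} : sets P" for i e using Um[OF dT] by measurable
 have EP: "E n e : sets P" for n e
 proof -
 have "E n e = (\<Union>i\<in>{i. i < n & d i <= r}. {w:space P. U (d i) w < e})" unfolding E_def by auto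
 then show ?thesis using lt by auto
 qed
 have E0P: "E0 : sets P"
 proof -
 have "E0 = (\<Inter>k. \<Union>i\<in>{i. d i <= r}. {w:space P. U (d i) w < inverse (real (Suc k))})" unfolding E0_def by auto
 then show ?thesis using lt by auto
 qed
 have nn: "AE w in P. 0 <= U r w" using zero[OF r] pos[OF r] by eventually_elim (auto simp: not_le[symmetric] intro: less_imp_le)
 have "(NN w. ennreal (ind E0 w * U r w)) <= ennreal e" if e: "0 < e" for e
 proof -
 obtain k where k: "inverse (real (Suc k)) < e" using reals_Archimedean[OF e] by auto
 have "(NN w. ennreal (ind E0 w * U r w)) <= (NN w. liminf (%n. ennreal (ind (E n e) w * U r w)))"
 proof (rule nn_integral_mono)
 fix w assume "w : space P"
 show "ennreal (ind E0 w * U r w) <= liminf (%n. ennreal (ind (E n e) w * U r w))"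
 proof (cases "w : E0")
 case True
 then obtain i where i: "d i <= r" "U (d i) w < inverse (real (Suc k))" unfolding E0_def by blast
 have "w : E n e" if "i < n" for n using that i k True unfolding E_def E0_def by force
 then have "EV n. ennreal (U r w) <= ennreal (ind (E n e) w * U r w)"
 unfolding eventually_sequentially by (intro exI[of _ "Suc i"]) auto
 then have "ennreal (U r w) <= liminf (%n. ennreal (ind (E n e) w * U r w))" by (rule Liminf_bounded)
 then show ?thesis using True by simp
 qed simp
 qed
 also have "... <= liminf (%n. (NN w. ennreal (ind (E n e) w * U r w)))"
 using EP Ur by (intro nn_integral_liminf) auto
 also have "... <= ennreal e"
 proof (intro Liminf_le always_eventually allI sequentially_bot)
 fix n
 have i: "integrable P (%w. ind (E n e) w * U r w)"
 using integrable_real_mult_indicator[OF EP L2F_integrable[OF U[OF r]]] by (simp add: mult.commute)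
 have "(EE w. ind {w:space M. EX q:d ` {..<n} Int {..r}. U q w < e} w * U r w) <= e * prob (space M)"
 by (rule first_hit_bound[OF _ _ _ e U sup]) (use dT r all sets.top[of P] in auto)
 then have "(EE w. ind (E n e) w * U r w) <= e" unfolding E_def using prob_space by simp
 moreover have "(NN w. ennreal (ind (E n e) w * U r w)) = ennreal (EE w. ind (E n e) w * U r w)"
 proof (rule nn_integral_eq_integral[OF i])
 show "AE w in P. 0 <= ind (E n e) w * U r w" using nn by eventually_elim simp
 qed
 ultimately show "(NN w. ennreal (ind (E n e) w * U r w)) <= ennreal e" by (simp add: ennreal_leI)
 qed
 finally show ?thesis .
 qed
 note small = this
 have "(NN w. ennreal (ind E0 w * U r w)) <= 0"
 by (rule ennreal_le_epsilon) (use small in simp)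
 then have "AE w in P. ennreal (ind E0 w * U r w) = 0"
 using E0P Ur by (subst (asm) le_zero_eq, subst (asm) nn_integral_0_iff_AE) auto
 then show ?thesis using pos[OF r] AE_space
 proof eventually_elim
 case (elim w)
 show ?case
 proof
 assume "r < \<tau> w"
 then have "w ~: E0" using elim(1,2) by (auto simp: ennreal_eq_0_iff)
 then obtain k where k: "!!i. d i <= r ==> inverse (real (Suc k)) <= U (d i) w" using elim(3) unfolding E0_def by (auto simp: not_less)
 show "EX e>0. ALL q:D. q <= r --> e <= U q w" using k unfolding d[symmetric] by (intro exI[of _ "inverse (real (Suc k))"]) auto
 qed
 qed
 qed
 have Uc: "AE w in P. continuous_on TI (%t. U t w)"
 using L2mart_cont[OF N(1)] by eventually_elim (auto simp: U_def intro!: continuous_intros)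
 obtain U' where U': "pred U'" "AE w in P. ALL t:TI. U' t w = U t w"
 using continuous_predictable[OF L2F_m[OF U] Uc] by blast
 have "AE w in P. ALL r:D. \<tau> w <= r --> U r w = 0" using zero DT D(1) by (subst AE_ball_countable) auto
 moreover have "AE w in P. ALL r:D. r < \<tau> w --> (EX e>0. ALL q:D. q <= r --> e <= U q w)" using stay DT D(1) by (subst AE_ball_countable) auto
 ultimately have "AE w in P. ALL t:TI. U' t w = 0 <-> a <= A t w"
 using Uc U'(2) AE_space
 proof eventually_elim
 case (elim w)
 have w: "w : space M" using elim(5) by simp
 have lim: "(%n. U (q n) w) ~> U t w" if "q ~> t" "t : TI" "!!n. q n : D" for q t
 by (rule continuous_on_tendsto_compose[OF elim(3) that(1,2)]) (use subsetD[OF DT that(3)] that(2) in auto)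
 show ?case
 proof
 fix t assume t: "t : TI"
 have "U t w = 0 <-> \<tau> w <= t"
 proof (cases "t = T")
 case True
 have "U T w = 0" if "\<tau> w <= T" using elim(1) D(3) that by blast
 moreover have "U T w ~= 0" if h: "T < \<tau> w"
 proof -
 obtain e where e: "0 < e" "ALL q:D. q <= T --> e <= U q w" using elim(2) D(3) h by blast
 then have "e <= U T w" using D(3) by blast
 then show ?thesis using e by simp
 qed
 ultimately show ?thesis unfolding True using not_le by blast
 next
 case False
 then have tT: "t < T" using t by simp
 show ?thesis
 proof
 assume le: "\<tau> w <= t"
 obtain q where q: "q ~> t" "!!n. q n : \<rat> & t < q n & q n < T" using rational_sequence[OF tT] by blast
 have qD: "q n : D" for n using q(2)[of n] t unfolding D_def by auto
 have "U (q n) w = 0" for n using elim(1) qD[of n] q(2)[of n] le by auto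
 then show "U t w = 0" using LIMSEQ_unique[OF lim[OF q(1) t qD], of 0] by simp
 next
 assume z: "U t w = 0"
 show "\<tau> w <= t"
 proof (rule ccontr)
 assume "\<not> \<tau> w <= t"
 then have "t < min (\<tau> w) T" using tT by simp
 then obtain r where r: "r : \<rat>" "t < r" "r < min (\<tau> w) T" using Rats_dense_in_real by blast
 have "r : D" using r t unfolding D_def by auto
 then obtain e where e: "0 < e" "!!q. q : D ==> q <= r ==> e <= U q w" using elim(2) r by auto
 obtain q where q: "q ~> t" "!!n. q n : \<rat> & t < q n & q n < r" using rational_sequence[OF r(2)] by blast
 have qD: "q n : D" for n using q(2)[of n] r(3) t unfolding D_def by auto
 have "e <= U t w" by (rule LIMSEQ_le_const[OF lim[OF q(1) t qD]]) (use e(2)[OF qD] q(2) in "auto intro: less_imp_le")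
 then show False using z e(1) by simp
 qed
 qed
 qed
 then show "U' t w = 0 <-> a <= A t w" using elim(4) t iff[OF w t] by simp
 qed
 qed
 with U'(1) show ?thesis by blast
qed

text \<open>\<open>A\<close> is the supremum of the nonnegative rational levels that it has reached,
  and for each level having reached it is a predictable event, by
  \<open>passage_predictable\<close>.\<close>

lemma increasing_predictable:
 fixes A :: "real => 'a => real"
 assumes A: "!!t. t : TI ==> A t : bm (F t)"
 and inc: "AE w in P. rcll T (%t. A t w) & mono_on TI (%t. A t w) & A 0 w = 0"
 shows "EX A'. pred A' & (AE w in P. ALL t:TI. A' t w = A t w)"
proof -
 define good where "good w <-> rcll T (%t. A t w) & mono_on TI (%t. A t w) & A 0 w = 0" for w
 \<comment> \<open>Paths are changed on a null set so that all of them are regular, as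
   \<open>passage_predictable\<close> demands; adaptedness survives because the filtration is
   augmented.\<close>
 define A0 where "A0 t w = (if good w then A t w else 0)" for t w
 have g: "AE w in P. good w" unfolding good_def by (rule inc)
 have A0: "A0 t : bm (F t)" if "t : TI" for t
 by (rule borel_F_AE[OF A[OF that]]) (use g in "auto elim!: eventually_mono simp: A0_def")
 have reg: "rcll T (%t. A0 t w) & mono_on TI (%t. A0 t w)" for w
 proof (cases "good w")
 case True
 then show ?thesis unfolding A0_def good_def by simp
 next
 case False
 then show ?thesis unfolding A0_def rcll_def by (auto intro!: mono_onI tendsto_const)
 qed
 define Q where "Q = {a:\<rat>. (0::real) <= a}"
 have Q: "countable Q" unfolding Q_def by (rule countable_subset[OF _ countable_rat]) auto
 have "ALL a. EX U'. pred U' & (AE w in P. ALL t:TI. U' t w = (0::real) <-> a <= A0 t w)"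
 using passage_predictable[OF A0 reg] by blast
 from choice[OF this] obtain U where U: "!!a. pred (U a)" "!!a. AE w in P. ALL t:TI. U a t w = (0::real) <-> a <= A0 t w" by blast
 \<comment> \<open>Levels not yet reached contribute 0, which is harmless in the supremum since
   \<open>A\<close> is nonnegative. The extended reals keep the supremum meaningful on the
   exceptional set.\<close>
 define A' where "A' t w = real_of_ereal (SUP a\<in>Q. ereal (if U a t w = 0 then a else 0))" for t w
 have "pred A'"
 proof -
 have [measurable]: "(%p. U a (fst p) (snd p)) : bm (PA)" for a
 using U(1)[of a] unfolding predictable_process_def by (simp add: case_prod_beta')
 have "(%p. ereal (if U a (fst p) (snd p) = 0 then a else 0)) : bm (PA)" for a
 by measurable
 then have "(%p. real_of_ereal (SUP a\<in>Q. ereal (if U a (fst p) (snd p) = 0 then a else 0))) : bm (PA)"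
 by (intro borel_measurable_real_of_ereal borel_measurable_SUP Q)
 then show ?thesis unfolding predictable_process_def A'_def by (simp add: case_prod_beta')
 qed
 moreover have "AE w in P. ALL a:Q. ALL t:TI. U a t w = 0 <-> a <= A0 t w" using U(2) Q by (subst AE_ball_countable) auto
 then have "AE w in P. ALL t:TI. A' t w = A t w"
 using g
 proof eventually_elim
 case (elim w)
 show ?case
 proof
 fix t assume t: "t : TI"
 have A0A: "A0 t w = A t w" using elim(2) unfolding A0_def by simp
 have nn: "0 <= A t w" using mono_onD[of "TI" "%t. A t w" 0 t] elim(2) t unfolding good_def by auto
 have "(SUP a\<in>Q. ereal (if U a t w = 0 then a else 0)) = ereal (A t w)"
 proof (rule antisym)
 show "(SUP a\<in>Q. ereal (if U a t w = 0 then a else 0)) <= ereal (A t w)"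
 using elim(1) t nn unfolding A0A[symmetric] by (intro SUP_least) auto
 show "ereal (A t w) <= (SUP a\<in>Q. ereal (if U a t w = 0 then a else 0))"
 proof (rule ereal_le_epsilon2)
 show "ereal (A t w) <= (SUP a\<in>Q. ereal (if U a t w = 0 then a else 0)) + ereal e" if e: "0 < e" for e :: real
 proof -
 have "EX a:Q. a <= A t w & A t w <= a + e"
 proof (cases "A t w <= e")
 case True
 then show ?thesis using nn by (intro bexI[of _ 0]) (auto simp: Q_def)
 next
 case False
 obtain a where "a : \<rat>" "A t w - e < a" "a < A t w" using Rats_dense_in_real[of "A t w - e" "A t w"] e by auto
 then show ?thesis using False by (intro bexI[of _ a]) (auto simp: Q_def)
 qed
 then obtain a where a: "a : Q" "a <= A t w" "A t w <= a + e" by blast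
 have "U a t w = 0" using elim(1) a t A0A by auto
 then have "ereal a <= (SUP a\<in>Q. ereal (if U a t w = 0 then a else 0))" using a(1) by (intro SUP_upper2[of a]) auto
 then have "ereal a + ereal e <= (SUP a\<in>Q. ereal (if U a t w = 0 then a else 0)) + ereal e" by (rule add_right_mono)
 then show "ereal (A t w) <= (SUP a\<in>Q. ereal (if U a t w = 0 then a else 0)) + ereal e" using a(3) by (auto intro: order_trans[rotated])
 qed
 qed
 qed
 then show "A' t w = A t w" unfolding A'_def by simp
 qed
 qed
 ultimately show ?thesis by blast
qed

end

section \<open>The parallelogram law and convergent convex combinations of integrals\<close>

context wiener begin

lemma Qv_parallelogram:
 assumes Z: "jm Z" and Z': "jm Z'" and w: "w : space M"
 shows "Qv 0 (Z ~- Z') w + 4 * Qv 0 (%u w. (1 / 2) *\<^sub>R (Z u w + Z' u w)) w = 2 * Qv 0 Z w + 2 * Qv 0 Z' w"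
proof -
 have [measurable]: "(%u. Z u w) : bm LT" "(%u. Z' u w) : bm LT" using jm_section w Z Z' by auto
 have Q: "Qv 0 X w = (NL u. ennreal ((norm (X u w))^2))" for X
 unfolding Qv_LT[OF order_refl] by (intro nn_integral_cong) (simp split: split_indicator)
 have p: "(norm (x - y))^2 + 4 * (norm ((1 / 2) *\<^sub>R (x + y)))^2 = 2 * (norm x)^2 + 2 * (norm y)^2" for x y :: "real ^ 'n"
 proof -
 have "4 * (norm ((1 / 2) *\<^sub>R (x + y)))^2 = (norm (x + y))^2" by (simp add: power_mult_distrib power_divide)
 then show ?thesis by (simp add: power2_norm_eq_inner inner_simps inner_commute)
 qed
 have e4: "4 * ennreal a = ennreal (4 * a)" "2 * ennreal a = ennreal (2 * a)" if "0 <= a" for a using that by (simp_all add: ennreal_mult)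
 have "(NL u. ennreal ((norm (Z u w - Z' u w))^2) + 4 * ennreal ((norm ((1 / 2) *\<^sub>R (Z u w + Z' u w)))^2))
 = (NL u. 2 * ennreal ((norm (Z u w))^2) + 2 * ennreal ((norm (Z' u w))^2))"
 by (intro nn_integral_cong) (simp only: e4 zero_le_power2 ennreal_plus[symmetric] mult_nonneg_nonneg zero_le_numeral p)
 then show ?thesis unfolding Q by (simp add: nn_integral_add nn_integral_cmult)
qed

lemma EQ_parallelogram:
 assumes Z: "jm Z" and Z': "jm Z'"
 shows "EQ (Z ~- Z') + 4 * EQ (%u w. (1 / 2) *\<^sub>R (Z u w + Z' u w)) = 2 * EQ Z + 2 * EQ Z'"
proof -
 have [measurable]: "Qv 0 Z : bm P" "Qv 0 Z' : bm P" "Qv 0 (Z ~- Z') : bm P"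
 "Qv 0 (%u w. (1 / 2) *\<^sub>R (Z u w + Z' u w)) : bm P"
 using Qv_m[OF _ order_refl] Z Z' jm_diff[OF Z Z'] jm_scale[OF jm_add[OF Z Z'], of "1/2"] by auto
 have "(NN w. Qv 0 (Z ~- Z') w + 4 * Qv 0 (%u w. (1 / 2) *\<^sub>R (Z u w + Z' u w)) w) = (NN w. 2 * Qv 0 Z w + 2 * Qv 0 Z' w)"
 by (intro nn_integral_cong Qv_parallelogram Z Z') simp
 then show ?thesis by (simp add: nn_integral_add nn_integral_cmult)
qed

lemma EQ_sum_finite:
 assumes "finite K" "!!k. k : K ==> jm (Z k) & EQ (Z k) < \<infinity>"
 shows "jm (%u w. SUM k:K. c k *\<^sub>R Z k u w) & EQ (%u w. SUM k:K. c k *\<^sub>R Z k u w) < \<infinity>"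
 using assms
proof (induction K rule: finite_induct)
 case empty
 show ?case by (simp add: jm_def)
next
 case (insert k K)
 let ?S = "%u w. SUM k:K. c k *\<^sub>R Z k u w"
 have IH: "jm ?S" "EQ ?S < \<infinity>" using insert.IH insert.prems by auto
 have k: "jm (Z k)" "EQ (Z k) < \<infinity>" using insert.prems by auto
 have jc: "jm (%u w. c k *\<^sub>R Z k u w)" by (rule jm_scale[OF k(1)])
 have m: "Qv 0 (Z k) : bm P" "Qv 0 ?S : bm P" using Qv_m[OF _ order_refl] k IH by auto
 have "EQ (%u w. c k *\<^sub>R Z k u w + ?S u w) <= (NN w. 2 * (ennreal ((c k)^2) * Qv 0 (Z k) w) + 2 * Qv 0 ?S w)"
 using Qv_sum_le_2[OF jc IH(1) order_refl] by (intro nn_integral_mono) (simp add: Qv_scale[OF k(1)])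
 also have "... = 2 * (ennreal ((c k)^2) * EQ (Z k)) + 2 * EQ ?S" using m by (simp add: nn_integral_add nn_integral_cmult)
 also have "... < \<infinity>" using k(2) IH(2) by (simp add: ennreal_mult_less_top)
 finally show ?case using jm_add[OF jc IH(1)] insert.hyps by simp
qed

text \<open>Mazur's lemma made concrete: \<open>almost_minimizing_sequence\<close> is applied to the
  expected quadratic variation, with the tolerances that \<open>sint_fast_limit\<close> asks for.
  Integrands and integrals are combined with the same weights, so these can afterwards be applied to
  the processes \<open>Y\<close> as well.\<close>

lemma sint_mazur:
 assumes s: "!!k. sint (Z k) (I k)" and b: "!!k. EQ (Z k) <= ennreal B"
 shows "EX c Z' I'. (ALL n. c n : weights n) & sint Z' I' & EQ Z' < \<infinity> &
 (AE w in P. AE u in LT. (%n. \<Sum>k | c n k ~= 0. c n k *\<^sub>R Z k u w) ~> Z' u w) &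
 (AE w in P. uniform_limit TI (%n t. \<Sum>k | c n k ~= 0. c n k * I k t w) (%t. I' t w) sequentially)"
proof -
 define S where "S c u w = (\<Sum>k | c k ~= 0. c k *\<^sub>R Z k u w)" for c u w
 define q where "q c = enn2real (EQ (S c))" for c
 define d where "d c c' = enn2real (EQ (S c ~- S c'))" for c c'
 have Zk: "jm (Z k) & EQ (Z k) < \<infinity>" for k
 using sintD(2)[OF s] le_less_trans[OF b[of k], of \<infinity>] by simp
 have S: "jm (S c)" "EQ (S c) < \<infinity>" "sint (S c) (%t w. \<Sum>k | c k ~= 0. c k * I k t w)" if "c : weights n" for c n
 proof -
 have fin: "finite {k. c k ~= 0}" using that unfolding weights_def by blast
 show "jm (S c)" "EQ (S c) < \<infinity>" using EQ_sum_finite[where Z = Z and c = c, OF fin Zk] unfolding S_def[abs_def] by blast+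
 show "sint (S c) (%t w. \<Sum>k | c k ~= 0. c k * I k t w)" unfolding S_def[abs_def] by (rule sint_sum[OF fin s])
 qed
 have Sd: "jm (S c ~- S c')" "EQ (S c ~- S c') < \<infinity>" if c: "c : weights n" and c': "c' : weights n'" for c c' n n'
 proof -
 show "jm (S c ~- S c')" by (rule jm_diff[OF S(1)[OF c] S(1)[OF c']])
 have "EQ (S c ~- S c') <= EQ (S c ~- S c') + 4 * EQ (%u w. (1 / 2) *\<^sub>R (S c u w + S c' u w))" by simp
 also have "... < \<infinity>" unfolding EQ_parallelogram[OF S(1)[OF c] S(1)[OF c']] using S(2)[OF c] S(2)[OF c'] by (simp add: ennreal_mult_less_top)
 finally show "EQ (S c ~- S c') < \<infinity>" .
 qed
 have "EX x. ALL n. x n : weights n & d (x n) (x (Suc n)) <= (1 / 16) ^ Suc n"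
 proof (rule almost_minimizing_sequence[where q = q and B = "max 0 B"])
 show "weights n \<subseteq> weights m" if "m <= n" for m n using that unfolding weights_def by auto
 show "0 <= q c" for c unfolding q_def by simp
 show "EX c:weights n. q c <= max 0 B" for n
 proof (rule bexI[of _ "%k. if k = n then 1 else 0"])
 have e: "S (%k. if k = n then 1 else 0) = Z n" unfolding S_def by (auto simp: fun_eq_iff)
 show "q (%k. if k = n then 1 else 0) <= max 0 B" unfolding q_def e
 using enn2real_mono[OF b[of n]] by (cases "0 <= B") (auto simp: ennreal_neg)
 qed (auto simp: weights_def)
 show "EX z:weights n. d x y <= 2 * q x + 2 * q y - 4 * q z" if x: "x : weights n" and y: "y : weights n" for n x y
 proof (rule bexI[of _ "%k. (x k + y k) / 2"])
 let ?z = "%k. (x k + y k) / 2"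
 show z: "?z : weights n" by (rule conv_weights_midpoint[OF x y])
 define L where "L = {k. x k ~= 0} Un {k. y k ~= 0}"
 have L: "finite L" "{k. x k ~= 0} \<subseteq> L" "{k. y k ~= 0} \<subseteq> L" "{k. ?z k ~= 0} \<subseteq> L"
 using x y unfolding L_def weights_def by auto
 have "S ?z u w = (1 / 2) *\<^sub>R (S x u w + S y u w)" for u w
 proof -
 have "S ?z u w = (SUM k:L. ?z k *\<^sub>R Z k u w)" unfolding S_def by (rule sum_support[OF L(1,4)]) simp
 also have "... = (1 / 2) *\<^sub>R ((SUM k:L. x k *\<^sub>R Z k u w) + (SUM k:L. y k *\<^sub>R Z k u w))"
 by (simp add: scaleR_sum_right sum.distrib[symmetric] scaleR_add_left[symmetric] add_divide_distrib)
 also have "(SUM k:L. x k *\<^sub>R Z k u w) = S x u w" unfolding S_def by (rule sum_support[OF L(1,2), symmetric]) simp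
 also have "(SUM k:L. y k *\<^sub>R Z k u w) = S y u w" unfolding S_def by (rule sum_support[OF L(1,3), symmetric]) simp
 finally show ?thesis .
 qed
 then have e: "S ?z = (%u w. (1 / 2) *\<^sub>R (S x u w + S y u w))" by (intro ext)
 have "EQ (S x ~- S y) + 4 * EQ (S ?z) = 2 * EQ (S x) + 2 * EQ (S y)"
 unfolding e by (rule EQ_parallelogram[OF S(1)[OF x] S(1)[OF y]])
 moreover have "ennreal (d x y) = EQ (S x ~- S y)" "ennreal (q c) = EQ (S c)" if "c : weights n" for c
 using Sd(2)[OF x y] S(2)[OF that] unfolding d_def q_def by simp_all
 ultimately have "ennreal (d x y) + 4 * ennreal (q ?z) = 2 * ennreal (q x) + 2 * ennreal (q y)" using x y z by simp
 moreover have "ennreal (d x y) + 4 * ennreal (q ?z) = ennreal (d x y + 4 * q ?z)"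
 by (simp add: q_def d_def ennreal_mult)
 moreover have "2 * ennreal (q x) + 2 * ennreal (q y) = ennreal (2 * q x + 2 * q y)" by (rule ennreal_two) (simp_all add: q_def)
 ultimately have "ennreal (d x y + 4 * q ?z) = ennreal (2 * q x + 2 * q y)" by metis
 then have "d x y + 4 * q ?z = 2 * q x + 2 * q y" by (subst (asm) ennreal_inj) (simp_all add: q_def d_def)
 then show "d x y <= 2 * q x + 2 * q y - 4 * q ?z" by simp
 qed
 show "decseq (%n. (1 / 16 :: real) ^ Suc n)" by (rule decseq_SucI) simp
 qed simp
 then obtain x where x: "!!n. x n : weights n" "!!n. d (x n) (x (Suc n)) <= (1 / 16) ^ Suc n" by blast
 have "EQ (%u w. S (x n) u w - S (x (Suc n)) u w) <= ennreal ((1 / 16) ^ Suc n)" for n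
 proof -
 have "EQ (%u w. S (x n) u w - S (x (Suc n)) u w) = ennreal (d (x n) (x (Suc n)))" using Sd(2)[OF x(1) x(1)] unfolding d_def by simp
 also have "... <= ennreal ((1 / 16) ^ Suc n)" by (rule ennreal_leI[OF x(2)])
 finally show ?thesis .
 qed
 from sint_fast_limit[OF S(3)[OF x(1)] S(2)[OF x(1)] this]
 show ?thesis using x(1) unfolding S_def by blast
qed

section \<open>Predictable processes: sections, time integrals and composition with the
  driver\<close>

lemma predictable_section: "t : TI ==> (%w. (t, w)) : F t \<rightarrow>\<^sub>M PA"
 unfolding predictable_algebra_def
proof (rule measurable_measure_of[OF predictable_generators])
 assume t: "t : TI"
 fix y assume "y : {{0} \<times> A |A. A : sets (F 0)} Un {{s<..t} \<times> A |s t A. 0 <= s & s <= t & t <= T & A : sets (F s)}"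
 then consider A where "y = {0} \<times> A" "A : sets (F 0)" | s r A where "y = {s<..r} \<times> A" "0 <= s" "A : sets (F s)" by blast
 then show "(%w. (t, w)) -` y Int space (F t) : sets (F t)"
 proof cases
 case 1
 have "A : sets (F t)" using 1 F_mono[of 0 t] t by auto
 moreover have "(%w. (t, w)) -` y Int space (F t) = (if t = 0 then A else {})"
 unfolding 1(1) using sets.sets_into_space[OF 1(2)] by auto
 ultimately show ?thesis by (cases "t = 0") auto
 next
 case 2
 show ?thesis
 proof (cases "s < t & t <= r")
 case True
 then have "A : sets (F t)" using 2 F_mono[of s t] by auto
 moreover have "(%w. (t, w)) -` y Int space (F t) = A Int space (F t)" unfolding 2(1) using True by auto
 ultimately show ?thesis by (metis sets.Int_space_eq2)
 next
 case False
 then have "(%w. (t, w)) -` y Int space (F t) = {}" unfolding 2(1) by auto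
 then show ?thesis by (metis sets.empty_sets)
 qed
 qed
qed auto

lemma pred_adapted: "pred X ==> t : TI ==> X t : bm (F t)"
 using measurable_compose[OF predictable_section, of t "%(t, w). X t w" borel] unfolding predictable_process_def by simp

text \<open>Progressive measurability. After stopping the clock at \<open>t\<close>, a generating
  rectangle that starts at time \<open>s >= t > 0\<close> is never met, and the others involve an
  event already in \<open>F t\<close>.\<close>

lemma predictable_stopped:
 assumes t: "t : TI"
 shows "(%(u, w). (min u t, w)) : LT \<Otimes>\<^sub>M F t \<rightarrow>\<^sub>M PA"
 unfolding predictable_algebra_def
proof (rule measurable_measure_of[OF predictable_generators])
 fix y assume "y : {{0} \<times> A |A. A : sets (F 0)} Un {{s<..t} \<times> A |s t A. 0 <= s & s <= t & t <= T & A : sets (F s)}"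
 then obtain s S A where y: "y = S \<times> A" "A : sets (F s)" "s < t \<or> s = 0 \<or> (ALL u. min u t ~: S)" "S : sets borel" "0 <= s"
 proof -
 consider (a) A where "y = {0} \<times> A" "A : sets (F 0)" | (b) s r A where "y = {s<..r} \<times> A" "0 <= s" "A : sets (F s)"
 using \<open>y : _\<close> by blast
 then show thesis
 proof cases
 case a
 show ?thesis by (rule that[of "{0}" A 0]) (use a in auto)
 next
 case b
 show ?thesis by (rule that[of "{s<..r}" A s]) (use b in auto)
 qed
 qed
 have eq: "(%(u, w). (min u t, w)) -` y Int space (LT \<Otimes>\<^sub>M F t) = ((%u. min u t) -` S Int space LT) \<times> A"
 using sets.sets_into_space[OF y(2)] unfolding y(1) by (auto simp: space_pair_measure)
 have 1: "(%u. min u t) -` S Int space LT : sets LT"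
 by (rule measurable_sets[OF _ y(4)]) (intro measurable_restrict_space1, measurable)
 show "(%(u, w). (min u t, w)) -` y Int space (LT \<Otimes>\<^sub>M F t) : sets (LT \<Otimes>\<^sub>M F t)"
 proof (cases "ALL u. min u t ~: S")
 case True
 then have "((%u. min u t) -` S Int space LT) \<times> A = {}" by auto
 then show ?thesis unfolding eq by (metis sets.empty_sets)
 next
 case False
 then have "A : sets (F t)" using y(2,3) F_mono[of s t] t by auto
 then show ?thesis unfolding eq using 1 by (rule pair_measureI[rotated])
 qed
qed (use t in "auto simp: space_pair_measure min_le_iff_disj")

text \<open>On \<open>{0..t}\<close> the stopped clock agrees with the true one, so the integrand
  may be replaced by one that is measurable with respect to \<open>F t\<close> jointly with
  time.\<close>

lemma predictable_integral_adapted: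
 fixes g :: "real => 'a => ennreal"
 assumes g: "(%(u, w). g u w) : bm (PA)" and t: "t : TI"
 shows "(%w. \<integral>\<^sup>+u\<in>{0..t}. g u w \<partial>lborel) : bm (F t)"
proof -
 have 1: "(%(u, w). g (min u t) w) : bm (LT \<Otimes>\<^sub>M F t)"
 using measurable_compose[OF predictable_stopped[OF t] g] by (simp add: case_prod_beta')
 have i: "ind {0..t} : bm LT" by (intro measurable_restrict_space1) simp
 have "(%(w, u). g (min u t) w * ind {0..t} u) : bm (F t \<Otimes>\<^sub>M LT)"
 using borel_measurable_times_ennreal[OF measurable_compose[OF measurable_pair_swap' 1] measurable_compose[OF measurable_snd i, of "F t"]]
 by (simp add: case_prod_beta')
 from LT.borel_measurable_nn_integral[OF this]
 have "(%w. (NL u. g (min u t) w * ind {0..t} u)) : bm (F t)" .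
 also have "(%w. (NL u. g (min u t) w * ind {0..t} u)) = (%w. \<integral>\<^sup>+u\<in>{0..t}. g u w \<partial>lborel)"
 proof
 fix w
 have "(NL u. g (min u t) w * ind {0..t} u) = (\<integral>\<^sup>+u\<in>TI. g (min u t) w * ind {0..t} u \<partial>lborel)"
 by (rule nn_integral_restrict_space) simp
 also have "... = (\<integral>\<^sup>+u\<in>{0..t}. g u w \<partial>lborel)" using t by (intro nn_integral_cong) (auto split: split_indicator)
 finally show "(NL u. g (min u t) w * ind {0..t} u) = (\<integral>\<^sup>+u\<in>{0..t}. g u w \<partial>lborel)" .
 qed
 finally show ?thesis .
qed

text \<open>\<open>bpath\<close> is the Brownian path made continuous on a null set, so that it always lies in \<open>C_paths T\<close>.\<close>
definition bpath :: "'a => real => real ^ 'n" where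
 "bpath w = (if continuous_on TI (%t. W t w) then brownian_path T W w else (\<lambda>t\<in>TI. 0))"

lemma bpath_C: "bpath w : C_paths T"
proof (cases "continuous_on TI (%t. W t w)")
 case True
 then have "continuous_on TI (\<lambda>t\<in>TI. W t w)" by (rule continuous_on_eq) simp
 then show ?thesis using True unfolding bpath_def C_paths_def brownian_path_def by simp
next
 case False
 have "continuous_on TI (\<lambda>t\<in>TI. 0 :: real ^ 'n)" by (rule continuous_on_eq[OF continuous_on_const[of _ 0]]) simp
 then show ?thesis using False unfolding bpath_def C_paths_def by simp
qed

lemma bpath_AE: "AE w in P. bpath w = brownian_path T W w"
 using W_cont by eventually_elim (simp add: bpath_def)

text \<open>The null set on which \<open>bpath\<close> differs from the Brownian path is absorbed by
  the augmented filtration, one coordinate at a time.\<close>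

lemma bpath_measurable: "bpath : F s \<rightarrow>\<^sub>M generated_filtration T (C_paths T) (%s w. w s) s"
 unfolding generated_filtration_def
proof (rule measurable_measure_of)
 fix y :: "(real => real ^ 'n) set"
 assume "y : {(%w. w r) -` B Int C_paths T | r B. r : TI & r <= s & B : sets borel}"
 then obtain r B where y: "y = (%w. w r) -` B Int C_paths T" "r : TI" "r <= s" "B : sets borel" by blast
 have "AE w in P. W r w = bpath w r" using bpath_AE by eventually_elim (use y(2) in "simp add: brownian_path_def")
 then have "(%w. bpath w r) : bm (F s)" by (rule borel_F_AE[OF W_F[OF y(2,3)]])
 from measurable_sets[OF this y(4)] have "(%w. bpath w r) -` B Int space (F s) : sets (F s)" .
 also have "(%w. bpath w r) -` B Int space (F s) = bpath -` y Int space (F s)" unfolding y(1) using bpath_C by auto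
 finally show "bpath -` y Int space (F s) : sets (F s)" .
qed (use bpath_C in auto)

lemma path_measurable: "(%(u, w). (u, bpath w)) : PA \<rightarrow>\<^sub>M path_predictable_algebra T"
 unfolding path_predictable_algebra_def predictable_algebra_def[of T "C_paths T"]
proof (rule measurable_measure_of)
 let ?G = "generated_filtration T (C_paths T) (%s (w :: real => real ^ 'n). w s)"
 have sp: "space (?G s) = C_paths T" for s unfolding generated_filtration_def by (simp add: space_measure_of_conv)
 show "{{0} \<times> A |A. A : sets (?G 0)} Un {{s<..t} \<times> A |s t A. 0 <= s & s <= t & t <= T & A : sets (?G s)} \<subseteq> Pow (TI \<times> C_paths T)"
 using sets.sets_into_space[of _ "?G _"] T_pos unfolding sp by fastforce
 fix y assume "y : {{0} \<times> A |A. A : sets (?G 0)} Un {{s<..t} \<times> A |s t A. 0 <= s & s <= t & t <= T & A : sets (?G s)}"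
 then obtain s S A where y: "y = S \<times> A" "A : sets (?G s)" "S = {0} & s = 0 \<or> (EX t. S = {s<..t} & 0 <= s & s <= t & t <= T)" by blast
 have "bpath -` A Int space M : sets (F s)" using measurable_sets[OF bpath_measurable y(2)] by simp
 then have "S \<times> (bpath -` A Int space M) : sets (PA)"
 unfolding sets_predictable using y(3) by (intro sigma_sets.Basic) blast
 moreover have "(%(u, w). (u, bpath w)) -` y Int space (PA) = S \<times> (bpath -` A Int space M)"
 unfolding y(1) using y(3) T_pos by auto
 ultimately show "(%(u, w). (u, bpath w)) -` y Int space (PA) : sets (PA)" by simp
qed (use bpath_C in auto)

lemma driver_predictable:
 assumes f: "driver T f" and Y: "pred Y" and Z: "pred Z"
 shows "(%(u, w). f u (bpath w) (Y u w) (Z u w)) : bm (PA)"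
proof -
 have "(%p. (case p of (u, w) => (u, bpath w), case p of (u, w) => Y u w, case p of (u, w) => Z u w))
 : PA \<rightarrow>\<^sub>M (path_predictable_algebra T \<Otimes>\<^sub>M (borel \<Otimes>\<^sub>M borel))"
 by (intro measurable_Pair path_measurable Y[unfolded predictable_process_def] Z[unfolded predictable_process_def])
 from measurable_compose[OF this f[unfolded driver_def]] show ?thesis by (simp add: case_prod_beta')
qed

end

section \<open>Localization and the energy bound\<close>

context wiener begin

text \<open>Localization: \<open>D t\<close> is the event that up to time \<open>t\<close> both the integral and its quadratic variation stay below \<open>R\<close>.\<close>
lemma sint_stopped:
 assumes s: "sint Z I" and I0: "AE w in P. I 0 w = 0" and R: "0 < (R::real)"
 shows "EX Z' I'. sint Z' I' & (AE w in P. Qv 0 Z' w <= ennreal R & (EX \<sigma>:TI. ALL t:TI. I' t w = I (min t \<sigma>) w & abs (I' t w) <= R) &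
 ((ALL t:TI. abs (I t w) < R) & Qv 0 Z w < ennreal R --> Qv 0 Z' w = Qv 0 Z w))"
proof -
 note S = sintD[OF s]
 define v where "v q w = (\<integral>\<^sup>+u\<in>{0..q}. ennreal ((norm (Z u w))^2) \<partial>lborel)" for q w
 define ok where "ok q w <-> abs (I q w) < R & v q w < ennreal R" for q w
 define D where "D t = {w:space M. ALL q:\<rat> Int {0..<t}. ok q w}" for t
 have vm: "v q : bm (F q)" if "q : TI" for q
 unfolding v_def[abs_def] using S(1) unfolding predictable_process_def
 by (intro predictable_integral_adapted[OF _ that]) (auto intro: measurable_compose[where f = "%(u, w). Z u w", simplified split_beta'] simp: split_beta')
 have okm: "{w:space M. ok q w} : sets (F q)" if "q : TI" for q
 proof -
 note [measurable] = vm[OF that] S(4)[OF that]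
 have "{w:space (F q). abs (I q w) < R & v q w < ennreal R} : sets (F q)" by measurable
 then show ?thesis unfolding ok_def by simp
 qed
 have okF: "{w:space M. ok q w} : sets (F t)" if "0 <= q" "q <= t" "t <= T" for q t using okm[of q] F_mono[of q t] that by auto
 have D: "D t : sets (F t)" if "t : TI" for t
 using sets.sets_Collect_countable_All'[of "\<rat> Int {0..<t}" "F t" "%q w. ok q w"] okF[of _ t] that countable_rat
 unfolding D_def by (auto intro: countable_Int1)
 \<comment> \<open>The stopping time itself. Only rational times strictly before \<open>t\<close>
   enter \<open>D t\<close>, so \<open>D t\<close> is an event of \<open>F t\<close> and holds
   exactly when \<open>t <= \<sigma> w\<close>.\<close>
 define \<sigma> where "\<sigma> w = Sup {t:TI. w : D t}" for w
 have T0: "0 : TI" "T : TI" using T_pos by auto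
 have bdd: "bdd_above {t:TI. w : D t}" for w by (intro bdd_aboveI[of _ T]) auto
 have D0: "0 : {t:TI. w : D t}" if "w : space M" for w using that T_pos unfolding D_def by auto
 have sr: "\<sigma> w : TI" if "w : space M" for w
 unfolding \<sigma>_def using cSup_upper[OF D0[OF that] bdd] cSup_least[of "{t:TI. w : D t}" T] D0[OF that] by fastforce
 have iff: "w : D t <-> t <= \<sigma> w" if w: "w : space M" and t: "t : TI" for w t
 proof
 assume "t <= \<sigma> w"
 show "w : D t" unfolding D_def
 proof (intro CollectI conjI w ballI)
 fix q assume q: "q : \<rat> Int {0..<t}"
 then have "q < Sup {t:TI. w : D t}" using \<open>t <= \<sigma> w\<close> unfolding \<sigma>_def by auto
 from less_cSupD[OF _ this] obtain t' where "w : D t'" "q < t'" using D0[OF w] by blast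
 then show "ok q w" using q unfolding D_def by auto
 qed
 qed (use t in "auto simp: \<sigma>_def intro!: cSup_upper bdd")
 define Zs where "Zs u w = ind (D u) w *\<^sub>R Z u w" for u w
 define Is where "Is t w = I (min t (\<sigma> w)) w" for t w
 have Zs: "pred Zs"
 proof -
 let ?N = "\<Union>q\<in>\<rat> Int TI. {q<..T} \<times> {w:space M. \<not> ok q w}"
 have "{w:space M. \<not> ok q w} : sets (F q)" if "q : TI" for q using sets.sets_Collect_neg[of "F q" "ok q"] okm[OF that] by simp
 then have "?N : sets (PA)"
 by (intro sets.countable_UN' countable_Int1 countable_rat) (auto intro!: predictable_rectangle)
 then have "(%x. indicat_real (space (PA) - ?N) x *\<^sub>R (%(u, w). Z u w) x) : bm (PA)"
 using S(1) unfolding predictable_process_def by (intro borel_measurable_scaleR borel_measurable_indicator sets.compl_sets)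
 moreover have "(%(u, w). Zs u w) x = indicat_real (space (PA) - ?N) x *\<^sub>R (%(u, w). Z u w) x"
 if "x : space (PA)" for x
 using that unfolding Zs_def D_def by (cases x) (auto split: split_indicator)
 ultimately show ?thesis unfolding predictable_process_def by (subst measurable_cong) auto
 qed
 define p where "p n k = real k * T / real (Suc n)" for n k
 have p: "p n k : TI" if "k <= Suc n" for n k using that T_pos by (auto simp: p_def divide_le_eq mult.commute intro!: mult_left_mono)
 have pS: "p n k <= p n (Suc k)" "p n (Suc k) = p n k + T / real (Suc n)" for n k
 using T_pos unfolding p_def by (auto simp: divide_right_mono add_divide_distrib[symmetric] algebra_simps)
 \<comment> \<open>On the cell from \<open>p n k\<close> to \<open>p n (Suc k)\<close> the integrand
   is kept if \<open>D (p n k)\<close> still holds. The sum over the cells stops at a grid point at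
   most \<open>T / (n + 1)\<close> after \<sigma>, and refining the grid removes the
   overshoot.\<close>
 define zk where "zk n k u w = cutZ (p n k) (D (p n k)) Z u w - cutZ (p n (Suc k)) (D (p n k)) Z u w" for n k u w
 define ik where "ik n k u w = cutI (p n k) (D (p n k)) I u w - cutI (p n (Suc k)) (D (p n k)) I u w" for n k u w
 define Zn where "Zn n u w = (\<Sum>k<Suc n. zk n k u w)" for n u w
 define In where "In n u w = (\<Sum>k<Suc n. ik n k u w)" for n u w
 have sk: "sint (zk n k) (ik n k)" if "k < Suc n" for n k
 unfolding zk_def[abs_def] ik_def[abs_def]
 using D[of "p n k"] p[of k n] p[of "Suc k" n] that F_mono[OF pS(1)[of n k]] by (intro sint_diff sint_restrict[OF s]) auto
 have sn: "sint (Zn n) (In n)" for n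
 using sint_sum[of "{..<Suc n}" "zk n" "ik n" "%_. 1", OF _ sk] unfolding Zn_def[abs_def] In_def[abs_def] by simp
 have repr: "EX r:TI. min (\<sigma> w) (p n j) <= r & r <= \<sigma> w + T / real (Suc n) & (p n j <= \<sigma> w --> r = p n j) &
 (ALL u:TI. (\<Sum>k<j. zk n k u w) = ind {0<..r} u *\<^sub>R Z u w) & (ALL t:TI. (\<Sum>k<j. ik n k t w) = I (min t r) w - I 0 w)"
 if w: "w : space M" and j: "j <= Suc n" for w n j
 using j
 proof (induction j)
 case 0
 show ?case using sr[OF w] T_pos by (intro bexI[of _ 0]) (auto simp: p_def)
 next
 case (Suc j)
 then obtain r where r: "r : TI" "min (\<sigma> w) (p n j) <= r" "r <= \<sigma> w + T / real (Suc n)" "p n j <= \<sigma> w --> r = p n j"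
 "!!u. u : TI ==> (\<Sum>k<j. zk n k u w) = ind {0<..r} u *\<^sub>R Z u w" "!!t. t : TI ==> (\<Sum>k<j. ik n k t w) = I (min t r) w - I 0 w" by auto
 have pj: "p n j : TI" "p n (Suc j) : TI" using p Suc.prems by auto
 show ?case
 proof (cases "p n j <= \<sigma> w")
 case True
 have rj: "r = p n j" using r(4) True by simp
 have A: "w : D (p n j)" using iff[OF w pj(1)] True by simp
 have "(\<Sum>k<Suc j. zk n k u w) = ind {0<..p n (Suc j)} u *\<^sub>R Z u w" if u: "u : TI" for u
 using r(5)[OF u] A u pj pS(1)[of n j] unfolding rj zk_def cutZ_def by (auto split: split_indicator)
 moreover have "(\<Sum>k<Suc j. ik n k t w) = I (min t (p n (Suc j))) w - I 0 w" if t: "t : TI" for t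
 using r(6)[OF t] A t pj pS(1)[of n j] unfolding rj ik_def cutI_def by (auto simp: min_def max_def)
 ultimately show ?thesis using pj pS(2)[of n j] True by (intro bexI[of _ "p n (Suc j)"]) auto
 next
 case False
 have A: "w ~: D (p n j)" using iff[OF w pj(1)] False by simp
 then have "zk n j u w = 0" "ik n j u w = 0" for u unfolding zk_def cutZ_def ik_def cutI_def by auto
 then show ?thesis using r False pS(1)[of n j] by (intro bexI[of _ r]) auto
 qed
 qed
 have Tn: "(%n. T / real (Suc n)) ~> 0" by (intro LIMSEQ_Suc lim_const_over_n)
 have pT: "p n (Suc n) = T" for n unfolding p_def by simp
 have Zs_eq: "Zs u w = ind {..\<sigma> w} u *\<^sub>R Z u w" if "w : space M" "u : TI" for u w using iff[OF that] unfolding Zs_def by (auto split: split_indicator)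
 have ok: "ok q w" if "w : space M" "q : \<rat>" "0 <= q" "q < \<sigma> w" for q w using iff[of w "\<sigma> w"] sr[OF that(1)] that unfolding D_def by auto
 have ae: "AE w in P. w : space M & I 0 w = 0 & Qv 0 Z w < \<infinity> & continuous_on TI (%t. I t w)" using I0 S(3,6) AE_space by eventually_elim simp
 have seq: "EX q. q ~> t & (ALL n. q n : \<rat> & 0 <= q n & q n < t)" if t: "0 < t" for t :: real
 proof -
 obtain q where q: "q ~> - t" "!!n. q n : \<rat> & - t < q n & q n < 0" using rational_sequence[of "- t" 0] t by auto
 have "- q n : \<rat> & 0 <= - q n & - q n < t" for n using q(2)[of n] by auto
 then show ?thesis using tendsto_minus[OF q(1)] by (intro exI[of _ "%n. - q n"]) auto
 qed
 have path: "AE w in P. Qv 0 Zs w <= ennreal R & (ALL t:TI. abs (Is t w) <= R) & continuous_on TI (%t. Is t w) &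
 (%n. Qv 0 (Zs ~- Zn n) w) ~> 0 & (ALL t:TI. (%n. In n t w) ~> Is t w)"
 using ae
 proof eventually_elim
 case (elim w)
 then have w: "w : space M" by blast
 note sw = sr[OF w]
 have c: "continuous_on TI (%t. I t w)" using elim by blast
 have b: "abs (I t w) <= R" if t: "0 <= t" "t <= \<sigma> w" for t
 proof (cases "t = 0")
 case False
 then obtain q where q: "q ~> t" "!!n. q n : \<rat> & 0 <= q n & q n < t" using seq[of t] t by auto
 have "q n : TI" for n using q(2)[of n] t sw by auto
 then have "(%n. I (q n) w) ~> I t w"
 by (intro continuous_on_tendsto_compose[OF c q(1)]) (use t sw in auto)
 moreover have "abs (I (q n) w) <= R" for n using ok[OF w, of "q n"] q(2)[of n] t unfolding ok_def by auto
 ultimately show ?thesis using LIMSEQ_le_const2[OF tendsto_rabs] by blast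
 qed (use elim R in simp)
 have cs: "continuous_on TI (%t. Is t w)" unfolding Is_def
 by (rule continuous_on_compose2[OF c]) (use sw in "auto intro!: continuous_intros")
 define h where "h u = ennreal ((norm (Z u w))^2)" for u
 have hm: "h : bm LT" unfolding h_def using jm_section[OF S(2) w] by auto
 have him: "(%u. h u * ind {x..y} u) : bm LT" "(%u. h u * ind {x<..y} u) : bm LT" for x y
 by (intro borel_measurable_times_ennreal[OF hm] measurable_restrict_space1; simp)+
 have Qs: "Qv 0 Zs w = (NL u. h u * ind {0..\<sigma> w} u)"
 unfolding Qv_LT[OF order_refl] by (intro nn_integral_cong) (auto simp: Zs_eq[OF w] h_def split: split_indicator)
 have "Qv 0 Zs w <= ennreal R"
 proof (cases "\<sigma> w = 0")
 case True
 have "AE u in LT. h u * ind {0..\<sigma> w} u = 0" using AE_LT_neq[of 0] by eventually_elim (simp add: True)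
 from nn_integral_cong_AE[OF this] show ?thesis unfolding Qs by simp
 next
 case False
 then obtain q where q: "q ~> \<sigma> w" "!!n. q n : \<rat> & 0 <= q n & q n < \<sigma> w" using seq[of "\<sigma> w"] sw by auto
 have "Qv 0 Zs w <= liminf (%n. (NL u. h u * ind {0..q n} u))"
 unfolding Qs
 proof (rule LT_fatou[OF hm])
 show "AE u in LT. u : {0..\<sigma> w} --> (EV n. u : {0..q n})"
 using AE_LT_neq[of "\<sigma> w"] proof eventually_elim
 case (elim u)
 have "u < \<sigma> w ==> EV n. u < q n" by (rule order_tendstoD(1)[OF q(1)])
 then show ?case using elim by (cases "u < \<sigma> w") (auto elim!: eventually_mono)
 qed
 qed simp
 also have "... <= ennreal R"
 proof (intro Liminf_le always_eventually allI sequentially_bot)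
 fix n
 have "(NL u. h u * ind {0..q n} u) = v (q n) w" unfolding v_def h_def
 by (subst nn_integral_restrict_space) (use q(2)[of n] sw in "auto intro!: nn_integral_cong split: split_indicator")
 then show "(NL u. h u * ind {0..q n} u) <= ennreal R" using ok[OF w, of "q n"] q(2)[of n] unfolding ok_def by auto
 qed
 finally show ?thesis .
 qed
 moreover have "abs (Is t w) <= R" if "t : TI" for t unfolding Is_def using sw that by (intro b) auto
 moreover have "(%n. Qv 0 (Zs ~- Zn n) w) ~> 0 & (ALL t:TI. (%n. In n t w) ~> Is t w)"
 proof -
 have "EX r. ALL n. r n : TI & \<sigma> w <= r n & r n <= \<sigma> w + T / real (Suc n) &
 (ALL u:TI. Zn n u w = ind {0<..r n} u *\<^sub>R Z u w) & (ALL t:TI. In n t w = I (min t (r n)) w - I 0 w)"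
 proof (intro choice allI)
 fix n
 have "min (\<sigma> w) T = \<sigma> w" using sw by simp
 with repr[OF w order_refl, of n] show "EX r. r : TI & \<sigma> w <= r & r <= \<sigma> w + T / real (Suc n) &
 (ALL u:TI. Zn n u w = ind {0<..r} u *\<^sub>R Z u w) & (ALL t:TI. In n t w = I (min t r) w - I 0 w)"
 unfolding Zn_def In_def pT by (elim bexE, intro exI) (elim conjE, intro conjI, assumption, simp, assumption+)
 qed
 then obtain r where r: "!!n. r n : TI" "!!n. \<sigma> w <= r n" "!!n. r n <= \<sigma> w + T / real (Suc n)"
 "!!n u. u : TI ==> Zn n u w = ind {0<..r n} u *\<^sub>R Z u w" "!!n t. t : TI ==> In n t w = I (min t (r n)) w - I 0 w" by blast
 have "(%n. \<sigma> w + T / real (Suc n)) ~> \<sigma> w + 0" by (intro tendsto_add tendsto_const Tn)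
 then have rl: "r ~> \<sigma> w" using tendsto_sandwich[OF always_eventually[OF allI[OF r(2)]] always_eventually[OF allI[OF r(3)]] tendsto_const] by simp
 have "(%n. In n t w) ~> Is t w" if t: "t : TI" for t
 proof -
 have "(%n. I (min t (r n)) w) ~> I (min t (\<sigma> w)) w"
 by (rule continuous_on_tendsto_compose[OF c tendsto_min[OF tendsto_const rl]]) (use t sw r(1) in "auto simp: min_le_iff_disj intro!: always_eventually")
 then show ?thesis unfolding r(5)[OF t] Is_def using elim by simp
 qed
 moreover have "(%n. (NL u. h u * ind {\<sigma> w<..r n} u)) ~> (NL u. 0)"
 proof (rule nn_integral_dominated_convergence[where w = h])
 show "(NL u. h u) < \<infinity>" using elim nn_integral_cong[of LT "%u. h u * ind TI u" h] unfolding Qv_LT[OF order_refl] h_def by simp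
 show "AE u in LT. (%n. h u * ind {\<sigma> w<..r n} u) ~> 0"
 proof (intro AE_I2)
 fix u
 show "(%n. h u * ind {\<sigma> w<..r n} u) ~> 0"
 proof (cases "\<sigma> w < u")
 case True
 have "EV n. r n < u" by (rule order_tendstoD(2)[OF rl True])
 then have "EV n. h u * ind {\<sigma> w<..r n} u = 0" by eventually_elim simp
 then show ?thesis by (rule tendsto_eventually)
 qed simp
 qed
 qed (use him hm in "auto split: split_indicator")
 moreover have "Qv 0 (Zs ~- Zn n) w = (NL u. h u * ind {\<sigma> w<..r n} u)" for n
 unfolding Qv_LT[OF order_refl]
 proof (rule nn_integral_cong_AE)
 show "AE u in LT. ennreal ((norm (Zs u w - Zn n u w))^2) * ind TI u = h u * ind {\<sigma> w<..r n} u"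
 using AE_LT_neq[of 0] AE_space
 proof eventually_elim
 case (elim u)
 then show ?case using Zs_eq[OF w, of u] r(4)[of u n] r(2)[of n] unfolding h_def by (auto split: split_indicator)
 qed
 qed
 ultimately show ?thesis by simp
 qed
 ultimately show ?case using cs by blast
 qed
 have "sint Zs Is"
 proof (rule sint_closed[OF sn Zs])
 show "AE w in P. Qv 0 Zs w < \<infinity>" using path by eventually_elim (auto intro: le_less_trans)
 show "AE w in P. continuous_on TI (%t. Is t w)" using path by eventually_elim blast
 show Im: "Is t : bm (F t)" if t: "t : TI" for t
 proof (rule borel_F_AE_lim[OF sintD(4)[OF sn t]])
 show "AE w in P. (%n. In n t w) ~> Is t w" using path by eventually_elim (use t in blast)
 qed
 show "tip (%n. Qv 0 (Zs ~- Zn n))"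
 proof (rule tip_AE)
 show "Qv 0 (Zs ~- Zn n) : bm P" for n
 by (intro Qv_m jm_diff predictable_jm[OF Zs] sintD(2)[OF sn]) simp
 qed (use path in "eventually_elim, blast")
 show "tip (%n w. ennreal (abs (In n t w - Is t w)))" if t: "t : TI" for t
 proof (rule tip_AE)
 show "(%w. ennreal (abs (In n t w - Is t w))) : bm P" for n
 using sintD(5)[OF sn t, of n] mFP[OF Im[OF t]] by simp
 show "AE w in P. (%n. ennreal (abs (In n t w - Is t w))) ~> 0"
 using path
 proof eventually_elim
 case (elim w)
 then have "(%n. In n t w - Is t w) ~> 0" using t by (simp add: LIM_zero)
 from tendsto_ennrealI[OF tendsto_rabs_zero[OF this]] show ?case by simp
 qed
 qed
 qed
 moreover have "AE w in P. Qv 0 Zs w <= ennreal R & (EX \<sigma>:TI. ALL t:TI. Is t w = I (min t \<sigma>) w & abs (Is t w) <= R) &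
 ((ALL t:TI. abs (I t w) < R) & Qv 0 Z w < ennreal R --> Qv 0 Zs w = Qv 0 Z w)"
 using path AE_space
 proof eventually_elim
 case (elim w)
 then have w: "w : space M" by simp
 have "Qv 0 Zs w = Qv 0 Z w" if A: "ALL t:TI. abs (I t w) < R" "Qv 0 Z w < ennreal R"
 proof -
 have "v q w < ennreal R" if "q : TI" for q
 by (rule le_less_trans[OF _ A(2)]) (use that in "auto simp: v_def Qv_def intro!: nn_integral_mono split: split_indicator")
 then have "w : D T" using A(1) w unfolding D_def ok_def by auto
 then have "T <= \<sigma> w" using iff[OF w T0(2)] by simp
 then show ?thesis unfolding Qv_def by (intro nn_integral_cong) (auto simp: Zs_eq[OF w] split: split_indicator)
 qed
 then show ?case using elim(1) sr[OF w] unfolding Is_def by blast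
 qed
 ultimately show ?thesis by blast
qed

text \<open>A discrete Ito formula for \<open>x\<^sup>2\<close>, where \<open>y - x\<close> is increasing and \<open>x\<close> is negative.\<close>
lemma squares_pathwise:
 fixes x y :: "real => real" and s :: "nat => real"
 assumes s: "!!i. i <= n ==> s i : S" "!!i. i < n ==> s i <= s (Suc i)" and x: "!!t. t : S ==> - (2 * c) <= x t & x t <= 0"
 and mono: "mono_on S (%t. y t - x t)" and m: "!!i. i < n ==> abs (y (s (Suc i)) - y (s i)) <= m"
 shows "(\<Sum>i<n. (y (s (Suc i)) - y (s i))^2) <= 4 * c^2 - 2 * (\<Sum>i<n. x (s i) * (y (s (Suc i)) - y (s i)))
 + 2 * m * ((y (s n) - x (s n)) - (y (s 0) - x (s 0)))"
proof -
 define b where "b t = y t - x t" for t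
 have step: "(y (s (Suc i)) - y (s i))^2 + 2 * (x (s i) * (y (s (Suc i)) - y (s i))) - 2 * m * (b (s (Suc i)) - b (s i))
 <= (x (s (Suc i)))^2 - (x (s i))^2" if i: "i < n" for i
 proof -
 define dy where "dy = y (s (Suc i)) - y (s i)"
 define db where "db = b (s (Suc i)) - b (s i)"
 have db: "0 <= db" using mono_onD[OF mono s(1)[of i] s(1)[of "Suc i"] s(2)[OF i]] i unfolding db_def b_def by auto
 have xs: "x (s (Suc i)) = x (s i) + dy - db" unfolding dy_def db_def b_def by simp
 \<comment> \<open>The drift term has the favourable sign because \<open>x <= 0 <= db\<close>; only
   the product \<open>dy * db\<close> has to be estimated, by the oscillation bound
   \<open>m\<close>.\<close>
 have 1: "0 <= - x (s i) * db" using x[OF s(1)[of i]] i db by (intro mult_nonneg_nonneg) auto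
 have "dy * db <= m * db" using m[OF i] db unfolding dy_def by (intro mult_right_mono) auto
 moreover have "(x (s i) + dy - db)^2 - (x (s i))^2 - (dy^2 + 2 * (x (s i) * dy) - 2 * (m * db)) = 2 * (m * db) - 2 * (dy * db) + 2 * (- x (s i) * db) + db^2"
 by (simp add: power2_eq_square algebra_simps)
 ultimately have "0 <= (x (s i) + dy - db)^2 - (x (s i))^2 - (dy^2 + 2 * (x (s i) * dy) - 2 * (m * db))"
 using 1 zero_le_power2[of db] by linarith
 then show ?thesis unfolding xs dy_def db_def by simp
 qed
 have "(\<Sum>i<n. (y (s (Suc i)) - y (s i))^2 + 2 * (x (s i) * (y (s (Suc i)) - y (s i))) - 2 * m * (b (s (Suc i)) - b (s i)))
 <= (\<Sum>i<n. (x (s (Suc i)))^2 - (x (s i))^2)" by (intro sum_mono step) auto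
 also have "... = (x (s n))^2 - (x (s 0))^2" by (rule sum_lessThan_telescope)
 also have "... <= 4 * c^2"
 proof -
 have "abs (x (s n)) <= abs (2 * c)" using x[OF s(1)[of n]] by auto
 then have "(x (s n))^2 <= (2 * c)^2" by (simp add: abs_le_square_iff)
 then show ?thesis by (simp add: power_mult_distrib) (smt (verit) zero_le_power2)
 qed
 finally have "(\<Sum>i<n. (y (s (Suc i)) - y (s i))^2) + 2 * (\<Sum>i<n. x (s i) * (y (s (Suc i)) - y (s i))) - 2 * m * (\<Sum>i<n. b (s (Suc i)) - b (s i)) <= 4 * c^2"
 unfolding sum_distrib_left by (subst (asm) sum_subtractf) (simp only: sum.distrib)
 moreover have "(\<Sum>i<n. b (s (Suc i)) - b (s i)) = b (s n) - b (s 0)" by (rule sum_lessThan_telescope)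
 ultimately show ?thesis unfolding b_def by simp
qed

lemma L2mart_squares:
 assumes N: "L2mart N" and s: "!!i. i <= n ==> s i : TI" "!!i. i < n ==> s i <= s (Suc i)"
 shows "(EE w. (\<Sum>i<n. (N (s (Suc i)) w - N (s i) w)^2)) = (EE w. (N (s n) w)^2) - (EE w. (N (s 0) w)^2)"
 and "integrable P (%w. \<Sum>i<n. (N (s (Suc i)) w - N (s i) w)^2)"
proof -
 have i: "integrable P (%w. (N (s (Suc i)) w - N (s i) w)^2)"
 and e: "(EE w. (N (s (Suc i)) w - N (s i) w)^2) = (EE w. (N (s (Suc i)) w)^2) - (EE w. (N (s i) w)^2)" if i: "i < n" for i
 proof -
 have L: "L2F (s i) (N (s i))" "L2F (s (Suc i)) (N (s (Suc i)))" using L2mart_L2F[OF N s(1)] i by auto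
 note int = L2F_square[OF L(1)] L2F_square[OF L(2)] L2F_mult[OF L]
 have eq: "(%w. (N (s (Suc i)) w - N (s i) w)^2) = (%w. (N (s (Suc i)) w)^2 + (N (s i) w)^2 - 2 * (N (s i) w * N (s (Suc i)) w))"
 by (auto simp: power2_diff)
 show "integrable P (%w. (N (s (Suc i)) w - N (s i) w)^2)" unfolding eq using int by auto
 have "(EE w. N (s i) w * N (s (Suc i)) w) = (EE w. N (s i) w * N (s i) w)"
 using L2mart_orth[OF N _ s(2)[OF i] _ L(1)] s(1)[of i] s(1)[of "Suc i"] i by auto
 then show "(EE w. (N (s (Suc i)) w - N (s i) w)^2) = (EE w. (N (s (Suc i)) w)^2) - (EE w. (N (s i) w)^2)"
 unfolding eq using int by (simp add: power2_eq_square)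
 qed
 show "integrable P (%w. \<Sum>i<n. (N (s (Suc i)) w - N (s i) w)^2)" using i by (intro Bochner_Integration.integrable_sum) auto
 show "(EE w. (\<Sum>i<n. (N (s (Suc i)) w - N (s i) w)^2)) = (EE w. (N (s n) w)^2) - (EE w. (N (s 0) w)^2)"
 using i e by (subst Bochner_Integration.integral_sum) (auto simp: sum_lessThan_telescope[of "%k. (EE w. (N (s k) w)^2)"])
qed

text \<open>Since \<open>X\<close> is nonpositive and \<open>I - X\<close> increasing,
  \<open>squares_pathwise\<close> bounds the sum of squared increments of the localized integral
  along a grid. In the mean this sum is the second moment at \<open>T\<close>, the sum of
  \<open>X\<close> times increments vanishes by orthogonality, and the error carries the oscillation
  \<open>m n\<close> over one cell, which is bounded and tends to 0. The factor 16 is the 4 of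
  \<open>squares_pathwise\<close> times the 4 of \<open>sint_energy\<close>.\<close>

lemma energy_0:
 assumes s: "sint Z I" and A: "A : sets P" and c: "0 <= c"
 and Xm: "!!t. t : TI ==> X t : bm (F t)"
 and ae: "AE w in P. I 0 w = 0 & (ALL t:TI. - (2 * (c * ind A w)) <= X t w & X t w <= 0) & mono_on TI (%t. I t w - X t w)"
 shows "EQ Z <= ennreal (16 * c^2) * emeasure P A"
proof -
 note D = sintD[OF s]
 have I0: "AE w in P. I 0 w = 0" using ae by eventually_elim blast
 define p where "p n k = real k * T / real (Suc n)" for n k
 have p: "p n k : TI" if "k <= Suc n" for n k using that T_pos by (auto simp: p_def divide_le_eq mult.commute intro!: mult_left_mono)
 have pS: "p n k <= p n (Suc k)" "p n (Suc k) = p n k + T / real (Suc n)" for n k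
 using T_pos unfolding p_def by (auto simp: divide_right_mono add_divide_distrib[symmetric] algebra_simps)
 have p0: "p n 0 = 0" "p n (Suc n) = T" for n unfolding p_def by auto
 have "EX Z'. jm Z' & EQ Z' <= ennreal (16 * c^2) * emeasure P A &
 (AE w in P. (ALL t:TI. abs (I t w) < real (Suc j)) & Qv 0 Z w < ennreal (real (Suc j)) --> Qv 0 Z' w = Qv 0 Z w)" for j
 proof -
 define R where "R = real (Suc j)"
 have R: "0 < R" unfolding R_def by simp
 obtain Z' I' where Z': "sint Z' I'" and st: "AE w in P. Qv 0 Z' w <= ennreal R & (EX \<sigma>:TI. ALL t:TI. I' t w = I (min t \<sigma>) w & abs (I' t w) <= R) &
 ((ALL t:TI. abs (I t w) < R) & Qv 0 Z w < ennreal R --> Qv 0 Z' w = Qv 0 Z w)" using sint_stopped[OF s I0 R] by blast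
 note D' = sintD[OF Z']
 have "EQ Z' <= (NN w. ennreal R)" using st by (intro nn_integral_mono_AE) (auto elim: eventually_mono)
 also have "... < \<infinity>" by (simp add: emeasure_space_1[simplified])
 finally have fin: "EQ Z' < \<infinity>" .
 note N = sint_L2(1)[OF Z' fin]
 define m where "m n w = Max ((%k. abs (I' (p n (Suc k)) w - I' (p n k) w)) ` {..n})" for n w
 have mm: "m n : bm P" for n
 unfolding m_def[abs_def] using p D'(5) by (intro borel_measurable_Max borel_measurable_abs borel_measurable_diff) auto
 have m: "abs (I' (p n (Suc k)) w - I' (p n k) w) <= m n w" if "k < Suc n" for n k w unfolding m_def using that by (intro Max_ge) auto
 have m0: "0 <= m n w" for n w using m[of 0 n w] by linarith
 have mR: "AE w in P. ALL n. m n w <= 2 * R"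
 using st
 proof eventually_elim
 case (elim w)
 show ?case
 proof
 fix n
 have "abs (I' (p n (Suc k)) w - I' (p n k) w) <= 2 * R" if "k <= n" for k
 proof -
 have "abs (I' (p n (Suc k)) w) <= R" "abs (I' (p n k) w) <= R" using elim p[of k n] p[of "Suc k" n] that by auto
 then show ?thesis by linarith
 qed
 then show "m n w <= 2 * R" unfolding m_def by (subst Max_le_iff) auto
 qed
 qed
 have ml: "AE w in P. (%n. m n w) ~> 0"
 using D'(6)
 proof eventually_elim
 case (elim w)
 show ?case
 proof (rule LIMSEQ_I)
 fix e :: real assume e: "0 < e"
 have "uniformly_continuous_on TI (%t. I' t w)" using elim by (intro compact_uniformly_continuous) auto
 then obtain d where d: "0 < d" "!!x y. x : TI ==> y : TI ==> dist y x < d ==> dist (I' y w) (I' x w) < e"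
 unfolding uniformly_continuous_on_def using e by metis
 have "(%n. T / real (Suc n)) ~> 0" by (intro LIMSEQ_Suc lim_const_over_n)
 from order_tendstoD(2)[OF this d(1)] obtain n0 where n0: "!!n. n >= n0 ==> T / real (Suc n) < d" unfolding eventually_sequentially by blast
 have "norm (m n w - 0) < e" if "n >= n0" for n
 proof -
 have "abs (I' (p n (Suc k)) w - I' (p n k) w) < e" if "k <= n" for k
 using d(2)[OF p p, of k n "Suc k" n] n0[OF \<open>n >= n0\<close>] that pS[of n k] T_pos unfolding dist_real_def by auto
 then have "m n w < e" unfolding m_def by (subst Max_less_iff) auto
 then show ?thesis using m0[of n w] by simp
 qed
 then show "EX n0. ALL n>=n0. norm (m n w - 0) < e" by blast
 qed
 qed
 have mi: "integrable P (m n)" for n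
 by (rule integrable_const_bound[where B = "2 * R", OF _ mm]) (use mR m0 in "auto elim!: eventually_mono")
 have mE: "(%n. (EE w. m n w)) ~> (EE w. 0)"
 proof (rule integral_dominated_convergence[where w = "%_. 2 * R"])
 show "AE w in P. norm (m n w) <= 2 * R" for n using mR m0 by (auto elim!: eventually_mono)
 qed (use mm ml in auto)
 have main: "(EE w. (I' T w)^2) <= 4 * c^2 * prob A + 2 * (2 * R + 4 * c) * (EE w. m n w)" for n
 proof -
 define x where "x k w = X (p n k) w * (I' (p n (Suc k)) w - I' (p n k) w)" for k w
 have L: "L2F (p n k) (X (p n k))" if "k <= n" for k
 proof (rule L2F_bounded[where C = "2 * c"])
 show "X (p n k) : bm (F (p n k))" using p[of k n] that by (intro Xm) auto
 show "AE w in P. abs (X (p n k) w) <= 2 * c"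
 using ae
 proof eventually_elim
 case (elim w)
 have "- (2 * (c * ind A w)) <= X (p n k) w & X (p n k) w <= 0" using elim p[of k n] that by auto
 moreover have "c * ind A w <= c * 1" using c by (intro mult_left_mono) (auto split: split_indicator)
 ultimately show ?case by auto
 qed
 qed
 have x: "integrable P (x k)" "(EE w. x k w) = 0" if "k <= n" for k
 proof -
 note i = L2F_mult[OF L[OF that] L2mart_L2F[OF N p[of k n]]] L2F_mult[OF L[OF that] L2mart_L2F[OF N p[of "Suc k" n]]]
 show "integrable P (x k)" unfolding x_def[abs_def] using i that by (simp add: right_diff_distrib)
 show "(EE w. x k w) = 0" unfolding x_def using i that L2mart_orth[OF N _ pS(1) _ L[OF that]] p[of k n] p[of "Suc k" n]
 by (simp add: right_diff_distrib)
 qed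
 have sq: "AE w in P. (\<Sum>k<Suc n. (I' (p n (Suc k)) w - I' (p n k) w)^2) <= 4 * c^2 * ind A w - 2 * (\<Sum>k<Suc n. x k w) + 2 * (2 * R + 4 * c) * m n w"
 using st ae
 proof eventually_elim
 case (elim w)
 then obtain \<sigma> where sg: "\<sigma> : TI" "!!t. t : TI ==> I' t w = I (min t \<sigma>) w" "!!t. t : TI ==> abs (I' t w) <= R" by blast
 have ms: "min t \<sigma> : TI" if "t : TI" for t using that sg(1) by auto
 have Xb: "- (2 * (c * ind A w)) <= X t w & X t w <= 0" if "t : TI" for t using elim that by blast
 have mo: "mono_on TI (%t. I t w - X t w)" using elim by blast
 have 1: "(\<Sum>k<Suc n. (I' (p n (Suc k)) w - I' (p n k) w)^2) <= 4 * (c * ind A w)^2 - 2 * (\<Sum>k<Suc n. X (min (p n k) \<sigma>) w * (I' (p n (Suc k)) w - I' (p n k) w))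
 + 2 * m n w * ((I' (p n (Suc n)) w - X (min (p n (Suc n)) \<sigma>) w) - (I' (p n 0) w - X (min (p n 0) \<sigma>) w))"
 proof (rule squares_pathwise[where S = "TI" and x = "%t. X (min t \<sigma>) w" and y = "%t. I' t w" and s = "p n"])
 show "mono_on TI (%t. I' t w - X (min t \<sigma>) w)"
 proof (rule mono_onI)
 fix r t assume rt: "r : TI" "t : TI" "r <= t"
 then have "min r \<sigma> <= min t \<sigma>" by auto
 from mono_onD[OF mo ms ms this] show "I' r w - X (min r \<sigma>) w <= I' t w - X (min t \<sigma>) w" using rt sg(2) by auto
 qed
 qed (use p pS(1) Xb ms m in auto)
 \<comment> \<open>Beyond \<sigma> the increments of \<open>I'\<close> vanish, so stopping
   \<open>X\<close> has no effect in this sum. The stopped \<open>X\<close> gives the monotonicity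
   along the path, the unstopped one is adapted and gives mean zero.\<close>
 have "(\<Sum>k<Suc n. X (min (p n k) \<sigma>) w * (I' (p n (Suc k)) w - I' (p n k) w)) = (\<Sum>k<Suc n. x k w)"
 proof (rule sum.cong[OF refl])
 fix k assume "k : {..<Suc n}"
 then have pk: "p n k : TI" "p n (Suc k) : TI" using p by auto
 show "X (min (p n k) \<sigma>) w * (I' (p n (Suc k)) w - I' (p n k) w) = x k w"
 using sg(2)[OF pk(1)] sg(2)[OF pk(2)] pS(1)[of n k] unfolding x_def by (cases "p n k <= \<sigma>") (auto simp: min_def)
 qed
 note 1[unfolded this]
 moreover have "2 * m n w * ((I' (p n (Suc n)) w - X (min (p n (Suc n)) \<sigma>) w) - (I' (p n 0) w - X (min (p n 0) \<sigma>) w)) <= 2 * m n w * (2 * R + 4 * c)"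
 proof (intro mult_left_mono)
 have "abs (I' (p n (Suc n)) w) <= R" "abs (I' (p n 0) w) <= R" using sg(3) p[of 0 n] p[of "Suc n" n] by auto
 moreover have "c * ind A w <= c * 1" using c by (intro mult_left_mono) (auto split: split_indicator)
 ultimately show "(I' (p n (Suc n)) w - X (min (p n (Suc n)) \<sigma>) w) - (I' (p n 0) w - X (min (p n 0) \<sigma>) w) <= 2 * R + 4 * c"
 using Xb[OF ms[OF p[of 0 n]]] Xb[OF ms[OF p[of "Suc n" n]]] by auto
 qed (use m0[of n w] in simp)
 moreover have "4 * (c * ind A w)^2 = 4 * c^2 * ind A w" by (auto split: split_indicator)
 moreover have "2 * m n w * (2 * R + 4 * c) = 2 * (2 * R + 4 * c) * m n w" by simp
 ultimately show ?case by linarith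
 qed
 have AE0: "(EE w. (I' 0 w)^2) = 0"
 proof -
 have "AE w in P. (I' 0 w)^2 = 0" using st I0
 proof eventually_elim
 case (elim w)
 then obtain \<sigma> where "\<sigma> : TI" "I' 0 w = I (min 0 \<sigma>) w" using T_pos by fastforce
 then show ?case using elim(2) by simp
 qed
 from integral_cong_AE[OF _ _ this] show ?thesis using D'(5)[of 0] T_pos by simp
 qed
 have A': "integrable P (ind A :: 'a => real)" using A emeasure_finite[of A] by (simp add: less_top[symmetric] del: emeasure_completion)
 have xi: "integrable P (%w. \<Sum>k<Suc n. x k w)" "(EE w. (\<Sum>k<Suc n. x k w)) = 0" using x by (auto simp: less_Suc_eq_le Bochner_Integration.integral_sum simp del: sum.lessThan_Suc)
 have "(EE w. (I' T w)^2) = (EE w. (\<Sum>k<Suc n. (I' (p n (Suc k)) w - I' (p n k) w)^2))"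
 using L2mart_squares(1)[OF N, of "Suc n" "p n"] p pS(1) AE0 unfolding p0 by simp
 also have "... <= (EE w. 4 * c^2 * ind A w - 2 * (\<Sum>k<Suc n. x k w) + 2 * (2 * R + 4 * c) * m n w)"
 proof (rule integral_mono_AE[OF _ _ sq])
 show "integrable P (%w. \<Sum>k<Suc n. (I' (p n (Suc k)) w - I' (p n k) w)^2)" by (rule L2mart_squares(2)[OF N]) (use p pS(1) in auto)
 show "integrable P (%w. 4 * c^2 * ind A w - 2 * (\<Sum>k<Suc n. x k w) + 2 * (2 * R + 4 * c) * m n w)"
 using A' xi(1) mi[of n] by (intro Bochner_Integration.integrable_add Bochner_Integration.integrable_diff integrable_mult_right) auto
 qed
 also have "... = 4 * c^2 * prob (A Int space M) + 2 * (2 * R + 4 * c) * (EE w. m n w)"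
 using A' xi mi[of n] A by (simp del: sum.lessThan_Suc)
 also have "A Int space M = A" using sets.sets_into_space[OF A] by auto
 finally show ?thesis .
 qed
 have "(%n. 4 * c^2 * prob A + 2 * (2 * R + 4 * c) * (EE w. m n w)) ~> 4 * c^2 * prob A + 2 * (2 * R + 4 * c) * (EE w. 0)"
 by (intro tendsto_intros mE)
 from LIMSEQ_le_const[OF this] main have le: "(EE w. (I' T w)^2) <= 4 * c^2 * prob A" by auto
 have "EQ Z' <= 4 * ennreal (4 * c^2 * prob A)" by (rule order_trans[OF sint_energy[OF Z' fin]]) (intro mult_left_mono ennreal_leI le, simp)
 also have "... = ennreal (16 * c^2) * emeasure P A"
 by (simp add: emeasure_eq_measure ennreal_four ennreal_mult[symmetric] del: emeasure_completion)
 finally show ?thesis using D'(2) st unfolding R_def by (intro exI[of _ Z']) (auto elim: eventually_mono)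
 qed
 then have "EX Zs. ALL j. jm (Zs j) & EQ (Zs j) <= ennreal (16 * c^2) * emeasure P A &
 (AE w in P. (ALL t:TI. abs (I t w) < real (Suc j)) & Qv 0 Z w < ennreal (real (Suc j)) --> Qv 0 (Zs j) w = Qv 0 Z w)" by (intro choice allI)
 then obtain Zs where Zs: "!!j. jm (Zs j)" "!!j. EQ (Zs j) <= ennreal (16 * c^2) * emeasure P A"
 "!!j. AE w in P. (ALL t:TI. abs (I t w) < real (Suc j)) & Qv 0 Z w < ennreal (real (Suc j)) --> Qv 0 (Zs j) w = Qv 0 Z w" by blast
 have "AE w in P. ALL j. (ALL t:TI. abs (I t w) < real (Suc j)) & Qv 0 Z w < ennreal (real (Suc j)) --> Qv 0 (Zs j) w = Qv 0 Z w"
 unfolding AE_all_countable using Zs(3) by blast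
 \<comment> \<open>For a fixed path, the integral and its variation are bounded, so for all large
   levels the localization leaves the variation unchanged. Fatou's lemma then removes the
   localization.\<close>
 then have "AE w in P. Qv 0 Z w <= liminf (%j. Qv 0 (Zs j) w)" using D(3,6)
 proof eventually_elim
 case (elim w)
 obtain b where b: "!!t. t : TI ==> abs (I t w) <= b"
 proof -
 have "bounded ((%t. I t w) ` TI)" by (intro compact_imp_bounded compact_continuous_image elim(3) compact_Icc)
 then obtain b where "ALL x:(%t. I t w) ` TI. norm x <= b" unfolding bounded_iff by blast
 then show ?thesis using that[of b] by simp
 qed
 obtain r where r: "Qv 0 Z w = ennreal r" using elim(2) by (cases "Qv 0 Z w") auto
 obtain j0 :: nat where j0: "max b r < real j0" using reals_Archimedean2 by blast
 have "Qv 0 Z w <= Qv 0 (Zs j) w" if j: "j0 <= j" for j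
 proof -
 have "max b r < real (Suc j)" using j0 j by linarith
 then have "abs (I t w) < real (Suc j)" if "t : TI" for t using b[OF that] by linarith
 moreover have "Qv 0 Z w < ennreal (real (Suc j))" unfolding r using \<open>max b r < real (Suc j)\<close> by (intro ennreal_lessI) auto
 ultimately show ?thesis using elim(1) by simp
 qed
 then show ?case by (intro Liminf_bounded) (auto simp: eventually_sequentially)
 qed
 then have "EQ Z <= (NN w. liminf (%j. Qv 0 (Zs j) w))" by (rule nn_integral_mono_AE)
 also have "... <= liminf (%j. EQ (Zs j))" by (intro nn_integral_liminf Qv_m Zs(1)) simp
 also have "... <= ennreal (16 * c^2) * emeasure P A" by (intro Liminf_le always_eventually allI sequentially_bot Zs(2))
 finally show ?thesis .
qed

text \<open>Cutting the integrand to the event \<open>A\<close> from time \<open>a\<close> on turns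
  the estimate conditional at \<open>a\<close> into \<open>energy_0\<close>. \<open>X'\<close> is 0
  before \<open>a\<close> and jumps downwards there, so the difference to the integral remains
  increasing.\<close>

lemma energy_bound:
 assumes sint: "sint Z I" and a: "a : TI" and A: "A : sets (F a)" and c: "0 < c"
 and Xm: "!!t. t : {a..T} ==> X t : bm (F t)"
 and Xb: "AE w in P. ALL t:{a..T}. - (2 * c) <= X t w & X t w <= 0"
 and mono: "AE w in P. mono_on {a..T} (%t. I t w - X t w)"
 shows "(NN w. Qv a Z w * ind A w) <= ennreal (16 * c^2) * emeasure P A"
proof -
 have AP: "A : sets P" using A sets_F_le by blast
 define X' where "X' t w = (if t < a then 0 else ind A w * X t w)" for t w
 have "EQ (cutZ a A Z) <= ennreal (16 * c^2) * emeasure P A"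
 proof (rule energy_0[OF sint_restrict[OF sint a A] AP less_imp_le[OF c]])
 show "X' t : bm (F t)" if t: "t : TI" for t
 proof (cases "t < a")
 case False
 then have "A : sets (F t)" using A F_mono[of a t] by auto
 then show ?thesis using False t Xm[of t] unfolding X'_def[abs_def] by auto
 qed (simp add: X'_def[abs_def])
 show "AE w in P. cutI a A I 0 w = 0 & (ALL t:TI. - (2 * (c * ind A w)) <= X' t w & X' t w <= 0) & mono_on TI (%t. cutI a A I t w - X' t w)"
 using Xb mono
 proof eventually_elim
 case (elim w)
 have "mono_on TI (%t. cutI a A I t w - X' t w)"
 proof (rule mono_onI)
 fix r t assume rt: "r : TI" "t : TI" "r <= t"
 show "cutI a A I r w - X' r w <= cutI a A I t w - X' t w"
 proof (cases "w : A & a <= t")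
 case True
 have m: "I (max a r) w - X (max a r) w <= I t w - X t w" using mono_onD[OF elim(2), of "max a r" t] rt True by auto
 have "X a w <= 0" using elim(1) a by auto
 then show ?thesis using m True rt unfolding cutI_def X'_def by (cases "r < a") (auto simp: max_def)
 next
 case False
 then show ?thesis using rt unfolding cutI_def X'_def by (auto split: split_indicator)
 qed
 qed
 then show ?case using elim(1) c a unfolding cutI_def X'_def by (auto split: split_indicator)
 qed
 qed
 moreover have "Qv a Z w * ind A w = Qv 0 (cutZ a A Z) w" for w
 proof (cases "w : A")
 case True
 have "AE u in lborel. ennreal ((norm (Z u w))^2) * ind {a..T} u = ennreal ((norm (cutZ a A Z u w))^2) * ind TI u"
 using AE_lborel_singleton[of a] by eventually_elim (use True a in "auto simp: cutZ_def split: split_indicator")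
 from nn_integral_cong_AE[OF this] show ?thesis unfolding Qv_def using True by simp
 qed (simp add: Qv_def cutZ_def)
 ultimately show ?thesis by simp
qed

end

section \<open>Right-continuous paths with left limits, and integrals along them\<close>

definition dle :: "ennreal => real => bool" where "dle a x <-> 0 <= x & a <= ennreal x"

text \<open>Additivity is the reason why \<open>dle\<close> includes \<open>0 <= x\<close>:
  \<open>ennreal\<close> sends negative numbers to 0, and such bounds could not be added.\<close>

lemma dle_add: "dle a x ==> dle b y ==> dle (a + b) (x + y)"
 unfolding dle_def by (auto intro: add_mono)

lemma dle_mono: "dle a x ==> b <= a ==> x <= y ==> dle b y"
 unfolding dle_def by (auto intro: order_trans ennreal_leI)

lemma rcll_cong: "(!!t. t : {0..T} ==> x t = y t) ==> rcll T x ==> rcll T y"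
proof -
 assume eq: "!!t. t : {0..T} ==> x t = y t" and r: "rcll T x"
 show "rcll T y"
 unfolding rcll_def
 proof (intro conjI ballI)
 fix t assume t: "t : {0..<T}"
 have "(x \<longlongrightarrow> x t) (at_right t)" using r t unfolding rcll_def by blast
 moreover have "\<forall>\<^sub>F s in at_right t. x s = y s"
 unfolding eventually_at_right_field using t eq by (intro exI[of _ T]) auto
 ultimately show "(y \<longlongrightarrow> y t) (at_right t)" using eq[of t] t by (auto elim: Lim_transform_eventually)
 next
 fix t assume t: "t : {0<..T}"
 then obtain l where "(x \<longlongrightarrow> l) (at_left t)" using r unfolding rcll_def by blast
 moreover have "\<forall>\<^sub>F s in at_left t. x s = y s"
 unfolding eventually_at_left_field using t eq by (intro exI[of _ 0]) auto
 ultimately show "EX l. (y \<longlongrightarrow> l) (at_left t)" by (blast intro: Lim_transform_eventually)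
 qed
qed

lemma rcll_lin:
 assumes "rcll T x" "rcll T y"
 shows "rcll T (%t. c * x t + d * y t)"
 unfolding rcll_def
proof (intro conjI ballI)
 show "((%t. c * x t + d * y t) \<longlongrightarrow> c * x t + d * y t) (at_right t)" if "t : {0..<T}" for t
 using assms that unfolding rcll_def by (intro tendsto_intros) auto
 fix t assume t: "t : {0<..T}"
 then obtain l l' where "(x \<longlongrightarrow> l) (at_left t)" "(y \<longlongrightarrow> l') (at_left t)" using assms unfolding rcll_def by blast
 then show "EX l. ((%t. c * x t + d * y t) \<longlongrightarrow> l) (at_left t)" by (intro exI[of _ "c * l + d * l'"] tendsto_intros)
qed

lemma rcll_continuous:
 assumes "continuous_on {0..T} x" shows "rcll T x"
 unfolding rcll_def
proof (intro conjI ballI)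
 show "(x \<longlongrightarrow> x t) (at_right t)" if "t : {0..<T}" for t
 proof -
 have "(x \<longlongrightarrow> x t) (at t within {t..T})" by (rule tendsto_within_subset[where S = "{0..T}"]) (use assms that in "auto simp: continuous_on_def")
 moreover have "at t within {t..T} = at_right t" using that by (simp add: at_within_Icc_at_right)
 ultimately show ?thesis by simp
 qed
 show "EX l. (x \<longlongrightarrow> l) (at_left t)" if "t : {0<..T}" for t
 proof -
 have "(x \<longlongrightarrow> x t) (at t within {0..t})" by (rule tendsto_within_subset[where S = "{0..T}"]) (use assms that in "auto simp: continuous_on_def")
 moreover have "at t within {0..t} = at_left t" using that by (simp add: at_within_Icc_at_left)
 ultimately show ?thesis by auto
 qed
qed

lemma rcll_le:
 assumes x: "rcll T x" and y: "rcll T y" and T: "x T <= (y T :: real)" and le: "!!t. t : \<rat> Int {0..T} ==> x t <= y t" and t: "t : {0..T}"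
 shows "x t <= y t"
proof (cases "t = T")
 case False
 then have tT: "t < T" using t by simp
 obtain q where q: "q ~> t" "!!n. q n : \<rat> & t < q n & q n < T" using rational_sequence[OF tT] by blast
 have "x (q n) <= y (q n)" for n using q(2)[of n] t by (intro le) auto
 then show ?thesis
 by (intro LIMSEQ_le[OF rcll_right_sequence[OF x _ tT q(1)] rcll_right_sequence[OF y _ tT q(1)]])
 (use q(2) t in auto)
qed (use T in simp)

lemma rcll_paste:
 assumes x: "rcll T x" and y: "rcll T y"
 shows "rcll T (%s. if t <= s then y s else x s)" (is "rcll T ?z")
 unfolding rcll_def
proof (intro conjI ballI)
 fix s assume s: "s : {0..<T}"
 show "(?z \<longlongrightarrow> ?z s) (at_right s)"
 proof (cases "t <= s")
 case True
 then have "\<forall>\<^sub>F r in at_right s. y r = ?z r" unfolding eventually_at_right_field by (intro exI[of _ "s + 1"]) auto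
 then show ?thesis using y s True unfolding rcll_def by (auto elim!: Lim_transform_eventually)
 next
 case False
 then have "\<forall>\<^sub>F r in at_right s. x r = ?z r" unfolding eventually_at_right_field by (intro exI[of _ t]) auto
 then show ?thesis using x s False unfolding rcll_def by (auto elim!: Lim_transform_eventually)
 qed
next
 fix s assume s: "s : {0<..T}"
 show "EX l. (?z \<longlongrightarrow> l) (at_left s)"
 proof (cases "t < s")
 case True
 then have "\<forall>\<^sub>F r in at_left s. y r = ?z r" unfolding eventually_at_left_field by (intro exI[of _ t]) auto
 then show ?thesis using y s unfolding rcll_def by (blast intro: Lim_transform_eventually)
 next
 case False
 then have "\<forall>\<^sub>F r in at_left s. x r = ?z r" unfolding eventually_at_left_field by (intro exI[of _ "s - 1"]) auto
 then show ?thesis using x s unfolding rcll_def by (blast intro: Lim_transform_eventually)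
 qed
qed

lemma rcll_update_end: "rcll T x ==> rcll T (%t. if t = T then c else x t)"
 by (rule rcll_cong[OF _ rcll_paste[of T x "%_. c" T]]) (auto intro: rcll_continuous)

lemma set_integrable_sub:
 fixes h :: "real => real"
 assumes "set_integrable lborel {0..T} h" "0 <= s" "t <= T"
 shows "set_integrable lborel {s..t} h" "h integrable_on {s..t}" "(LINT u:{s..t}|lborel. h u) = integral {s..t} h"
proof -
 show *: "set_integrable lborel {s..t} h" using assms by (intro set_integrable_subset[OF assms(1)]) auto
 show "h integrable_on {s..t}" "(LINT u:{s..t}|lborel. h u) = integral {s..t} h" using set_borel_integral_eq_integral[OF *] by auto
qed

lemma nn_integral_excess:
 fixes h :: "real => real"
 assumes h: "set_integrable lborel {0..T} h" and st: "0 <= s" "s <= t" "t <= T" and m: "!!u. u : {s..t} ==> m <= h u"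
 shows "(\<integral>\<^sup>+u\<in>{s..t}. ennreal (h u - m) \<partial>lborel) = ennreal (integral {s..t} h - m * (t - s))" "m * (t - s) <= integral {s..t} h"
proof -
 note H = set_integrable_sub[OF h st(1,3)]
 have c: "set_integrable lborel {s..t} (%_. m)" unfolding set_integrable_def by (simp add: integrable_indicator_iff emeasure_lborel_Icc_eq)
 have i: "integrable lborel (%u. ind {s..t} u *\<^sub>R (h u - m))" using set_integral_diff(1)[OF H(1) c] unfolding set_integrable_def .
 have I: "(\<integral>u. ind {s..t} u *\<^sub>R (h u - m) \<partial>lborel) = integral {s..t} h - m * (t - s)"
 using set_integral_diff(2)[OF H(1) c] H(3) st unfolding set_lebesgue_integral_def by (simp add: mult.commute)
 have nn: "0 <= ind {s..t} u *\<^sub>R (h u - m)" for u using m by (simp split: split_indicator)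
 have "(\<integral>\<^sup>+u\<in>{s..t}. ennreal (h u - m) \<partial>lborel) = (\<integral>\<^sup>+u. ennreal (ind {s..t} u *\<^sub>R (h u - m)) \<partial>lborel)"
 by (intro nn_integral_cong) (simp split: split_indicator)
 then show "(\<integral>\<^sup>+u\<in>{s..t}. ennreal (h u - m) \<partial>lborel) = ennreal (integral {s..t} h - m * (t - s))"
 using nn_integral_eq_integral[OF i] nn I by simp
 have "0 <= (\<integral>u. ind {s..t} u *\<^sub>R (h u - m) \<partial>lborel)" by (intro Bochner_Integration.integral_nonneg nn)
 then show "m * (t - s) <= integral {s..t} h" unfolding I by simp
qed

lemma set_integrable_excess:
 fixes h :: "real => real"
 assumes h: "h : bm (restrict_space lborel {0..T})" and m: "!!u. u : {0..T} ==> m <= h u"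
 and fin: "(\<integral>\<^sup>+u\<in>{0..T}. ennreal (h u - m) \<partial>lborel) < \<infinity>"
 shows "set_integrable lborel {0..T} h"
proof -
 have [measurable]: "(%u. ind {0..T} u *\<^sub>R h u) : borel_measurable lborel" using h by (subst (asm) borel_measurable_restrict_space_iff) auto
 have "(\<integral>\<^sup>+u. ennreal (norm (ind {0..T} u *\<^sub>R (h u - m))) \<partial>lborel) = (\<integral>\<^sup>+u\<in>{0..T}. ennreal (h u - m) \<partial>lborel)"
 using m by (intro nn_integral_cong) (auto split: split_indicator)
 moreover have "(%u. ind {0..T} u *\<^sub>R (h u - m)) : borel_measurable lborel" unfolding scaleR_diff_right by measurable
 ultimately have "set_integrable lborel {0..T} (%u. h u - m)" unfolding set_integrable_def integrable_iff_bounded using fin by simp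
 moreover have "set_integrable lborel {0..T} (%_. m)" unfolding set_integrable_def by (simp add: integrable_indicator_iff emeasure_lborel_Icc_eq)
 ultimately have "set_integrable lborel {0..T} (%u. (h u - m) + m)" by (rule set_integral_add(1))
 then show ?thesis by simp
qed

section \<open>Bounded supersolutions as integral inequalities\<close>

locale bsde = wiener M T W for M :: "'a measure" and T :: real and W :: "real => 'a => real ^ 'n::finite" +
 fixes f :: "'n driver" and Xi :: "'a => real" and c\<^sub>0 :: real
 assumes f_meas: "driver T f" and f1: "cond_f1 T f" and f2: "cond_f2 T f" and f3: "cond_f3 T f" and f4: "cond_f4 T f" and f5: "cond_f5 T f"
 and f_inc: "increasing_in_y T f" and Xi_meas: "Xi : bm (F T)" and Xi_le: "AE w in P. abs (Xi w) <= c\<^sub>0"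
begin

lemma f_convex: "t : {0..T} ==> convex_on UNIV (%z. f t (bpath w) y z)"
 and f_mono: "t : {0..T} ==> y <= y' ==> f t (bpath w) y z <= f t (bpath w) y' z"
 using f1 f_inc bpath_C monoD[of "%y. f t (bpath w) y z" y y'] unfolding cond_f1_def increasing_in_y_def by blast+

lemma f_continuous:
 assumes t: "t : {0..T}" and z: "z ~> l"
 shows "(%n. f t (bpath w) y (z n)) ~> f t (bpath w) y l"
proof -
 obtain b where b: "0 <= b" "!!z1 z2. max (norm z1) (norm z2) <= norm l + 1 ==> abs (f t (bpath w) y z1 - f t (bpath w) y z2) <= b * norm (z1 - z2)"
 proof -
 have "0 <= norm l + 1" by simp
 from f4[unfolded cond_f4_def, rule_format, OF this] t bpath_C that show thesis by blast
 qed
 have "EV n. norm (z n) < norm l + 1" using tendsto_norm[OF z] by (rule order_tendstoD) simp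
 then have le: "EV n. norm (f t (bpath w) y (z n) - f t (bpath w) y l) <= b * norm (z n - l)"
 by eventually_elim (use b(2) in simp)
 have "(%n. b * norm (z n - l)) ~> b * norm (l - l)" by (intro tendsto_intros z)
 then have "(%n. b * norm (z n - l)) ~> 0" by simp
 from Lim_null_comparison[OF le this] show ?thesis by (simp add: LIM_zero_iff)
qed

text \<open>Affine growth in \<open>y\<close> from the Lipschitz condition and the bounds at
  \<open>y = 0\<close>. The upper bound concerns \<open>z = 0\<close>, where the upper barrier
  lives; the lower bound is uniform in \<open>z\<close>. Both share one constant, which becomes the
  rate of the barrier.\<close>

lemma f_bounds:
 shows "EX K>=1. ALL t:{0..T}. ALL w y z. f t (bpath w) y 0 <= K * (1 + abs y) & - K * (1 + abs y) <= f t (bpath w) y z"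
proof -
 obtain c where c: "!!t w. t : {0..T} ==> abs (f t (bpath w) 0 0) <= c" using f2 bpath_C unfolding cond_f2_def by blast
 obtain K where K: "0 <= K" "!!t w y z. t : {0..T} ==> abs (f t (bpath w) y z - f t (bpath w) 0 z) <= K * (sup_dist t (bpath w) (bpath w) + abs (y - 0))"
 using f3 bpath_C unfolding cond_f3_def by blast
 have K': "abs (f t (bpath w) y z - f t (bpath w) 0 z) <= K * abs y" if "t : {0..T}" for t w y z
 using K(2)[OF that, of w y z] that by (simp add: sup_dist_def)
 obtain m where m: "!!t w z. t : {0..T} ==> m <= f t (bpath w) 0 z"
 proof -
 obtain m where "ALL t:{0..T}. ALL w:C_paths T. ALL y:{-0..0}. ALL z. m <= f t w y z" using f5[unfolded cond_f5_def, rule_format, of 0] by auto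
 then show thesis using bpath_C by (intro that[of m]) auto
 qed
 define L where "L = 1 + K + abs c + abs m"
 have "f t (bpath w) y 0 <= L * (1 + abs y) & - L * (1 + abs y) <= f t (bpath w) y z" if t: "t : {0..T}" for t w y z
 proof -
 have "L * (1 + abs y) = L + K * abs y + (1 + abs c + abs m) * abs y" unfolding L_def by (simp add: algebra_simps)
 moreover have "0 <= (1 + abs c + abs m) * abs y" by simp
 ultimately have "K * abs y + abs c + abs m <= L * (1 + abs y)" unfolding L_def using K(1) by linarith
 then show ?thesis using K'[OF t, of w y 0] K'[OF t, of w y z] c[OF t, of w] m[OF t, of w z] by (simp add: abs_le_iff) linarith
 qed
 moreover have "1 <= L" unfolding L_def using K(1) by simp
 ultimately show ?thesis by blast
qed

definition lower :: "real => real => bool" where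
 "lower C m <-> 0 <= C & (ALL t:{0..T}. ALL w y z. abs y <= C --> m <= f t (bpath w) y z)"

definition drv :: "real => real => real => (real => 'a => real) => (real => 'a => real ^ 'n) => 'a => ennreal" where
 "drv m s t Y Z w = (\<integral>\<^sup>+u\<in>{s..t}. ennreal (f u (bpath w) (Y u w) (Z u w) - m) \<partial>lborel)"

text \<open>It says that \<open>Y s\<close> is at least \<open>Y t\<close> plus the integral of the
  driver minus the increment of \<open>I\<close>. Moving \<open>m * (t - s)\<close> to the other
  side makes the integrand nonnegative, so the statement has a meaning before integrability of the
  driver is known.\<close>

definition ineq :: "real => (real => 'a => real) => (real => 'a => real ^ 'n) => (real => 'a => real) => 'a => bool" where
 "ineq m Y Z I w <-> (ALL s t. 0 <= s & s <= t & t <= T --> dle (drv m s t Y Z w) (Y s w - Y t w + I t w - I s w - m * (t - s)))"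

text \<open>Supersolutions bounded by \<open>C\<close>, without their increasing part: subtracting a lower bound \<open>m\<close> of the driver makes the integral a monotone one.\<close>
definition adm :: "real => real => (real => 'a => real) => (real => 'a => real ^ 'n) => (real => 'a => real) => bool" where
 "adm C m Y Z I <-> pred Y & sint Z I & (AE w in P. rcll T (%t. Y t w) & (ALL t:{0..T}. abs (Y t w) <= C) & Y T w = Xi w & ineq m Y Z I w)"

lemma ineq_cong: assumes eq: "ALL t:{0..T}. Y' t w = Y t w" shows "ineq m Y' Z I w = ineq m Y Z I w"
proof -
 have "drv m s t Y' Z w = drv m s t Y Z w" if "0 <= s" "t <= T" for s t
 unfolding drv_def using eq that by (intro nn_integral_cong) (auto split: split_indicator)
 then have "dle (drv m s t Y' Z w) (Y' s w - Y' t w + I t w - I s w - m * (t - s)) = dle (drv m s t Y Z w) (Y s w - Y t w + I t w - I s w - m * (t - s))"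
 if "0 <= s & s <= t & t <= T" for s t using eq that by simp
 then show ?thesis unfolding ineq_def by blast
qed

text \<open>\<open>Y\<close> is a continuous adapted process minus an increasing one, normalized to
  start at 0; each of the two has a predictable version.\<close>

lemma predictable_version:
 assumes Y: "!!t. t : {0..T} ==> Y t : bm (F t)" and I: "sint Z I"
 and ae: "AE w in P. rcll T (%t. Y t w) & mono_on {0..T} (%t. I t w - m * t - Y t w)"
 shows "EX Y'. pred Y' & (AE w in P. ALL t:{0..T}. Y' t w = (Y t w :: real))"
proof -
 note D = sintD[OF I]
 have T0: "0 : {0..T}" using T_pos by simp
 define V where "V t w = I t w - m * t - (I 0 w - Y 0 w)" for t w
 define A where "A t w = V t w - Y t w" for t w
 have V: "V t : bm (F t)" if t: "t : {0..T}" for t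
 proof -
 note [measurable] = D(4)[OF t] mF_mono[OF _ D(4)[OF T0], of t] mF_mono[OF _ Y[OF T0], of t]
 show ?thesis unfolding V_def using t by simp
 qed
 have Vc: "AE w in P. continuous_on {0..T} (%t. V t w)"
 using D(6) by eventually_elim (auto simp: V_def intro!: continuous_intros)
 obtain V' where V': "pred V'" "AE w in P. ALL t:{0..T}. V' t w = V t w" using continuous_predictable[OF V Vc] by blast
 have "AE w in P. rcll T (%t. A t w) & mono_on {0..T} (%t. A t w) & A 0 w = 0"
 using ae Vc
 proof eventually_elim
 case (elim w)
 have "rcll T (%t. 1 * V t w + (-1) * Y t w)" by (rule rcll_lin[OF rcll_continuous[OF elim(2)]]) (use elim(1) in blast)
 moreover have "mono_on {0..T} (%t. A t w)"
 using elim(1) unfolding A_def V_def mono_on_def by (auto simp: algebra_simps)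
 ultimately show ?case unfolding A_def by (simp add: V_def)
 qed
 moreover have "A t : bm (F t)" if "t : {0..T}" for t unfolding A_def using V[OF that] Y[OF that] by simp
 ultimately obtain A' where A': "pred A'" "AE w in P. ALL t:{0..T}. A' t w = A t w" using increasing_predictable[of A] by blast
 define Y' where "Y' t w = V' t w - A' t w" for t w
 have "AE w in P. ALL t:{0..T}. Y' t w = Y t w" using V'(2) A'(2) by eventually_elim (simp add: Y'_def A_def)
 moreover have "pred Y'" using borel_measurable_diff[OF V'(1)[unfolded predictable_process_def] A'(1)[unfolded predictable_process_def]]
 unfolding predictable_process_def Y'_def by (simp add: case_prod_beta')
 ultimately show ?thesis by blast
qed

lemma ineq_mono: "ineq m Y Z I w ==> mono_on {0..T} (%t. I t w - m * t - Y t w)"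
 unfolding ineq_def dle_def mono_on_def by (simp add: algebra_simps)

lemma adm_AE:
 assumes Y: "pred Y'" and I: "sint Z I" and eq: "AE w in P. ALL t:{0..T}. Y' t w = Y t w"
 and ae: "AE w in P. rcll T (%t. Y t w) & (ALL t:{0..T}. abs (Y t w) <= C) & Y T w = Xi w & ineq m Y Z I w"
 shows "adm C m Y' Z I"
proof -
 have "AE w in P. rcll T (%t. Y' t w) & (ALL t:{0..T}. abs (Y' t w) <= C) & Y' T w = Xi w & ineq m Y' Z I w"
 using ae eq
 proof eventually_elim
 case (elim w)
 have "rcll T (%t. Y' t w)" by (rule rcll_cong[of T "%t. Y t w"]) (use elim in auto)
 then show ?case using elim ineq_cong[of Y' w Y m Z I, OF elim(2)] T_pos by auto
 qed
 then show ?thesis using Y I unfolding adm_def by blast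
qed

lemma admI:
 assumes Y: "!!t. t : {0..T} ==> Y t : bm (F t)" and I: "sint Z I"
 and ae: "AE w in P. rcll T (%t. Y t w) & (ALL t:{0..T}. abs (Y t w) <= C) & Y T w = Xi w & ineq m Y Z I w"
 shows "EX Y'. adm C m Y' Z I & (AE w in P. ALL t:{0..T}. Y' t w = Y t w)"
proof -
 have "AE w in P. rcll T (%t. Y t w) & mono_on {0..T} (%t. I t w - m * t - Y t w)"
 using ae by eventually_elim (blast intro: ineq_mono)
 from predictable_version[OF Y I this] obtain Y' where "pred Y'" "AE w in P. ALL t:{0..T}. Y' t w = Y t w" by blast
 with adm_AE[OF _ I _ ae] show ?thesis by blast
qed

text \<open>\<open>X = Y + m * t - c\<close> differs from the integral by a decreasing process, and
  this \<open>c\<close> places it between \<open>- 2 * c\<close> and 0; the summand 1 makes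
  \<open>c\<close> positive. The driver enters only through its lower bound \<open>m\<close>, whence
  a constant that is the same for the whole class.\<close>

lemma adm_energy:
 assumes adm: "adm C m Y Z I" and C: "0 <= C" and a: "a : {0..T}" and A: "A : sets (F a)"
 shows "(NN w. Qv a Z w * ind A w) <= ennreal (16 * (C + abs m * T + 1)^2) * emeasure P A"
proof -
 define c where "c = C + abs m * T + 1"
 have mT: "abs (m * t) <= abs m * T" if "t : {0..T}" for t using that by (auto simp: abs_mult intro!: mult_left_mono)
 have "0 <= abs m * T" using T_pos by simp
 then have c0: "0 < c" unfolding c_def using C by linarith
 define X where "X t w = Y t w + m * t - c" for t w
 show ?thesis unfolding c_def[symmetric]
 proof (rule energy_bound[where X = X, OF _ a A c0])
 show "sint Z I" using adm unfolding adm_def by blast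
 show "X t : bm (F t)" if "t : {a..T}" for t
 unfolding X_def using pred_adapted[of Y t] adm that a unfolding adm_def by auto
 have "AE w in P. ALL t:{0..T}. abs (Y t w) <= C" using adm unfolding adm_def by auto
 then show "AE w in P. ALL t:{a..T}. - (2 * c) <= X t w & X t w <= 0"
 proof eventually_elim
 case (elim w)
 show ?case
 proof
 fix t assume "t : {a..T}"
 then have "t : {0..T}" using a by auto
 define K where "K = abs m * T"
 have "abs (Y t w) <= C" "abs (m * t) <= K" unfolding K_def using bspec[OF elim \<open>t : {0..T}\<close>] mT[OF \<open>t : {0..T}\<close>] by auto
 then show "- (2 * c) <= X t w & X t w <= 0" using \<open>0 <= \<bar>m\<bar> * T\<close> C unfolding X_def c_def K_def[symmetric] by auto
 qed
 qed
 have "AE w in P. ineq m Y Z I w" using adm unfolding adm_def by auto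
 then show "AE w in P. mono_on {a..T} (%t. I t w - X t w)"
 proof eventually_elim
 case (elim w)
 show ?case using mono_on_subset[OF ineq_mono[OF elim], of "{a..T}"] a unfolding X_def mono_on_def by (auto simp: algebra_simps)
 qed
 qed
qed

lemma adm_EQ:
 assumes "adm C m Y Z I" "0 <= C"
 shows "EQ Z <= ennreal (16 * (C + abs m * T + 1)^2)"
proof -
 have "(NN w. Qv 0 Z w * ind (space M) w) = EQ Z" by (intro nn_integral_cong) simp
 then show ?thesis using adm_energy[OF assms, of 0 "space M"] T_pos sets.top[of "F 0"] emeasure_space_1 by simp
qed

end

section \<open>From supersolutions to inequalities and back\<close>

context bsde begin

lemma driver_section:
 assumes "driver T f'" "pred Y" "pred Z" "w : space M"
 shows "(%u. f' u (bpath w) (Y u w) (Z u w)) : bm LT"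
proof -
 have "(%(u, w). f' u (bpath w) (Y u w) (Z u w)) : bm (LT \<Otimes>\<^sub>M P)"
 by (rule measurable_from_subalg[OF _ driver_predictable[OF assms(1-3)]])
 (use predictable_sets_subset in "auto simp: subalgebra_def space_pair_measure")
 then show ?thesis using jm_section[of "%u w. f' u (bpath w) (Y u w) (Z u w)"] assms(4) unfolding jm_def by blast
qed

text \<open>The excess of \<open>f'\<close> over \<open>f\<close> and of \<open>Xi'\<close> over
  \<open>Xi\<close>, as well as the increase of \<open>A'\<close>, all act in the same direction and
  are absorbed by the inequality. \<open>Y'\<close> is altered at the single time \<open>T\<close>,
  where it is lowered to \<open>Xi\<close>; this preserves the path regularity, and monotonicity in
  \<open>y\<close> keeps the driver below.\<close>

lemma supersolution_adm:
 assumes sup: "supersolution M T W f' Xi' Y' Z' A'" and le: "ALL t:TI. ALL w:C_paths T. ALL y z. f t w y z <= f' t w y z"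
 and xi: "AE w in P. Xi w <= Xi' w" and b: "AE w in P. ALL t:TI. abs (Y' t w) <= C" "AE w in P. abs (Xi w) <= C" and m: "lower C m"
 shows "EX Y I. adm C m Y Z' I & (AE w in P. ALL t:TI. Y t w <= Y' t w)"
proof -
 note S = sup[unfolded supersolution_def]
 obtain I where I: "sint Z' I" "AE w in P. ALL t:TI. Y' t w = Xi' w + (LINT s:{t..T}|lborel. f' s (brownian_path T W w) (Y' s w) (Z' s w))
 - (I T w - I t w) + A' T w - A' t w" using S by (auto simp: AE_completion_iff)
 define Y where "Y t w = (if t = T then Xi w else Y' t w)" for t w
 have TT: "T : TI" using T_pos by simp
 have r: "AE w in P. rcll T (%t. Y' t w)" "AE w in P. mono_on TI (%t. A' t w)"
 "AE w in P. set_integrable lborel TI (%s. f' s (brownian_path T W w) (Y' s w) (Z' s w))"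
 using S by (auto simp: AE_completion_iff elim: eventually_mono)
 have main: "AE w in P. rcll T (%t. Y t w) & (ALL t:TI. abs (Y t w) <= C) & Y T w = Xi w & ineq m Y Z' I w & (ALL t:TI. Y t w <= Y' t w)"
 using r I(2) xi b bpath_AE
 proof eventually_elim
 case (elim w)
 define h where "h u = f' u (bpath w) (Y' u w) (Z' u w)" for u
 have h: "set_integrable lborel TI h" using elim(3) unfolding h_def elim(8) .
 have eq: "Y' t w = Xi' w + integral {t..T} h - (I T w - I t w) + A' T w - A' t w" if "t : TI" for t
 using elim(4)[rule_format, OF that] set_integrable_sub(3)[OF h, of t T] that unfolding h_def elim(8) by simp
 have YT: "Y' T w = Xi' w" using eq[OF TT] by simp
 have YY: "Y t w <= Y' t w" if "t : TI" for t unfolding Y_def using elim(5) YT by simp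
 have bnd: "abs (Y t w) <= C" if "t : TI" for t unfolding Y_def using elim(6,7) that by simp
 have fh: "m <= f u (bpath w) (Y u w) (Z' u w)" "f u (bpath w) (Y u w) (Z' u w) <= h u" if u: "u : TI" for u
 proof -
 show "m <= f u (bpath w) (Y u w) (Z' u w)" using m bnd[OF u] u unfolding lower_def by blast
 have "f u (bpath w) (Y u w) (Z' u w) <= f u (bpath w) (Y' u w) (Z' u w)" by (rule f_mono[OF u YY[OF u]])
 also have "... <= h u" unfolding h_def using le u bpath_C by blast
 finally show "f u (bpath w) (Y u w) (Z' u w) <= h u" .
 qed
 have "ineq m Y Z' I w" unfolding ineq_def
 proof (intro allI impI)
 fix s t assume st: "0 <= s & s <= t & t <= T"
 have "drv m s t Y Z' w <= (\<integral>\<^sup>+u\<in>{s..t}. ennreal (h u - m) \<partial>lborel)"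
 unfolding drv_def using fh(2) st by (intro nn_integral_mono) (auto intro!: ennreal_leI split: split_indicator)
 also have "... = ennreal (integral {s..t} h - m * (t - s))"
 by (rule nn_integral_excess(1)[OF h]) (use st in "auto intro!: order_trans[OF fh]")
 finally have 1: "drv m s t Y Z' w <= ennreal (integral {s..t} h - m * (t - s))" .
 have 2: "m * (t - s) <= integral {s..t} h" by (rule nn_integral_excess(2)[OF h]) (use st in "auto intro!: order_trans[OF fh]")
 have "integral {s..t} h <= Y s w - Y t w + I t w - I s w"
 \<comment> \<open>At \<open>s = t = T\<close> both ends are lowered and the claim is trivial; for
   \<open>s < t\<close> only the right end can be lowered, which helps.\<close>
 proof (cases "s = t")
 case False
 have "integral {s..t} h + integral {t..T} h = integral {s..T} h"
 using st by (intro Henstock_Kurzweil_Integration.integral_combine set_integrable_sub(2)[OF h]) auto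
 moreover have "A' s w <= A' t w" using elim(2) st by (auto intro: mono_onD)
 ultimately have "integral {s..t} h <= Y' s w - Y' t w + I t w - I s w" using eq[of s] eq[of t] st by simp
 also have "... <= Y s w - Y t w + I t w - I s w" using YY[of t] st False by (simp add: Y_def)
 finally show ?thesis .
 qed simp
 then show "dle (drv m s t Y Z' w) (Y s w - Y t w + I t w - I s w - m * (t - s))"
 by (intro dle_mono[OF _ 1, of "integral {s..t} h - m * (t - s)"]) (use 2 in "simp_all add: dle_def")
 qed
 then show ?case using rcll_update_end[OF elim(1), of "Xi w"] bnd YY by (auto simp: Y_def)
 qed
 have "Y t : bm (F t)" if "t : TI" for t
 using Xi_meas pred_adapted[of Y' t] S that unfolding Y_def by (cases "t = T") auto
 from admI[OF this I(1), of C m] main obtain Y2 where Y2: "adm C m Y2 Z' I" "AE w in P. ALL t:TI. Y2 t w = Y t w"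
 by (auto elim!: eventually_mono)
 have "AE w in P. ALL t:TI. Y2 t w <= Y' t w" using Y2(2) main by eventually_elim auto
 with Y2(1) show ?thesis by blast
qed

text \<open>\<open>A\<close> is the deficit of the inequality between 0 and \<open>t\<close>. Its
  definition uses \<open>drv\<close>, whose adaptedness follows from predictability without
  exceptional sets; only afterwards is it identified with the ordinary integral of the
  driver.\<close>

lemma adm_supersolution:
 assumes adm: "adm C m Y Z I" and m: "lower C m"
 shows "EX A. supersolution M T W f Xi Y Z A"
proof -
 have TT: "T : TI" "0 : TI" using T_pos by auto
 have Y: "pred Y" and I: "sint Z I" and ae: "AE w in P. rcll T (%t. Y t w) & (ALL t:TI. abs (Y t w) <= C) & Y T w = Xi w & ineq m Y Z I w"
 using adm unfolding adm_def by auto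
 note D = sintD[OF I]
 define h where "h w u = f u (bpath w) (Y u w) (Z u w)" for w u
 define A where "A t w = Y 0 w - Y t w + I t w - I 0 w - (enn2real (drv m 0 t Y Z w) + m * t)" for t w
 have main: "AE w in P. set_integrable lborel TI (h w) & (ALL t:TI. enn2real (drv m 0 t Y Z w) + m * t = integral {0..t} (h w)) &
 (ALL s t. 0 <= s & s <= t & t <= T --> integral {s..t} (h w) <= Y s w - Y t w + I t w - I s w)"
 using ae AE_space
 proof eventually_elim
 case (elim w)
 have mh: "m <= h w u" if "u : TI" for u using m elim that unfolding lower_def h_def by auto
 have dr: "drv m s t Y Z w = (\<integral>\<^sup>+u\<in>{s..t}. ennreal (h w u - m) \<partial>lborel)" for s t unfolding drv_def h_def ..
 have dle: "dle (drv m s t Y Z w) (Y s w - Y t w + I t w - I s w - m * (t - s))" if "0 <= s & s <= t & t <= T" for s t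
 using elim that unfolding ineq_def by blast
 have h: "set_integrable lborel TI (h w)"
 proof (rule set_integrable_excess)
 show "h w : bm (restrict_space lborel TI)" unfolding h_def[abs_def] using driver_section[OF f_meas Y D(1)] elim by simp
 show "(\<integral>\<^sup>+u\<in>TI. ennreal (h w u - m) \<partial>lborel) < \<infinity>"
 using dle[of 0 T] T_pos unfolding dle_def dr by (auto intro: le_less_trans)
 qed (rule mh)
 have e: "drv m s t Y Z w = ennreal (integral {s..t} (h w) - m * (t - s))" "m * (t - s) <= integral {s..t} (h w)" if "0 <= s & s <= t & t <= T" for s t
 unfolding dr using nn_integral_excess[OF h, of s t m] mh that by auto
 have "integral {s..t} (h w) <= Y s w - Y t w + I t w - I s w" if "0 <= s & s <= t & t <= T" for s t
 proof -
 note d = dle[OF that, unfolded dle_def e(1)[OF that]]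
 show ?thesis using d[THEN conjunct2] unfolding ennreal_le_iff[OF d[THEN conjunct1]] by simp
 qed
 moreover have "enn2real (drv m 0 t Y Z w) + m * t = integral {0..t} (h w)" if "t : TI" for t
 using e[of 0 t] that by simp
 ultimately show ?case using h by blast
 qed
 have "AE w in P. rcll T (%t. A t w) & mono_on TI (%t. A t w) & A 0 w = 0"
 using ae main D(6)
 proof eventually_elim
 case (elim w)
 have Aeq: "A t w = (Y 0 w + I t w - I 0 w - integral {0..t} (h w)) - Y t w" if "t : TI" for t
 using elim(2) that unfolding A_def by simp
 have hi: "h w integrable_on TI" using set_integrable_sub(2)[of T "h w" 0 T] elim(2) by simp
 have "continuous_on TI (%t. Y 0 w + I t w - I 0 w - integral {0..t} (h w))"
 using elim(3) indefinite_integral_continuous_1[OF hi] by (intro continuous_intros)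
 from rcll_lin[OF rcll_continuous[OF this], of "%t. Y t w" 1 "-1"]
 have r: "rcll T (%t. 1 * (Y 0 w + I t w - I 0 w - integral {0..t} (h w)) + - 1 * Y t w)" using elim(1) by blast
 have "rcll T (%t. A t w)" by (rule rcll_cong[OF _ r]) (simp add: Aeq)
 moreover have "mono_on TI (%t. A t w)"
 proof (rule mono_onI)
 fix s t assume st: "s : TI" "t : TI" "s <= t"
 have "integral {0..s} (h w) + integral {s..t} (h w) = integral {0..t} (h w)"
 using st elim(2) by (intro Henstock_Kurzweil_Integration.integral_combine set_integrable_sub(2)[of T "h w" 0 t]) auto
 moreover have "integral {s..t} (h w) <= Y s w - Y t w + I t w - I s w" using elim(2) st by auto
 ultimately show "A s w <= A t w" unfolding Aeq[OF st(1)] Aeq[OF st(2)] by linarith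
 qed
 ultimately show ?case using Aeq[OF TT(2)] by simp
 qed
 moreover have "A t : bm (F t)" if t: "t : TI" for t
 proof -
 have "(%(u, w). ennreal (f u (bpath w) (Y u w) (Z u w) - m)) : bm (PA)"
 using driver_predictable[OF f_meas Y D(1)] by (simp add: case_prod_beta')
 from predictable_integral_adapted[OF this t] have [measurable]: "drv m 0 t Y Z : bm (F t)" unfolding drv_def[abs_def] .
 have t0: "0 <= t" using t by simp
 note [measurable] = D(4)[OF t] mF_mono[OF t0 D(4)[OF TT(2)]] pred_adapted[OF Y t] mF_mono[OF t0 pred_adapted[OF Y TT(2)]]
 show ?thesis unfolding A_def by measurable
 qed
 ultimately obtain A' where A': "pred A'" "AE w in P. ALL t:TI. A' t w = A t w"
 and Ar: "AE w in P. rcll T (%t. A t w) & mono_on TI (%t. A t w) & A 0 w = 0" using increasing_predictable[of A] by blast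
 have 1: "AE w in P. rcll T (%t. A' t w) & mono_on TI (%t. A' t w) & A' 0 w = 0"
 using A'(2) Ar
 proof eventually_elim
 case (elim w)
 have "rcll T (%t. A' t w)" by (rule rcll_cong[of T "%t. A t w"]) (use elim in auto)
 moreover have "mono_on TI (%t. A' t w)" using elim unfolding mono_on_def by auto
 ultimately show ?case using elim TT by auto
 qed
 have 2: "AE w in P. set_integrable lborel TI (%s. f s (brownian_path T W w) (Y s w) (Z s w))"
 using main bpath_AE
 proof eventually_elim
 case (elim w)
 then show ?case unfolding h_def[abs_def] by simp
 qed
 have 3: "AE w in P. ALL t:TI. Y t w = Xi w + (LINT s:{t..T}|lborel. f s (brownian_path T W w) (Y s w) (Z s w))
 - (I T w - I t w) + A' T w - A' t w"
 using main bpath_AE A'(2) ae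
 proof eventually_elim
 case (elim w)
 show ?case
 proof
 fix t assume t: "t : TI"
 have "(LINT s:{t..T}|lborel. f s (brownian_path T W w) (Y s w) (Z s w)) = integral {t..T} (h w)"
 using set_integrable_sub(3)[of T "h w" t T] elim(1) t unfolding elim(2)[symmetric] h_def[abs_def] by auto
 moreover have "integral {0..t} (h w) + integral {t..T} (h w) = integral TI (h w)"
 using t elim(1) by (intro Henstock_Kurzweil_Integration.integral_combine set_integrable_sub(2)[of T "h w" 0 T]) auto
 moreover have "enn2real (drv m 0 t Y Z w) + m * t = integral {0..t} (h w)" "enn2real (drv m 0 T Y Z w) + m * T = integral TI (h w)"
 using elim(1) t TT by auto
 ultimately show "Y t w = Xi w + (LINT s:{t..T}|lborel. f s (brownian_path T W w) (Y s w) (Z s w)) - (I T w - I t w) + A' T w - A' t w"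
 using elim(3,4) t TT unfolding A_def by auto
 qed
 qed
 have 4: "AE w in M. set_integrable lborel TI (%s. (norm (Z s w))^2)" using I unfolding is_stochastic_integral_def by blast
 have 5: "AE w in P. rcll T (%t. Y t w)" using ae by eventually_elim blast
 show ?thesis
 unfolding supersolution_def terminal_condition_def
 using f_meas Xi_meas Y D(1) A'(1) 1 2 3 4 5 I by (intro exI[of _ A'] conjI exI[of _ I]) (auto simp: AE_completion_iff)
qed

end

section \<open>Pasting, and a sequence approaching the essential infimum\<close>

context bsde begin

definition Adm :: "real => real => (real => 'a => real) set" where
 "Adm C m = {Y. EX Z I. adm C m Y Z I}"

lemma AdmD:
 assumes "Y : Adm C m"
 shows "t : TI ==> Y t : bm (F t)" "AE w in P. ALL t:TI. abs (Y t w) <= C" "AE w in P. Y T w = Xi w" "AE w in P. rcll T (%t. Y t w)"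
 using assms pred_adapted[of Y t] unfolding Adm_def adm_def by (auto elim: eventually_mono)

text \<open>At time \<open>t\<close> the process switches to \<open>Y2\<close> on the event, known
  at \<open>t\<close>, that \<open>Y2\<close> is smaller. The switch is a downward jump, which the
  inequality tolerates, and the integral switches by \<open>sint_restrict\<close>. Times before
  \<open>t\<close> are left unchanged.\<close>

lemma adm_paste:
 assumes Y1: "Y1 : Adm C m" and Y2: "Y2 : Adm C m" and t: "t : TI"
 shows "EX Y:Adm C m. (AE w in P. ALL s:{0..<t}. Y s w = Y1 s w) & (AE w in P. Y t w = min (Y1 t w) (Y2 t w))"
proof -
 obtain Z1 I1 where 1: "adm C m Y1 Z1 I1" using Y1 unfolding Adm_def by blast
 obtain Z2 I2 where 2: "adm C m Y2 Z2 I2" using Y2 unfolding Adm_def by blast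
 have s1: "sint Z1 I1" and s2: "sint Z2 I2" and p: "pred Y1" "pred Y2" using 1 2 unfolding adm_def by auto
 define B where "B = {w:space M. Y2 t w < Y1 t w}"
 note [measurable] = AdmD(1)[OF Y1 t] AdmD(1)[OF Y2 t]
 have "{w:space (F t). Y2 t w < Y1 t w} : sets (F t)" by measurable
 then have B: "B : sets (F t)" unfolding B_def by simp
 define Y where "Y s w = (if w : B then if t <= s then Y2 s w else Y1 s w else Y1 s w)" for s w
 define Z where "Z u w = Z1 u w + cutZ t B (Z2 ~- Z1) u w" for u w
 define I where "I u w = I1 u w + cutI t B (I2 ~- I1) u w" for u w
 have sI: "sint Z I" unfolding Z_def[abs_def] I_def[abs_def]
 by (rule sint_add[OF s1 sint_restrict[OF sint_diff[OF s2 s1] t B]])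
 have "AE w in P. rcll T (%t. Y t w) & (ALL t:TI. abs (Y t w) <= C) & Y T w = Xi w & ineq m Y Z I w"
 using 1[unfolded adm_def, THEN conjunct2, THEN conjunct2] 2[unfolded adm_def, THEN conjunct2, THEN conjunct2] AE_space
 proof eventually_elim
 case (elim w)
 show ?case
 proof (cases "w : B")
 case False
 then have "Y s w = Y1 s w" "Z s w = Z1 s w" "I s w = I1 s w" for s unfolding Y_def Z_def I_def cutZ_def cutI_def by auto
 then show ?thesis using elim unfolding ineq_def drv_def by simp
 next
 case True
 have Ys: "Y s w = (if t <= s then Y2 s w else Y1 s w)" for s using True unfolding Y_def by simp
 have Zu: "Z u w = (if t < u then Z2 u w else Z1 u w)" if "u <= T" for u
 using True that unfolding Z_def cutZ_def by simp
 have Iu: "I u w = (if t <= u then I2 u w + I1 t w - I2 t w else I1 u w)" for u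
 using True unfolding I_def cutI_def by (simp add: max_def)
 define h1 h2 h where "h1 u = ennreal (f u (bpath w) (Y1 u w) (Z1 u w) - m)" and "h2 u = ennreal (f u (bpath w) (Y2 u w) (Z2 u w) - m)"
 and "h u = ennreal (f u (bpath w) (Y u w) (Z u w) - m)" for u
 have hh: "h u = (if t < u then h2 u else h1 u)" if "u ~= t" "u <= T" for u
 unfolding h_def h1_def h2_def Ys Zu[OF that(2)] using that(1) by simp
 have hm: "h1 : bm LT" "h2 : bm LT"
 unfolding h1_def h2_def using driver_section[OF f_meas p(1) sintD(1)[OF s1]] driver_section[OF f_meas p(2) sintD(1)[OF s2]] elim by auto
 have i1: "dle (\<integral>\<^sup>+u\<in>{s..r}. h1 u \<partial>lborel) (Y1 s w - Y1 r w + I1 r w - I1 s w - m * (r - s))"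
 and i2: "dle (\<integral>\<^sup>+u\<in>{s..r}. h2 u \<partial>lborel) (Y2 s w - Y2 r w + I2 r w - I2 s w - m * (r - s))"
 if "0 <= s & s <= r & r <= T" for s r using elim that unfolding ineq_def drv_def h1_def h2_def by auto
 have "ineq m Y Z I w" unfolding ineq_def drv_def h_def[symmetric]
 proof (intro allI impI)
 fix s r assume sr: "0 <= s & s <= r & r <= T"
 consider "r < t" | "t <= s" | "s < t" "t <= r" by linarith
 then show "dle (\<integral>\<^sup>+u\<in>{s..r}. h u \<partial>lborel) (Y s w - Y r w + I r w - I s w - m * (r - s))"
 proof cases
 case 1
 have "(\<integral>\<^sup>+u\<in>{s..r}. h u \<partial>lborel) = (\<integral>\<^sup>+u\<in>{s..r}. h1 u \<partial>lborel)"
 using 1 sr hh by (intro nn_integral_cong) (auto split: split_indicator)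
 then show ?thesis using i1[OF sr] 1 sr by (simp add: Ys Iu)
 next
 case 2
 have "(\<integral>\<^sup>+u\<in>{s..r}. h u \<partial>lborel) = (\<integral>\<^sup>+u\<in>{s..r}. h2 u \<partial>lborel)"
 by (rule nn_integral_cong_AE, use AE_lborel_singleton[of t] in eventually_elim) (use 2 sr hh in "auto split: split_indicator")
 then show ?thesis using i2[OF sr] 2 sr by (simp add: Ys Iu algebra_simps)
 next
 case 3
 have "(\<integral>\<^sup>+u\<in>{s..r}. h u \<partial>lborel) = (NL u. h u * ind {s..r} u)"
 by (subst nn_integral_restrict_space) (use sr in "auto intro!: nn_integral_cong split: split_indicator")
 also have "... <= (NL u. h1 u * ind {s..t} u + h2 u * ind {t..r} u)"
 proof (rule nn_integral_mono_AE)
 have "AE u in LT. u ~= t" using AE_lborel_singleton[of t] by (subst AE_restrict_space_iff) (auto elim: eventually_mono)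
 then show "AE u in LT. h u * ind {s..r} u <= h1 u * ind {s..t} u + h2 u * ind {t..r} u"
 using AE_space by eventually_elim (use 3 sr hh in "auto split: split_indicator")
 qed
 also have "... = (NL u. h1 u * ind {s..t} u) + (NL u. h2 u * ind {t..r} u)"
 using hm by (intro nn_integral_add borel_measurable_times_ennreal) (auto intro!: measurable_restrict_space1)
 also have "(NL u. h1 u * ind {s..t} u) = (\<integral>\<^sup>+u\<in>{s..t}. h1 u \<partial>lborel)"
 by (subst nn_integral_restrict_space) (use sr 3 in "auto intro!: nn_integral_cong split: split_indicator")
 also have "(NL u. h2 u * ind {t..r} u) = (\<integral>\<^sup>+u\<in>{t..r}. h2 u \<partial>lborel)"
 by (subst nn_integral_restrict_space) (use sr 3 in "auto intro!: nn_integral_cong split: split_indicator")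
 finally have le: "(\<integral>\<^sup>+u\<in>{s..r}. h u \<partial>lborel) <= (\<integral>\<^sup>+u\<in>{s..t}. h1 u \<partial>lborel) + (\<integral>\<^sup>+u\<in>{t..r}. h2 u \<partial>lborel)" .
 have "dle ((\<integral>\<^sup>+u\<in>{s..t}. h1 u \<partial>lborel) + (\<integral>\<^sup>+u\<in>{t..r}. h2 u \<partial>lborel))
 ((Y1 s w - Y1 t w + I1 t w - I1 s w - m * (t - s)) + (Y2 t w - Y2 r w + I2 r w - I2 t w - m * (r - t)))"
 by (intro dle_add i1 i2) (use sr 3 t in auto)
 then show ?thesis
 proof (rule dle_mono[OF _ le])
 have "Y2 t w <= Y1 t w" using True unfolding B_def by simp
 then show "(Y1 s w - Y1 t w + I1 t w - I1 s w - m * (t - s)) + (Y2 t w - Y2 r w + I2 r w - I2 t w - m * (r - t))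
 <= Y s w - Y r w + I r w - I s w - m * (r - s)" using 3 by (simp add: Ys Iu algebra_simps)
 qed
 qed
 qed
 then show ?thesis using elim rcll_paste[of T "%t. Y1 t w" "%t. Y2 t w" t] t unfolding Ys by auto
 qed
 qed
 moreover have "Y s : bm (F s)" if "s : TI" for s
 proof (cases "t <= s")
 case True
 have [measurable]: "B : sets (F s)" using B F_mono[OF True] by auto
 note [measurable] = AdmD(1)[OF Y1 that] AdmD(1)[OF Y2 that]
 show ?thesis unfolding Y_def[abs_def] using True by simp
 next
 case False
 then have "Y s = Y1 s" by (simp add: Y_def fun_eq_iff)
 then show ?thesis using AdmD(1)[OF Y1 that] by simp
 qed
 ultimately obtain Y' where Y': "adm C m Y' Z I" "AE w in P. ALL t:TI. Y' t w = Y t w" using admI[OF _ sI, of Y C m] by blast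
 have "AE w in P. ALL s:{0..<t}. Y' s w = Y1 s w" using Y'(2) by eventually_elim (use t in "auto simp: Y_def")
 moreover have "AE w in P. Y' t w = min (Y1 t w) (Y2 t w)" using Y'(2) AE_space by eventually_elim (use t in "auto simp: Y_def B_def")
 ultimately show ?thesis using Y'(1) unfolding Adm_def by blast
qed

text \<open>The times are treated in increasing order: pasting at \<open>t\<close> does not change
  earlier times, so what was achieved there persists.\<close>

lemma Adm_finite:
 assumes G: "finite G" "G \<subseteq> TI" and \<Phi>: "finite \<Phi>" "\<Phi> \<subseteq> Adm C m" and Y0: "Y0 : Adm C m"
 shows "EX R:Adm C m. ALL t:G. ALL S:\<Phi>. AE w in P. R t w <= S t w"
 using G
proof (induction G rule: finite_linorder_max_induct)
 case empty
 then show ?case using Y0 by blast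
next
 case (insert t G)
 then obtain R where R: "R : Adm C m" "!!s S. s : G ==> S : \<Phi> ==> AE w in P. R s w <= S s w" by auto
 have t: "t : TI" using insert.prems by simp
 have "EX R':Adm C m. (AE w in P. ALL s:{0..<t}. R' s w = R s w) & (ALL S:\<Phi>. AE w in P. R' t w <= S t w)"
 using \<Phi>
 proof (induction \<Phi> rule: finite_induct)
 case empty
 then show ?case using R(1) by (intro bexI[of _ R]) auto
 next
 case (insert S \<Phi>)
 then obtain R' where R': "R' : Adm C m" "AE w in P. ALL s:{0..<t}. R' s w = R s w" "!!S. S : \<Phi> ==> AE w in P. R' t w <= S t w" by auto
 obtain Y where Y: "Y : Adm C m" "AE w in P. ALL s:{0..<t}. Y s w = R' s w" "AE w in P. Y t w = min (R' t w) (S t w)"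
 using adm_paste[OF R'(1) _ t, of S] insert.prems by auto
 have "AE w in P. ALL s:{0..<t}. Y s w = R s w" using Y(2) R'(2) by eventually_elim simp
 moreover have "AE w in P. Y t w <= S' t w" if S': "S' : insert S \<Phi>" for S'
 proof (cases "S' = S")
 case True
 show ?thesis using Y(3) by eventually_elim (simp add: True)
 next
 case False
 then have "AE w in P. R' t w <= S' t w" using R'(3) S' by blast
 then show ?thesis using Y(3) by eventually_elim simp
 qed
 ultimately show ?case using Y(1) by blast
 qed
 then obtain R' where R': "R' : Adm C m" "AE w in P. ALL s:{0..<t}. R' s w = R s w" "!!S. S : \<Phi> ==> AE w in P. R' t w <= S t w" by blast
 have "AE w in P. R' s w <= S s w" if "s : insert t G" "S : \<Phi>" for s S
 proof (cases "s = t")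
 case True
 then show ?thesis using R'(3)[OF that(2)] by simp
 next
 case False
 then have s: "s : G" "s : {0..<t}" using that insert.hyps insert.prems by auto
 show ?thesis using R(2)[OF s(1) that(2)] R'(2) by eventually_elim (use s in auto)
 qed
 then show ?case using R'(1) by blast
qed

text \<open>At each time of \<open>D\<close> the means over the class have an infimum. The sequence
  \<open>R\<close> decreases eventually at each of these times and falls below near-minimizers, so
  its limit has minimal mean; pasting with any other member cannot lower that mean, hence the limit
  lies below that member almost surely.\<close>

lemma Adm_sequence:
 assumes Y0: "Y0 : Adm C m" and D: "countable D" "D ~= {}" "D \<subseteq> TI"
 shows "EX R V. (ALL n. R n : Adm C m) & (ALL t:D. (V t :: 'a => real) : bm (F t) & (AE w in P. (%n. R n t w) ~> V t w) &
 (ALL S:Adm C m. AE w in P. V t w <= S t w))"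
proof -
 define d where "d = from_nat_into D"
 have d: "range d = D" unfolding d_def using D by simp
 have dT: "d i : TI" for i using d D by blast
 have int: "integrable P (Y t)" and Ym: "Y t : bm P" if "Y : Adm C m" "t : TI" for Y t
 proof -
 show m: "Y t : bm P" by (rule mFP[OF AdmD(1)[OF that]])
 have "AE w in P. norm (Y t w) <= C" using AdmD(2)[OF that(1)] by eventually_elim (use that in auto)
 then show "integrable P (Y t)" by (rule integrable_const_bound[OF _ m])
 qed
 have Elow: "- C <= (EE w. Y t w)" if "Y : Adm C m" "t : TI" for Y t
 proof -
 have "AE w in P. - C <= Y t w" using AdmD(2)[OF that(1)] by eventually_elim (drule bspec[OF _ that(2)], linarith)
 from integral_mono_AE[OF _ int[OF that] this] show ?thesis using prob_space by simp
 qed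
 define e where "e t = Inf ((%Y. (EE w. Y t w)) ` Adm C m)" for t
 have e_le: "e t <= (EE w. Y t w)" if "Y : Adm C m" "t : TI" for Y t
 unfolding e_def using that Elow by (intro cInf_lower bdd_belowI[of _ "- C"]) auto
 have "ALL p. EX Y. Y : Adm C m & (EE w. Y (d (fst p)) w) < e (d (fst p)) + inverse (real (Suc (snd p)))"
 proof
 fix p :: "nat \<times> nat"
 have "EX x:(%Y. (EE w. Y (d (fst p)) w)) ` Adm C m. x < e (d (fst p)) + inverse (real (Suc (snd p)))"
 unfolding e_def by (rule cInf_lessD) (use Y0 in auto)
 then show "EX Y. Y : Adm C m & (EE w. Y (d (fst p)) w) < e (d (fst p)) + inverse (real (Suc (snd p)))" by blast
 qed
 from choice[OF this] obtain S where S: "!!p. S p : Adm C m" "!!p. (EE w. S p (d (fst p)) w) < e (d (fst p)) + inverse (real (Suc (snd p)))" by blast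
 \<comment> \<open>\<open>S (i, j)\<close> is within \<open>1 / (j + 1)\<close> of the infimum of
   means at time \<open>d i\<close>. The \<open>n\<close>-th term has to lie below all those with
   \<open>i\<close> and \<open>j\<close> up to \<open>n\<close>, finitely many conditions, so that
   \<open>Adm_finite\<close> applies.\<close>
 define A where "A n Y <-> Y : Adm C m & (ALL i<=n. ALL j<=n. AE w in P. Y (d i) w <= S (i, j) (d i) w)" for n :: nat and Y
 have step: "EX y. A n y & (ALL i<=n. AE w in P. y (d i) w <= x (d i) w)" if "x : Adm C m" for n x
 proof -
 have "finite (d ` {..n})" "d ` {..n} \<subseteq> TI" "finite (insert x (S ` ({..n} \<times> {..n})))" "insert x (S ` ({..n} \<times> {..n})) \<subseteq> Adm C m" using dT S that by auto
 from Adm_finite[OF this that] obtain R where R: "R : Adm C m" "ALL t:d ` {..n}. ALL S:insert x (S ` ({..n} \<times> {..n})). AE w in P. R t w <= S t w" by blast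
 then show ?thesis unfolding A_def by (intro exI[of _ R]) auto
 qed
 have "EX R. ALL n. A n (R n) & (ALL i<=Suc n. AE w in P. R (Suc n) (d i) w <= R n (d i) w)"
 proof (rule dependent_nat_choice)
 show "EX x. A 0 x" using step[OF Y0] by blast
 show "EX y. A (Suc n) y & (ALL i<=Suc n. AE w in P. y (d i) w <= x (d i) w)" if "A n x" for x n
 using step[of x "Suc n"] that unfolding A_def by blast
 qed
 then obtain R where R: "!!n. A n (R n)" "!!n i. i <= Suc n ==> AE w in P. R (Suc n) (d i) w <= R n (d i) w" by blast
 have RA: "R n : Adm C m" for n using R(1) unfolding A_def by blast
 define V where "V t w = lim (%n. R n t w)" for t w
 have lim: "AE w in P. (%n. R n (d i) w) ~> V (d i) w" for i
 proof -
 have "AE w in P. ALL n. R (Suc (n + i)) (d i) w <= R (n + i) (d i) w" unfolding AE_all_countable using R(2)[of i] by (auto simp: trans_le_add2 le_SucI)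
 moreover have "AE w in P. ALL n. ALL t:TI. abs (R n t w) <= C" unfolding AE_all_countable using AdmD(2)[OF RA] by blast
 ultimately show ?thesis
 proof eventually_elim
 case (elim w)
 have "decseq (%n. R (n + i) (d i) w)" by (rule decseq_SucI) (use elim(1) in simp)
 moreover have "ALL n. - C <= R (n + i) (d i) w" using elim(2) dT[of i] by (auto simp: abs_le_iff minus_le_iff)
 ultimately obtain L where "(%n. R (n + i) (d i) w) ~> L" using decseq_convergent by metis
 then have "(%n. R n (d i) w) ~> L" by (rule LIMSEQ_offset)
 then show ?case unfolding V_def by (simp add: limI)
 qed
 qed
 have Vm: "V t : bm (F t)" if "t : TI" for t
 unfolding V_def using AdmD(1)[OF RA that] by (rule borel_measurable_lim_metric)
 have "AE w in P. V (d i) w <= X (d i) w" if X: "X : Adm C m" for X i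
 proof -
 let ?t = "d i"
 note [measurable] = mFP[OF Vm[OF dT[of i]]] Ym[OF RA dT[of i]] Ym[OF X dT[of i]]
 have b: "AE w in P. abs (R n ?t w) <= C" "AE w in P. abs (X ?t w) <= C" for n
 using AdmD(2)[OF RA] AdmD(2)[OF X] by (eventually_elim; use dT[of i] in blast)+
 have 1: "(%n. (EE w. R n ?t w)) ~> (EE w. V ?t w)" and iV: "integrable P (V ?t)"
 proof -
 show "(%n. (EE w. R n ?t w)) ~> (EE w. V ?t w)"
 by (rule integral_dominated_convergence[where w = "%_. C"]) (use b(1) lim[of i] in auto)
 show "integrable P (V ?t)"
 by (rule integrable_dominated_convergence[where w = "%_. C" and s = "%n. R n ?t"]) (use b(1) lim[of i] in auto)
 qed
 have 2: "(%n. (EE w. min (R n ?t w) (X ?t w))) ~> (EE w. min (V ?t w) (X ?t w))"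
 proof (rule integral_dominated_convergence[where w = "%_. C"])
 show "AE w in P. (%n. min (R n ?t w) (X ?t w)) ~> min (V ?t w) (X ?t w)" using lim[of i] by eventually_elim (intro tendsto_intros)
 show "AE w in P. norm (min (R n ?t w) (X ?t w)) <= C" for n using b(1)[of n] b(2) by eventually_elim (auto simp: min_def)
 qed auto
 have "(EE w. V ?t w) <= e ?t + inverse (real (Suc j))" for j
 proof (rule LIMSEQ_le_const2[OF 1], intro exI[of _ "max i j"] allI impI)
 fix n assume n: "max i j <= n"
 then have "AE w in P. R n ?t w <= S (i, j) ?t w" using R(1)[of n] unfolding A_def by auto
 from integral_mono_AE[OF int[OF RA dT] int[OF S(1) dT] this] S(2)[of "(i, j)"]
 show "(EE w. R n ?t w) <= e ?t + inverse (real (Suc j))" by simp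
 qed
 moreover have "(%j. e ?t + inverse (real (Suc j))) ~> e ?t + 0" by (intro tendsto_intros LIMSEQ_inverse_real_of_nat)
 ultimately have "(EE w. V ?t w) <= e ?t" using LIMSEQ_le_const[of "%j. e ?t + inverse (real (Suc j))" "e ?t"] by auto
 \<comment> \<open>Pasting realizes \<open>min (R n) X\<close> at this time by a member of the
   class, so its mean is still at least the infimum.\<close>
 also have "... <= (EE w. min (V ?t w) (X ?t w))"
 proof (rule LIMSEQ_le_const[OF 2], intro exI[of _ 0] allI impI)
 fix n
 obtain Y where Y: "Y : Adm C m" "AE w in P. Y ?t w = min (R n ?t w) (X ?t w)" using adm_paste[OF RA X dT] by blast
 have "e ?t <= (EE w. Y ?t w)" by (rule e_le[OF Y(1) dT])
 also have "... = (EE w. min (R n ?t w) (X ?t w))" using Y(2) Ym[OF Y(1) dT] by (intro integral_cong_AE) auto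
 finally show "e ?t <= (EE w. min (R n ?t w) (X ?t w))" .
 qed
 finally have le: "(EE w. V ?t w) <= (EE w. min (V ?t w) (X ?t w))" .
 have im: "integrable P (%w. min (V ?t w) (X ?t w))" using iV int[OF X dT[of i]] by (rule integrable_min)
 have nn: "AE w in P. 0 <= V ?t w - min (V ?t w) (X ?t w)" by simp
 have "(EE w. V ?t w - min (V ?t w) (X ?t w)) = 0" using le integral_nonneg_AE[OF nn] iV im by simp
 then have "AE w in P. V ?t w - min (V ?t w) (X ?t w) = 0" using iV im nn by (subst (asm) integral_nonneg_eq_0_iff_AE) auto
 then show ?thesis by eventually_elim (simp add: min_def split: if_splits)
 qed
 then show ?thesis using RA Vm lim dT d by (intro exI[of _ R] exI[of _ V]) blast
qed

end

section \<open>Right-continuous regularization of a decreasing function on a countable set\<close>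

definition reg :: "real set => real => (real => real) => real => real" where
 "reg D T U t = Sup (U ` (D Int ({t<..} Un {T})))"

context
 fixes D :: "real set" and T :: real and U :: "real => real"
 assumes D: "0 : D" "T : D" "D \<subseteq> {0..T}" and anti': "ALL s:D. ALL t:D. s <= t --> U t <= U s"
begin

lemmas anti = anti'[rule_format]

text \<open>For decreasing \<open>U\<close> the supremum over later times is the right limit along
  \<open>D\<close>. The time \<open>T\<close> always counts as later, so the supremum is over a
  nonempty set even at \<open>t = T\<close>.\<close>

lemma reg_upper: "s : D ==> t < s \<or> s = T ==> U s <= reg D T U t"
 unfolding reg_def
proof (rule cSup_upper)
 show "bdd_above (U ` (D Int ({t<..} Un {T})))"
 proof (rule bdd_aboveI[of _ "U 0"])
 fix x assume "x : U ` (D Int ({t<..} Un {T}))"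
 then obtain r where "r : D" "x = U r" by blast
 then show "x <= U 0" using anti[OF D(1), of r] D(3) by auto
 qed
qed auto

lemma reg_approx: assumes "0 < e" shows "EX s:D. (t < s \<or> s = T) & reg D T U t - e < U s"
proof -
 have "U ` (D Int ({t<..} Un {T})) ~= {}" using D(2) by blast
 from less_cSupD[OF this, of "reg D T U t - e"] show ?thesis using assms unfolding reg_def by auto
qed

lemma reg_end: "reg D T U T = U T"
proof -
 have "D Int ({T<..} Un {T}) = {T}" using D by auto
 then show ?thesis unfolding reg_def by simp
qed

lemma reg_anti: "s <= t ==> reg D T U t <= reg D T U s"
proof (rule field_le_epsilon)
 fix e :: real assume st: "s <= t" and e: "0 < e"
 obtain r where r: "r : D" "t < r \<or> r = T" "reg D T U t - e < U r" using reg_approx[OF e] by blast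
 then have "U r <= reg D T U s" using st by (intro reg_upper) auto
 then show "reg D T U t <= reg D T U s + e" using r(3) by linarith
qed

text \<open>Stated relative to a set \<open>E\<close>, so that one argument gives both the right
  limit of \<open>U\<close> along \<open>D\<close> and the right-continuity of \<open>reg\<close>
  itself.\<close>

lemma reg_right:
 assumes t: "t < T" and y: "!!s. t < s ==> y s <= reg D T U t" "!!s r. t < s ==> s < r ==> r : D ==> s : E ==> U r <= y s"
 shows "(y \<longlongrightarrow> reg D T U t) (at t within ({t<..} Int E))"
proof (rule order_tendstoI)
 fix a assume "a < reg D T U t"
 then obtain r where r: "r : D" "t < r" "a < U r" using reg_approx[of "reg D T U t - a" t] t by auto
 have "\<forall>\<^sub>F s in at t within ({t<..} Int E). s < r & t < s & s : E"
 unfolding eventually_at using r(2) by (intro exI[of _ "r - t"]) (auto simp: dist_real_def)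
 then show "\<forall>\<^sub>F s in at t within ({t<..} Int E). a < y s"
 proof eventually_elim
 case (elim s)
 then have "U r <= y s" by (intro y(2) r(1)) auto
 then show ?case using r(3) by simp
 qed
next
 fix a assume a: "reg D T U t < a"
 have "\<forall>\<^sub>F s in at t within ({t<..} Int E). t < s" unfolding eventually_at by (intro exI[of _ 1]) auto
 then show "\<forall>\<^sub>F s in at t within ({t<..} Int E). y s < a" by eventually_elim (rule le_less_trans[OF y(1) a])
qed

lemma reg_sequence:
 assumes t: "t < T" and q: "q ~> t" "!!n. q n : D & t < q n"
 shows "(%n. U (q n)) ~> reg D T U t"
proof -
 have "((%s. if s : D then U s else reg D T U t) \<longlongrightarrow> reg D T U t) (at t within ({t<..} Int D))"
 by (rule reg_right[OF t]) (auto intro: reg_upper anti)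
 moreover have "filterlim q (at t within ({t<..} Int D)) sequentially"
 using q by (intro filterlim_at_withinI) (auto simp: less_imp_neq intro!: always_eventually)
 ultimately have "(%n. if q n : D then U (q n) else reg D T U t) ~> reg D T U t" by (rule filterlim_compose)
 then show ?thesis using q(2) by simp
qed

lemma reg_rcll: "rcll T (reg D T U)"
 unfolding rcll_def
proof (intro conjI ballI)
 fix t assume t: "t : {0..<T}"
 have "(reg D T U \<longlongrightarrow> reg D T U t) (at t within ({t<..} Int UNIV))"
 using t by (intro reg_right) (auto intro: reg_anti reg_upper)
 then show "(reg D T U \<longlongrightarrow> reg D T U t) (at_right t)" by simp
next
 fix t assume t: "t : {0<..T}"
 define l where "l = Inf (reg D T U ` {..<t})"
 have bdd: "bdd_below (reg D T U ` {..<t})" by (intro bdd_belowI[of _ "reg D T U t"]) (auto intro: reg_anti)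
 have "(reg D T U \<longlongrightarrow> l) (at_left t)"
 proof (rule order_tendstoI)
 fix a assume "a < l"
 moreover have "\<forall>\<^sub>F s in at_left t. s < t" unfolding eventually_at_left_field by (intro exI[of _ "t - 1"]) auto
 ultimately show "\<forall>\<^sub>F s in at_left t. a < reg D T U s"
 by (auto elim!: eventually_mono intro: less_le_trans simp: l_def intro!: cInf_lower bdd)
 next
 fix a assume "l < a"
 then obtain s where s: "s < t" "reg D T U s < a" using cInf_lessD[of "reg D T U ` {..<t}" a] unfolding l_def by auto
 then have "\<forall>\<^sub>F r in at_left t. s < r" unfolding eventually_at_left_field by (intro exI[of _ s]) auto
 then show "\<forall>\<^sub>F r in at_left t. reg D T U r < a" by eventually_elim (rule le_less_trans[OF reg_anti s(2)], simp)
 qed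
 then show "EX l. (reg D T U \<longlongrightarrow> l) (at_left t)" ..
qed

end

section \<open>The minimal element of a class\<close>

context bsde begin

text \<open>Fatou's lemma along convex combinations, using that the driver is convex in \<open>z\<close> and increasing in \<open>y\<close>.\<close>
lemma driver_fatou:
 assumes m: "lower C m" and c: "!!n. c n : weights n" and w: "w : space M" and st: "0 <= s" "s <= t" "t <= T"
 and p: "!!k. pred (R k)" "!!k. pred (Zk k)" and b: "!!k u. u : TI ==> abs (R k u w) <= C"
 and le: "!!k u. u : TI ==> Y u w <= R k u w"
 and Z: "AE u in LT. (%n. \<Sum>k | c n k ~= 0. c n k *\<^sub>R Zk k u w) ~> Z u w"
 and d: "!!k. dle (drv m s t (R k) (Zk k) w) (x k)" and x: "(%n. \<Sum>k | c n k ~= 0. c n k * x k) ~> (l :: real)"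
 shows "drv m s t Y Z w <= ennreal l"
proof -
 have c': "finite {k. c n k ~= 0}" "0 <= c n k" "(\<Sum>k | c n k ~= 0. c n k) = 1" for n k using c[of n] unfolding weights_def by auto
 define g where "g k u = f u (bpath w) (R k u w) (Zk k u w) - m" for k u
 have g0: "0 <= g k u" if "u : TI" for k u using m b[OF that] that unfolding lower_def g_def by auto
 have gm: "(%u. ennreal (g k u) * ind {s..t} u) : bm LT" for k
 unfolding g_def using driver_section[OF f_meas p w, of k k] by (intro borel_measurable_times_ennreal) (auto intro!: measurable_restrict_space1)
 have LTe: "(\<integral>\<^sup>+u\<in>{s..t}. h u \<partial>lborel) = (NL u. h u * ind {s..t} u)" for h
 by (subst nn_integral_restrict_space) (use st in "auto intro!: nn_integral_cong split: split_indicator")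
 define G where "G n u = (\<Sum>k | c n k ~= 0. ennreal (c n k) * (ennreal (g k u) * ind {s..t} u))" for n u
 have "drv m s t Y Z w <= (NL u. liminf (%n. G n u))"
 unfolding drv_def LTe
 proof (rule nn_integral_mono_AE)
 show "AE u in LT. ennreal (f u (bpath w) (Y u w) (Z u w) - m) * ind {s..t} u <= liminf (%n. G n u)"
 using Z AE_space
 proof eventually_elim
 case (elim u)
 then have u: "u : TI" by simp
 show ?case
 proof (cases "u : {s..t}")
 case True
 have jensen: "f u (bpath w) (Y u w) (\<Sum>k | c n k ~= 0. c n k *\<^sub>R Zk k u w) - m <= (\<Sum>k | c n k ~= 0. c n k * g k u)" for n
 proof -
 have "f u (bpath w) (Y u w) (\<Sum>k | c n k ~= 0. c n k *\<^sub>R Zk k u w) <= (\<Sum>k | c n k ~= 0. c n k * f u (bpath w) (Y u w) (Zk k u w))"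
 proof (rule convex_on_sum[OF c'(1) _ f_convex[OF u] c'(3)])
 show "{k. c n k ~= 0} ~= {}" using c'(3)[of n] by (metis sum.empty zero_neq_one)
 qed (use c'(2) in auto)
 also have "... <= (\<Sum>k | c n k ~= 0. c n k * (g k u + m))"
 unfolding g_def by (intro sum_mono mult_left_mono c') (use f_mono[OF u le[OF u]] in simp)
 also have "... = (\<Sum>k | c n k ~= 0. c n k * g k u) + m" using c'(3)[of n] by (simp add: distrib_left sum.distrib sum_distrib_right[symmetric])
 finally show ?thesis by simp
 qed
 have le': "ennreal (f u (bpath w) (Y u w) (\<Sum>k | c n k ~= 0. c n k *\<^sub>R Zk k u w) - m) <= G n u" for n
 proof -
 have "G n u = ennreal (\<Sum>k | c n k ~= 0. c n k * g k u)"
 unfolding G_def using True g0[OF u] c'(2) by (subst sum_ennreal[symmetric]) (auto simp: ennreal_mult)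
 then show ?thesis using jensen[of n] by (simp add: ennreal_leI)
 qed
 have "(%n. ennreal (f u (bpath w) (Y u w) (\<Sum>k | c n k ~= 0. c n k *\<^sub>R Zk k u w) - m)) ~> ennreal (f u (bpath w) (Y u w) (Z u w) - m)"
 by (intro tendsto_ennrealI tendsto_diff tendsto_const f_continuous[OF u elim(1)])
 from lim_imp_Liminf[OF sequentially_bot this]
 have "ennreal (f u (bpath w) (Y u w) (Z u w) - m) = liminf (%n. ennreal (f u (bpath w) (Y u w) (\<Sum>k | c n k ~= 0. c n k *\<^sub>R Zk k u w) - m))" by simp
 also have "... <= liminf (%n. G n u)" by (intro Liminf_mono always_eventually allI le')
 finally show ?thesis using True by simp
 qed simp
 qed
 qed
 also have "... <= liminf (%n. (NL u. G n u))"
 unfolding G_def by (intro nn_integral_liminf borel_measurable_sum borel_measurable_times_ennreal[OF borel_measurable_const gm])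
 also have "... <= liminf (%n. ennreal (\<Sum>k | c n k ~= 0. c n k * x k))"
 proof (intro Liminf_mono always_eventually allI)
 fix n
 have "(NL u. G n u) = (\<Sum>k | c n k ~= 0. ennreal (c n k) * drv m s t (R k) (Zk k) w)"
 unfolding G_def drv_def LTe g_def[symmetric] using gm by (simp add: nn_integral_sum nn_integral_cmult)
 also have "... <= (\<Sum>k | c n k ~= 0. ennreal (c n k) * ennreal (x k))" using d unfolding dle_def by (intro sum_mono mult_left_mono) auto
 also have "... = ennreal (\<Sum>k | c n k ~= 0. c n k * x k)"
 using d c'(2) unfolding dle_def by (subst sum_ennreal[symmetric]) (auto simp: ennreal_mult)
 finally show "(NL u. G n u) <= ennreal (\<Sum>k | c n k ~= 0. c n k * x k)" .
 qed
 also have "... = ennreal l" by (rule lim_imp_Liminf[OF sequentially_bot tendsto_ennrealI[OF x]])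
 finally show ?thesis .
qed

lemma ineqD: "ineq m Y Z I w ==> 0 <= s ==> s <= t ==> t <= T ==> dle (drv m s t Y Z w) (Y s w - Y t w + I t w - I s w - m * (t - s))"
 unfolding ineq_def by blast

text \<open>The convex weights are found for the integrands, but any tail combination of a
  convergent sequence keeps its limit; so the same weights serve for \<open>Z\<close>, for
  \<open>I\<close> and for the values of \<open>R\<close>. Since \<open>Y\<close> lies below every
  \<open>R k\<close>, monotonicity of the driver allows the common argument \<open>Y\<close> before
  convexity is used.\<close>

lemma Adm_minimal:
 assumes m: "lower C m" and Y0: "Y0 : Adm C m"
 shows "EX Y Z I. adm C m Y Z I & (ALL S:Adm C m. AE w in P. ALL t:TI. Y t w <= S t w)"
proof -
 define D where "D = (\<rat> Int TI) Un {T}"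
 have D: "countable D" "0 : D" "T : D" "D \<subseteq> TI" "D ~= {}" unfolding D_def using T_pos by (auto intro: countable_subset[OF _ countable_rat])
 obtain R V where R: "!!n. R n : Adm C m" and V: "!!t. t : D ==> (V t :: 'a => real) : bm (F t)"
 "!!t. t : D ==> AE w in P. (%n. R n t w) ~> V t w" "!!t S. t : D ==> S : Adm C m ==> AE w in P. V t w <= S t w"
 using Adm_sequence[OF Y0 D(1,5,4)] by blast
 have "ALL k. EX p. adm C m (R k) (fst p) (snd p)" using R unfolding Adm_def by auto
 from choice[OF this] obtain p where p: "!!k. adm C m (R k) (fst (p k)) (snd (p k))" by blast
 define Zk where "Zk k = fst (p k)" for k
 define Ik where "Ik k = snd (p k)" for k
 have adm: "adm C m (R k) (Zk k) (Ik k)" for k using p unfolding Zk_def Ik_def by simp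
 have sk: "sint (Zk k) (Ik k)" and pk: "pred (R k)" for k using adm[of k] unfolding adm_def by auto
 have C0: "0 <= C" using m unfolding lower_def by simp
 obtain c Z I where c: "!!n. c n : weights n" and I: "sint Z I"
 and Zlim: "AE w in P. AE u in LT. (%n. \<Sum>k | c n k ~= 0. c n k *\<^sub>R Zk k u w) ~> Z u w"
 and Ilim: "AE w in P. uniform_limit TI (%n t. \<Sum>k | c n k ~= 0. c n k * Ik k t w) (%t. I t w) sequentially"
 using sint_mazur[where Z = Zk and I = Ik, OF sk adm_EQ[OF adm C0]] by blast
 note DI = sintD[OF I]
 \<comment> \<open>The decreasing part of the infimum on \<open>D\<close>: it is the limit of convex
   combinations of \<open>uk\<close>, each decreasing by \<open>ineq\<close>. Regularizing it and
   adding back the continuous remainder gives a right-continuous process with left limits.\<close>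
 define U where "U w s = V s w + m * s - I s w" for w s
 define Y where "Y t w = I t w - m * t + reg D T (U w) t" for t w
 define uk where "uk k s w = R k s w + m * s - Ik k s w" for k s w
 have "AE w in P. ALL k. (ALL t:TI. abs (R k t w) <= C) & R k T w = Xi w & ineq m (R k) (Zk k) (Ik k) w"
 unfolding AE_all_countable using adm unfolding adm_def by (auto elim: eventually_mono)
 moreover have "AE w in P. ALL t:D. (%n. R n t w) ~> V t w" using V(2) D(1) by (subst AE_ball_countable) auto
 ultimately have good: "AE w in P. (ALL k. (ALL t:TI. abs (R k t w) <= C) & ineq m (R k) (Zk k) (Ik k) w) & V T w = Xi w & (ALL t:D. abs (V t w) <= C) &
 continuous_on TI (%t. I t w) & (ALL s:D. (%n. \<Sum>k | c n k ~= 0. c n k * uk k s w) ~> U w s) &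
 (ALL s:D. ALL t:D. s <= t --> U w t <= U w s)"
 using Ilim DI(6)
 proof eventually_elim
 case (elim w)
 have lim: "(%n. \<Sum>k | c n k ~= 0. c n k * uk k s w) ~> U w s" if s: "s : D" for s
 proof -
 have "(%n. \<Sum>k | c n k ~= 0. c n k * (R k s w + m * s)) ~> V s w + m * s"
 by (intro conv_weights_tendsto[OF c] tendsto_intros) (use elim(2) s in blast)
 moreover have "(%n. \<Sum>k | c n k ~= 0. c n k * Ik k s w) ~> I s w" using tendsto_uniform_limitI[OF elim(3)] s D(4) by blast
 ultimately have "(%n. (\<Sum>k | c n k ~= 0. c n k * (R k s w + m * s)) - (\<Sum>k | c n k ~= 0. c n k * Ik k s w)) ~> V s w + m * s - I s w"
 by (rule tendsto_diff)
 then show ?thesis unfolding U_def uk_def by (simp add: sum_subtractf[symmetric] right_diff_distrib)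
 qed
 have "U w t <= U w s" if "s : D" "t : D" "s <= t" for s t
 proof (rule LIMSEQ_le[OF lim lim])
 have "uk k t w <= uk k s w" for k
 proof -
 have ik: "ineq m (R k) (Zk k) (Ik k) w" using elim(1) by blast
 have "0 <= R k s w - R k t w + Ik k t w - Ik k s w - m * (t - s)" using ineqD[of m "R k" "Zk k" "Ik k" w s t] subsetD[OF D(4) that(1)] subsetD[OF D(4) that(2)] that(3) ik unfolding dle_def by simp
 then show ?thesis unfolding uk_def by (simp add: algebra_simps)
 qed
 then show "EX N. ALL n>=N. (\<Sum>k | c n k ~= 0. c n k * uk k t w) <= (\<Sum>k | c n k ~= 0. c n k * uk k s w)"
 using c unfolding weights_def by (intro exI[of _ 0] allI impI sum_mono mult_left_mono) auto
 qed (use that in auto)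
 moreover have "V T w = Xi w"
 proof (rule LIMSEQ_unique[OF bspec[OF elim(2) D(3)]])
 have "R n T w = Xi w" for n using elim(1) by blast
 then show "(%n. R n T w) ~> Xi w" by simp
 qed
 moreover have "abs (V t w) <= C" if "t : D" for t
 by (rule LIMSEQ_le_const2[OF tendsto_rabs[OF bspec[OF elim(2) that]]]) (use elim(1) that D(4) in auto)
 ultimately show ?case using elim(1,4) lim by blast
 qed
 have conv: "AE w in P. ALL t q. 0 <= t & t < T & q ~> t & (ALL n. q n : D & t < q n) --> (%n. V (q n) w) ~> Y t w"
 using good
 proof eventually_elim
 case (elim w)
 show ?case
 proof (intro allI impI)
 fix t q assume q: "0 <= t & t < T & q ~> t & (ALL n. q n : D & t < q n)"
 then have qT: "ALL n. q n : TI" using D(4) by blast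
 have "(%n. U w (q n)) ~> reg D T (U w) t" using q D(2-4) elim by (intro reg_sequence) blast+
 moreover have "continuous_on TI (%t. I t w)" using elim by blast
 then have "(%n. I (q n) w) ~> I t w"
 by (rule continuous_on_tendsto_compose[of "TI" "%t. I t w"]) (use q qT in auto)
 ultimately have "(%n. I (q n) w - m * q n + U w (q n)) ~> I t w - m * t + reg D T (U w) t" using q by (intro tendsto_intros) auto
 then show "(%n. V (q n) w) ~> Y t w" unfolding U_def Y_def by simp
 qed
 qed
 have seq: "EX q. q ~> t & (ALL n. q n : D & t < q n & q n < r)" if tr: "0 <= t" "t < r" "r <= T" for t r
 proof -
 obtain q where q: "q ~> t" "!!n. q n : \<rat> & t < q n & q n < r" using rational_sequence[OF tr(2)] by blast
 have "q n : D & t < q n & q n < r" for n using q(2)[of n] tr unfolding D_def by auto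
 then show ?thesis using q(1) by blast
 qed
 have Yreg: "AE w in P. rcll T (%t. Y t w) & mono_on TI (%t. I t w - m * t - Y t w) & (ALL t:TI. abs (Y t w) <= C) & Y T w = Xi w"
 using good conv
 proof eventually_elim
 case (elim w)
 have anti: "ALL s:D. ALL t:D. s <= t --> U w t <= U w s" and cI: "continuous_on TI (%t. I t w)" using elim(1) by blast+
 have "continuous_on TI (%t. I t w - m * t)" using cI by (intro continuous_intros)
 from rcll_lin[OF rcll_continuous[OF this] reg_rcll[OF D(2-4) anti], where c = 1 and d = 1]
 have "rcll T (%t. Y t w)" unfolding Y_def by simp
 moreover have "mono_on TI (%t. I t w - m * t - Y t w)" unfolding Y_def by (intro mono_onI) (simp add: reg_anti[OF D(2-4) anti])
 moreover have YT: "Y T w = Xi w" unfolding Y_def reg_end[OF D(2-4) anti] U_def using elim(1) by simp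
 moreover have "abs (Y t w) <= C" if t: "t : TI" for t
 proof (cases "t = T")
 case True
 then show ?thesis using YT elim(1) D(3) by auto
 next
 case False
 then obtain q where q: "q ~> t" "ALL n. q n : D & t < q n" using seq[of t T] t by auto
 then have "(%n. V (q n) w) ~> Y t w" using elim(2) t False by auto
 from LIMSEQ_le_const2[OF tendsto_rabs[OF this]] show ?thesis using elim(1) q(2) by blast
 qed
 ultimately show ?case by blast
 qed
 have Ym: "Y t : bm (F t)" if t: "t : TI" for t
 proof (cases "t = T")
 case True
 have "AE w in P. Xi w = Y T w" using Yreg by eventually_elim simp
 then show ?thesis unfolding True by (rule borel_F_AE[OF Xi_meas])
 next
 case False
 then have tT: "0 <= t" "t < T" using t by auto
 have bnd: "AE w in P. abs (Y t w) <= C" using Yreg by eventually_elim (use t in blast)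
 \<comment> \<open>\<open>Y t\<close> is a limit of values of \<open>V\<close> at times of
   \<open>D\<close> between \<open>t\<close> and \<open>r\<close>, hence known at every
   \<open>r > t\<close>; right-continuity of the filtration makes it known at
   \<open>t\<close>.\<close>
 show ?thesis
 proof (rule F_right_continuous[OF tT _ bnd])
 fix r assume r: "t < r" "r <= T"
 obtain q where q: "q ~> t" "!!n. q n : D & t < q n & q n < r" using seq[OF tT(1) r] by blast
 show "Y t : bm (F r)"
 proof (rule borel_F_AE_lim)
 show "V (q n) : bm (F r)" for n using mF_mono[OF _ V(1)[of "q n"], of r] q(2)[of n] by auto
 show "AE w in P. (%n. V (q n) w) ~> Y t w" using conv by eventually_elim (use q tT in blast)
 qed
 qed
 qed
 have below: "AE w in P. ALL t:TI. Y t w <= S t w" if S: "S : Adm C m" for S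
 proof -
 have "AE w in P. ALL t:D. V t w <= S t w" using V(3) S D(1) by (subst AE_ball_countable) auto
 then show ?thesis using AdmD(4)[OF S] AdmD(3)[OF S] conv Yreg
 proof eventually_elim
 case (elim w)
 show ?case
 proof
 fix t assume t: "t : TI"
 show "Y t w <= S t w"
 proof (cases "t = T")
 case True
 then show ?thesis using elim(3,5) by simp
 next
 case False
 then have tT: "0 <= t" "t < T" using t by auto
 then obtain q where q: "q ~> t" "!!n. q n : D & t < q n" using seq[of t T] by blast
 have "(%n. V (q n) w) ~> Y t w" using elim(4) q tT by blast
 moreover have "(%n. S (q n) w) ~> S t w" by (rule rcll_right_sequence[OF elim(2) tT q(1)]) (use q(2) in blast)
 ultimately show ?thesis by (rule LIMSEQ_le) (use elim(1) q(2) in blast)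
 qed
 qed
 qed
 qed
 have "AE w in P. rcll T (%t. Y t w) & mono_on TI (%t. I t w - m * t - Y t w)" using Yreg by eventually_elim blast
 from predictable_version[OF Ym I this] obtain Y' where Y': "pred Y'" "AE w in P. ALL t:TI. Y' t w = Y t w" by blast
 have "AE w in P. ALL k. ALL t:TI. Y t w <= R k t w" unfolding AE_all_countable using below[OF R] by blast
 then have "AE w in P. rcll T (%t. Y t w) & (ALL t:TI. abs (Y t w) <= C) & Y T w = Xi w & ineq m Y Z I w"
 using good Yreg Zlim Y'(2) AE_space
 proof eventually_elim
 case (elim w)
 have w: "w : space M" using elim(6) by simp
 have anti: "ALL s:D. ALL t:D. s <= t --> U w t <= U w s" using elim(2) by blast
 define x where "x t = reg D T (U w) t" for t
 \<comment> \<open>Between two times of \<open>D\<close> the values of \<open>R\<close> converge and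
   \<open>driver_fatou\<close> applies directly; other times are reached from these.\<close>
 have onD: "drv m s t Y Z w <= ennreal (U w s - U w t)" if st: "s : D" "t : D" "s <= t" for s t
 proof (rule driver_fatou[where R = R and Zk = Zk and c = c and C = C and x = "%k. uk k s w - uk k t w", OF m c w])
 show "pred (R k)" "pred (Zk k)" for k by (rule pk, rule sintD(1)[OF sk])
 show "AE u in LT. (%n. \<Sum>k | c n k ~= 0. c n k *\<^sub>R Zk k u w) ~> Z u w" by (rule elim(4))
 show "dle (drv m s t (R k) (Zk k) w) (uk k s w - uk k t w)" for k
 proof -
 have "dle (drv m s t (R k) (Zk k) w) (R k s w - R k t w + Ik k t w - Ik k s w - m * (t - s))" by (rule ineqD) (use elim(2) st D(4) in auto)
 moreover have "R k s w - R k t w + Ik k t w - Ik k s w - m * (t - s) = uk k s w - uk k t w" unfolding uk_def by (simp add: algebra_simps)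
 ultimately show ?thesis by simp
 qed
 have "(%n. (\<Sum>k | c n k ~= 0. c n k * uk k s w) - (\<Sum>k | c n k ~= 0. c n k * uk k t w)) ~> U w s - U w t"
 using elim(2) st by (intro tendsto_diff) auto
 then show "(%n. \<Sum>k | c n k ~= 0. c n k * (uk k s w - uk k t w)) ~> U w s - U w t" by (simp add: sum_subtractf right_diff_distrib)
 qed (use st D(4) elim(1,2) in auto)
 define h where "h u = ennreal (f u (bpath w) (Y' u w) (Z u w) - m)" for u
 have hm: "h : bm LT" unfolding h_def using driver_section[OF f_meas Y'(1) DI(1) w] by auto
 have dr: "drv m s t Y Z w = (NL u. h u * ind {s..t} u)" if "0 <= s" "t <= T" for s t
 unfolding drv_def h_def by (subst nn_integral_restrict_space) (use elim(5) that in "auto intro!: nn_integral_cong split: split_indicator")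
 have "ineq m Y Z I w" unfolding ineq_def
 proof (intro allI impI)
 fix s t assume st: "0 <= s & s <= t & t <= T"
 have xx: "Y s w - Y t w + I t w - I s w - m * (t - s) = x s - x t" unfolding Y_def x_def by (simp add: algebra_simps)
 have xle: "x t <= x s" unfolding x_def using st reg_anti[OF D(2-4) anti] by blast
 show "dle (drv m s t Y Z w) (Y s w - Y t w + I t w - I s w - m * (t - s))"
 unfolding xx dle_def
 proof (intro conjI)
 show "drv m s t Y Z w <= ennreal (x s - x t)"
 proof (cases "s = t")
 case True
 have "(\<integral>\<^sup>+u\<in>{t}. k u \<partial>lborel) = 0" for k :: "real => ennreal"
 using nn_integral_cong_AE[of "%u. k u * ind {t} u" "%_. 0" lborel] AE_lborel_singleton[of t] by (auto elim: eventually_mono)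
 then show ?thesis unfolding drv_def True by simp
 next
 case False
 then have "s < t" using st by simp
 from seq[OF _ this] st obtain q where q: "q ~> s" "!!n. q n : D & s < q n & q n < t" by blast
 \<comment> \<open>The left end is approached from the right by \<open>q n\<close> in
   \<open>D\<close>; the right end is moved outwards to some \<open>t'\<close> in \<open>D\<close>
   where \<open>U\<close> is within \<open>e\<close> of its regularization at \<open>t\<close>.
   Enlarging the interval is allowed because the integrand of \<open>drv\<close> is
   nonnegative.\<close>
 have eps: "drv m s t Y Z w <= ennreal (x s - x t) + ennreal e" if e: "0 < e" for e
 proof -
 obtain t' where t': "t' : D" "t < t' \<or> t' = T" "x t - e < U w t'" using reg_approx[where t = t, OF D(2-4) anti e] unfolding x_def by blast
 have tt: "t <= t'" "t' <= T" using t' st D(4) by auto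
 have "drv m s t Y Z w <= liminf (%n. (NL u. h u * ind {q n..t'} u))"
 unfolding dr[OF conjunct1[OF st] conjunct2[OF conjunct2[OF st]]]
 proof (rule LT_fatou[OF hm])
 show "AE u in LT. u : {s..t} --> (EV n. u : {q n..t'})"
 using AE_LT_neq[of s] proof eventually_elim
 case (elim u)
 have "s < u ==> EV n. q n < u" by (rule order_tendstoD(2)[OF q(1)])
 then show ?case using elim tt by (cases "s < u") (auto elim!: eventually_mono)
 qed
 qed simp
 also have "... <= ennreal (x s - x t) + ennreal e"
 proof (intro Liminf_le always_eventually allI sequentially_bot)
 fix n
 have qn: "q n : D" "s < q n" "q n <= t'" "0 <= q n" using q(2)[of n] tt st by auto
 have "(NL u. h u * ind {q n..t'} u) <= ennreal (U w (q n) - U w t')"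
 using onD[OF qn(1) t'(1) qn(3)] dr[OF qn(4) tt(2)] by simp
 also have "U w (q n) <= x s" unfolding x_def by (rule reg_upper[OF D(2-4) anti qn(1)]) (use qn in auto)
 then have "ennreal (U w (q n) - U w t') <= ennreal ((x s - x t) + e)" using t'(3) by (intro ennreal_leI) linarith
 also have "... = ennreal (x s - x t) + ennreal e" using xle e by (intro ennreal_plus) auto
 finally show "(NL u. h u * ind {q n..t'} u) <= ennreal (x s - x t) + ennreal e" .
 qed
 finally show ?thesis .
 qed
 show ?thesis by (rule ennreal_le_epsilon[OF eps])
 qed
 qed (use xle in simp)
 qed
 then show ?case using elim(3) by blast
 qed
 from adm_AE[OF Y'(1) I Y'(2) this] have "adm C m Y' Z I" .
 moreover have "AE w in P. ALL t:TI. Y' t w <= S t w" if "S : Adm C m" for S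
 using below[OF that] Y'(2) by eventually_elim auto
 ultimately show ?thesis by blast
qed

end

section \<open>The exponential barrier and a bound common to all classes\<close>

context bsde begin

text \<open>The solution of \<open>y' = - 2 * K * y\<close> with \<open>y T = c\<^sub>0 + 1\<close>.
  The extra 1 gives \<open>1 <= y\<close>, so that the growth bound \<open>K * (1 + y)\<close> is at
  most \<open>2 * K * y\<close>, and it leaves a margin over the terminal value.\<close>

definition bar :: "real => real => real" where
 "bar K t = (c\<^sub>0 + 1) * exp (2 * K * (T - t))"

lemma c0_nonneg: "0 <= c\<^sub>0"
proof -
 have "AE w in P. 0 <= c\<^sub>0" using Xi_le by eventually_elim linarith
 then show ?thesis by simp
qed

lemma barrier_bounds:
 assumes "1 <= K" "t : TI" shows "c\<^sub>0 + 1 <= bar K t" "bar K t <= bar K 0"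
proof -
 have "(c\<^sub>0 + 1) * 1 <= (c\<^sub>0 + 1) * exp (2 * K * (T - t))" using assms c0_nonneg by (intro mult_left_mono) auto
 then show "c\<^sub>0 + 1 <= bar K t" unfolding bar_def by simp
 show "bar K t <= bar K 0" unfolding bar_def using assms c0_nonneg by (intro mult_left_mono) auto
qed

lemma barrier_integral:
 assumes "s <= t" and nonneg: "!!u. u : {s..t} ==> 0 <= a * (2 * K * bar K u) - m"
 shows "(\<integral>\<^sup>+u\<in>{s..t}. ennreal (a * (2 * K * bar K u) - m) \<partial>lborel) = ennreal (a * (bar K s - bar K t) - m * (t - s))"
 and "0 <= a * (bar K s - bar K t) - m * (t - s)"
proof -
 define G where "G u = - a * bar K u - m * u" for u
 have d: "(G has_real_derivative a * (2 * K * bar K u) - m) (at u within X)" for u X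
 unfolding G_def bar_def by (auto intro!: derivative_eq_intros simp: field_simps)
 have G: "G t - G s = a * (bar K s - bar K t) - m * (t - s)" unfolding G_def by (simp add: algebra_simps)
 have b: "(%u. a * (2 * K * bar K u) - m) : borel_measurable borel" unfolding bar_def by measurable
 show "(\<integral>\<^sup>+u\<in>{s..t}. ennreal (a * (2 * K * bar K u) - m) \<partial>lborel) = ennreal (a * (bar K s - bar K t) - m * (t - s))"
 unfolding G[symmetric] by (rule nn_integral_FTC_Icc[OF b _ _ assms(1)]) (use d nonneg in auto)
 have "G s <= G t" by (rule DERIV_nonneg_imp_nondecreasing[OF assms(1)], intro exI conjI, rule d, rule nonneg) simp
 then show "0 <= a * (bar K s - bar K t) - m * (t - s)" using G by simp
qed

definition f_bound :: "real => bool" where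
 "f_bound K <-> 1 <= K & (ALL t:TI. ALL w y z. f t (bpath w) y 0 <= K * (1 + abs y) & - K * (1 + abs y) <= f t (bpath w) y z)"

text \<open>With integrand 0 the barrier decreases at least as fast as the driver demands, and at
  \<open>T\<close> it drops to \<open>Xi\<close>, a downward jump. This shows that the class is
  nonempty and that its minimal element is below the barrier.\<close>

lemma barrier_Adm:
 assumes K: "f_bound K" and m: "lower C m" and C: "bar K 0 <= C"
 shows "EX Y:Adm C m. AE w in P. ALL t:TI. Y t w <= bar K t"
proof -
 have K1: "1 <= K" using K unfolding f_bound_def by blast
 note b = barrier_bounds[OF K1]
 define Y where "Y t w = (if t = T then Xi w else bar K t)" for t w
 have TT: "T : TI" using T_pos by simp
 have dr: "drv m s t Y (%_ _. 0) w <= ennreal (1 * (bar K s - bar K t) - m * (t - s)) & 0 <= 1 * (bar K s - bar K t) - m * (t - s)"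
 if st: "0 <= s" "s <= t" "t <= T" for s t w
 proof -
 have fb: "f u (bpath w) (bar K u) 0 <= 2 * K * bar K u" and mb: "m <= 2 * K * bar K u" if u: "u : TI" for u
 proof -
 have B: "1 <= bar K u" using b(1)[OF u] c0_nonneg by linarith
 have "f u (bpath w) (bar K u) 0 <= K * (1 + abs (bar K u))" using K u unfolding f_bound_def by blast
 also have "... <= K * (2 * bar K u)" using K1 B by (intro mult_left_mono) auto
 finally show F: "f u (bpath w) (bar K u) 0 <= 2 * K * bar K u" by simp
 have "m <= f u (bpath w) (bar K u) 0" using m u B b(2)[OF u] C unfolding lower_def by auto
 then show "m <= 2 * K * bar K u" using F by simp
 qed
 have nn: "!!u. u : {s..t} ==> 0 <= 1 * (2 * K * bar K u) - m" using mb st by auto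
 have "drv m s t Y (%_ _. 0) w <= (\<integral>\<^sup>+u\<in>{s..t}. ennreal (1 * (2 * K * bar K u) - m) \<partial>lborel)"
 unfolding drv_def
 proof (rule nn_integral_mono_AE)
 show "AE u in lborel. ennreal (f u (bpath w) (Y u w) 0 - m) * ind {s..t} u <= ennreal (1 * (2 * K * bar K u) - m) * ind {s..t} u"
 using AE_lborel_singleton[of T]
 proof eventually_elim
 case (elim u)
 have "ennreal (f u (bpath w) (Y u w) 0 - m) <= ennreal (1 * (2 * K * bar K u) - m)" if "u : {s..t}"
 using fb[of u] that st elim unfolding Y_def by (intro ennreal_leI) auto
 then show ?case by (auto split: split_indicator)
 qed
 qed
 then show ?thesis using barrier_integral[OF st(2) nn] by simp
 qed
 have "AE w in P. rcll T (%t. Y t w) & (ALL t:TI. abs (Y t w) <= C) & Y T w = Xi w & ineq m Y (%_ _. 0) (%_ _. 0) w"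
 using Xi_le
 proof eventually_elim
 case (elim w)
 have "continuous_on TI (bar K)" unfolding bar_def by (intro continuous_intros)
 from rcll_update_end[OF rcll_continuous[OF this]] have "rcll T (%t. Y t w)" unfolding Y_def .
 moreover have "abs (Y t w) <= C" if t: "t : TI" for t using elim b[OF t] b[OF TT] C c0_nonneg unfolding Y_def by auto
 moreover have "ineq m Y (%_ _. 0) (%_ _. 0) w"
 unfolding ineq_def
 proof (intro allI impI)
 fix s t assume st: "0 <= s & s <= t & t <= T"
 have "Y t w <= bar K t" using elim b(1)[OF TT] unfolding Y_def by (cases "t = T") simp_all
 moreover have "Y s w = bar K s" if "s < t" using that st unfolding Y_def by simp
 ultimately have *: "1 * (bar K s - bar K t) - m * (t - s) <= Y s w - Y t w + 0 - 0 - m * (t - s)"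
 using st by (cases "s = t") simp_all
 have "dle (drv m s t Y (%_ _. 0) w) (1 * (bar K s - bar K t) - m * (t - s))"
 unfolding dle_def using dr[of s t w] st by blast
 from dle_mono[OF this order_refl *] show "dle (drv m s t Y (%_ _. 0) w) (Y s w - Y t w + 0 - 0 - m * (t - s))" .
 qed
 ultimately show ?case unfolding Y_def by simp
 qed
 moreover have "Y t : bm (F t)" for t
 using Xi_meas unfolding Y_def[abs_def] by (cases "t = T") auto
 ultimately obtain Y' where Y': "adm C m Y' (%_ _. 0) (%_ _. 0)" "AE w in P. ALL t:TI. Y' t w = Y t w"
 using admI[where Y = Y, OF _ sint_zero] by blast
 have "AE w in P. ALL t:TI. Y' t w <= bar K t"
 using Y'(2) Xi_le
 proof eventually_elim
 case (elim w)
 have "Y t w <= bar K t" for t using elim(2) b(1)[OF TT] unfolding Y_def by (cases "t = T") simp_all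
 then show ?case using elim(1) by simp
 qed
 then show ?thesis using Y'(1) unfolding Adm_def by blast
qed

text \<open>Where \<open>Y >= - k * bar K\<close>, the driver is at least
  \<open>- K * (1 + k) * bar K\<close>, which is exactly the rate at which
  \<open>v = - ((1 + k) / 2) * bar K\<close> moves. Hence on the event that \<open>Y s\<close> is
  below \<open>v s\<close> the increment of the martingale \<open>I\<close> from \<open>s\<close> to
  \<open>T\<close> is at least 1, by the margin at the terminal time; its mean over that event is 0,
  so the event is null. The condition on \<open>m\<close> keeps the comparison integrand
  nonnegative.\<close>

lemma lower_bound_step:
 assumes K: "f_bound K" and adm: "adm C m Y Z I" and k: "1 <= k" "k <= C" and m: "m <= - K * (1 + C) * bar K 0"
 and lo: "AE w in P. ALL t:TI. - k * bar K t <= Y t w"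
 shows "AE w in P. ALL t:TI. - ((1 + k) / 2) * bar K t <= Y t w"
proof -
 have K1: "1 <= K" using K unfolding f_bound_def by blast
 note b = barrier_bounds[OF K1]
 have TT: "T : TI" using T_pos by simp
 have bT: "bar K T = c\<^sub>0 + 1" unfolding bar_def by simp
 have pY: "pred Y" and I: "sint Z I" and ae: "AE w in P. rcll T (%t. Y t w) & (ALL t:TI. abs (Y t w) <= C) & Y T w = Xi w & ineq m Y Z I w"
 using adm unfolding adm_def by auto
 have C0: "0 <= C" using k by simp
 have L2I: "L2mart I" by (rule sint_L2(1)[OF I]) (rule le_less_trans[OF adm_EQ[OF adm C0]], simp)
 define v where "v t = - ((1 + k) / 2) * bar K t" for t
 have step: "AE w in P. v s <= Y s w" if s: "s : TI" for s
 proof -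
 define A where "A = {w : space M. Y s w < v s}"
 have Ym: "Y s : bm (F s)" by (rule pred_adapted[OF pY s])
 have A: "A : sets (F s)" unfolding A_def using borel_measurable_less[OF Ym borel_measurable_const[of "v s"]] by simp
 have AP: "A : sets P" using A sets_F_le by blast
 have ge: "AE w in P. ind A w <= ind A w * (I T w - I s w)"
 using ae lo Xi_le
 proof eventually_elim
 case (elim w)
 have iw: "ineq m Y Z I w" "Y T w = Xi w" using elim(1) by blast+
 have nn: "0 <= - ((1 + k) / 2) * (2 * K * bar K u) - m" if u: "u : {s..T}" for u
 proof -
 have u': "u : TI" using u s by simp
 have "(1 + k) * K * bar K u <= (1 + C) * K * bar K 0" using k K1 b[OF u'] c0_nonneg by (intro mult_mono) auto
 moreover have "- K * (1 + C) * bar K 0 = - ((1 + C) * K * bar K 0)" by simp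
 moreover have "- ((1 + k) / 2) * (2 * K * bar K u) = - ((1 + k) * K * bar K u)" by (simp add: field_simps)
 ultimately show ?thesis using m by linarith
 qed
 have fl: "- ((1 + k) / 2) * (2 * K * bar K u) <= f u (bpath w) (Y u w) (Z u w)" if u: "u : {s..T}" for u
 proof -
 have u': "u : TI" using u s by simp
 have B: "1 <= bar K u" using b(1)[OF u'] c0_nonneg by linarith
 have "- K * (1 + abs (- k * bar K u)) <= f u (bpath w) (- k * bar K u) (Z u w)" using K u' unfolding f_bound_def by blast
 also have "... <= f u (bpath w) (Y u w) (Z u w)" by (rule f_mono[OF u']) (use elim(2) u' in blast)
 finally have F: "- K * (1 + abs (- k * bar K u)) <= f u (bpath w) (Y u w) (Z u w)" .
 have "1 + abs (- k * bar K u) <= (1 + k) * bar K u" using B k by (simp add: abs_mult algebra_simps)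
 then have "K * (1 + abs (- k * bar K u)) <= K * ((1 + k) * bar K u)" using K1 by (intro mult_left_mono) auto
 then have "- (K * ((1 + k) * bar K u)) <= - K * (1 + abs (- k * bar K u))" unfolding mult_minus_left by (rule le_imp_neg_le)
 moreover have "- ((1 + k) / 2) * (2 * K * bar K u) = - (K * ((1 + k) * bar K u))" by (simp add: field_simps)
 ultimately show ?thesis using order_trans[OF _ F] by metis
 qed
 have "ennreal (- ((1 + k) / 2) * (bar K s - bar K T) - m * (T - s)) <= drv m s T Y Z w"
 unfolding drv_def barrier_integral(1)[where a = "- ((1 + k) / 2)", OF _ nn, symmetric] using s
 by (subst barrier_integral(1)[where a = "- ((1 + k) / 2)" and K = K, symmetric])
 (use nn fl in "auto intro!: nn_integral_mono ennreal_leI split: split_indicator")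
 also have "... <= ennreal (Y s w - Y T w + I T w - I s w - m * (T - s))"
 using ineqD[OF iw(1), of s T] s unfolding dle_def by auto
 finally have "- ((1 + k) / 2) * (bar K s - bar K T) - m * (T - s) <= Y s w - Y T w + I T w - I s w - m * (T - s)"
 using ineqD[OF iw(1), of s T] s unfolding dle_def by (subst (asm) ennreal_le_iff) auto
 then have *: "v s + ((1 + k) / 2) * (c\<^sub>0 + 1) - Y s w + Xi w <= I T w - I s w"
 unfolding v_def bT iw(2) by (simp add: algebra_simps)
 have "1 * (c\<^sub>0 + 1) <= ((1 + k) / 2) * (c\<^sub>0 + 1)" using k c0_nonneg by (intro mult_right_mono) auto
 then have "1 <= I T w - I s w" if "w : A" using that elim(3) * unfolding A_def by auto
 then show ?case by (auto split: split_indicator)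
 qed
 have iA: "L2F s (ind A :: 'a => real)" using A by (rule L2F_indicator)
 have int: "integrable P (%w. ind A w * I t w)" if "t : {s..T}" for t
 by (rule L2F_mult[OF iA L2mart_L2F[OF L2I]]) (use that s in auto)
 have "(EE w. ind A w) <= (EE w. ind A w * I T w - ind A w * I s w)"
 proof (rule integral_mono_AE)
 show "integrable P (%w. ind A w * I T w - ind A w * I s w)" using int[of T] int[of s] s by auto
 show "AE w in P. ind A w <= ind A w * I T w - ind A w * I s w" using ge by (simp add: right_diff_distrib)
 qed (use AP emeasure_finite[of A] in "simp add: less_top[symmetric]")
 also have "(EE w. ind A w * I T w - ind A w * I s w) = (EE w. ind A w * I T w) - (EE w. ind A w * I s w)"
 using int[of T] int[of s] s by (intro Bochner_Integration.integral_diff) auto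
 also have "... = 0" using L2mart_orth[OF L2I _ _ _ iA, of T] s by simp
 finally have "measure P (A Int space M) <= 0" using AP by simp
 moreover have "A Int space M = A" unfolding A_def by auto
 ultimately have "measure P A = 0" using measure_nonneg[of P A] by simp
 then have "AE w in P. w ~: A" using AP by (intro AE_not_in) (auto simp: emeasure_eq_measure null_sets_def)
 then show ?thesis using AE_space by eventually_elim (auto simp: A_def)
 qed
 have "AE w in P. ALL s:\<rat> Int TI. v s <= Y s w" using step by (subst AE_ball_countable) (auto intro: countable_subset[OF _ countable_rat])
 then show ?thesis using step[OF TT] ae unfolding v_def[symmetric]
 proof eventually_elim
 case (elim w)
 have "continuous_on TI v" unfolding v_def bar_def by (intro continuous_intros)
 then have "v t <= Y t w" if "t : TI" for t
 by (rule rcll_le[where x = v and y = "%t. Y t w", OF rcll_continuous]) (use elim that in auto)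
 then show ?case by blast
 qed
qed

text \<open>Each step halves the excess of \<open>k\<close> over 1, starting from
  \<open>k = C\<close>; in the limit the bound no longer depends on \<open>C\<close>.\<close>

lemma lower_bound:
 assumes K: "f_bound K" and adm: "adm C m Y Z I" and C: "1 <= C" and m: "m <= - K * (1 + C) * bar K 0"
 shows "AE w in P. ALL t:TI. - bar K t <= Y t w"
proof -
 have K1: "1 <= K" using K unfolding f_bound_def by blast
 have "AE w in P. ALL t:TI. - (1 + (C - 1) / 2 ^ n) * bar K t <= Y t w" for n
 proof (induction n)
 case 0
 have "AE w in P. ALL t:TI. abs (Y t w) <= C" using adm unfolding adm_def by (auto elim: eventually_mono)
 then show ?case
 proof eventually_elim
 case (elim w)
 show ?case
 proof
 fix t assume t: "t : TI"
 have "C * 1 <= C * bar K t" using barrier_bounds(1)[OF K1 t] c0_nonneg C by (intro mult_left_mono) auto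
 then show "- (1 + (C - 1) / 2 ^ 0) * bar K t <= Y t w" using bspec[OF elim t] by simp
 qed
 qed
 next
 case (Suc n)
 have "(C - 1) / 2 ^ n <= C - 1" using C by (simp add: divide_le_eq mult_le_cancel_left1)
 from lower_bound_step[OF K adm _ _ m Suc] this C show ?case by (simp add: field_simps)
 qed
 then have "AE w in P. ALL n. ALL t:TI. - (1 + (C - 1) / 2 ^ n) * bar K t <= Y t w" by (simp add: AE_all_countable)
 then show ?thesis
 proof eventually_elim
 case (elim w)
 show ?case
 proof
 fix t assume t: "t : TI"
 have "(%n. - (1 + (C - 1) * (1 / 2) ^ n) * bar K t) ~> - (1 + (C - 1) * 0) * bar K t"
 by (intro tendsto_intros LIMSEQ_realpow_zero) auto
 from LIMSEQ_le_const2[OF this] show "- bar K t <= Y t w" using elim t by (simp add: power_divide)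
 qed
 qed
qed

text \<open>A lower bound may be decreased at will; the additional \<open>b\<close> meets the
  smallness condition on \<open>m\<close> in \<open>lower_bound\<close>.\<close>

lemma lower_exists: "0 <= C ==> EX m<=b. lower C m"
proof -
 assume C: "0 <= C"
 from f5[unfolded cond_f5_def, rule_format, OF C] obtain m where m: "ALL t:TI. ALL w:C_paths T. ALL y:{-C..C}. ALL z. m <= f t w y z" ..
 have "m <= f t (bpath w) y z" if "t : TI" "abs y <= C" for t w y z using m bpath_C[of w] that(1) that(2)[unfolded abs_le_iff] by auto
 then have "lower C (min m b)" using C unfolding lower_def by (simp add: min.coboundedI1)
 then show ?thesis by (intro exI[of _ "min m b"]) simp
qed

lemma minimal_supersolution:
 "EX C m Y Z I A. 0 <= C & adm C m Y Z I & supersolution M T W f Xi Y Z A &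
 (ALL f' Xi' Y' Z' A'. (ALL t:TI. ALL w:C_paths T. ALL y z. f t w y z <= f' t w y z) & (AE w in P. Xi w <= Xi' w) &
 supersolution M T W f' Xi' Y' Z' A' & (EX c. AE w in P. ALL t:TI. abs (Y' t w) <= c) --> (AE w in P. ALL t:TI. Y t w <= Y' t w))"
proof -
 obtain K where K: "f_bound K" using f_bounds unfolding f_bound_def by blast
 then have K1: "1 <= K" unfolding f_bound_def by blast
 note b = barrier_bounds[OF K1]
 define C where "C = bar K 0"
 have C1: "1 <= C" and C0: "0 <= C" and cC: "c\<^sub>0 <= C" using b(1)[of 0] T_pos c0_nonneg unfolding C_def by auto
 obtain m where m: "lower C m" using lower_exists[OF C0] by blast
 obtain Y0 where "Y0 : Adm C m" using barrier_Adm[OF K m] unfolding C_def by blast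
 from Adm_minimal[OF m this] obtain Y Z I where Y: "adm C m Y Z I" and min: "!!S. S : Adm C m ==> AE w in P. ALL t:TI. Y t w <= S t w" by blast
 obtain A where A: "supersolution M T W f Xi Y Z A" using adm_supersolution[OF Y m] by blast
 have "AE w in P. ALL t:TI. Y t w <= Y' t w"
 if le: "ALL t:TI. ALL w:C_paths T. ALL y z. f t w y z <= f' t w y z" and xi: "AE w in P. Xi w <= Xi' w"
 and sup: "supersolution M T W f' Xi' Y' Z' A'" and c: "AE w in P. ALL t:TI. abs (Y' t w) <= c" for f' Xi' Y' Z' A' c
 proof -
 \<comment> \<open>The competitor may exceed \<open>C\<close>, so it is compared inside a larger
   class first.\<close>
 define C1 where "C1 = max C c"
 have CC: "1 <= C1" "0 <= C1" "bar K 0 <= C1" using C1 unfolding C1_def C_def by auto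
 obtain m1 where m1: "m1 <= - K * (1 + C1) * bar K 0" "lower C1 m1" using lower_exists[OF CC(2)] by blast
 have "AE w in P. ALL t:TI. abs (Y' t w) <= C1" using c by eventually_elim (auto simp: C1_def)
 moreover have "AE w in P. abs (Xi w) <= C1" using Xi_le by eventually_elim (use cC in "auto simp: C1_def")
 ultimately obtain Y1 I1 where Y1: "adm C1 m1 Y1 Z' I1" "AE w in P. ALL t:TI. Y1 t w <= Y' t w"
 using supersolution_adm[OF sup le xi _ _ m1(2)] by blast
 obtain Y0 where Y0: "Y0 : Adm C1 m1" "AE w in P. ALL t:TI. Y0 t w <= bar K t" using barrier_Adm[OF K m1(2) CC(3)] by blast
 from Adm_minimal[OF m1(2) Y0(1)] obtain Y2 Z2 I2 where Y2: "adm C1 m1 Y2 Z2 I2"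
 and min2: "!!S. S : Adm C1 m1 ==> AE w in P. ALL t:TI. Y2 t w <= S t w" by blast
 \<comment> \<open>The minimal element of the larger class turns out to be bounded by
   \<open>C\<close>. Passing through a genuine supersolution exchanges the constant
   \<open>m1\<close> of its inequality for \<open>m\<close>, which returns it to the class where
   \<open>Y\<close> is minimal.\<close>
 obtain A2 where A2: "supersolution M T W f Xi Y2 Z2 A2" using adm_supersolution[OF Y2 m1(2)] by blast
 have "AE w in P. ALL t:TI. abs (Y2 t w) <= C"
 using lower_bound[OF K Y2 CC(1) m1(1)] min2[OF Y0(1)] Y0(2)
 proof eventually_elim
 case (elim w)
 show ?case
 proof
 fix t assume t: "t : TI"
 then have "- bar K t <= Y2 t w" "Y2 t w <= bar K t" using elim by fastforce+
 then show "abs (Y2 t w) <= C" using b(2)[OF t] unfolding C_def by linarith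
 qed
 qed
 moreover have "AE w in P. abs (Xi w) <= C" using Xi_le by eventually_elim (use cC in auto)
 moreover have "AE w in P. Xi w <= Xi w" by simp
 ultimately obtain Y3 I3 where Y3: "adm C m Y3 Z2 I3" "AE w in P. ALL t:TI. Y3 t w <= Y2 t w"
 using supersolution_adm[OF A2 _ _ _ _ m] by blast
 have "Y1 : Adm C1 m1" "Y3 : Adm C m" using Y1(1) Y3(1) unfolding Adm_def by auto
 from min[OF this(2)] Y3(2) min2[OF this(1)] Y1(2) show ?thesis
 proof eventually_elim
 case (elim w)
 show ?case
 proof
 fix t assume "t : TI"
 then have "Y t w <= Y3 t w" "Y3 t w <= Y2 t w" "Y2 t w <= Y1 t w" "Y1 t w <= Y' t w" using elim by blast+
 then show "Y t w <= Y' t w" by linarith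
 qed
 qed
 qed
 note cmp = this
 show ?thesis
 by (rule exI[of _ C], rule exI[of _ m], rule exI[of _ Y], rule exI[of _ Z], rule exI[of _ I], rule exI[of _ A], intro conjI allI impI C0 Y A, elim conjE exE, rule cmp)
qed

end

section \<open>Energy estimates at stopping times and the BMO property\<close>

context wiener begin

text \<open>A stopping time is approximated from above by its values rounded up to the grids \<open>k * T / n\<close>.\<close>
lemma energy_stopping:
 assumes Z: "jm Z" and b: "!!a A. a : TI ==> A : sets (F a) ==> (NN w. Qv a Z w * ind A w) <= B * emeasure P A"
 and tau: "\<tau> : space M \<rightarrow> TI" and A: "A : sets P" "!!t. {w : A. \<tau> w <= t} : sets (F t)"
 shows "(%w. Qv (\<tau> w) Z w * ind A w) : bm P" "(NN w. Qv (\<tau> w) Z w * ind A w) <= B * emeasure P A"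
proof -
 define p where "p n k = real k * T / real (Suc n)" for n k
 \<comment> \<open>The event that \<tau> rounds up to \<open>p n k\<close>. It is known at
   \<open>p n k\<close>, so the hypothesis at deterministic times applies to it, and for fixed
   \<open>n\<close> these events are disjoint with union \<open>A\<close>.\<close>
 define Ak where "Ak n k = {w : A. \<tau> w <= p n k} - {w : A. \<tau> w <= p n k - T / real (Suc n)}" for n k
 define S where "S n w = (SUM k<=Suc n. Qv (p n k) Z w * ind (Ak n k) w)" for n w
 have p: "p n k : TI" if "k <= Suc n" for n k
 using that T_pos by (auto simp: p_def divide_le_eq mult.commute intro!: mult_left_mono)
 have Ak: "Ak n k : sets (F (p n k))" for n k
 proof -
 have "sets (F (p n k - T / real (Suc n))) \<subseteq> sets (F (p n k))" using T_pos by (intro F_mono) simp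
 then show ?thesis unfolding Ak_def using A(2) by blast
 qed
 have AkP: "Ak n k : sets P" for n k using Ak sets_F_le by blast
 have inA: "EX k<=Suc n. (ALL j. w : Ak n j <-> j = k) & \<tau> w <= p n k & p n k <= \<tau> w + T / real (Suc n)" if w: "w : A" for n w
 proof -
 have tw: "\<tau> w : TI" using tau w sets.sets_into_space[OF A(1)] by auto
 define r where "r = \<tau> w * real (Suc n) / T"
 have r0: "0 <= r" and rn: "r <= real (Suc n)" unfolding r_def using tw T_pos by (auto simp: divide_le_eq mult.commute intro!: mult_left_mono)
 have iff0: "x <= y * T / N <-> x * N / T <= y" if "0 < N" for x y N :: real using T_pos that by (simp add: field_simps)
 have iff: "w : Ak n j <-> r <= real j & real j - 1 < r" for j
 proof -
 have "\<tau> w <= p n j <-> r <= real j" unfolding p_def r_def by (rule iff0) simp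
 moreover have "p n j - T / real (Suc n) = (real j - 1) * T / real (Suc n)" unfolding p_def by (simp add: left_diff_distrib diff_divide_distrib)
 then have "\<tau> w <= p n j - T / real (Suc n) <-> r <= real j - 1" unfolding r_def by (simp only: iff0[of "real (Suc n)"] of_nat_0_less_iff zero_less_Suc)
 ultimately show ?thesis unfolding Ak_def using w by auto
 qed
 define k where "k = nat \<lceil>r\<rceil>"
 have k: "r <= real k" "real k - 1 < r" unfolding k_def using r0 by linarith+
 have ik: "w : Ak n j <-> j = k" for j unfolding iff using k by auto
 moreover have "k <= Suc n" using rn k(2) by linarith
 moreover have "\<tau> w <= p n k" "p n k <= \<tau> w + T / real (Suc n)"
 using ik[of k] unfolding Ak_def by auto
 ultimately show ?thesis by blast
 qed
 have Sk: "S n w = Qv (p n k) Z w" if "k <= Suc n" "ALL j. w : Ak n j <-> j = k" for n k w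
 proof -
 have "S n w = (SUM j<=Suc n. if j = k then Qv (p n k) Z w else 0)"
 unfolding S_def using that(2) by (intro sum.cong) (auto simp: indicator_def)
 then show ?thesis using that(1) by simp
 qed
 have Sm: "S n : bm P" for n
 unfolding S_def[abs_def] using AkP p Z by (intro borel_measurable_sum borel_measurable_times_ennreal Qv_m borel_measurable_indicator) auto
 have lim: "Qv (\<tau> w) Z w * ind A w = liminf (%n. S n w)" if w: "w : space M" for w
 proof (cases "w : A")
 case False
 then have "S n w = 0" for n unfolding S_def Ak_def by simp
 then show ?thesis using False by (simp add: Liminf_const)
 next
 case True
 have tw: "\<tau> w : TI" using tau w by auto
 have "EX s. ALL n. S n w = Qv (s n) Z w & \<tau> w <= s n & s n <= \<tau> w + T / real (Suc n)"
 using inA[OF True] Sk by (intro choice allI) blast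
 then obtain s where s: "!!n. S n w = Qv (s n) Z w" "!!n. \<tau> w <= s n" "!!n. s n <= \<tau> w + T / real (Suc n)" by blast
 have "(%n. \<tau> w + T / real (Suc n)) ~> \<tau> w + 0" by (intro tendsto_intros LIMSEQ_Suc lim_const_over_n)
 then have sl: "s ~> \<tau> w" using tendsto_sandwich[OF always_eventually[OF allI[OF s(2)]] always_eventually[OF allI[OF s(3)]] tendsto_const] by simp
 define h where "h u = ennreal ((norm (Z u w))^2)" for u
 have hm: "h : bm LT" unfolding h_def using jm_section[OF Z] w by auto
 have "Qv (\<tau> w) Z w <= liminf (%n. (NL u. h u * ind {s n..T} u))"
 unfolding Qv_LT[OF tw[THEN atLeastAtMost_iff[THEN iffD1], THEN conjunct1]] h_def[symmetric]
 proof (rule LT_fatou[OF hm])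
 show "AE u in LT. u : {\<tau> w..T} --> (EV n. u : {s n..T})"
 using AE_LT_neq[of "\<tau> w"] proof eventually_elim
 case (elim u)
 have "\<tau> w < u ==> EV n. s n < u" by (rule order_tendstoD(2)[OF sl])
 then show ?case using elim by (cases "\<tau> w < u") (auto elim!: eventually_mono)
 qed
 qed simp
 also have "... = liminf (%n. S n w)"
 unfolding s(1) h_def by (subst Qv_LT) (use s(2) tw in "auto intro: order_trans")
 finally have "Qv (\<tau> w) Z w <= liminf (%n. S n w)" .
 moreover have "S n w <= Qv (\<tau> w) Z w" for n
 unfolding s(1) Qv_def by (intro nn_integral_mono) (use s(2)[of n] in "auto split: split_indicator")
 then have "liminf (%n. S n w) <= Qv (\<tau> w) Z w" by (intro Liminf_le always_eventually allI) auto
 ultimately show ?thesis using True by simp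
 qed
 have Seq: "(NN w. Qv (\<tau> w) Z w * ind A w) = (NN w. liminf (%n. S n w))" using lim by (intro nn_integral_cong) simp
 show "(%w. Qv (\<tau> w) Z w * ind A w) : bm P"
 using borel_measurable_liminf[OF Sm] lim by (subst measurable_cong[where g = "%w. liminf (%n. S n w)"]) auto
 have Sb: "(NN w. S n w) <= B * emeasure P A" for n
 proof -
 have "(NN w. S n w) = (SUM k<=Suc n. (NN w. Qv (p n k) Z w * ind (Ak n k) w))"
 unfolding S_def using AkP p Z by (intro nn_integral_sum borel_measurable_times_ennreal Qv_m borel_measurable_indicator) auto
 also have "... <= (SUM k<=Suc n. B * emeasure P (Ak n k))" using p Ak by (intro sum_mono b) auto
 also have "... = B * (SUM k<=Suc n. emeasure P (Ak n k))" by (simp only: sum_distrib_left)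
 also have "(SUM k<=Suc n. emeasure P (Ak n k)) = emeasure P (\<Union>k\<le>Suc n. Ak n k)"
 proof (rule sum_emeasure)
 show "disjoint_family_on (Ak n) {..Suc n}" unfolding disjoint_family_on_def
 proof (intro ballI impI)
 fix i j :: nat assume "i ~= j"
 moreover have "i = j" if "w : Ak n i" "w : Ak n j" for w
 proof -
 have "w : A" using that(1) unfolding Ak_def by auto
 from inA[OF this, of n] obtain k where "ALL j. w : Ak n j <-> j = k" by blast
 then show ?thesis using that by simp
 qed
 ultimately show "Ak n i Int Ak n j = {}" by blast
 qed
 qed (use AkP in auto)
 also have "... <= emeasure P A" by (intro emeasure_mono A(1)) (auto simp: Ak_def)
 finally show ?thesis by (simp add: mult_left_mono)
 qed
 have "(NN w. liminf (%n. S n w)) <= liminf (%n. (NN w. S n w))" by (rule nn_integral_liminf[OF Sm])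
 also have "... <= B * emeasure P A" using Sb by (intro Liminf_le always_eventually allI) auto
 finally show "(NN w. Qv (\<tau> w) Z w * ind A w) <= B * emeasure P A" unfolding Seq .
qed

text \<open>The event that the conditional energy exceeds \<open>B\<close> belongs to the
  sigma-algebra of \<tau>. The integrated bound of \<open>energy_stopping\<close> on that event
  leaves no mass for the excess, so the event is null.\<close>

lemma BMO_I:
 assumes Z: "pred Z" and B: "0 <= B"
 and b: "!!a A. a : TI ==> A : sets (F a) ==> (NN w. Qv a Z w * ind A w) <= ennreal B * emeasure P A"
 shows "BMO M T W Z"
 unfolding BMO_def
proof (intro conjI exI[of _ B] allI impI B Z)
 fix \<tau> assume tau: "stopping_time F \<tau> & \<tau> : space M \<rightarrow> TI"
 interpret f: filtration "space M" F using F_mono by unfold_locales auto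
 let ?G = "f.pre_sigma \<tau>"
 have jZ: "jm Z" by (rule predictable_jm[OF Z])
 have st: "{w : space M. \<tau> w <= t} : sets (F t)" for t using tau unfolding stopping_time_def pred_def by simp
 have GD: "{w : A. \<tau> w <= t} : sets (F t)" if "A : sets ?G" for A t by (rule f.sets_pre_sigmaD[OF conjunct1[OF tau] that])
 have GP: "sets ?G \<subseteq> sets P"
 proof
 fix A assume A: "A : sets ?G"
 have "{w : A. \<tau> w <= T} = A" using sets.sets_into_space[OF A] tau unfolding f.space_pre_sigma by auto
 then show "A : sets P" using GD[OF A, of T] sets_F_le[of T] by auto
 qed
 interpret S: finite_measure_subalgebra P ?G by unfold_locales (use GP in "auto simp: subalgebra_def f.space_pre_sigma")
 define g where "g w = Qv (\<tau> w) Z w" for w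
 have "(%w. g w * ind (space M) w) : bm P"
 unfolding g_def by (rule energy_stopping(1)[OF jZ b _ _ st]) (use tau in "auto simp: sets.top[of P, simplified]")
 then have gm: "g : bm P" by (subst measurable_cong[where g = "%w. g w * ind (space M) w"]) auto
 define h where "h = nn_cond_exp P ?G g"
 have hm: "h : borel_measurable ?G" unfolding h_def by simp
 have hP: "h : bm P" using GP by (intro measurable_from_subalg[OF S.subalg hm])
 define A where "A = {w : space M. ennreal B < h w}"
 have A: "A : sets ?G" unfolding A_def using borel_measurable_less[OF borel_measurable_const hm] by (simp add: f.space_pre_sigma)
 have AP: "A : sets P" using A GP by blast
 have "(NN w. ind A w * h w) = (NN w. ind A w * g w)"
 unfolding h_def using S.nn_cond_exp_intg[of "ind A" g, OF borel_measurable_indicator[OF A] gm] .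
 also have "(NN w. ind A w * g w) <= ennreal B * emeasure P A"
 unfolding g_def mult.commute[of "ind A _"]
 by (rule energy_stopping(2)[where Z = Z and B = "ennreal B" and A = A and \<tau> = \<tau>, OF jZ _ conjunct2[OF tau] AP GD[OF A]]) (rule b)
 finally have le: "(NN w. ind A w * h w) <= ennreal B * emeasure P A" .
 have "(NN w. ind A w * (h w - ennreal B)) = (NN w. ind A w * h w - ennreal B * ind A w)"
 by (intro nn_integral_cong) (auto split: split_indicator)
 also have "... = (NN w. ind A w * h w) - (NN w. ennreal B * ind A w)"
 proof (rule nn_integral_diff)
 show "AE w in P. ennreal B * ind A w <= ind A w * h w" by (intro AE_I2) (auto simp: A_def split: split_indicator)
 qed (use AP hP emeasure_finite[of A] in "auto simp: nn_integral_cmult ennreal_mult_eq_top_iff")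
 also have "... = 0"
 proof -
 have "(NN w. ind A w * h w) < top"
 by (rule le_less_trans[OF le], subst ennreal_mult_less_top) (simp add: less_top[symmetric] del: emeasure_completion)
 then show ?thesis using le AP by (simp add: nn_integral_cmult diff_eq_0_iff_ennreal less_top del: emeasure_completion)
 qed
 finally have "AE w in P. ind A w * (h w - ennreal B) = 0" using AP hP by (subst (asm) nn_integral_0_iff_AE) auto
 then have "AE w in P. h w <= ennreal B" using AE_space
 proof eventually_elim
 case (elim w)
 show ?case
 proof (rule ccontr)
 assume "\<not> h w <= ennreal B"
 then have "ennreal B < h w" by simp
 with elim show False unfolding A_def by (auto simp: diff_eq_0_iff_ennreal)
 qed
 qed
 then show "AE w in M. nn_cond_exp P ?G (%w. \<integral>\<^sup>+s\<in>{\<tau> w..T}. ennreal ((norm (Z s w))^2) \<partial>lborel) w <= ennreal B"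
 unfolding h_def g_def[abs_def] Qv_def by (simp add: AE_completion_iff)
qed

section \<open>Measurability of a lower semicontinuous function of the path\<close>

lemma path_approx:
 fixes v :: "real => real ^ 'n"
 assumes v: "v : C_paths T" and Q: "!!X. open X ==> X ~= {} ==> EX d:Q. d : X" and e: "0 < e"
 shows "EX n. EX ys:lists Q. ALL t:TI. norm (v t - ys ! nat \<lfloor>real n * t\<rfloor>) <= e"
proof -
 have "uniformly_continuous_on TI v" using v unfolding C_paths_def by (intro compact_uniformly_continuous) auto
 then obtain d where d: "0 < d" "!!s t. s : TI ==> t : TI ==> dist s t < d ==> dist (v s) (v t) < e / 2"
 unfolding uniformly_continuous_on_def using e by (meson half_gt_zero)
 obtain n where n: "inverse (real (Suc n)) < d" using reals_Archimedean[OF d(1)] by blast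
 have "EX y:Q. dist (v (real k / real (Suc n))) y < e / 2" for k
 using Q[of "ball (v (real k / real (Suc n))) (e / 2)"] e by auto
 then have "EX y. ALL k. y k : Q & dist (v (real k / real (Suc n))) (y k) < e / 2" by (intro choice) blast
 then obtain y where y: "!!k. y k : Q" "!!k. dist (v (real k / real (Suc n))) (y k) < e / 2" by blast
 \<comment> \<open>One value of \<open>Q\<close> for each cell of length \<open>1 / (n + 1)\<close>,
   including the cell that contains \<open>T\<close>. A finite list and a number encode the step
   function, so there are only countably many candidates.\<close>
 define ys where "ys = map y [0..<Suc (nat \<lfloor>real (Suc n) * T\<rfloor>)]"
 have "norm (v t - ys ! nat \<lfloor>real (Suc n) * t\<rfloor>) <= e" if t: "t : TI" for t
 proof -
 define k where "k = nat \<lfloor>real (Suc n) * t\<rfloor>"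
 have "real (nat \<lfloor>x\<rfloor>) <= x & x < real (nat \<lfloor>x\<rfloor>) + 1" if "0 <= x" for x :: real using that by linarith
 then have k: "real k <= real (Suc n) * t" "real (Suc n) * t < real k + 1" unfolding k_def using t by simp_all
 have "\<lfloor>real (Suc n) * t\<rfloor> <= \<lfloor>real (Suc n) * T\<rfloor>" using t by (intro floor_mono mult_left_mono) auto
 then have "ys ! k = y k" unfolding ys_def k_def by (subst nth_map) (auto simp del: upt_Suc simp: nat_mono less_Suc_eq_le)
 moreover have "real k / real (Suc n) : TI" "dist (real k / real (Suc n)) t < d"
 proof -
 have "x / N <= t" "t - x / N < inverse N" if "0 < N" "x <= N * t" "N * t < x + 1" for x N :: real
 proof -
 have "t - x / N = (N * t - x) / N" using that(1) by (simp add: diff_divide_distrib)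
 also have "... < 1 / N" using that by (intro divide_strict_right_mono) auto
 finally show "t - x / N < inverse N" by (simp add: inverse_eq_divide)
 qed (use that in "simp add: divide_le_eq mult.commute")
 from this[OF _ k] have "real k / real (Suc n) <= t" "t - real k / real (Suc n) < inverse (real (Suc n))" by auto
 then show "real k / real (Suc n) : TI" "dist (real k / real (Suc n)) t < d" using t n unfolding dist_real_def by auto
 qed
 ultimately have "dist (v t) (ys ! k) < e"
 using dist_triangle3[of "v t" "y k" "v (real k / real (Suc n))"] d(2)[of "real k / real (Suc n)" t] y(2)[of k] t by auto
 then show ?thesis unfolding k_def dist_norm by simp
 qed
 moreover have "ys : lists Q" unfolding ys_def using y(1) by auto
 ultimately show ?thesis by blast
qed

text \<open>Lower semicontinuity makes superlevel sets open, and an open set of paths is a countable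
  union of tubes around step functions with values in a countable dense set. By continuity the tubes
  need testing only at the countably many times \<open>R\<close>.\<close>

lemma semicontinuous_measurable:
 assumes lsc: "lower_semicontinuous T \<phi>"
 shows "(%w. \<phi> (brownian_path T W w)) : bm (F T)"
proof -
 obtain Q :: "(real ^ 'n) set" where Q: "countable Q" "!!X. open X ==> X ~= {} ==> EX d:Q. d : X" by (rule countable_dense_setE) blast
 define R where "R = \<rat> Int TI Un {T}"
 have R: "countable R" unfolding R_def by (intro countable_Un countable_Int1 countable_rat) simp
 define tube where "tube n ys j = {v :: real => real ^ 'n. ALL t:R. norm (v t - ys ! nat \<lfloor>real n * t\<rfloor>) <= 1 / real (Suc j)}" for n j :: nat and ys
 have meas: "{w : space M. bpath w : tube n ys j} : sets (F T)" for n ys j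
 proof -
 have "{w : space (F T). ALL t:R. norm (bpath w t - ys ! nat \<lfloor>real n * t\<rfloor>) <= 1 / real (Suc j)} : sets (F T)"
 proof (rule sets.sets_Collect_countable_All'[OF _ R])
 fix t assume "t : R"
 then have t: "t : TI" "t <= T" unfolding R_def using T_pos by auto
 have "AE w in P. W t w = bpath w t" using bpath_AE by eventually_elim (use t in "simp add: brownian_path_def")
 then have [measurable]: "(%w. bpath w t) : bm (F T)" by (rule borel_F_AE[OF W_F[OF t]])
 show "{w : space (F T). norm (bpath w t - ys ! nat \<lfloor>real n * t\<rfloor>) <= 1 / real (Suc j)} : sets (F T)" by measurable
 qed
 then show ?thesis unfolding tube_def by simp
 qed
 have "{w : space M. a < \<phi> (bpath w)} : sets (F T)" for a
 proof -
 \<comment> \<open>The tubes of continuous paths that lie wholly inside the superlevel set. Around a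
   given path of this set a tube of radius below half of the \<delta> from semicontinuity is of this
   kind, since two paths in it differ by at most twice the radius.\<close>
 define J where "J = {(n, ys, j). ys : lists Q & (ALL u:C_paths T. u : tube n ys j --> a < \<phi> u)}"
 have "countable ((UNIV :: nat set) \<times> lists Q \<times> (UNIV :: nat set))" using Q(1) by (intro countable_SIGMA countable_lists) auto
 then have J: "countable J" by (rule countable_subset[rotated]) (auto simp: J_def)
 have "{w : space M. a < \<phi> (bpath w)} = (\<Union>(n, ys, j)\<in>J. {w : space M. bpath w : tube n ys j})"
 proof (intro subset_antisym subsetI)
 fix w assume w: "w : {w : space M. a < \<phi> (bpath w)}"
 then obtain \<delta> where \<delta>: "0 < \<delta>" "!!u. u : C_paths T ==> sup_dist T (bpath w) u < \<delta> ==> a < \<phi> u"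
 using lsc bpath_C[of w] unfolding lower_semicontinuous_def by blast
 obtain j where j: "inverse (real (Suc j)) < \<delta> / 2" using reals_Archimedean[of "\<delta> / 2"] \<delta>(1) by auto
 have "EX n. EX ys:lists Q. ALL t:TI. norm (bpath w t - ys ! nat \<lfloor>real n * t\<rfloor>) <= 1 / real (Suc j)"
 by (rule path_approx[OF bpath_C Q(2)]) auto
 then obtain n ys where ys: "ys : lists Q" "!!t. t : TI ==> norm (bpath w t - ys ! nat \<lfloor>real n * t\<rfloor>) <= 1 / real (Suc j)" by blast
 have bt: "bpath w : tube n ys j" unfolding tube_def R_def using ys(2) T_pos by auto
 have "a < \<phi> u" if u: "u : C_paths T" "u : tube n ys j" for u
 proof (rule \<delta>(2)[OF u(1)])
 have R2: "norm (bpath w t - u t) <= 2 / real (Suc j)" if t: "t : R" for t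
 proof -
 have "norm (bpath w t - u t) <= norm (bpath w t - ys ! nat \<lfloor>real n * t\<rfloor>) + norm (u t - ys ! nat \<lfloor>real n * t\<rfloor>)"
 by (rule norm_diff_triangle_le[OF order_refl]) (simp add: norm_minus_commute)
 also have "... <= 1 / real (Suc j) + 1 / real (Suc j)" using bt u(2) t unfolding tube_def by (intro add_mono) auto
 also have "1 / real (Suc j) + 1 / real (Suc j) = 2 / real (Suc j)" by simp
 finally show ?thesis .
 qed
 have "continuous_on TI (%t. norm (bpath w t - u t))" using u(1) bpath_C[of w] unfolding C_paths_def by (intro continuous_intros) auto
 then have "norm (bpath w t - u t) <= 2 / real (Suc j)" if "t : TI" for t
 by (rule rcll_le[OF rcll_continuous rcll_continuous[OF continuous_on_const] R2 R2 that]) (auto simp: R_def)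
 then have "sup_dist T (bpath w) u <= 2 / real (Suc j)" unfolding sup_dist_def using T_pos by (intro cSUP_least) auto
 also have "... < \<delta>" using j by (simp add: field_simps)
 finally show "sup_dist T (bpath w) u < \<delta>" .
 qed
 then have "(n, ys, j) : J" unfolding J_def using ys(1) by blast
 then show "w : (\<Union>(n, ys, j)\<in>J. {w : space M. bpath w : tube n ys j})" using w bt by blast
 qed (use bpath_C in "auto simp: J_def")
 also have "... : sets (F T)" using J meas by (intro sets.countable_UN') auto
 finally show ?thesis .
 qed
 then have "(%w. \<phi> (bpath w)) : bm (F T)" by (intro borel_measurable_iff_greater[THEN iffD2]) simp
 moreover have "AE w in P. \<phi> (bpath w) = \<phi> (brownian_path T W w)" using bpath_AE by eventually_elim simp
 ultimately show ?thesis by (rule borel_F_AE)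
qed

end

theorem corollary2p8:
  fixes M :: "'a measure" and T :: real and W :: "real \<Rightarrow> 'a \<Rightarrow> real ^ 'n::finite"
    and f :: "real \<Rightarrow> (real \<Rightarrow> real ^ 'n) \<Rightarrow> real \<Rightarrow> real ^ 'n \<Rightarrow> real"
    and \<phi> :: "(real \<Rightarrow> real ^ 'n) \<Rightarrow> real"
  assumes "0 < T"
    and "brownian_motion M T W"
    and "driver T f"
    and "cond_f1 T f" and "cond_f2 T f" and "cond_f3 T f" and "cond_f4 T f" and "cond_f5 T f"
    and "increasing_in_y T f"
    and "bounded (\<phi> ` C_paths T)"
    and "lower_semicontinuous T \<phi>"
  shows "\<exists>Y Z A.
    minimal_bounded_supersolution M T W f (\<lambda>\<omega>. \<phi> (brownian_path T W \<omega>)) Y Z A \<and>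
    bounded_comparison_from_above M T W f (\<lambda>\<omega>. \<phi> (brownian_path T W \<omega>)) Y Z A \<and>
    BMO M T W Z"
proof -
 interpret wiener M T W using assms(1,2) by unfold_locales
 let ?x = "%w. \<phi> (brownian_path T W w)"
 obtain c where c: "!!v. v : C_paths T ==> abs (\<phi> v) <= c" using assms(10) unfolding bounded_iff by auto
 have xle: "AE w in P. abs (?x w) <= c" using bpath_AE
 proof eventually_elim
 case (elim w)
 show ?case using c[OF bpath_C[of w]] unfolding elim .
 qed
 interpret bsde M T W f ?x c
 by unfold_locales (use assms(3-9) semicontinuous_measurable[OF assms(11)] xle in auto)
 obtain C m Y Z I A where C: "0 <= C" and adm: "adm C m Y Z I" and sup: "supersolution M T W f ?x Y Z A"
 and min: "!!f' Xi' Y' Z' A'. (ALL t:{0..T}. ALL w:C_paths T. ALL y z. f t w y z <= f' t w y z) & (AE w in P. ?x w <= Xi' w) &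
 supersolution M T W f' Xi' Y' Z' A' & (EX c. AE w in P. ALL t:{0..T}. abs (Y' t w) <= c) ==> AE w in P. ALL t:{0..T}. Y t w <= Y' t w"
 using minimal_supersolution by blast
 have cmp: "bounded_comparison_from_above M T W f ?x Y Z A"
 unfolding bounded_comparison_from_above_def
 proof (intro conjI sup allI impI)
 fix f' Xi' Y' Z' A'
 assume "(ALL t:{0..T}. ALL w:C_paths T. ALL y z. f t w y z <= f' t w y z) & (AE w in M. ?x w <= Xi' w) &
 supersolution M T W f' Xi' Y' Z' A' & bounded_process M T Y'"
 then have "AE w in P. ALL t:{0..T}. Y t w <= Y' t w" by (intro min[of f' Xi' Y' Z' A']) (simp add: bounded_process_def AE_completion_iff)
 then show "AE w in M. ALL t:{0..T}. Y t w <= Y' t w" by (simp add: AE_completion_iff)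
 qed
 have "AE w in P. ALL t:{0..T}. abs (Y t w) <= C" using adm unfolding adm_def by (auto elim: eventually_mono)
 then have bp: "bounded_process M T Y" unfolding bounded_process_def by (auto simp: AE_completion_iff)
 have "minimal_bounded_supersolution M T W f ?x Y Z A"
 unfolding minimal_bounded_supersolution_def
 proof (intro conjI sup bp allI impI)
 fix Y' Z' A' assume "supersolution M T W f ?x Y' Z' A' & bounded_process M T Y'"
 \<comment> \<open>Minimality is comparison with the driver and the terminal value
   themselves.\<close>
 then have "AE w in P. ALL t:{0..T}. Y t w <= Y' t w" by (intro min[of f ?x Y' Z' A']) (simp add: bounded_process_def AE_completion_iff)
 then show "AE w in M. ALL t:{0..T}. Y t w <= Y' t w" by (simp add: AE_completion_iff)
 qed
 moreover have "pred Z" using adm sintD(1) unfolding adm_def by blast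
 \<comment> \<open>The energy bound at deterministic times holds with the single constant of
   \<open>adm_energy\<close>, which becomes the BMO constant.\<close>
 then have "BMO M T W Z" by (rule BMO_I[OF _ _ adm_energy[OF adm C]]) simp
 ultimately show ?thesis using cmp by blast
qed

end
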